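(* There exists $0<\beta_0<8\pi$ such that, for every $0<\beta<\beta_0$, $$\lim_{N\to\infty} Z_N(\beta)=\det\nolimits_2(I-\beta G)^{-1/2}.$$ As a consequence, for every $0<\beta<\beta_0$, the law of $\omega_N$ on $\mathcal D'(\mathbb T)$, when the positions $(x_1,\dots,x_N)$ are distributed according to $\nu_{N,\beta}$, converges weakly as $N\to\infty$ to $\mu_\beta$.
   Context: $\mathbb T=\mathbb R^2/\mathbb Z^2$ is the flat two-dimensional torus with Lebesgue measure $dx$ of total mass one, and $dx^N$ is the product measure on $\mathbb T^N$. $G$ is the Green function of the Laplacian on $\mathbb T$: $-\Delta G=\delta_0-1$, $\int_{\mathbb T}G(x)\,dx=0$. The symbol $G$ also denotes the Hilbert–Schmidt operator $f\mapsto G\ast f$ on $L^2_0(\mathbb T)$, the space of zero-average functions in $L^2(\mathbb T)$. $\det_2$ is the Carleman–Fredholm determinant: $\det_2(I-\beta G)=\det\big((I-\beta G)e^{\beta G}\big)$, where $\det$ is the Fredholm determinant, i.e. $\det_2(I-\beta G)=\prod_j(1-\beta\lambda_j)e^{\beta\lambda_j}$ with $\lambda_j$ the eigenvalues of $G$ on $L^2_0(\mathbb T)$ counted with multiplicity. For $N\ge 2$ let $H_N(x_1,\dots,x_N)=\sum_{1\le i<j\le N}G(x_i-x_j)$ and, for $\beta<8\pi$, $$Z_N(\beta)=\int_{\mathbb T^N}e^{\frac{\beta}{N}H_N}\,dx^N<\infty,\qquad d\nu_{N,\beta}=\frac1{Z_N(\beta)}e^{\frac{\beta}{N}H_N(x_1,\dots,x_N)}\,dx^N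 .$$ The rescaled empirical vorticity is the random distribution $\omega_N=\frac1{\sqrt N}\big(\sum_{j=1}^N\delta_{x_j}-N\,dx\big)$. Let $\mu_0$ be the law on $\mathcal D'(\mathbb T)$ of zero-average space white noise $\xi$, i.e. the centered Gaussian process on $L^2_0(\mathbb T)$ with $E[\xi(\phi)\xi(\psi)]=\int_{\mathbb T}\phi\psi\,dx$. Let $:\!E\!:\;=\frac12:\!\langle\xi,G\ast\xi\rangle\!:$ be the Wick-ordered quadratic functional, i.e. one half of the double Wiener–Itô integral of the kernel $G(x-y)$ with respect to $\xi$, an element of the second Wiener chaos. For $\beta<4\pi^2$, $\mu_\beta$ is the probability measure with $\frac{d\mu_\beta}{d\mu_0}=Z_\beta^{-1}e^{\beta :E:}$, $Z_\beta=\int e^{\beta :E:}\,d\mu_0<\infty$; equivalently, $\mu_\beta$ is the centered Gaussian measure with covariance operator $(I-\beta G)^{-1}$ on $L^2_0(\mathbb T)$ (the energy-enstrophy ensemble). *)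

theory Defs
  imports "HOL-Probability.Probability"
begin

text \<open>
  Functions on the flat torus are represented by \<open>\<int>\<^sup>2\<close>-periodic functions on the plane, and the
  normalised Lebesgue measure by the uniform distribution on the fundamental domain \<open>[0,1)\<^sup>2\<close>.
\<close>

definition torus_measure :: "(real \<times> real) measure"
  where "torus_measure = uniform_measure lborel ({0..<1} \<times> {0..<1})"

definition periodic :: "(real \<times> real \<Rightarrow> 'a) \<Rightarrow> bool"
  where "periodic f \<longleftrightarrow> (\<forall>x y. f (x + 1, y) = f (x, y) \<and> f (x, y + 1) = f (x, y))"


subsection \<open>Test functions and distributions\<close>

definition deriv1 :: "(real \<times> real \<Rightarrow> real) \<Rightarrow> real \<times> real \<Rightarrow> real"
  where "deriv1 f z = deriv (\<lambda>s. f (s, snd z)) (fst z)"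

definition deriv2 :: "(real \<times> real \<Rightarrow> real) \<Rightarrow> real \<times> real \<Rightarrow> real"
  where "deriv2 f z = deriv (\<lambda>s. f (fst z, s)) (snd z)"

definition partial :: "nat \<Rightarrow> nat \<Rightarrow> (real \<times> real \<Rightarrow> real) \<Rightarrow> real \<times> real \<Rightarrow> real"
  where "partial a b f = (deriv1 ^^ a) ((deriv2 ^^ b) f)"

definition laplacian :: "(real \<times> real \<Rightarrow> real) \<Rightarrow> real \<times> real \<Rightarrow> real"
  where "laplacian f z = partial 2 0 f z + partial 0 2 f z"

text \<open>
  Since every \<^term>\<open>partial a b f\<close> is required to be Frechet differentiable everywhere, all of them
  are continuous and the order of differentiation is irrelevant, so this is \<open>C\<^sup>\<infinity>\<close> of the torus.
\<close>

definition test_functions :: "(real \<times> real \<Rightarrow> real) set"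
  where "test_functions = {f. periodic f \<and> (\<forall>a b z. partial a b f differentiable (at z))}"

definition Ck_norm :: "nat \<Rightarrow> (real \<times> real \<Rightarrow> real) \<Rightarrow> real"
  where "Ck_norm m f = (\<Sum>a\<le>m. \<Sum>b\<le>m - a. SUP z. \<bar>partial a b f z\<bar>)"

definition bounded_test_set :: "(real \<times> real \<Rightarrow> real) set \<Rightarrow> bool"
  where "bounded_test_set B \<longleftrightarrow> B \<subseteq> test_functions \<and> (\<forall>m. bdd_above (Ck_norm m ` B))"

text \<open>
  A distribution is a linear functional on test functions that is continuous for the Frechet
  topology given by the norms \<^term>\<open>Ck_norm m\<close>. Its irrelevant values on functions that are not
  test functions are fixed to 0, so that equality of distributions is equality on test functions.
\<close>

typedef distribution =
  "{T :: (real \<times> real \<Rightarrow> real) \<Rightarrow> real.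
      (\<forall>\<phi>. \<phi> \<notin> test_functions \<longrightarrow> T \<phi> = 0) \<and>
      (\<forall>\<phi>\<in>test_functions. \<forall>\<psi>\<in>test_functions. \<forall>c d.
          T (\<lambda>z. c * \<phi> z + d * \<psi> z) = c * T \<phi> + d * T \<psi>) \<and>
      (\<exists>m C. \<forall>\<phi>\<in>test_functions. \<bar>T \<phi>\<bar> \<le> C * Ck_norm m \<phi>)}"
  morphisms pairing Abs_distribution
  by (rule exI[of _ "\<lambda>\<phi>. 0"]) (auto intro!: exI[of _ 0])

text \<open>The strong topology: uniform convergence on bounded sets of test functions.\<close>

instantiation distribution :: topological_space
begin

definition open_distribution :: "distribution set \<Rightarrow> bool"
  where "open_distribution U \<longleftrightarrow>
    (\<forall>T\<in>U. \<exists>B \<epsilon>. bounded_test_set B \<and> 0 < \<epsilon> \<and>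
       {S. \<forall>\<phi>\<in>B. \<bar>pairing S \<phi> - pairing T \<phi>\<bar> \<le> \<epsilon>} \<subseteq> U)"

instance
proof
  show "open (UNIV :: distribution set)"
    by (auto simp: open_distribution_def bounded_test_set_def intro!: exI[of _ "{}"] exI[of _ 1])
next
  fix U V :: "distribution set"
  assume U: "open U" and V: "open V"
  show "open (U \<inter> V)"
    unfolding open_distribution_def
  proof
    fix T assume T: "T \<in> U \<inter> V"
    obtain B \<epsilon> where B: "bounded_test_set B" "0 < \<epsilon>"
      "{S. \<forall>\<phi>\<in>B. \<bar>pairing S \<phi> - pairing T \<phi>\<bar> \<le> \<epsilon>} \<subseteq> U"
      using U T unfolding open_distribution_def by (meson IntD1)
    obtain C \<delta> where C: "bounded_test_set C" "0 < \<delta>"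
      "{S. \<forall>\<phi>\<in>C. \<bar>pairing S \<phi> - pairing T \<phi>\<bar> \<le> \<delta>} \<subseteq> V"
      using V T unfolding open_distribution_def by (meson IntD2)
    have "bounded_test_set (B \<union> C)"
      using B(1) C(1) by (auto simp: bounded_test_set_def image_Un)
    moreover have "0 < min \<epsilon> \<delta>"
      using B(2) C(2) by simp
    moreover have "{S. \<forall>\<phi>\<in>B \<union> C. \<bar>pairing S \<phi> - pairing T \<phi>\<bar> \<le> min \<epsilon> \<delta>} \<subseteq> U \<inter> V"
      using B(3) C(3) by auto
    ultimately show "\<exists>B \<epsilon>. bounded_test_set B \<and> 0 < \<epsilon> \<and>
        {S. \<forall>\<phi>\<in>B. \<bar>pairing S \<phi> - pairing T \<phi>\<bar> \<le> \<epsilon>} \<subseteq> U \<inter> V"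
      by blast
  qed
next
  fix K :: "distribution set set"
  assume K: "\<forall>U\<in>K. open U"
  show "open (\<Union>K)"
    unfolding open_distribution_def
  proof
    fix T assume "T \<in> \<Union>K"
    then obtain U where U: "U \<in> K" "T \<in> U" by blast
    then obtain B \<epsilon> where "bounded_test_set B" "0 < \<epsilon>"
      "{S. \<forall>\<phi>\<in>B. \<bar>pairing S \<phi> - pairing T \<phi>\<bar> \<le> \<epsilon>} \<subseteq> U"
      using K unfolding open_distribution_def by meson
    with U(1) show "\<exists>B \<epsilon>. bounded_test_set B \<and> 0 < \<epsilon> \<and>
        {S. \<forall>\<phi>\<in>B. \<bar>pairing S \<phi> - pairing T \<phi>\<bar> \<le> \<epsilon>} \<subseteq> \<Union>K"
      by blast
  qed
qed

end

definition weakly_converges :: "(nat \<Rightarrow> 'a::topological_space measure) \<Rightarrow> 'a measure \<Rightarrow> bool"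
  where "weakly_converges M L \<longleftrightarrow>
    prob_space L \<and> sets L = sets borel \<and>
    (\<forall>\<^sub>F n in sequentially. prob_space (M n) \<and> sets (M n) = sets borel) \<and>
    (\<forall>F :: 'a \<Rightarrow> real. continuous_on UNIV F \<and> bounded (range F) \<longrightarrow>
       (\<lambda>n. \<integral>T. F T \<partial>M n) \<longlonglongrightarrow> (\<integral>T. F T \<partial>L))"


subsection \<open>The Green function and the Carleman--Fredholm determinant\<close>

definition is_green_function :: "(real \<times> real \<Rightarrow> real) \<Rightarrow> bool"
  where "is_green_function G \<longleftrightarrow>
    periodic G \<and> G \<in> borel_measurable borel \<and>
    integrable torus_measure G \<and> (\<integral>z. G z \<partial>torus_measure) = 0 \<and>
    (\<forall>\<phi>\<in>test_functions.
       (\<integral>z. G z * (- laplacian \<phi> z) \<partial>torus_measure) = \<phi> 0 - (\<integral>z. \<phi> z \<partial>torus_measure))"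

text \<open>The Green function is determined almost everywhere, which is all that is used below.\<close>

definition green :: "real \<times> real \<Rightarrow> real"
  where "green = (SOME G. is_green_function G)"

definition green_op :: "(real \<times> real \<Rightarrow> real) \<Rightarrow> real \<times> real \<Rightarrow> real"
  where "green_op f x = (\<integral>y. green (x - y) * f y \<partial>torus_measure)"

definition L2_zero :: "(real \<times> real \<Rightarrow> real) set"
  where "L2_zero = {f \<in> borel_measurable borel.
    integrable torus_measure (\<lambda>z. (f z)\<^sup>2) \<and> (\<integral>z. f z \<partial>torus_measure) = 0}"

text \<open>
  Elements of \<open>L\<^sup>2\<close> are represented by functions, so equality, being nonzero and linear
  independence are all understood up to null sets.
\<close>

definition eigenspace ::
    "((real \<times> real \<Rightarrow> real) \<Rightarrow> real \<times> real \<Rightarrow> real) \<Rightarrow> real \<Rightarrow> (real \<times> real \<Rightarrow> real) set"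
  where "eigenspace A \<kappa> = {f \<in> L2_zero. AE z in torus_measure. A f z = \<kappa> * f z}"

definition eigenvalues :: "((real \<times> real \<Rightarrow> real) \<Rightarrow> real \<times> real \<Rightarrow> real) \<Rightarrow> real set"
  where "eigenvalues A = {\<kappa>. \<exists>f\<in>eigenspace A \<kappa>. \<not> (AE z in torus_measure. f z = 0)}"

definition multiplicity_of :: "((real \<times> real \<Rightarrow> real) \<Rightarrow> real \<times> real \<Rightarrow> real) \<Rightarrow> real \<Rightarrow> nat"
  where "multiplicity_of A \<kappa> = Sup {n. \<exists>f :: nat \<Rightarrow> real \<times> real \<Rightarrow> real.
    (\<forall>i<n. f i \<in> eigenspace A \<kappa>) \<and>
    (\<forall>c. (AE z in torus_measure. (\<Sum>i<n. c i * f i z) = 0) \<longrightarrow> (\<forall>i<n. c i = 0))}"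

text \<open>
  \<open>det\<^sub>2 (I - \<beta> A)\<close> for a self-adjoint Hilbert--Schmidt operator \<open>A\<close> on zero-average \<open>L\<^sup>2\<close>, as the
  (unordered) product over the eigenvalues of \<open>A\<close> repeated according to multiplicity. A possible
  eigenvalue \<open>0\<close> contributes the factor 1.
\<close>

definition det2_I_minus :: "real \<Rightarrow> ((real \<times> real \<Rightarrow> real) \<Rightarrow> real \<times> real \<Rightarrow> real) \<Rightarrow> real"
  where "det2_I_minus \<beta> A = Lim (finite_subsets_at_top (eigenvalues A))
    (\<lambda>F. \<Prod>\<kappa>\<in>F. ((1 - \<beta> * \<kappa>) * exp (\<beta> * \<kappa>)) ^ multiplicity_of A \<kappa>)"


subsection \<open>The point vortex ensemble\<close>

definition hamiltonian :: "nat \<Rightarrow> (nat \<Rightarrow> real \<times> real) \<Rightarrow> real"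
  where "hamiltonian N x = (\<Sum>j<N. \<Sum>i<j. green (x i - x j))"

definition partition_fun :: "nat \<Rightarrow> real \<Rightarrow> real"
  where "partition_fun N \<beta> =
    (\<integral>x. exp (\<beta> / real N * hamiltonian N x) \<partial>(\<Pi>\<^sub>M i\<in>{..<N}. torus_measure))"

definition gibbs :: "nat \<Rightarrow> real \<Rightarrow> (nat \<Rightarrow> real \<times> real) measure"
  where "gibbs N \<beta> = density (\<Pi>\<^sub>M i\<in>{..<N}. torus_measure)
    (\<lambda>x. ennreal (exp (\<beta> / real N * hamiltonian N x) / partition_fun N \<beta>))"

definition empirical_vorticity :: "nat \<Rightarrow> (nat \<Rightarrow> real \<times> real) \<Rightarrow> distribution"
  where "empirical_vorticity N x = Abs_distribution (\<lambda>\<phi>.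
    if \<phi> \<in> test_functions
    then 1 / sqrt (real N) * ((\<Sum>j<N. \<phi> (x j)) - real N * (\<integral>z. \<phi> z \<partial>torus_measure))
    else 0)"

definition vorticity_law :: "nat \<Rightarrow> real \<Rightarrow> distribution measure"
  where "vorticity_law N \<beta> = distr (gibbs N \<beta>) borel (empirical_vorticity N)"


subsection \<open>White noise and the energy-enstrophy ensemble\<close>

definition centered_gaussian :: "'a measure \<Rightarrow> ('a \<Rightarrow> real) \<Rightarrow> bool"
  where "centered_gaussian M X \<longleftrightarrow> X \<in> borel_measurable M \<and>
    ((AE \<omega> in M. X \<omega> = 0) \<or> (\<exists>\<sigma>>0. distributed M lborel X (normal_density 0 \<sigma>)))"

definition zero_average_test_functions :: "(real \<times> real \<Rightarrow> real) set"
  where "zero_average_test_functions =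
    {\<phi> \<in> test_functions. (\<integral>z. \<phi> z \<partial>torus_measure) = 0}"

text \<open>
  Joint Gaussianity is automatic: a linear combination of pairings is again a pairing with a test
  function. The last condition says that the noise itself has zero average.
\<close>

definition is_white_noise_law :: "distribution measure \<Rightarrow> bool"
  where "is_white_noise_law M \<longleftrightarrow>
    prob_space M \<and> sets M = sets borel \<and>
    (\<forall>\<phi>\<in>zero_average_test_functions. centered_gaussian M (\<lambda>\<xi>. pairing \<xi> \<phi>)) \<and>
    (\<forall>\<phi>\<in>zero_average_test_functions. \<forall>\<psi>\<in>zero_average_test_functions.
       (\<integral>\<xi>. pairing \<xi> \<phi> * pairing \<xi> \<psi> \<partial>M) = (\<integral>z. \<phi> z * \<psi> z \<partial>torus_measure)) \<and>
    (AE \<xi> in M. pairing \<xi> (\<lambda>z. 1) = 0)"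

definition white_noise_law :: "distribution measure"
  where "white_noise_law = (SOME M. is_white_noise_law M)"

text \<open>
  The double Wiener--Ito integral of a kernel with zero average in each variable is the \<open>L\<^sup>2\<close>-limit
  of the integrals of finite-rank kernels \<open>\<Sum> \<phi> \<otimes> \<psi>\<close> approximating it in \<open>L\<^sup>2\<close>, the integral of
  \<open>\<phi> \<otimes> \<psi>\<close> being the Wick product \<open>\<xi>(\<phi>) \<xi>(\<psi>) - E[\<xi>(\<phi>) \<xi>(\<psi>)]\<close>. By the Ito isometry the limit does
  not depend, up to null sets, on the approximating sequence.
\<close>

definition tensor_kernel ::
    "((real \<times> real \<Rightarrow> real) \<times> (real \<times> real \<Rightarrow> real)) list \<Rightarrow> real \<times> real \<Rightarrow> real \<times> real \<Rightarrow> real"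
  where "tensor_kernel ts x y = (\<Sum>(\<phi>, \<psi>)\<leftarrow>ts. \<phi> x * \<psi> y)"

definition tensor_wiener_integral ::
    "((real \<times> real \<Rightarrow> real) \<times> (real \<times> real \<Rightarrow> real)) list \<Rightarrow> distribution \<Rightarrow> real"
  where "tensor_wiener_integral ts \<xi> =
    (\<Sum>(\<phi>, \<psi>)\<leftarrow>ts. pairing \<xi> \<phi> * pairing \<xi> \<psi> - (\<integral>z. \<phi> z * \<psi> z \<partial>torus_measure))"

definition is_double_wiener_integral ::
    "distribution measure \<Rightarrow> (real \<times> real \<Rightarrow> real \<times> real \<Rightarrow> real) \<Rightarrow> (distribution \<Rightarrow> real) \<Rightarrow> bool"
  where "is_double_wiener_integral M K X \<longleftrightarrow> X \<in> borel_measurable M \<and>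
    (\<exists>ts. (\<forall>n. set (ts n) \<subseteq> zero_average_test_functions \<times> zero_average_test_functions) \<and>
       (\<lambda>n. \<integral>\<^sup>+(x, y). ennreal ((tensor_kernel (ts n) x y - K x y)\<^sup>2)
              \<partial>(torus_measure \<Otimes>\<^sub>M torus_measure)) \<longlonglongrightarrow> 0 \<and>
       (\<lambda>n. \<integral>\<^sup>+\<xi>. ennreal ((tensor_wiener_integral (ts n) \<xi> - X \<xi>)\<^sup>2) \<partial>M) \<longlonglongrightarrow> 0)"

definition wick_energy :: "distribution \<Rightarrow> real"
  where "wick_energy \<xi> = 1 / 2 *
    (SOME X. is_double_wiener_integral white_noise_law (\<lambda>x y. green (x - y)) X) \<xi>"

definition energy_enstrophy :: "real \<Rightarrow> distribution measure"
  where "energy_enstrophy \<beta> = density white_noise_law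
    (\<lambda>\<xi>. ennreal (exp (\<beta> * wick_energy \<xi>) / (\<integral>\<zeta>. exp (\<beta> * wick_energy \<zeta>) \<partial>white_noise_law)))"

end

theory Submission
  imports Defs
begin

text \<open>In the basis \<open>cas k\<close> the Green function is \<open>\<Sum>k. lam k * cas k\<close>, and the truncated energy of the
  particles is exactly \<open>\<Sum>k. lam k * ((a k)\<^sup>2 - 1) / 2\<close> in the Fourier coefficients \<open>a k\<close> of the
  empirical vorticity. By the central limit theorem these converge jointly to independent standard
  Gaussians, the coefficients of white noise, for which the same expression is the truncated Wick
  energy. The truncation error is small in \<open>L\<^sup>2\<close> uniformly in \<open>N\<close>, since the pair interactions are
  orthogonal, and the exponentials are uniformly integrable at high temperature: decoupling the
  particles into two halves and a second-order expansion of the conditional expectation reduce this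
  to exponential moments of \<open>\<bar>\<Sum>j. cis (phase k (x j))\<bar>\<^sup>2 / N\<close>. Hence the weighted expectations
  converge. The limit of the partition functions is a product of Gaussian integrals, i.e. the
  regularised determinant. For continuous functions of the distribution itself one uses that synthesis
  from the coefficients is continuous on the boxes \<open>\<bar>a k\<bar> \<le> R * sqw k\<close>, which carry almost all the mass.\<close>

text \<open>The logarithmic singularity of G makes the energy discontinuous in the empirical
  measure, so weak convergence cannot be applied to it directly. Every exponential estimate is
  therefore made for the trigonometric truncations of G, with constants free of the cut-off and of
  N, and the cut-off is removed by Fatou or by L2 approximation. In two dimensions
  \<open>lam\<close> is square summable but not summable: the self-interactions diverge with the
  cut-off and have to be subtracted, which is why a Wick-ordered energy and a regularised
  determinant appear in the limit, while L2 errors remain under control.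

  Both \<open>green\<close> and \<open>white_noise_law\<close> are chosen by description, so nothing
  may be read off a preferred construction. Existence has to be shown, and all further facts come
  from the defining properties: \<open>green\<close> is reached through its Fourier coefficients,
  white noise through the law of its coefficients.

  The range of \<beta> is set by the exponential bound alone. Its constants are made to be easily
  verified rather than sharp.\<close>

type_synonym plane = "real \<times> real"

type_synonym freq = "int \<times> int"

abbreviation \<T> :: "plane measure" where "\<T> \<equiv> torus_measure"

abbreviation \<P> :: "nat set \<Rightarrow> (nat \<Rightarrow> plane) measure" where "\<P> A \<equiv> \<Pi>\<^sub>M i\<in>A. \<T>"

abbreviation particles :: "nat \<Rightarrow> (nat \<Rightarrow> plane) measure" where "particles N \<equiv> \<P> {..<N}"

abbreviation \<D> :: "(plane \<Rightarrow> real) set" where "\<D> \<equiv> test_functions"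

abbreviation \<Z> :: "(plane \<Rightarrow> real) set" where "\<Z> \<equiv> zero_average_test_functions"

abbreviation \<W> :: "distribution measure" where "\<W> \<equiv> white_noise_law"

abbreviation \<N> :: "real measure" where "\<N> \<equiv> std_normal_distribution"

subsection \<open>Translation invariance and the trigonometric basis\<close>

lemma sets_torus_measure [measurable_cong, simp]: "sets \<T> = sets borel"
 by (simp add: torus_measure_def)

lemma space_torus_measure [simp]: "space \<T> = UNIV"
 by (simp add: torus_measure_def)

lemma measurable_torus_eq [simp]: "measurable \<T> N = measurable borel N"
 by (rule measurable_cong_sets) auto

lemma unit_square_sets [measurable]: "{0..<1::real} \<times> {0..<1::real} \<in> sets borel"
 by (intro borel_Times) auto

lemma emeasure_unit_square: "emeasure lborel ({0..<1::real} \<times> {0..<1::real}) = 1"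
proof -
 have "emeasure (lborel \<Otimes>\<^sub>M lborel) ({0..<1::real} \<times> {0..<1::real}) = 1"
  by (subst lborel.emeasure_pair_measure_Times) auto
 then show ?thesis by (simp add: lborel_prod)
qed

interpretation torus: prob_space \<T>
 unfolding torus_measure_def
 by (rule prob_space_uniform_measure) (auto simp: emeasure_unit_square)

lemma nn_integral_torus:
 assumes [measurable]: "f \<in> borel_measurable borel"
 shows "(\<integral>\<^sup>+z. f z \<partial>\<T>) = (\<integral>\<^sup>+z. f z * indicator ({0..<1} \<times> {0..<1}) z \<partial>lborel)"
 unfolding torus_measure_def
 by (subst nn_integral_uniform_measure) (auto simp: emeasure_unit_square divide_ennreal_def)

section \<open>Fundamental domains and invariance of the torus measure\<close>

definition lattice :: "freq \<Rightarrow> plane"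
 where "lattice k = (of_int (fst k), of_int (snd k))"

definition wrap :: "plane \<Rightarrow> plane"
 where "wrap z = (frac (fst z), frac (snd z))"

lemma measurable_wrap [measurable]: "wrap \<in> borel_measurable borel"
proof -
 have [measurable]: "fst \<in> borel_measurable (borel :: plane measure)"
  "snd \<in> borel_measurable (borel :: plane measure)"
  by (auto intro!: borel_measurable_continuous_onI continuous_intros)
 show ?thesis
  unfolding wrap_def[abs_def] frac_def by (rule borel_measurable_Pair; measurable)
qed

lemma wrap_add_lattice [simp]: "wrap (z + lattice k) = wrap z"
 by (simp add: wrap_def lattice_def frac_def)

lemma periodic_int:
 assumes "periodic f"
 shows "f (x + of_int m, y + of_int n) = f (x, y)"
proof -
 have 1: "f (x + 1, y) = f (x, y)" and 2: "f (x, y + 1) = f (x, y)" for x y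
  using assms by (auto simp: periodic_def)
 have "f (x + of_int m, y) = f (x, y)" for x y
 proof (induction m rule: int_induct[where k = 0])
  case (step1 i) then show ?case using 1[of "x + of_int i" y] by (simp add: add_ac)
 next
  case (step2 i) then show ?case using 1[of "x + of_int (i - 1)" y] by (simp add: algebra_simps)
 qed simp
 moreover have "f (x, y + of_int n) = f (x, y)" for x y
 proof (induction n rule: int_induct[where k = 0])
  case (step1 i) then show ?case using 2[of x "y + of_int i"] by (simp add: add_ac)
 next
  case (step2 i) then show ?case using 2[of x "y + of_int (i - 1)"] by (simp add: algebra_simps)
 qed simp
 ultimately show ?thesis by metis
qed

lemma periodic_add_lattice: "periodic f \<Longrightarrow> f (z + lattice k) = f z"
 using periodic_int[of f "fst z" "fst k" "snd z" "snd k"]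
 by (cases z) (simp add: lattice_def)

lemma wrap_eq: "\<exists>k. wrap z = z + lattice k"
 by (rule exI[of _ "(- \<lfloor>fst z\<rfloor>, - \<lfloor>snd z\<rfloor>)"]) (simp add: wrap_def lattice_def frac_def prod_eq_iff)

lemma periodic_wrap [simp]: "periodic f \<Longrightarrow> f (wrap z) = f z"
 using wrap_eq[of z] by (auto simp: periodic_add_lattice)

lemma wrap_in_square: "wrap z \<in> {0..<1} \<times> {0..<1}"
 by (simp add: wrap_def frac_lt_1)

lemma ex1_lattice_square: "\<exists>!k. z + lattice k \<in> {0..<1} \<times> {0..<1}"
proof (rule ex1I[of _ "(- \<lfloor>fst z\<rfloor>, - \<lfloor>snd z\<rfloor>)"])
 show "z + lattice (- \<lfloor>fst z\<rfloor>, - \<lfloor>snd z\<rfloor>) \<in> {0..<1} \<times> {0..<1}"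
  by (cases z) (simp add: lattice_def, linarith)
next
 fix k assume "z + lattice k \<in> {0..<1} \<times> {0..<1}"
 then show "k = (- \<lfloor>fst z\<rfloor>, - \<lfloor>snd z\<rfloor>)"
  by (cases z; cases k) (simp add: lattice_def, linarith)
qed

lemma nn_integral_lattice_indicator:
 assumes "\<exists>!k. z + lattice k \<in> P"
 shows "(\<integral>\<^sup>+k. indicator P (z + lattice k) \<partial>count_space UNIV) = 1"
proof -
 obtain k where k: "z + lattice k \<in> P" "\<forall>l. z + lattice l \<in> P \<longrightarrow> l = k"
  using assms by (rule ex1E)
 have "z + lattice l \<in> P \<longleftrightarrow> l = k" for l
  using k(1) k(2)[rule_format, of l] by (cases "l = k") auto
 then have "indicator P (z + lattice l) = (indicator {k} l :: ennreal)" for l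
  by (simp only: indicator_def singleton_iff)
 then show ?thesis by simp
qed

lemma nn_integral_lborel_shift:
 fixes f :: "plane \<Rightarrow> ennreal"
 assumes [measurable]: "f \<in> borel_measurable borel"
 shows "(\<integral>\<^sup>+z. f (z + c) \<partial>lborel) = (\<integral>\<^sup>+z. f z \<partial>lborel)"
proof -
 have "(\<integral>\<^sup>+z. f z \<partial>distr lborel borel ((+) c)) = (\<integral>\<^sup>+z. f (c + z) \<partial>lborel)"
  by (subst nn_integral_distr) auto
 then show ?thesis by (simp add: lborel_distr_plus add.commute)
qed

lemma nn_integral_lborel_reflect:
 fixes f :: "plane \<Rightarrow> ennreal"
 assumes [measurable]: "f \<in> borel_measurable borel"
 shows "(\<integral>\<^sup>+z. f (c - z) \<partial>lborel) = (\<integral>\<^sup>+z. f z \<partial>lborel)"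
proof -
 have eq: "c + (\<Sum>j\<in>Basis. (- 1 * (x \<bullet> j)) *\<^sub>R j) = c - x" for x :: "plane"
  using euclidean_representation[of x] by (simp add: sum_negf)
 have "(lborel :: plane measure) = density (distr lborel borel (\<lambda>x. c - x)) (\<lambda>_. 1)"
  using lborel_affine_euclidean[of "\<lambda>_. - 1" c] by (simp add: eq[simplified])
 then have "(\<integral>\<^sup>+z. f z \<partial>lborel) = (\<integral>\<^sup>+z. f z \<partial>distr lborel borel (\<lambda>x. c - x))"
  by (metis density_1)
 also have "... = (\<integral>\<^sup>+z. f (c - z) \<partial>lborel)"
  by (subst nn_integral_distr) auto
 finally show ?thesis by simp
qed

text \<open>Any two fundamental domains give the same integral: insert the partition of unity
 \<open>1 = (\<Sum>k. indicator Q (z + k))\<close> and shift each term back by the periodicity of \<open>f\<close>.\<close>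

lemma nn_integral_fundamental_domain:
 assumes f [measurable]: "f \<in> borel_measurable borel" and per: "\<And>z k. f (z + lattice k) = f z"
  and P [measurable]: "P \<in> sets borel" and ex1: "\<And>z. \<exists>!k. z + lattice k \<in> P"
 shows "(\<integral>\<^sup>+z. f z * indicator P z \<partial>lborel) = (\<integral>\<^sup>+z. f z \<partial>\<T>)"
proof -
 let ?Q = "{0..<1} \<times> {0..<1} :: plane set"
 have "(\<integral>\<^sup>+z. f z * indicator P z \<partial>lborel)
   = (\<integral>\<^sup>+z. (\<integral>\<^sup>+k. f z * indicator P z * indicator ?Q (z + lattice k) \<partial>count_space UNIV) \<partial>lborel)"
  by (subst nn_integral_cmult) (simp_all add: nn_integral_lattice_indicator[OF ex1_lattice_square])
 also have "... = (\<integral>\<^sup>+k. (\<integral>\<^sup>+z. f z * indicator P z * indicator ?Q (z + lattice k) \<partial>lborel) \<partial>count_space UNIV)"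
  by (rule nn_integral_count_space_nn_integral) auto
 also have "... = (\<integral>\<^sup>+k. (\<integral>\<^sup>+z. f z * indicator ?Q z * indicator P (z + lattice (- k)) \<partial>lborel) \<partial>count_space UNIV)"
 proof (rule nn_integral_cong)
  fix k
  have neg: "lattice (- k) = - lattice k" by (simp add: lattice_def)
  have "(\<integral>\<^sup>+z. f z * indicator ?Q z * indicator P (z + lattice (- k)) \<partial>lborel)
    = (\<integral>\<^sup>+z. f (z + lattice k) * indicator ?Q (z + lattice k) * indicator P (z + lattice k + lattice (- k)) \<partial>lborel)"
   by (subst nn_integral_lborel_shift) auto
  then show "(\<integral>\<^sup>+z. f z * indicator P z * indicator ?Q (z + lattice k) \<partial>lborel)
    = (\<integral>\<^sup>+z. f z * indicator ?Q z * indicator P (z + lattice (- k)) \<partial>lborel)"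
   by (simp add: per neg mult_ac)
 qed
 also have "... = (\<integral>\<^sup>+k. (\<integral>\<^sup>+z. f z * indicator ?Q z * indicator P (z + lattice k) \<partial>lborel) \<partial>count_space UNIV)"
  by (rule nn_integral_bij_count_space[where g = uminus, of UNIV UNIV "\<lambda>k. (\<integral>\<^sup>+z. f z * indicator ?Q z * indicator P (z + lattice k) \<partial>lborel)"])
    (auto simp: bij_betw_def inj_on_def intro!: surjI[of uminus uminus])
 also have "... = (\<integral>\<^sup>+z. (\<integral>\<^sup>+k. f z * indicator ?Q z * indicator P (z + lattice k) \<partial>count_space UNIV) \<partial>lborel)"
  by (rule nn_integral_count_space_nn_integral[symmetric]) auto
 also have "... = (\<integral>\<^sup>+z. f z * indicator ?Q z \<partial>lborel)"
  by (subst nn_integral_cmult) (simp_all add: nn_integral_lattice_indicator[OF ex1])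
 finally show ?thesis by (simp add: nn_integral_torus)
qed

lemma measure_eqI_nn_integral_indicator:
 assumes "sets M = sets borel" "sets N = sets borel"
  and "\<And>A. A \<in> sets borel \<Longrightarrow> (\<integral>\<^sup>+x. indicator A x \<partial>M) = (\<integral>\<^sup>+x. indicator A x \<partial>N)"
 shows "M = N"
 using assms by (intro measure_eqI) auto

text \<open>The preimage of the unit square under z |-> y - z is again a fundamental domain, so
  \<open>nn_integral_fundamental_domain\<close> applies. Reflections suffice for all invariance: a
  translation is the composition of two of them, which is how \<open>integral_torus_shift\<close> is
  obtained.\<close>

lemma distr_torus_reflect: "distr \<T> borel (\<lambda>z. wrap (y - z)) = \<T>"
proof (rule measure_eqI_nn_integral_indicator)
 fix A :: "plane set" assume [measurable]: "A \<in> sets borel"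
 let ?Q = "{0..<1} \<times> {0..<1} :: plane set"
 define f where "f = (\<lambda>z. indicator A (wrap z) :: ennreal)"
 have [measurable]: "f \<in> borel_measurable borel" unfolding f_def by measurable
 have P: "(\<lambda>z. y - z) -` ?Q \<in> sets borel"
  by (rule measurable_sets_borel[of _ borel]) measurable
 have ex1: "\<exists>!k. z + lattice k \<in> (\<lambda>z. y - z) -` ?Q" for z
 proof -
  obtain k where k: "y - z + lattice k \<in> ?Q" "\<forall>l. y - z + lattice l \<in> ?Q \<longrightarrow> l = k"
   using ex1_lattice_square[of "y - z"] by (rule ex1E)
  have eq: "y - (z + lattice l) = y - z + lattice (- l)" for l
   by (simp add: lattice_def diff_diff_eq prod_eq_iff)
  show ?thesis
  proof (rule ex1I[of _ "- k"])
   show "z + lattice (- k) \<in> (\<lambda>z. y - z) -` ?Q"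
    using k(1) unfolding vimage_eq eq by simp
   fix l assume "z + lattice l \<in> (\<lambda>z. y - z) -` ?Q"
   then have "- l = k" unfolding vimage_eq eq by (rule k(2)[rule_format])
   then show "l = - k" by (metis minus_minus)
  qed
 qed
 have "(\<integral>\<^sup>+x. indicator A x \<partial>distr \<T> borel (\<lambda>z. wrap (y - z))) = (\<integral>\<^sup>+z. f (y - z) \<partial>\<T>)"
  by (subst nn_integral_distr) (auto simp: f_def)
 also have "... = (\<integral>\<^sup>+z. f (y - z) * indicator ((\<lambda>z. y - z) -` ?Q) (y - z) \<partial>lborel)"
  by (subst nn_integral_torus) (auto intro!: nn_integral_cong simp: indicator_def)
 also have "... = (\<integral>\<^sup>+z. f z * indicator ((\<lambda>z. y - z) -` ?Q) z \<partial>lborel)"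
  using P by (subst nn_integral_lborel_reflect[of "\<lambda>z. f z * indicator ((\<lambda>z. y - z) -` ?Q) z"]) auto
 also have "... = (\<integral>\<^sup>+z. f z \<partial>\<T>)"
  using P ex1 by (intro nn_integral_fundamental_domain) (auto simp: f_def)
 also have "... = (\<integral>\<^sup>+x. indicator A x \<partial>\<T>)"
 proof -
  have "f z * indicator ?Q z = indicator A z * indicator ?Q z" for z
   by (cases z) (auto simp: f_def indicator_def wrap_def frac_eq)
  then show ?thesis by (simp only: nn_integral_torus \<open>f \<in> borel_measurable borel\<close> borel_measurable_indicator \<open>A \<in> sets borel\<close>)
 qed
 finally show "(\<integral>\<^sup>+x. indicator A x \<partial>distr \<T> borel (\<lambda>z. wrap (y - z))) = (\<integral>\<^sup>+x. indicator A x \<partial>\<T>)" .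
qed auto

lemma integral_torus_reflect:
 fixes f :: "plane \<Rightarrow> 'a::{banach, second_countable_topology}"
 assumes "periodic f" "f \<in> borel_measurable borel"
 shows "(\<integral>z. f (y - z) \<partial>\<T>) = (\<integral>z. f z \<partial>\<T>)"
proof -
 have "(\<integral>z. f z \<partial>distr \<T> borel (\<lambda>z. wrap (y - z))) = (\<integral>z. f (wrap (y - z)) \<partial>\<T>)"
  using assms(2) by (subst integral_distr) auto
 then show ?thesis using assms(1) by (simp add: distr_torus_reflect)
qed

lemma periodic_reflect:
 assumes "periodic f" shows "periodic (\<lambda>z. f (x - z))"
 unfolding periodic_def
proof (intro allI conjI)
 fix a b
 have "f (fst x - a - 1 + 1, snd x - b) = f (fst x - a - 1, snd x - b)" "f (fst x - a, snd x - b - 1 + 1) = f (fst x - a, snd x - b - 1)"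
  using assms unfolding periodic_def by blast+
 then show "f (x - (a + 1, b)) = f (x - (a, b))" "f (x - (a, b + 1)) = f (x - (a, b))"
  by (simp_all add: minus_prod_def diff_diff_eq)
qed

lemma integral_torus_shift:
 fixes f :: "plane \<Rightarrow> 'a::{banach, second_countable_topology}"
 assumes "periodic f" "f \<in> borel_measurable borel"
 shows "(\<integral>z. f (z + y) \<partial>\<T>) = (\<integral>z. f z \<partial>\<T>)"
 using integral_torus_reflect[OF periodic_reflect[OF assms(1)], of y 0] assms(2)
 by (simp add: integral_torus_reflect[OF assms] add.commute)

lemma nn_integral_torus_reflect:
 fixes f :: "plane \<Rightarrow> ennreal"
 assumes "periodic f" "f \<in> borel_measurable borel"
 shows "(\<integral>\<^sup>+z. f (y - z) \<partial>\<T>) = (\<integral>\<^sup>+z. f z \<partial>\<T>)"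
proof -
 have "(\<integral>\<^sup>+z. f z \<partial>distr \<T> borel (\<lambda>z. wrap (y - z))) = (\<integral>\<^sup>+z. f (wrap (y - z)) \<partial>\<T>)"
  using assms(2) by (subst nn_integral_distr) auto
 then show ?thesis using assms(1) by (simp add: distr_torus_reflect)
qed

section \<open>The real trigonometric basis\<close>

definition phase :: "freq \<Rightarrow> plane \<Rightarrow> real"
 where "phase k z = 2 * pi * (of_int (fst k) * fst z + of_int (snd k) * snd z)"

text \<open>\<open>cas k\<close> and \<open>cas (- k)\<close> span the cosine and the sine of frequency \<open>k\<close>, so the \<open>cas k\<close> form a
 real orthonormal basis indexed by \<open>\<int>\<^sup>2\<close>.\<close>

definition cas :: "freq \<Rightarrow> plane \<Rightarrow> real"
 where "cas k z = cos (phase k z) + sin (phase k z)"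

lemma phase_add_left: "phase (k + l) z = phase k z + phase l z"
 and phase_diff_left: "phase (k - l) z = phase k z - phase l z"
 and phase_minus_left: "phase (- k) z = - phase k z"
 and phase_add_right: "phase k (z + w) = phase k z + phase k w"
 and phase_diff_right: "phase k (z - w) = phase k z - phase k w"
 and phase_minus_right: "phase k (- z) = - phase k z"
 and phase_0_left [simp]: "phase 0 z = 0"
 and phase_0_right [simp]: "phase k 0 = 0"
 by (simp_all add: phase_def algebra_simps)

lemma cas_0 [simp]: "cas 0 z = 1"
 by (simp add: cas_def)

lemma continuous_on_phase [continuous_intros]:
 "continuous_on A f \<Longrightarrow> continuous_on A (\<lambda>x. phase k (f x))"
 unfolding phase_def by (intro continuous_intros)

lemma continuous_on_cas [continuous_intros]:
 fixes f :: "'a::t2_space \<Rightarrow> plane"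
 shows
 "continuous_on A f \<Longrightarrow> continuous_on A (\<lambda>x. cas k (f x))"
 unfolding cas_def by (intro continuous_intros)

lemma measurable_phase [measurable]: "phase k \<in> borel_measurable borel"
 by (intro borel_measurable_continuous_onI continuous_on_phase continuous_on_id)

lemma measurable_cas [measurable]: "cas k \<in> borel_measurable borel"
 by (intro borel_measurable_continuous_onI continuous_intros)

lemma abs_cas_le: "\<bar>cas k z\<bar> \<le> 2"
 unfolding cas_def using abs_cos_le_one[of "phase k z"] abs_sin_le_one[of "phase k z"] by linarith

lemma cis_periodic_phase: "periodic (\<lambda>z. cis (phase k z))"
proof -
 have "cis (phase k (x + 1, y)) = cis (phase k (x, y)) * cis (2 * pi * of_int (fst k))"
  "cis (phase k (x, y + 1)) = cis (phase k (x, y)) * cis (2 * pi * of_int (snd k))" for x y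
  by (simp_all add: cis_mult phase_def algebra_simps)
 then show ?thesis by (simp add: periodic_def cis_multiple_2pi)
qed

lemma periodic_cos_phase: "periodic (\<lambda>z. cos (phase k z))"
 and periodic_sin_phase: "periodic (\<lambda>z. sin (phase k z))"
 using cis_periodic_phase[of k] by (auto simp: periodic_def complex_eq_iff)

lemma periodic_cas: "periodic (cas k)"
 using periodic_cos_phase[of k] periodic_sin_phase[of k] by (simp add: periodic_def cas_def)

text \<open>Translating by y multiplies the integral by \<open>cis (phase k y)\<close>; it must
  vanish as soon as this factor differs from 1 for some y.\<close>

lemma integral_cis_phase: "(\<integral>z. cis (phase k z) \<partial>\<T>) = (if k = 0 then 1 else 0)"
proof (cases "k = 0")
 case False
 let ?I = "\<integral>z. cis (phase k z) \<partial>\<T>"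
 \<comment> \<open>Half a period in a coordinate where k does not vanish: the phase there is pi and
   the factor is -1.\<close>
 obtain y where y: "cis (phase k y) \<noteq> 1"
 proof (cases "fst k = 0")
  case True
  then have "snd k \<noteq> 0" using False by (cases k) (auto simp: zero_prod_def)
  then have "phase k (0, 1 / (2 * of_int (snd k))) = pi" by (simp add: phase_def)
  then show thesis by (intro that[of "(0, 1 / (2 * of_int (snd k)))"]) simp
 next
  case False
  then have "phase k (1 / (2 * of_int (fst k)), 0) = pi" by (simp add: phase_def)
  then show thesis by (intro that[of "(1 / (2 * of_int (fst k)), 0)"]) simp
 qed
 have "?I = (\<integral>z. cis (phase k (z + y)) \<partial>\<T>)"
  by (rule integral_torus_shift[symmetric, OF cis_periodic_phase])
    (intro borel_measurable_continuous_onI continuous_intros)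
 also have "... = cis (phase k y) * ?I"
  by (simp add: phase_add_right cis_mult[symmetric] mult.commute)
 finally show ?thesis using y False by auto
qed (use torus.prob_space in simp)

lemma integrable_torus_bounded:
 fixes f :: "plane \<Rightarrow> 'a::{banach, second_countable_topology}"
 assumes "f \<in> borel_measurable borel" "\<And>z. norm (f z) \<le> B"
 shows "integrable \<T> f"
 using assms by (intro torus.integrable_const_bound[of _ B]) auto

lemma integrable_cis_phase: "integrable \<T> (\<lambda>z. cis (phase k z))"
 by (rule integrable_torus_bounded[of _ 1])
   (auto intro!: borel_measurable_continuous_onI continuous_intros)

lemma integrable_cos_phase [simp]: "integrable \<T> (\<lambda>z. cos (phase k z))"
 and integrable_sin_phase [simp]: "integrable \<T> (\<lambda>z. sin (phase k z))"
 by (rule integrable_torus_bounded[of _ 1]; simp)+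

lemma integral_cos_phase: "(\<integral>z. cos (phase k z) \<partial>\<T>) = (if k = 0 then 1 else 0)"
 and integral_sin_phase: "(\<integral>z. sin (phase k z) \<partial>\<T>) = 0"
 using integral_cis_phase[of k]
  integral_Re[OF integrable_cis_phase[of k]] integral_Im[OF integrable_cis_phase[of k]]
 by (auto split: if_splits)

text \<open>Products of equal type give the cosine of the difference, mixed products the sine of the
  sum. Sines always integrate to zero, so orthonormality depends on the frequency k - l
  alone.\<close>

lemma cas_mult_cas: "cas k z * cas l w = cos (phase k z - phase l w) + sin (phase k z + phase l w)"
 by (simp add: cas_def cos_diff sin_add algebra_simps)

lemma integral_cas_mult_cas:
 "(\<integral>z. cas k z * cas l z \<partial>\<T>) = (if k = l then 1 else 0)"
proof -
 have "(\<integral>z. cas k z * cas l z \<partial>\<T>)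
   = (\<integral>z. cos (phase (k - l) z) + sin (phase (k + l) z) \<partial>\<T>)"
  by (simp add: cas_mult_cas phase_add_left phase_diff_left)
 also have "... = (if k = l then 1 else 0)"
  by (subst Bochner_Integration.integral_add) (auto simp: integral_cos_phase integral_sin_phase)
 finally show ?thesis .
qed

lemma integrable_cas_mult:
 assumes "integrable \<T> f"
 shows "integrable \<T> (\<lambda>z. f z * cas k z)"
proof (rule Bochner_Integration.integrable_bound[of _ "\<lambda>z. 2 * f z"])
 show "AE z in \<T>. norm (f z * cas k z) \<le> norm (2 * f z)"
  using abs_cas_le[of k] by (intro AE_I2) (auto simp: abs_mult mult.commute[of 2] simp del: split_paired_All intro!: mult_left_mono)
qed (use assms in auto)

lemma integrable_cas [simp]: "integrable \<T> (cas k)"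
 by (rule integrable_torus_bounded[of _ 2]) (auto simp: abs_cas_le)

lemma integral_cas: "(\<integral>z. cas k z \<partial>\<T>) = (if k = 0 then 1 else 0)"
 using integral_cas_mult_cas[of k 0] by simp

definition cas_coeff :: "(plane \<Rightarrow> real) \<Rightarrow> freq \<Rightarrow> real"
 where "cas_coeff f k = (\<integral>z. f z * cas k z \<partial>\<T>)"

text \<open>A square cut-off: symmetric under negation, so that parts odd in the frequency cancel,
  and a product, so that sums can be taken row by row.\<close>

definition grid :: "nat \<Rightarrow> freq set"
 where "grid n = {- int n..int n} \<times> {- int n..int n}"

lemma finite_grid [simp]: "finite (grid n)"
 by (simp add: grid_def)

lemma grid_mono: "m \<le> n \<Longrightarrow> grid m \<subseteq> grid n"
 by (auto simp: grid_def)

lemma uminus_in_grid [simp]: "- k \<in> grid n \<longleftrightarrow> k \<in> grid n"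
 by (cases k) (auto simp: grid_def)

lemma mem_grid_self: "k \<in> grid (nat (max \<bar>fst k\<bar> \<bar>snd k\<bar>))"
 by (cases k) (auto simp: grid_def)

lemma filterlim_grid: "filterlim grid (finite_subsets_at_top UNIV) sequentially"
 unfolding filterlim_finite_subsets_at_top
proof (intro allI impI)
 fix X :: "freq set" assume X: "finite X \<and> X \<subseteq> UNIV"
 define n where "n = Max (insert 0 ((\<lambda>k. nat (max \<bar>fst k\<bar> \<bar>snd k\<bar>)) ` X))"
 have "X \<subseteq> grid m" if "n \<le> m" for m
 proof
  fix k assume "k \<in> X"
  then have "nat (max \<bar>fst k\<bar> \<bar>snd k\<bar>) \<le> n" using X unfolding n_def by (intro Max_ge) auto
  then show "k \<in> grid m" using mem_grid_self[of k] grid_mono[of _ m] that by (meson order_trans subsetD)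
 qed
 then show "\<forall>\<^sub>F m in sequentially. finite (grid m) \<and> X \<subseteq> grid m \<and> grid m \<subseteq> UNIV"
  unfolding eventually_sequentially by (intro exI[of _ n]) auto
qed

lemma sum_grid_uminus: "(\<Sum>k\<in>grid n. f (- k)) = (\<Sum>k\<in>grid n. f k)"
 by (rule sum.reindex_bij_witness[of _ uminus uminus]) auto

section \<open>Square-integrable functions\<close>

lemma integrable_mult_of_squares:
 fixes f g :: "'a \<Rightarrow> real"
 assumes [measurable]: "f \<in> borel_measurable M" "g \<in> borel_measurable M"
  and f: "integrable M (\<lambda>x. (f x)^2)" and g: "integrable M (\<lambda>x. (g x)^2)"
 shows "integrable M (\<lambda>x. f x * g x)"
proof (rule Bochner_Integration.integrable_bound)
 show "integrable M (\<lambda>x. (f x)^2 + (g x)^2)" using f g by simp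
 have "\<bar>a * b\<bar> \<le> a\<^sup>2 + b\<^sup>2" for a b :: real
 proof -
  have "2 * (\<bar>a\<bar> * \<bar>b\<bar>) \<le> a\<^sup>2 + b\<^sup>2"
   using sum_squares_bound[of "\<bar>a\<bar>" "\<bar>b\<bar>"] by (simp add: mult.assoc)
  moreover have "0 \<le> \<bar>a\<bar> * \<bar>b\<bar>" by simp
  ultimately show ?thesis unfolding abs_mult by linarith
 qed
 then show "AE x in M. norm (f x * g x) \<le> norm ((f x)^2 + (g x)^2)" by simp
qed auto

lemma integral_double_sum:
 fixes f :: "'i \<Rightarrow> 'j \<Rightarrow> 'a \<Rightarrow> real"
 assumes "\<And>i j. i \<in> I \<Longrightarrow> j \<in> J \<Longrightarrow> integrable M (f i j)"
 shows "integrable M (\<lambda>x. \<Sum>i\<in>I. \<Sum>j\<in>J. f i j x)"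
  and "(\<integral>x. (\<Sum>i\<in>I. \<Sum>j\<in>J. f i j x) \<partial>M) = (\<Sum>i\<in>I. \<Sum>j\<in>J. \<integral>x. f i j x \<partial>M)"
proof -
 let ?A = "\<integral>x. (\<Sum>i\<in>I. \<Sum>j\<in>J. f i j x) \<partial>M"
 show "integrable M (\<lambda>x. \<Sum>i\<in>I. \<Sum>j\<in>J. f i j x)" using assms by (intro Bochner_Integration.integrable_sum) auto
 have "?A = (\<Sum>i\<in>I. \<integral>x. (\<Sum>j\<in>J. f i j x) \<partial>M)"
  using assms by (intro Bochner_Integration.integral_sum Bochner_Integration.integrable_sum) auto
 then show "?A = (\<Sum>i\<in>I. \<Sum>j\<in>J. \<integral>x. f i j x \<partial>M)"
  using assms by (simp add: Bochner_Integration.integral_sum)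
qed

lemma orthogonal_sum_square:
 fixes U :: "'b \<Rightarrow> 'a \<Rightarrow> real"
 assumes I: "finite I" and m: "\<And>i. i \<in> I \<Longrightarrow> U i \<in> borel_measurable M"
  and sq: "\<And>i. i \<in> I \<Longrightarrow> integrable M (\<lambda>x. (U i x)^2)"
  and orth: "\<And>i j. i \<in> I \<Longrightarrow> j \<in> I \<Longrightarrow> i \<noteq> j \<Longrightarrow> (\<integral>x. U i x * U j x \<partial>M) = 0"
 shows "integrable M (\<lambda>x. (\<Sum>i\<in>I. U i x)^2)" and "(\<integral>x. (\<Sum>i\<in>I. U i x)^2 \<partial>M) = (\<Sum>i\<in>I. \<integral>x. (U i x)^2 \<partial>M)"
proof -
 let ?A = "\<integral>x. (\<Sum>i\<in>I. U i x)^2 \<partial>M"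
 have int: "integrable M (\<lambda>x. U i x * U j x)" if "i \<in> I" "j \<in> I" for i j
  using that m sq by (intro integrable_mult_of_squares) auto
 have eq: "(\<Sum>i\<in>I. U i x)^2 = (\<Sum>i\<in>I. \<Sum>j\<in>I. U i x * U j x)" for x by (simp add: power2_eq_square sum_product)
 show "integrable M (\<lambda>x. (\<Sum>i\<in>I. U i x)^2)" unfolding eq by (rule integral_double_sum(1)[OF int])
 have "?A = (\<Sum>i\<in>I. \<Sum>j\<in>I. if i = j then \<integral>x. (U i x)^2 \<partial>M else 0)"
  unfolding eq by (subst integral_double_sum(2)[OF int]) (auto intro!: sum.cong simp: orth power2_eq_square)
 then show "?A = (\<Sum>i\<in>I. \<integral>x. (U i x)^2 \<partial>M)" using I by simp
qed

lemma Cauchy_Schwarz_integral: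
 fixes f g :: "'a \<Rightarrow> real"
 assumes [measurable]: "f \<in> borel_measurable M" "g \<in> borel_measurable M"
  and f: "integrable M (\<lambda>x. (f x)^2)" and g: "integrable M (\<lambda>x. (g x)^2)"
 shows "(\<integral>x. \<bar>f x * g x\<bar> \<partial>M) \<le> sqrt (\<integral>x. (f x)^2 \<partial>M) * sqrt (\<integral>x. (g x)^2 \<partial>M)"
proof -
 let ?A = "\<integral>\<^sup>+x. ennreal \<bar>f x\<bar> * ennreal \<bar>g x\<bar> \<partial>M"
 let ?B = "\<integral>\<^sup>+x. (ennreal \<bar>f x\<bar>)^2 \<partial>M"
 let ?C = "\<integral>\<^sup>+x. (ennreal \<bar>g x\<bar>)^2 \<partial>M"
 let ?D = "\<integral>x. \<bar>f x * g x\<bar> \<partial>M"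
 have fg: "integrable M (\<lambda>x. \<bar>f x * g x\<bar>)"
  using integrable_mult_of_squares[OF assms] by simp
 have "?A^2
   \<le> ?B * ?C"
  by (rule Cauchy_Schwarz_nn_integral) auto
 also have "?A = ennreal ?D"
  using nn_integral_eq_integral[OF fg] by (simp add: ennreal_mult' abs_mult)
 also have "?B = ennreal (\<integral>x. (f x)^2 \<partial>M)"
  using nn_integral_eq_integral[OF f] by (simp add: ennreal_power)
 also have "?C = ennreal (\<integral>x. (g x)^2 \<partial>M)"
  using nn_integral_eq_integral[OF g] by (simp add: ennreal_power)
 finally have "?D^2 \<le> (\<integral>x. (f x)^2 \<partial>M) * (\<integral>x. (g x)^2 \<partial>M)"
  by (simp add: ennreal_power ennreal_mult'[symmetric])
 then show ?thesis
  by (simp add: real_le_rsqrt real_sqrt_mult[symmetric])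
qed

lemma abs_integral_mult_le:
 fixes f g :: "'a \<Rightarrow> real"
 assumes "f \<in> borel_measurable M" "g \<in> borel_measurable M"
  and "integrable M (\<lambda>x. (f x)^2)" and "integrable M (\<lambda>x. (g x)^2)"
 shows "\<bar>\<integral>x. f x * g x \<partial>M\<bar> \<le> sqrt (\<integral>x. (f x)^2 \<partial>M) * sqrt (\<integral>x. (g x)^2 \<partial>M)"
 by (rule order.trans[OF integral_abs_bound Cauchy_Schwarz_integral[OF assms]])

lemma integrable_square_diff:
 fixes f g :: "'a \<Rightarrow> real"
 assumes [measurable]: "f \<in> borel_measurable M" "g \<in> borel_measurable M"
  and f: "integrable M (\<lambda>x. (f x)^2)" and g: "integrable M (\<lambda>x. (g x)^2)"
 shows "integrable M (\<lambda>x. (f x - g x)^2)"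
 using integrable_mult_of_squares[OF assms] f g by (simp add: power2_diff mult.assoc)

lemma (in prob_space) integral_abs_le_sqrt:
 fixes f :: "'a \<Rightarrow> real"
 assumes "f \<in> borel_measurable M" "integrable M (\<lambda>x. (f x)^2)"
 shows "(\<integral>x. \<bar>f x\<bar> \<partial>M) \<le> sqrt (\<integral>x. (f x)^2 \<partial>M)"
 using Cauchy_Schwarz_integral[of f M "\<lambda>_. 1"] assms by (simp add: prob_space)

text \<open>The limit is the pointwise \<open>lim\<close> along a subsequence and not just some L2
  limit: pointwise properties of the approximants, such as periodicity, then pass to it. The
  subsequence converges almost everywhere because on a probability space L2 Cauchy implies L1
  Cauchy.\<close>

lemma (in prob_space) L2_Cauchy_limit:
 fixes f :: "nat \<Rightarrow> 'a \<Rightarrow> real"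
 assumes meas [measurable]: "\<And>n. f n \<in> borel_measurable M"
  and sq: "\<And>n. integrable M (\<lambda>x. (f n x)^2)"
  and Cauchy: "\<And>e. e > 0 \<Longrightarrow> \<exists>N. \<forall>i\<ge>N. \<forall>j\<ge>N. (\<integral>x. (f i x - f j x)^2 \<partial>M) < e"
 obtains r g where "strict_mono r" "g = (\<lambda>x. lim (\<lambda>n. f (r n) x))" "g \<in> borel_measurable M"
  "AE x in M. (\<lambda>n. f (r n) x) \<longlonglongrightarrow> g x" "integrable M (\<lambda>x. (g x)^2)"
  "(\<lambda>n. \<integral>x. (f n x - g x)^2 \<partial>M) \<longlonglongrightarrow> 0"
proof -
 have sqd: "integrable M (\<lambda>x. (f i x - f j x)^2)" for i j
  by (rule integrable_square_diff) (auto intro: sq)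
 obtain r where r: "strict_mono r" "AE x in M. Cauchy (\<lambda>i. f (r i) x)"
 proof (rule cauchy_L1_AE_cauchy_subseq[of M f])
  show "integrable M (f n)" for n
   by (rule square_integrable_imp_integrable[OF meas sq])
  fix e :: real assume "e > 0"
  then obtain N where N: "\<forall>i\<ge>N. \<forall>j\<ge>N. (\<integral>x. (f i x - f j x)^2 \<partial>M) < e\<^sup>2"
   using Cauchy[of "e\<^sup>2"] by auto
  have "LINT x|M. norm (f i x - f j x) < e" if "i \<ge> N" "j \<ge> N" for i j
  proof -
   have "(\<integral>x. \<bar>f i x - f j x\<bar> \<partial>M) \<le> sqrt (\<integral>x. (f i x - f j x)^2 \<partial>M)"
    by (rule integral_abs_le_sqrt) (auto intro: sqd)
   also have "... < e"
    using N that \<open>e > 0\<close> by (intro real_less_lsqrt) auto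
   finally show ?thesis by simp
  qed
  then show "\<exists>N. \<forall>i\<ge>N. \<forall>j\<ge>N. LINT x|M. norm (f i x - f j x) < e" by blast
 qed
 define g where "g = (\<lambda>x. lim (\<lambda>n. f (r n) x))"
 have g [measurable]: "g \<in> borel_measurable M" unfolding g_def by measurable
 have conv: "AE x in M. (\<lambda>n. f (r n) x) \<longlonglongrightarrow> g x"
  using r(2) by eventually_elim (simp add: g_def convergent_LIMSEQ_iff[symmetric] Cauchy_convergent)
 \<comment> \<open>Fatou along the subsequence turns the Cauchy estimate into an estimate against
   the limit. It is stated with nonnegative integrals because g is not yet known to be square
   integrable.\<close>
 have bound: "(\<integral>\<^sup>+x. ennreal ((f i x - g x)^2) \<partial>M) \<le> ennreal e"
  if N: "\<forall>i\<ge>N. \<forall>j\<ge>N. (\<integral>x. (f i x - f j x)^2 \<partial>M) < e" and i: "i \<ge> N" for N e i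
 proof -
  have "(\<integral>\<^sup>+x. ennreal ((f i x - g x)^2) \<partial>M)
    \<le> (\<integral>\<^sup>+x. liminf (\<lambda>n. ennreal ((f i x - f (r n) x)^2)) \<partial>M)"
  proof (rule nn_integral_mono_AE, use conv in eventually_elim)
   case (elim x)
   have "(\<lambda>n. ennreal ((f i x - f (r n) x)^2)) \<longlonglongrightarrow> ennreal ((f i x - g x)^2)"
    by (intro tendsto_ennrealI tendsto_intros elim)
   then show ?case by (subst lim_imp_Liminf) auto
  qed
  also have "... \<le> liminf (\<lambda>n. (\<integral>\<^sup>+x. ennreal ((f i x - f (r n) x)^2) \<partial>M))"
   by (rule nn_integral_liminf) auto
  also have "... \<le> ennreal e"
  proof (rule Liminf_le)
   have "eventually (\<lambda>n. n \<ge> N) sequentially" by (rule eventually_ge_at_top)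
   then show "\<forall>\<^sub>F n in sequentially. (\<integral>\<^sup>+x. ennreal ((f i x - f (r n) x)^2) \<partial>M) \<le> ennreal e"
   proof eventually_elim
    case (elim n)
    then have "r n \<ge> N" using seq_suble[OF r(1), of n] by simp
    then have "(\<integral>x. (f i x - f (r n) x)^2 \<partial>M) < e" using N i by blast
    then show ?case using nn_integral_eq_integral[OF sqd[of i "r n"]]
     by (simp add: ennreal_leI less_imp_le)
   qed
  qed simp
  finally show ?thesis .
 qed
 have int: "integrable M (\<lambda>x. (g x)^2)"
 proof -
  obtain N where N: "\<forall>i\<ge>N. \<forall>j\<ge>N. (\<integral>x. (f i x - f j x)^2 \<partial>M) < 1"
   using Cauchy[of 1] by auto
  have "(\<integral>\<^sup>+x. ennreal ((f N x - g x)^2) \<partial>M) < \<infinity>"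
   using bound[OF N order_refl] by (simp add: le_less_trans)
  then have "integrable M (\<lambda>x. (f N x - g x)^2)"
   by (intro integrableI_nonneg) auto
  from integrable_square_diff[OF _ _ sq[of N] this] show ?thesis by simp
 qed
 have "(\<lambda>n. \<integral>x. (f n x - g x)^2 \<partial>M) \<longlonglongrightarrow> 0"
 proof (rule LIMSEQ_I)
  fix e :: real assume "e > 0"
  then obtain N where N: "\<forall>i\<ge>N. \<forall>j\<ge>N. (\<integral>x. (f i x - f j x)^2 \<partial>M) < e / 2"
   using Cauchy[of "e / 2"] by auto
  have "norm ((\<integral>x. (f i x - g x)^2 \<partial>M) - 0) < e" if "i \<ge> N" for i
  proof -
   have "ennreal (\<integral>x. (f i x - g x)^2 \<partial>M) \<le> ennreal (e / 2)"
    using bound[OF N that] nn_integral_eq_integral[OF integrable_square_diff[OF meas g sq int]]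
    by simp
   then show ?thesis using \<open>e > 0\<close> by (simp add: ennreal_le_iff)
  qed
  then show "\<exists>N. \<forall>i\<ge>N. norm ((\<integral>x. (f i x - g x)^2 \<partial>M) - 0) < e" by blast
 qed
 with that r(1) g_def g conv int show thesis by blast
qed

section \<open>Uniqueness of Fourier coefficients\<close>

inductive_set trig_poly :: "(plane \<Rightarrow> real) set" where
 cas: "(\<lambda>z. c * cas k z) \<in> trig_poly"
| add: "f \<in> trig_poly \<Longrightarrow> g \<in> trig_poly \<Longrightarrow> (\<lambda>z. f z + g z) \<in> trig_poly"

lemma cos_phase_eq_cas: "cos (phase k z) = (cas k z + cas (- k) z) / 2"
 and sin_phase_eq_cas: "sin (phase k z) = (cas k z - cas (- k) z) / 2"
 by (simp_all add: cas_def phase_minus_left)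

lemma trig_poly_cos: "(\<lambda>z. c * cos (phase k z)) \<in> trig_poly"
 using trig_poly.add[OF trig_poly.cas[of "c / 2" k] trig_poly.cas[of "c / 2" "- k"]]
 by (simp add: cos_phase_eq_cas distrib_left add_divide_distrib)

lemma trig_poly_sin: "(\<lambda>z. c * sin (phase k z)) \<in> trig_poly"
 using trig_poly.add[OF trig_poly.cas[of "c / 2" k] trig_poly.cas[of "- c / 2" "- k"]]
 by (simp add: sin_phase_eq_cas right_diff_distrib diff_divide_distrib)

lemma trig_poly_mult:
 assumes "f \<in> trig_poly" "g \<in> trig_poly"
 shows "(\<lambda>z. f z * g z) \<in> trig_poly"
 using assms(1)
proof induction
 case (cas c k)
 show ?case using assms(2)
 proof induction
  case (cas d l)
  have "(\<lambda>z. c * cas k z * (d * cas l z))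
    = (\<lambda>z. c * d * cos (phase (k - l) z) + c * d * sin (phase (k + l) z))"
   using cas_mult_cas[of k _ l] by (auto simp: fun_eq_iff phase_add_left phase_diff_left algebra_simps)
  then show ?case by (simp add: trig_poly.add trig_poly_cos trig_poly_sin)
 qed (simp add: distrib_left trig_poly.add)
qed (simp add: distrib_right trig_poly.add)

lemma trig_poly_integral_zero:
 assumes f: "integrable \<T> f" and 0: "\<And>k. cas_coeff f k = 0" and "h \<in> trig_poly"
 shows "integrable \<T> (\<lambda>z. f z * h z) \<and> (\<integral>z. f z * h z \<partial>\<T>) = 0"
 using assms(3)
proof induction
 case (cas c k)
 have "(\<lambda>z. f z * (c * cas k z)) = (\<lambda>z. c * (f z * cas k z))" by (simp add: fun_eq_iff mult_ac)
 then show ?case using integrable_cas_mult[OF f, of k] 0[of k] by (simp add: cas_coeff_def)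
qed (simp add: distrib_left)

text \<open>Functions on the torus are periodic functions on the plane, which is not a compact
  domain for Stone-Weierstrass. The product of two circles in four-dimensional space provides one,
  and continuous functions of the embedded point are periodic by construction.\<close>

definition torus_embed :: "plane \<Rightarrow> (plane) \<times> (plane)"
 where "torus_embed z = ((cos (phase (1, 0) z), sin (phase (1, 0) z)), (cos (phase (0, 1) z), sin (phase (0, 1) z)))"

lemma continuous_torus_embed: "continuous_on UNIV torus_embed"
 unfolding torus_embed_def by (intro continuous_intros)

lemma torus_embed_bounded: "torus_embed z \<in> cball 0 2"
proof -
 have "norm (torus_embed z) \<le> norm (cos (phase (1, 0) z), sin (phase (1, 0) z)) + norm (cos (phase (0, 1) z), sin (phase (0, 1) z))"
  unfolding torus_embed_def by (rule norm_Pair_le)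
 also have "... = 2" by (simp add: norm_Pair)
 finally show ?thesis by simp
qed

text \<open>A Borel left inverse of x |-> (cos 2 pi x, sin 2 pi x) on [0,1). The clamping keeps the
  argument of \<open>arccos\<close> in its domain, which makes the function Borel on the whole
  plane.\<close>

definition circle_arg :: "plane \<Rightarrow> real"
 where "circle_arg p = (if 0 \<le> snd p then arccos (max (- 1) (min 1 (fst p))) / (2 * pi)
   else 1 - arccos (max (- 1) (min 1 (fst p))) / (2 * pi))"

lemma measurable_circle_arg: "circle_arg \<in> borel_measurable borel"
proof -
 have [measurable]: "fst \<in> borel_measurable (borel :: plane measure)"
  "snd \<in> borel_measurable (borel :: plane measure)"
  by (auto intro!: borel_measurable_continuous_onI continuous_intros)
 have [measurable]: "(\<lambda>x::real. arccos (max (- 1) (min 1 x))) \<in> borel_measurable borel"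
  by (intro borel_measurable_continuous_onI continuous_on_arccos continuous_intros) auto
 show ?thesis unfolding circle_arg_def[abs_def] by measurable
qed

lemma circle_arg_cos_sin:
 assumes "0 \<le> x" "x < 1"
 shows "circle_arg (cos (2 * pi * x), sin (2 * pi * x)) = x"
proof (cases "2 * pi * x \<le> pi")
 case True
 then have "0 \<le> sin (2 * pi * x)" using assms by (intro sin_ge_zero) auto
 then show ?thesis using True assms by (simp add: circle_arg_def arccos_cos)
next
 case False
 then have "sin (2 * pi * x) < 0" using assms by (intro sin_lt_zero) auto
 moreover have "arccos (cos (2 * pi * x)) = 2 * pi - 2 * pi * x"
 proof -
  have "cos (2 * pi * x) = cos (2 * pi - 2 * pi * x)" by (simp add: cos_diff)
  also have "arccos ... = 2 * pi - 2 * pi * x" using False assms by (intro arccos_cos) (auto simp: algebra_simps)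
  finally show ?thesis .
 qed
 ultimately show ?thesis by (simp add: circle_arg_def diff_divide_distrib)
qed

lemma torus_embed_left_inverse:
 assumes "z \<in> {0..<1} \<times> {0..<1}"
 shows "(circle_arg (fst (torus_embed z)), circle_arg (snd (torus_embed z))) = z"
 using assms circle_arg_cos_sin[of "fst z"] circle_arg_cos_sin[of "snd z"]
 by (cases z) (simp add: torus_embed_def phase_def)

lemma AE_torus_in_square: "AE z in \<T>. z \<in> {0..<1} \<times> {0..<1}"
 unfolding torus_measure_def by (rule AE_uniform_measureI) auto

lemma measurable_torus_embed [measurable]: "torus_embed \<in> borel_measurable borel"
 by (rule borel_measurable_continuous_onI[OF continuous_torus_embed])

lemma coeffs_zero_imp_integral_continuous_zero:
 assumes f: "integrable \<T> f" and 0: "\<And>k. cas_coeff f k = 0"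
  and g: "continuous_on UNIV g"
 shows "(\<integral>z. f z * g (torus_embed z) \<partial>\<T>) = 0"
proof -
 \<comment> \<open>Continuous functions whose pull-back is a trigonometric polynomial. The four
   coordinates belong to R, so points of the whole ball are separated, not only those of the
   embedded torus.\<close>
 define R where "R = {g. continuous_on (UNIV :: ((plane) \<times> (plane)) set) g \<and> (\<lambda>z. g (torus_embed z)) \<in> trig_poly}"
 interpret function_ring_on R "cball 0 2"
 proof
  fix x y :: "(plane) \<times> (plane)" assume "x \<noteq> y"
  have "(\<lambda>p. fst (fst p)) \<in> R" "(\<lambda>p. snd (fst p)) \<in> R" "(\<lambda>p. fst (snd p)) \<in> R" "(\<lambda>p. snd (snd p)) \<in> R"
   using trig_poly_cos[of 1] trig_poly_sin[of 1]
   by (auto simp: R_def torus_embed_def intro!: continuous_intros)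
  with \<open>x \<noteq> y\<close> show "\<exists>f\<in>R. f x \<noteq> f y"
   by (metis prod_eqI)
 next
  fix c :: real
  show "(\<lambda>_. c) \<in> R" using trig_poly.cas[of c 0] by (simp add: R_def)
 qed (auto simp: R_def intro!: continuous_intros trig_poly.add trig_poly_mult elim: continuous_on_subset)
 have gm [measurable]: "g \<in> borel_measurable borel" using g by (rule borel_measurable_continuous_onI)
 have int: "integrable \<T> (\<lambda>z. f z * g (torus_embed z))"
 proof -
  have "compact (g ` cball 0 2)"
   by (intro compact_continuous_image continuous_on_subset[OF g]) auto
  then obtain B where B: "\<And>p. p \<in> cball 0 2 \<Longrightarrow> \<bar>g p\<bar> \<le> B"
   by (metis bounded_iff compact_imp_bounded image_eqI real_norm_def)
  show ?thesis
  proof (rule Bochner_Integration.integrable_bound)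
   show "integrable \<T> (\<lambda>z. B * f z)" using f by simp
   have "\<bar>f z\<bar> * \<bar>g (torus_embed z)\<bar> \<le> \<bar>f z\<bar> * \<bar>B\<bar>" for z
    using B[OF torus_embed_bounded, of z] by (intro mult_left_mono) auto
   then show "AE z in \<T>. norm (f z * g (torus_embed z)) \<le> norm (B * f z)"
    by (simp add: abs_mult mult.commute)
  qed (use f in measurable)
 qed
 have "\<bar>\<integral>z. f z * g (torus_embed z) \<partial>\<T>\<bar> \<le> e * (\<integral>z. \<bar>f z\<bar> \<partial>\<T>)" if "e > 0" for e
 proof -
  obtain h where h: "h \<in> R" "\<And>p. p \<in> cball 0 2 \<Longrightarrow> \<bar>g p - h p\<bar> < e"
   using Stone_Weierstrass_basic[OF continuous_on_subset[OF g] \<open>e > 0\<close>] by auto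
  have hf: "integrable \<T> (\<lambda>z. f z * h (torus_embed z))"
   "(\<integral>z. f z * h (torus_embed z) \<partial>\<T>) = 0"
   using trig_poly_integral_zero[OF f 0, of "\<lambda>z. h (torus_embed z)"] h(1) by (auto simp: R_def)
  have "(\<integral>z. f z * g (torus_embed z) \<partial>\<T>)
    = (\<integral>z. f z * g (torus_embed z) - f z * h (torus_embed z) \<partial>\<T>)"
   using int hf by (subst Bochner_Integration.integral_diff) auto
  also have "\<bar>...\<bar> \<le> (\<integral>z. \<bar>f z * g (torus_embed z) - f z * h (torus_embed z)\<bar> \<partial>\<T>)"
   by (rule integral_abs_bound)
  also have "... \<le> (\<integral>z. e * \<bar>f z\<bar> \<partial>\<T>)"
  proof (rule integral_mono)
   fix z
   have "\<bar>f z * g (torus_embed z) - f z * h (torus_embed z)\<bar> = \<bar>f z\<bar> * \<bar>g (torus_embed z) - h (torus_embed z)\<bar>"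
    by (simp add: abs_mult[symmetric] right_diff_distrib)
   also have "... \<le> \<bar>f z\<bar> * e" using h(2)[OF torus_embed_bounded, of z] by (intro mult_left_mono) auto
   finally show "\<bar>f z * g (torus_embed z) - f z * h (torus_embed z)\<bar> \<le> e * \<bar>f z\<bar>" by (simp add: mult.commute)
  qed (use int hf f in auto)
  finally show ?thesis by simp
 qed
 note small = this
 define K where "K = (\<integral>z. \<bar>f z\<bar> \<partial>\<T>)"
 have K: "K \<ge> 0" by (simp add: K_def)
 have "\<bar>\<integral>z. f z * g (torus_embed z) \<partial>\<T>\<bar> \<le> 0 + d" if "d > 0" for d
 proof -
  have "\<bar>\<integral>z. f z * g (torus_embed z) \<partial>\<T>\<bar> \<le> d / (K + 1) * K"
   using small[of "d / (K + 1)"] that K by (simp add: K_def[symmetric])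
  also have "... \<le> d" using that K by (simp add: field_simps)
  finally show ?thesis by simp
 qed
 then have "\<bar>\<integral>z. f z * g (torus_embed z) \<partial>\<T>\<bar> \<le> 0" by (rule field_le_epsilon)
 then show ?thesis by simp
qed

lemma coeffs_zero_imp_integral_closed_zero:
 assumes f: "integrable \<T> f" and 0: "\<And>k. cas_coeff f k = 0" and C: "closed C"
 shows "(\<integral>z. f z * indicator C (torus_embed z) \<partial>\<T>) = 0"
proof (cases "C = {}")
 let ?A = "\<integral>z. f z * indicator C (torus_embed z) \<partial>\<T>"
 case False
 have [measurable]: "C \<in> sets borel" using C by simp
 \<comment> \<open>Tents over C: continuous, between 0 and 1, with the indicator as pointwise limit
   because C is closed.\<close>
 have "(\<lambda>n. \<integral>z. f z * max 0 (1 - real n * infdist (torus_embed z) C) \<partial>\<T>)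
   \<longlonglongrightarrow> ?A"
 proof (rule integral_dominated_convergence[where w = "\<lambda>z. \<bar>f z\<bar>"])
  show "AE z in \<T>. (\<lambda>n. f z * max 0 (1 - real n * infdist (torus_embed z) C)) \<longlonglongrightarrow> f z * indicator C (torus_embed z)"
  proof (intro AE_I2 tendsto_mult tendsto_const)
   fix z
   show "(\<lambda>n. max 0 (1 - real n * infdist (torus_embed z) C)) \<longlonglongrightarrow> indicator C (torus_embed z)"
   proof (cases "torus_embed z \<in> C")
    case False
    then have d: "infdist (torus_embed z) C > 0"
     using C \<open>C \<noteq> {}\<close> by (metis in_closed_iff_infdist_zero infdist_nonneg order_le_less)
    obtain N :: nat where "1 / infdist (torus_embed z) C \<le> real N" using real_arch_simple by blast
    then have "eventually (\<lambda>n. max 0 (1 - real n * infdist (torus_embed z) C) = 0) sequentially"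
     unfolding eventually_sequentially
    proof (intro exI[of _ N] allI impI)
     fix n assume "1 / infdist (torus_embed z) C \<le> real N" "N \<le> n"
     then have "1 / infdist (torus_embed z) C \<le> real n" by simp
     then show "max 0 (1 - real n * infdist (torus_embed z) C) = 0" using d by (simp add: field_simps)
    qed
    then show ?thesis using False by (simp add: tendsto_eventually)
   qed simp
  qed
  show "AE z in \<T>. norm (f z * max 0 (1 - real n * infdist (torus_embed z) C)) \<le> \<bar>f z\<bar>" for n
  proof (intro AE_I2)
   fix z
   have "\<bar>max 0 (1 - real n * infdist (torus_embed z) C)\<bar> \<le> 1" by (simp add: infdist_nonneg)
   then show "norm (f z * max 0 (1 - real n * infdist (torus_embed z) C)) \<le> \<bar>f z\<bar>"
    using mult_left_mono[of _ 1 "\<bar>f z\<bar>"] by (simp add: abs_mult)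
  qed
  have [measurable]: "(\<lambda>p. infdist p C) \<in> borel_measurable borel"
   by (intro borel_measurable_continuous_onI continuous_intros)
  have [measurable]: "f \<in> borel_measurable borel" using f by (auto dest: borel_measurable_integrable)
  show "(\<lambda>z. f z * max 0 (1 - real n * infdist (torus_embed z) C)) \<in> borel_measurable \<T>" for n
   by measurable
  show "(\<lambda>z. f z * indicator C (torus_embed z)) \<in> borel_measurable \<T>"
   by measurable
 qed (use f in auto)
 moreover have "(\<integral>z. f z * max 0 (1 - real n * infdist (torus_embed z) C) \<partial>\<T>) = 0" for n
  by (rule coeffs_zero_imp_integral_continuous_zero[OF f 0, where g = "\<lambda>p. max 0 (1 - real n * infdist p C)"])
    (intro continuous_intros)
 ultimately have "(\<lambda>n. 0::real) \<longlonglongrightarrow> ?A" by simp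
 from LIMSEQ_unique[OF this tendsto_const] show ?thesis .
qed simp

text \<open>The sets B for which f has integral zero over the preimage of B include the closed sets
  and form a Dynkin system, hence they are all Borel sets. As \<open>torus_embed\<close> has a Borel
  left inverse on the unit square, every Borel set of the plane is such a preimage up to a null set.
  The statement for integrable f serves alike for Green functions, continuous functions and
  eigenfunctions.\<close>

lemma torus_uniqueness:
 assumes f: "integrable \<T> f" and 0: "\<And>k. cas_coeff f k = 0"
 shows "AE z in \<T>. f z = 0"
proof -
 have [measurable]: "f \<in> borel_measurable borel" using f by (auto dest: borel_measurable_integrable)
 have si: "set_integrable \<T> A f" if "A \<in> sets borel" for A
  unfolding set_integrable_def using f that by (intro integrable_mult_indicator) auto
 have pre: "torus_embed -` B \<in> sets borel" if "B \<in> sets borel" for B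
  using that by (rule measurable_sets_borel[OF measurable_torus_embed])
 have zero: "set_lebesgue_integral \<T> (torus_embed -` B) f = 0" if "B \<in> sets borel" for B
 proof -
  have "Int_stable (Collect closed :: ((plane) \<times> (plane)) set set)"
   "(Collect closed :: ((plane) \<times> (plane)) set set) \<subseteq> Pow UNIV"
   by (auto simp: Int_stable_def)
  moreover have "B \<in> sigma_sets UNIV (Collect closed)" using that by (simp add: borel_eq_closed)
  ultimately show ?thesis
  proof (induction rule: sigma_sets_induct_disjoint)
   case (basic A)
   then show ?case using coeffs_zero_imp_integral_closed_zero[OF f 0, of A]
    by (simp add: set_lebesgue_integral_def indicator_def mult.commute)
  next
   case (compl A)
   then have A: "A \<in> sets borel" by (simp add: borel_eq_closed)
   have "(\<integral>z. f z \<partial>\<T>) = 0" using 0[of 0] by (simp add: cas_coeff_def)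
   moreover have "set_lebesgue_integral \<T> (torus_embed -` A \<union> torus_embed -` (UNIV - A)) f
     = set_lebesgue_integral \<T> (torus_embed -` A) f + set_lebesgue_integral \<T> (torus_embed -` (UNIV - A)) f"
    using A by (intro set_integral_Un si pre) auto
   moreover have "torus_embed -` A \<union> torus_embed -` (UNIV - A) = UNIV" by auto
   ultimately show ?case using compl by (simp add: set_lebesgue_integral_def)
  next
   case (union A)
   have A: "A i \<in> sets borel" for i using union(2) by (auto simp: borel_eq_closed)
   have "set_lebesgue_integral \<T> (\<Union>i. torus_embed -` A i) f
     = (\<Sum>i. set_lebesgue_integral \<T> (torus_embed -` A i) f)"
   proof (rule lebesgue_integral_countable_add)
    show "\<And>i j. i \<noteq> j \<Longrightarrow> torus_embed -` A i \<inter> torus_embed -` A j = {}"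
     using union(1) unfolding disjoint_family_on_def by blast
    show "set_integrable \<T> (\<Union>i. torus_embed -` A i) f"
     by (intro si sets.countable_UN) (auto simp: pre A)
   qed (simp add: pre A)
   then show ?case using union(3) by (simp add: vimage_UN)
  qed (auto simp: set_lebesgue_integral_def)
 qed
 define g where "g = (\<lambda>p :: plane \<times> (plane). (circle_arg (fst p), circle_arg (snd p)))"
 have [measurable]: "g \<in> borel_measurable borel"
 proof -
  have "fst \<in> borel_measurable (borel :: ((plane) \<times> (plane)) measure)"
   "snd \<in> borel_measurable (borel :: ((plane) \<times> (plane)) measure)"
   by (auto intro!: borel_measurable_continuous_onI continuous_intros)
  from measurable_compose[OF this(1) measurable_circle_arg] measurable_compose[OF this(2) measurable_circle_arg]
  show ?thesis unfolding g_def by (rule borel_measurable_Pair)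
 qed
 show ?thesis
 proof (rule density_unique_real[OF f, of "\<lambda>_. 0"])
  fix A assume "A \<in> sets \<T>"
  then have A [measurable]: "A \<in> sets borel" by simp
  have gA: "g -` A \<in> sets borel" by (rule measurable_sets_borel[of g borel]) auto
  have "set_lebesgue_integral \<T> A f = set_lebesgue_integral \<T> (torus_embed -` (g -` A)) f"
   unfolding set_lebesgue_integral_def
  proof (rule integral_cong_AE)
   show "AE z in \<T>. indicator A z *\<^sub>R f z = indicator (torus_embed -` (g -` A)) z *\<^sub>R f z"
    using AE_torus_in_square
   proof eventually_elim
    case (elim z)
    then have "g (torus_embed z) = z" unfolding g_def by (rule torus_embed_left_inverse)
    then show ?case by (simp add: indicator_def)
   qed
  qed (use pre[OF gA] in auto)
  then show "set_lebesgue_integral \<T> A f = set_lebesgue_integral \<T> A (\<lambda>_. 0)"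
   using zero[OF gA] by (simp add: set_lebesgue_integral_def)
 qed simp
qed

section \<open>Synthesis from square-summable coefficients\<close>

lemma integrable_cas_mult_cas: "integrable \<T> (\<lambda>z. cas k z * cas l z)"
 by (rule integrable_cas_mult) simp

lemma integral_cas_sum_squared:
 assumes "finite J"
 shows "integrable \<T> (\<lambda>z. (\<Sum>k\<in>J. c k * cas k z)^2)"
  and "(\<integral>z. (\<Sum>k\<in>J. c k * cas k z)^2 \<partial>\<T>) = (\<Sum>k\<in>J. (c k)^2)"
proof -
 let ?A = "\<lambda>z. (\<Sum>k\<in>J. c k * cas k z)^2"
 have eq: "?A = (\<lambda>z. \<Sum>k\<in>J. \<Sum>l\<in>J. c k * c l * (cas k z * cas l z))"
  by (auto simp: power2_eq_square sum_product fun_eq_iff mult_ac intro!: sum.cong)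
 show "integrable \<T> ?A"
  unfolding eq by (simp add: integrable_cas_mult_cas)
 show "(\<integral>z. (\<Sum>k\<in>J. c k * cas k z)^2 \<partial>\<T>) = (\<Sum>k\<in>J. (c k)^2)"
  unfolding eq using assms
  by (simp add: integrable_cas_mult_cas integral_cas_mult_cas power2_eq_square if_distrib[of "\<lambda>x. _ * x"] sum.delta cong: if_cong)
qed

lemma summable_on_sum_diff_small:
 fixes f :: "'a \<Rightarrow> real"
 assumes "f summable_on UNIV" "\<And>k. f k \<ge> 0" "e > 0"
 obtains F where "finite F" "\<And>J. finite J \<Longrightarrow> J \<inter> F = {} \<Longrightarrow> sum f J < e"
proof -
 have "(sum f \<longlongrightarrow> infsum f UNIV) (finite_subsets_at_top UNIV)"
  using assms(1) by (rule infsum_tendsto)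
 then have "\<forall>\<^sub>F F in finite_subsets_at_top UNIV. dist (sum f F) (infsum f UNIV) < e / 2"
  using tendstoD half_gt_zero[OF assms(3)] by blast
 then obtain F where F: "finite F" "\<And>Y. finite Y \<Longrightarrow> F \<subseteq> Y \<Longrightarrow> dist (sum f Y) (infsum f UNIV) < e / 2"
  unfolding eventually_finite_subsets_at_top by auto
 show thesis
 proof (rule that[OF F(1)])
  fix J assume J: "finite J" "J \<inter> F = {}"
  have "sum f (F \<union> J) = sum f F + sum f J" using F J by (intro sum.union_disjoint) auto
  then show "sum f J < e"
   using F(2)[of "F \<union> J"] F(2)[of F] F(1) J(1) by (simp add: dist_real_def abs_if split: if_splits)
 qed
qed

lemma finite_subset_grid:
 assumes "finite F"
 shows "\<exists>n. F \<subseteq> grid n"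
proof -
 have "\<forall>\<^sub>F n in sequentially. F \<subseteq> grid n"
  using filterlim_grid assms unfolding filterlim_finite_subsets_at_top by simp
 then show ?thesis by (auto simp: eventually_sequentially)
qed

lemma L2_synthesis:
 fixes c :: "freq \<Rightarrow> real"
 assumes c: "(\<lambda>k. (c k)^2) summable_on UNIV"
 obtains r g where "strict_mono r" "g = (\<lambda>z. lim (\<lambda>n. \<Sum>k\<in>grid (r n). c k * cas k z))"
  "g \<in> borel_measurable borel" "AE z in \<T>. (\<lambda>n. \<Sum>k\<in>grid (r n). c k * cas k z) \<longlonglongrightarrow> g z"
  "integrable \<T> (\<lambda>z. (g z)^2)"
  "(\<lambda>n. \<integral>z. ((\<Sum>k\<in>grid n. c k * cas k z) - g z)^2 \<partial>\<T>) \<longlonglongrightarrow> 0"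
proof -
 define f where "f n z = (\<Sum>k\<in>grid n. c k * cas k z)" for n z
 have meas: "f n \<in> borel_measurable \<T>" for n unfolding f_def by measurable
 have sq: "integrable \<T> (\<lambda>z. (f n z)^2)" for n
  unfolding f_def by (rule integral_cas_sum_squared) simp
 have diff: "(\<integral>z. (f i z - f j z)^2 \<partial>\<T>) = (\<Sum>k\<in>grid j - grid i. (c k)^2)" if "i \<le> j" for i j
 proof -
  have "f j z - f i z = (\<Sum>k\<in>grid j - grid i. c k * cas k z)" for z
   unfolding f_def using grid_mono[OF that] by (subst sum_diff) auto
  then have "(f i z - f j z)^2 = (\<Sum>k\<in>grid j - grid i. c k * cas k z)^2" for z
   by (metis power2_commute)
  then show ?thesis using integral_cas_sum_squared(2)[of "grid j - grid i" c] by simp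
 qed
 have Cauchy: "\<exists>N. \<forall>i\<ge>N. \<forall>j\<ge>N. (\<integral>z. (f i z - f j z)^2 \<partial>\<T>) < e" if e: "e > 0" for e
 proof -
  obtain F where F: "finite F" "\<And>J. finite J \<Longrightarrow> J \<inter> F = {} \<Longrightarrow> (\<Sum>k\<in>J. (c k)^2) < e"
   using summable_on_sum_diff_small[OF c _ e] by auto
  obtain N where N: "F \<subseteq> grid N" using finite_subset_grid[OF F(1)] by blast
  have *: "(\<integral>z. (f i z - f j z)^2 \<partial>\<T>) < e" if "N \<le> i" "i \<le> j" for i j
   unfolding diff[OF that(2)] using N grid_mono[OF that(1)] by (intro F(2)) auto
  have "(\<integral>z. (f i z - f j z)^2 \<partial>\<T>) < e" if "N \<le> i" "N \<le> j" for i j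
   using *[of i j] *[of j i] that by (cases "i \<le> j") (auto simp: power2_commute)
  then show ?thesis by blast
 qed
 obtain r g where "strict_mono r" "g = (\<lambda>z. lim (\<lambda>n. f (r n) z))" "g \<in> borel_measurable \<T>"
  "AE z in \<T>. (\<lambda>n. f (r n) z) \<longlonglongrightarrow> g z" "integrable \<T> (\<lambda>z. (g z)^2)"
  "(\<lambda>n. \<integral>z. (f n z - g z)^2 \<partial>\<T>) \<longlonglongrightarrow> 0"
  by (rule torus.L2_Cauchy_limit[OF meas sq Cauchy])
 then show thesis unfolding f_def by (intro that[of r g]) simp_all
qed

text \<open>Pairing with a fixed h is L2 continuous, and on a partial sum it is a finite sum of
  coefficients of h. This is Parseval's identity with convergence assumed for one factor
  only.\<close>

lemma cas_coeff_L2_limit: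
 assumes g: "g \<in> borel_measurable borel" "integrable \<T> (\<lambda>z. (g z)^2)"
  and lim: "(\<lambda>n. \<integral>z. ((\<Sum>k\<in>grid n. c k * cas k z) - g z)^2 \<partial>\<T>) \<longlonglongrightarrow> 0"
  and h: "h \<in> borel_measurable borel" "integrable \<T> (\<lambda>z. (h z)^2)"
 shows "(\<lambda>n. \<Sum>k\<in>grid n. c k * cas_coeff h k) \<longlonglongrightarrow> (\<integral>z. g z * h z \<partial>\<T>)"
proof -
 let ?A = "\<integral>z. g z * h z \<partial>\<T>"
 let ?B = "\<integral>z. (h z)^2 \<partial>\<T>"
 define f where "f n z = (\<Sum>k\<in>grid n. c k * cas k z)" for n z
 have meas: "f n \<in> borel_measurable \<T>" for n unfolding f_def by measurable
 have sq: "integrable \<T> (\<lambda>z. (f n z)^2)" for n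
  unfolding f_def by (rule integral_cas_sum_squared) simp
 have h1: "integrable \<T> h"
  by (rule torus.square_integrable_imp_integrable) (simp_all add: h)
 have eq: "(\<Sum>k\<in>grid n. c k * cas_coeff h k) = (\<integral>z. f n z * h z \<partial>\<T>)" for n
 proof -
  have "f n z * h z = (\<Sum>k\<in>grid n. c k * (h z * cas k z))" for z
   unfolding f_def sum_distrib_right by (rule sum.cong) auto
  then have "(\<integral>z. f n z * h z \<partial>\<T>) = (\<integral>z. (\<Sum>k\<in>grid n. c k * (h z * cas k z)) \<partial>\<T>)"
   by simp
  then show ?thesis using integrable_cas_mult[OF h1] by (simp add: cas_coeff_def)
 qed
 have "norm ((\<integral>z. f n z * h z \<partial>\<T>) - ?A)
   \<le> sqrt (\<integral>z. (f n z - g z)^2 \<partial>\<T>) * sqrt ?B" for n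
 proof -
  have "(\<integral>z. f n z * h z \<partial>\<T>) - ?A = (\<integral>z. (f n z - g z) * h z \<partial>\<T>)"
   using integrable_mult_of_squares[OF meas[of n] _ sq[of n] h(2)]
    integrable_mult_of_squares[OF _ _ g(2) h(2)] g(1) h(1) by (simp add: left_diff_distrib)
  then show ?thesis
   using abs_integral_mult_le[OF _ _ integrable_square_diff[OF meas[of n] _ sq[of n] g(2)] h(2)] g(1) h(1) meas[of n]
   by simp
 qed
 moreover have "(\<lambda>n. sqrt (\<integral>z. (f n z - g z)^2 \<partial>\<T>) * sqrt ?B) \<longlonglongrightarrow> 0"
  using tendsto_mult_right[OF tendsto_real_sqrt[OF lim[folded f_def]], of "sqrt ?B"] by simp
 ultimately have "(\<lambda>n. (\<integral>z. f n z * h z \<partial>\<T>) - ?A) \<longlonglongrightarrow> 0"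
  by (rule Lim_null_comparison[OF always_eventually[OF allI]])
 then show ?thesis unfolding eq by (simp add: LIM_zero_iff)
qed

lemma cas_coeff_of_L2_limit:
 assumes g: "g \<in> borel_measurable borel" "integrable \<T> (\<lambda>z. (g z)^2)"
  and lim: "(\<lambda>n. \<integral>z. ((\<Sum>k\<in>grid n. c k * cas k z) - g z)^2 \<partial>\<T>) \<longlonglongrightarrow> 0"
 shows "cas_coeff g l = c l"
proof -
 have "(\<lambda>n. \<Sum>k\<in>grid n. c k * cas_coeff (cas l) k) \<longlonglongrightarrow> cas_coeff g l"
  unfolding cas_coeff_def[of g] using g lim
  by (rule cas_coeff_L2_limit) (use integrable_cas_mult_cas[of l l] in \<open>simp_all add: power2_eq_square\<close>)
 moreover have "eventually (\<lambda>n. (\<Sum>k\<in>grid n. c k * cas_coeff (cas l) k) = c l) sequentially"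
 proof -
  obtain N where N: "{l} \<subseteq> grid N" using finite_subset_grid[of "{l}"] by auto
  show ?thesis
   unfolding eventually_sequentially
  proof (intro exI[of _ N] allI impI)
   fix n assume "N \<le> n"
   then have "l \<in> grid n" using N grid_mono by blast
   moreover have "c k * cas_coeff (cas l) k = (if l = k then c k else 0)" for k
    by (simp add: cas_coeff_def integral_cas_mult_cas)
   ultimately show "(\<Sum>k\<in>grid n. c k * cas_coeff (cas l) k) = c l" by (simp add: sum.delta)
  qed
 qed
 ultimately show ?thesis by (metis LIMSEQ_unique tendsto_eventually)
qed

declare split_paired_All [simp del] split_paired_Ex [simp del]

subsection \<open>Test functions and their Fourier series\<close>

lemma deriv_shift: "deriv f (x + c) = deriv (\<lambda>s. f (s + c)) (x::real)"
 by (simp add: deriv_def DERIV_shift)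

lemma periodic_deriv1:
 assumes "periodic f" shows "periodic (deriv1 f)"
 using assms by (simp add: periodic_def deriv1_def deriv_shift)

lemma periodic_deriv2:
 assumes "periodic f" shows "periodic (deriv2 f)"
 using assms by (simp add: periodic_def deriv2_def deriv_shift)

lemma partial_0_0 [simp]: "partial 0 0 f = f"
 and partial_Suc1: "partial (Suc a) b f = deriv1 (partial a b f)"
 and partial_Suc2: "partial 0 (Suc b) f = deriv2 (partial 0 b f)"
 by (simp_all add: partial_def)

lemma periodic_partial:
 assumes "periodic f" shows "periodic (partial a b f)"
proof (induction a)
 case 0
 show ?case by (induction b) (simp_all add: assms partial_Suc2 periodic_deriv2)
qed (simp add: partial_Suc1 periodic_deriv1)

lemma test_functionsD:
 assumes "f \<in> \<D>"
 shows "periodic f" "partial a b f differentiable (at z)"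
 using assms unfolding test_functions_def by blast+

lemma continuous_partial:
 assumes "f \<in> \<D>"
 shows "continuous_on UNIV (partial a b f)"
 using test_functionsD(2)[OF assms, of a b] differentiable_imp_continuous_within
 by (blast intro: continuous_at_imp_continuous_on)

lemma continuous_test_function: "f \<in> \<D> \<Longrightarrow> continuous_on UNIV f"
 using continuous_partial[of f 0 0] by simp

lemma measurable_partial: "f \<in> \<D> \<Longrightarrow> partial a b f \<in> borel_measurable borel"
 by (intro borel_measurable_continuous_onI continuous_partial)

lemma measurable_test_function: "f \<in> \<D> \<Longrightarrow> f \<in> borel_measurable borel"
 by (intro borel_measurable_continuous_onI continuous_test_function)

lemma periodic_continuous_bounded:
 fixes f :: "plane \<Rightarrow> real"
 assumes "periodic f" "continuous_on UNIV f"
 shows "\<exists>B. \<forall>z. \<bar>f z\<bar> \<le> B"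
proof -
 have "compact (f ` cbox (0, 0) (1, 1))"
  by (intro compact_continuous_image continuous_on_subset[OF assms(2)]) auto
 then obtain B where B: "\<And>z. z \<in> cbox (0, 0) (1, 1) \<Longrightarrow> \<bar>f z\<bar> \<le> B"
  by (metis bounded_iff compact_imp_bounded image_eqI real_norm_def)
 have "\<bar>f z\<bar> \<le> B" for z
 proof -
  have "wrap z \<in> cbox (0, 0) (1, 1)"
   using frac_lt_1[of "fst z"] frac_lt_1[of "snd z"] by (simp add: wrap_def less_imp_le)
  then show ?thesis using B[of "wrap z"] periodic_wrap[OF assms(1)] by simp
 qed
 then show ?thesis by blast
qed

lemma integrable_periodic_continuous:
 fixes f :: "plane \<Rightarrow> real"
 assumes "periodic f" "continuous_on UNIV f"
 shows "integrable \<T> f"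
proof -
 obtain B where "\<And>z. \<bar>f z\<bar> \<le> B" using periodic_continuous_bounded[OF assms] by blast
 then show ?thesis
  by (intro integrable_torus_bounded[of _ B] borel_measurable_continuous_onI assms(2)) simp
qed

lemma bdd_above_abs_partial:
 assumes "f \<in> \<D>"
 shows "bdd_above (range (\<lambda>z. \<bar>partial a b f z\<bar>))"
 using periodic_continuous_bounded[OF periodic_partial[OF test_functionsD(1)[OF assms]] continuous_partial[OF assms], of a b]
 by (auto simp: bdd_above_def)

lemma abs_partial_le_SUP:
 assumes "f \<in> \<D>"
 shows "\<bar>partial a b f z\<bar> \<le> (SUP z. \<bar>partial a b f z\<bar>)"
 using bdd_above_abs_partial[OF assms] by (rule cSUP_upper[OF UNIV_I])

lemma SUP_abs_partial_nonneg:
 assumes "f \<in> \<D>"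
 shows "0 \<le> (SUP z. \<bar>partial a b f z\<bar>)"
 using abs_partial_le_SUP[OF assms, of a b 0] by linarith

lemma abs_partial_le_Ck_norm:
 assumes f: "f \<in> \<D>" and ab: "a + b \<le> m"
 shows "\<bar>partial a b f z\<bar> \<le> Ck_norm m f"
proof -
 have "\<bar>partial a b f z\<bar> \<le> (SUP z. \<bar>partial a b f z\<bar>)" by (rule abs_partial_le_SUP[OF f])
 also have "... \<le> (\<Sum>b\<le>m - a. SUP z. \<bar>partial a b f z\<bar>)"
  using ab by (intro member_le_sum SUP_abs_partial_nonneg f) auto
 also have "... \<le> Ck_norm m f"
  unfolding Ck_norm_def
  using ab by (intro member_le_sum[of a _ "\<lambda>a. \<Sum>b\<le>m - a. SUP z. \<bar>partial a b f z\<bar>"] sum_nonneg SUP_abs_partial_nonneg f) auto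
 finally show ?thesis .
qed

lemma has_deriv1:
 assumes "f differentiable (at (x, y))"
 shows "((\<lambda>s. f (s, y)) has_field_derivative deriv1 f (x, y)) (at x)"
proof -
 have "(\<lambda>s. (s, y)) differentiable (at x)"
  by (intro differentiableI[of _ "\<lambda>h. (h, 0)"] derivative_eq_intros) auto
 then have "(f \<circ> (\<lambda>s. (s, y))) differentiable (at x)"
  by (rule differentiable_chain_at) (use assms in simp)
 then show ?thesis
  by (simp add: deriv1_def o_def DERIV_deriv_iff_real_differentiable)
qed

lemma has_deriv2:
 assumes "f differentiable (at (x, y))"
 shows "((\<lambda>s. f (x, s)) has_field_derivative deriv2 f (x, y)) (at y)"
proof -
 have "(\<lambda>s. (x, s)) differentiable (at y)"
  by (intro differentiableI[of _ "\<lambda>h. (0, h)"] derivative_eq_intros) auto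
 then have "(f \<circ> (\<lambda>s. (x, s))) differentiable (at y)"
  by (rule differentiable_chain_at) (use assms in simp)
 then show ?thesis
  by (simp add: deriv2_def o_def DERIV_deriv_iff_real_differentiable)
qed

text \<open>The difference quotients of a periodic function have vanishing integral by translation
 invariance, hence so does the derivative.\<close>

lemma integral_directional_derivative_zero:
 fixes g g' :: "plane \<Rightarrow> real"
 assumes per: "periodic g" and cont: "continuous_on UNIV g"
  and per': "periodic g'" and cont': "continuous_on UNIV g'"
  and deriv: "\<And>z t. ((\<lambda>s. g (z + s *\<^sub>R e)) has_field_derivative g' (z + t *\<^sub>R e)) (at t)"
 shows "(\<integral>z. g' z \<partial>\<T>) = 0"
proof -
 obtain B where B: "\<And>z. \<bar>g' z\<bar> \<le> B" using periodic_continuous_bounded[OF per' cont'] by blast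
 obtain C where C: "\<And>z. \<bar>g z\<bar> \<le> C" using periodic_continuous_bounded[OF per cont] by blast
 have gm [measurable]: "g \<in> borel_measurable borel" "g' \<in> borel_measurable borel"
  using cont cont' by (auto intro: borel_measurable_continuous_onI)
 define h where "h n = 1 / real (Suc n)" for n
 have h: "h n > 0" for n by (simp add: h_def)
 have h0: "h \<longlonglongrightarrow> 0" unfolding h_def by (rule LIMSEQ_inverse_real_of_nat[unfolded inverse_eq_divide])
 have "(\<lambda>n. \<integral>z. (g (z + h n *\<^sub>R e) - g z) / h n \<partial>\<T>) \<longlonglongrightarrow> (\<integral>z. g' z \<partial>\<T>)"
 proof (rule integral_dominated_convergence[where w = "\<lambda>_. B"])
  show "AE z in \<T>. (\<lambda>n. (g (z + h n *\<^sub>R e) - g z) / h n) \<longlonglongrightarrow> g' z"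
  proof (rule AE_I2)
   fix z
   have "((\<lambda>t. (g (z + t *\<^sub>R e) - g z) / t) \<longlongrightarrow> g' z) (at 0)"
    using deriv[of z 0] unfolding DERIV_def by simp
   moreover have "filterlim h (at 0) sequentially"
    using h0 h by (auto simp: filterlim_at intro!: always_eventually) (metis less_irrefl)
   ultimately show "(\<lambda>n. (g (z + h n *\<^sub>R e) - g z) / h n) \<longlonglongrightarrow> g' z"
    by (rule filterlim_compose)
  qed
  \<comment> \<open>By the mean value theorem each quotient is a value of g', hence bounded
    independently of n.\<close>
  show "AE z in \<T>. norm ((g (z + h n *\<^sub>R e) - g z) / h n) \<le> B" for n
  proof (rule AE_I2)
   fix z
   obtain t where "g (z + h n *\<^sub>R e) - g (z + 0 *\<^sub>R e) = (h n - 0) * g' (z + t *\<^sub>R e)"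
    using MVT2[OF h[of n], of "\<lambda>s. g (z + s *\<^sub>R e)" "\<lambda>t. g' (z + t *\<^sub>R e)"] deriv by blast
   then have "(g (z + h n *\<^sub>R e) - g z) / h n = g' (z + t *\<^sub>R e)" using h[of n] by simp
   then show "norm ((g (z + h n *\<^sub>R e) - g z) / h n) \<le> B" using B by simp
  qed
  have [measurable]: "(\<lambda>z. g (z + h n *\<^sub>R e)) \<in> borel_measurable borel" for n
   by (intro borel_measurable_continuous_onI continuous_on_compose2[OF cont] continuous_intros) auto
  show "(\<lambda>z. (g (z + h n *\<^sub>R e) - g z) / h n) \<in> borel_measurable \<T>" for n
   by measurable
 qed auto
 moreover have "(\<integral>z. (g (z + h n *\<^sub>R e) - g z) / h n \<partial>\<T>) = 0" for n
 proof -
  have [measurable]: "(\<lambda>z. g (z + h n *\<^sub>R e)) \<in> borel_measurable borel"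
   by (intro borel_measurable_continuous_onI continuous_on_compose2[OF cont] continuous_intros) auto
  have "integrable \<T> (\<lambda>z. g (z + h n *\<^sub>R e))" "integrable \<T> g"
   by (rule integrable_torus_bounded[of _ C]; simp add: C)+
  then show ?thesis using integral_torus_shift[OF per, of "h n *\<^sub>R e"] by simp
 qed
 ultimately have "(\<lambda>n. 0) \<longlonglongrightarrow> (\<integral>z. g' z \<partial>\<T>)" by (simp only:)
 from LIMSEQ_unique[OF this tendsto_const] show ?thesis .
qed

lemma integral_deriv1_zero:
 assumes "periodic g" "\<And>z. g differentiable (at z)" "continuous_on UNIV (deriv1 g)"
 shows "(\<integral>z. deriv1 g z \<partial>\<T>) = 0"
proof (rule integral_directional_derivative_zero[of g _ "(1, 0)"])
 show "continuous_on UNIV g"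
  using assms(2) differentiable_imp_continuous_within by (blast intro: continuous_at_imp_continuous_on)
 fix z :: "plane" and t :: real
 have "((\<lambda>s. g (s, snd z)) has_field_derivative deriv1 g (fst z + t, snd z)) (at (fst z + t))"
  by (rule has_deriv1) (rule assms)
 then have "((\<lambda>s. g (s, snd z)) has_field_derivative deriv1 g (fst z + t, snd z)) (at (t + fst z))"
  by (simp add: add.commute)
 then have "((\<lambda>s. g (s + fst z, snd z)) has_field_derivative deriv1 g (fst z + t, snd z)) (at t)"
  by (simp add: DERIV_shift)
 then show "((\<lambda>s. g (z + s *\<^sub>R (1, 0))) has_field_derivative deriv1 g (z + t *\<^sub>R (1, 0))) (at t)"
  by (cases z) (simp add: add.commute)
qed (use assms periodic_deriv1 in auto)

lemma integral_deriv2_zero: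
 assumes "periodic g" "\<And>z. g differentiable (at z)" "continuous_on UNIV (deriv2 g)"
 shows "(\<integral>z. deriv2 g z \<partial>\<T>) = 0"
proof (rule integral_directional_derivative_zero[of g _ "(0, 1)"])
 show "continuous_on UNIV g"
  using assms(2) differentiable_imp_continuous_within by (blast intro: continuous_at_imp_continuous_on)
 fix z :: "plane" and t :: real
 have "((\<lambda>s. g (fst z, s)) has_field_derivative deriv2 g (fst z, snd z + t)) (at (snd z + t))"
  by (rule has_deriv2) (rule assms)
 then have "((\<lambda>s. g (fst z, s)) has_field_derivative deriv2 g (fst z, snd z + t)) (at (t + snd z))"
  by (simp add: add.commute)
 then have "((\<lambda>s. g (fst z, s + snd z)) has_field_derivative deriv2 g (fst z, snd z + t)) (at t)"
  by (simp add: DERIV_shift)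
 then show "((\<lambda>s. g (z + s *\<^sub>R (0, 1))) has_field_derivative deriv2 g (z + t *\<^sub>R (0, 1))) (at t)"
  by (cases z) (simp add: add.commute)
qed (use assms periodic_deriv2 in auto)

lemma differentiable_cas: "cas k differentiable (at z)"
proof -
 have "phase k differentiable (at z)"
  unfolding phase_def[abs_def]
  by (intro differentiable_mult differentiable_add differentiable_const
    bounded_linear_imp_differentiable bounded_linear_fst bounded_linear_snd)
 moreover have "cos differentiable (at x)" "sin differentiable (at x)" for x :: real
  using DERIV_cos DERIV_sin real_differentiable_def by blast+
 ultimately have "(\<lambda>z. cos (phase k z)) differentiable (at z)" "(\<lambda>z. sin (phase k z)) differentiable (at z)"
  using differentiable_chain_at[of "phase k" z cos] differentiable_chain_at[of "phase k" z sin]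
  by (simp_all add: o_def)
 then show ?thesis unfolding cas_def[abs_def] by (rule differentiable_add)
qed

lemma deriv1_cas: "deriv1 (cas k) z = 2 * pi * of_int (fst k) * cas (- k) z"
 and deriv2_cas: "deriv2 (cas k) z = 2 * pi * of_int (snd k) * cas (- k) z"
 unfolding deriv1_def deriv2_def cas_def phase_minus_left
 by (rule DERIV_imp_deriv, auto simp: phase_def intro!: derivative_eq_intros, simp add: algebra_simps)+

lemma deriv1_lincomb:
 assumes "f differentiable (at z)" "g differentiable (at z)"
 shows "deriv1 (\<lambda>z. c * f z + d * g z) z = c * deriv1 f z + d * deriv1 g z"
 using has_deriv1[of f "fst z" "snd z"] has_deriv1[of g "fst z" "snd z"] assms
 by (subst deriv1_def, intro DERIV_imp_deriv) (auto intro!: derivative_eq_intros)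

lemma deriv2_lincomb:
 assumes "f differentiable (at z)" "g differentiable (at z)"
 shows "deriv2 (\<lambda>z. c * f z + d * g z) z = c * deriv2 f z + d * deriv2 g z"
 using has_deriv2[of f "fst z" "snd z"] has_deriv2[of g "fst z" "snd z"] assms
 by (subst deriv2_def, intro DERIV_imp_deriv) (auto intro!: derivative_eq_intros)

lemma deriv1_mult:
 assumes "f differentiable (at z)" "g differentiable (at z)"
 shows "deriv1 (\<lambda>z. f z * g z) z = deriv1 f z * g z + f z * deriv1 g z"
 using has_deriv1[of f "fst z" "snd z"] has_deriv1[of g "fst z" "snd z"] assms
 by (subst deriv1_def, intro DERIV_imp_deriv) (auto intro!: derivative_eq_intros)

lemma deriv2_mult:
 assumes "f differentiable (at z)" "g differentiable (at z)"
 shows "deriv2 (\<lambda>z. f z * g z) z = deriv2 f z * g z + f z * deriv2 g z"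
 using has_deriv2[of f "fst z" "snd z"] has_deriv2[of g "fst z" "snd z"] assms
 by (subst deriv2_def, intro DERIV_imp_deriv) (auto intro!: derivative_eq_intros)

lemma periodic_mult: "periodic f \<Longrightarrow> periodic g \<Longrightarrow> periodic (\<lambda>z. f z * g z)"
 and periodic_lincomb: "periodic f \<Longrightarrow> periodic g \<Longrightarrow> periodic (\<lambda>z. c * f z + d * g z)"
 for f g :: "plane \<Rightarrow> real"
 by (simp_all add: periodic_def)

text \<open>Integration by parts against \<open>cas k\<close>. The derivative of
  \<open>cas k\<close> is a multiple of \<open>cas (- k)\<close>, so each derivative flips the
  frequency. The pair D, l lets one proof serve both coordinates.\<close>

lemma cas_coeff_derivative:
 assumes per: "periodic f" and f: "\<And>z. f differentiable (at z)"
  and D: "D = deriv1 \<and> l = fst \<or> D = deriv2 \<and> l = snd" and cont': "continuous_on UNIV (D f)"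
 shows "cas_coeff (D f) k = - 2 * pi * of_int (l k) * cas_coeff f (- k)"
proof -
 let ?A = "\<lambda>z. f z * cas k z"
 have cont: "continuous_on UNIV f"
  using f differentiable_imp_continuous_within by (blast intro: continuous_at_imp_continuous_on)
 have D_mult: "D ?A z = D f z * cas k z + 2 * pi * of_int (l k) * (f z * cas (- k) z)" for z
  using D deriv1_mult[OF f differentiable_cas, of k z] deriv2_mult[OF f differentiable_cas, of k z]
  by (auto simp: deriv1_cas deriv2_cas)
 have diff: "?A differentiable (at z)" for z
  by (intro differentiable_mult f differentiable_cas)
 have "continuous_on UNIV (D ?A)"
  unfolding D_mult by (intro continuous_intros cont cont')
 then have "(\<integral>z. D ?A z \<partial>\<T>) = 0"
  using D integral_deriv1_zero[OF periodic_mult[OF per periodic_cas] diff]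
   integral_deriv2_zero[OF periodic_mult[OF per periodic_cas] diff] by auto
 moreover have "integrable \<T> f" "integrable \<T> (D f)"
 proof -
  have "periodic (D f)" using D periodic_deriv1[OF per] periodic_deriv2[OF per] by auto
  then show "integrable \<T> f" "integrable \<T> (D f)"
   using per cont cont' by (auto intro: integrable_periodic_continuous)
 qed
 then have "integrable \<T> (\<lambda>z. f z * cas (- k) z)" "integrable \<T> (\<lambda>z. D f z * cas k z)"
  by (auto intro: integrable_cas_mult)
 ultimately show ?thesis
  unfolding D_mult cas_coeff_def by simp
qed

lemma cas_coeff_partial_Suc1:
 assumes "f \<in> \<D>"
 shows "cas_coeff (partial (Suc a) b f) k = - 2 * pi * of_int (fst k) * cas_coeff (partial a b f) (- k)"
 unfolding partial_Suc1
 by (rule cas_coeff_derivative)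
   (auto simp: periodic_partial test_functionsD[OF assms] partial_Suc1[symmetric] continuous_partial[OF assms])

lemma cas_coeff_partial_Suc2:
 assumes "f \<in> \<D>"
 shows "cas_coeff (partial 0 (Suc b) f) k = - 2 * pi * of_int (snd k) * cas_coeff (partial 0 b f) (- k)"
 unfolding partial_Suc2
 by (rule cas_coeff_derivative)
   (auto simp: periodic_partial test_functionsD[OF assms] partial_Suc2[symmetric] continuous_partial[OF assms])

lemma abs_cas_coeff_partial:
 assumes "f \<in> \<D>"
 shows "\<bar>cas_coeff (partial a b f) k\<bar> = \<bar>2 * pi * of_int (fst k)\<bar> ^ a * \<bar>2 * pi * of_int (snd k)\<bar> ^ b
  * \<bar>cas_coeff f (if even (a + b) then k else - k)\<bar>"
proof -
 have 0: "\<bar>cas_coeff (partial 0 b f) k\<bar> = \<bar>2 * pi * of_int (snd k)\<bar> ^ b * \<bar>cas_coeff f (if even b then k else - k)\<bar>" for k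
  by (induction b arbitrary: k) (auto simp: cas_coeff_partial_Suc2[OF assms] abs_mult)
 show ?thesis
  by (induction a arbitrary: k) (auto simp: 0 cas_coeff_partial_Suc1[OF assms] abs_mult)
qed

section \<open>Decay of the Fourier coefficients of test functions\<close>

lemma abs_cas_coeff_le:
 assumes "f \<in> borel_measurable borel" "\<And>z. \<bar>f z\<bar> \<le> B"
 shows "\<bar>cas_coeff f k\<bar> \<le> 2 * B"
proof -
 have int: "integrable \<T> f" using assms by (auto intro!: integrable_torus_bounded)
 have "\<bar>cas_coeff f k\<bar> \<le> (\<integral>z. \<bar>f z * cas k z\<bar> \<partial>\<T>)"
  unfolding cas_coeff_def by (rule integral_abs_bound)
 also have "... \<le> (\<integral>z. 2 * B \<partial>\<T>)"
 proof (rule integral_mono)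
  show "\<bar>f z * cas k z\<bar> \<le> 2 * B" for z
   using mult_mono[OF assms(2)[of z] abs_cas_le[of k z]] order.trans[OF abs_ge_zero assms(2)[of z]]
   by (simp add: abs_mult mult.commute)
 qed (use integrable_cas_mult[OF int] in auto)
 finally show ?thesis using torus.prob_space by simp
qed

text \<open>Unlike |k|^2 this weight is positive at the zero frequency too, so it can be divided by
  everywhere.\<close>

definition sqw :: "freq \<Rightarrow> real"
 where "sqw k = 1 + (of_int (fst k))^2 + (of_int (snd k))^2"

lemma sqw_ge_1: "1 \<le> sqw k" and sqw_pos: "0 < sqw k"
 by (simp_all add: sqw_def add_pos_nonneg)

lemma power2_le_abs_pi: "\<bar>x\<bar> ^ n \<le> \<bar>2 * pi * x\<bar> ^ n"
proof (rule power_mono)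
 have "1 * \<bar>x\<bar> \<le> 2 * pi * \<bar>x\<bar>" using pi_gt3 by (intro mult_right_mono) auto
 then show "\<bar>x\<bar> \<le> \<bar>2 * pi * x\<bar>" by (simp add: abs_mult)
qed simp

text \<open>Power means of three numbers, with constants 3^(2-1) and 3^(3-1). The right-hand sides
  contain pure powers only, which are what derivatives in a single coordinate control.\<close>

lemma sqw_power_le:
 shows "sqw k ^ 2 \<le> 3 * (1 + of_int (fst k) ^ 4 + of_int (snd k) ^ 4)"
  and "sqw k ^ 3 \<le> 9 * (1 + of_int (fst k) ^ 6 + of_int (snd k) ^ 6)"
proof -
 have 2: "(1 + x + y)^2 \<le> 3 * (1 + x\<^sup>2 + y\<^sup>2)" for x y :: real
  using zero_le_power2[of "1 - x"] zero_le_power2[of "1 - y"] zero_le_power2[of "x - y"]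
  by (simp add: power2_eq_square algebra_simps)
 have 3: "(1 + x + y) ^ 3 \<le> 9 * (1 + x ^ 3 + y ^ 3)" if "0 \<le> x" "0 \<le> y" for x y :: real
 proof -
  have *: "a\<^sup>2 * b + a * b\<^sup>2 \<le> a ^ 3 + b ^ 3" if "0 \<le> a" "0 \<le> b" for a b :: real
  proof -
   have "0 \<le> (a + b) * (a - b)^2" using that by simp
   then show ?thesis by (simp add: power2_eq_square power3_eq_cube algebra_simps)
  qed
  have "0 \<le> (x - y) * (x - y) * (1 + x + y)" using that by simp
  moreover have "0 \<le> (1 - y) * (1 - y) * (1 + x + y)" using that by simp
  moreover have "0 \<le> (1 - x) * (1 - x) * (1 + x + y)" using that by simp
  ultimately show ?thesis
   using *[of 1 x] *[of 1 y] *[OF that] that by (simp add: power2_eq_square power3_eq_cube algebra_simps)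
 qed
 show "sqw k ^ 2 \<le> 3 * (1 + of_int (fst k) ^ 4 + of_int (snd k) ^ 4)"
  using 2[of "(of_int (fst k))^2" "(of_int (snd k))^2"] by (simp add: sqw_def power_mult[symmetric])
 show "sqw k ^ 3 \<le> 9 * (1 + of_int (fst k) ^ 6 + of_int (snd k) ^ 6)"
  using 3[of "(of_int (fst k))^2" "(of_int (snd k))^2"] by (simp add: sqw_def power_mult[symmetric])
qed

text \<open>The three terms of \<open>sqw_power_le\<close> are controlled by f and its two pure
  sixth derivatives. As \<open>cas\<close> is bounded by 2, each contributes at most twice
  \<open>Ck_norm 6 f\<close>, whence 54 = 9 * 3 * 2. The explicit seminorm gives uniformity over
  bounded sets of test functions, as the strong topology demands.\<close>

lemma sqw_cube_cas_coeff_le: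
 assumes f: "f \<in> \<D>"
 shows "sqw k ^ 3 * \<bar>cas_coeff f k\<bar> \<le> 54 * Ck_norm 6 f"
proof -
 have le: "\<bar>cas_coeff (partial a b f) k\<bar> \<le> 2 * Ck_norm 6 f" if "a + b \<le> 6" for a b
  by (rule abs_cas_coeff_le[OF measurable_partial[OF f]]) (rule abs_partial_le_Ck_norm[OF f that])
 have "of_int (fst k) ^ 6 * \<bar>cas_coeff f k\<bar> \<le> \<bar>cas_coeff (partial 6 0 f) k\<bar>"
  using power2_le_abs_pi[of "of_int (fst k)" 6] by (simp add: abs_cas_coeff_partial[OF f] mult_right_mono)
 moreover have "of_int (snd k) ^ 6 * \<bar>cas_coeff f k\<bar> \<le> \<bar>cas_coeff (partial 0 6 f) k\<bar>"
  using power2_le_abs_pi[of "of_int (snd k)" 6] by (simp add: abs_cas_coeff_partial[OF f] mult_right_mono)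
 moreover have "sqw k ^ 3 * \<bar>cas_coeff f k\<bar> \<le> 9 * (1 + of_int (fst k) ^ 6 + of_int (snd k) ^ 6) * \<bar>cas_coeff f k\<bar>"
  by (intro mult_right_mono sqw_power_le) simp
 ultimately show ?thesis using le[of 6 0] le[of 0 6] le[of 0 0] by (simp add: algebra_simps)
qed

lemma sqw_square_cas_coeff_partial_bounded:
 assumes f: "f \<in> \<D>"
 shows "\<exists>K. \<forall>k. sqw k ^ 2 * \<bar>cas_coeff (partial a b f) k\<bar> \<le> K"
proof -
 have le: "\<bar>cas_coeff (partial a b f) k\<bar> \<le> 2 * (SUP z. \<bar>partial a b f z\<bar>)" for a b k
  by (rule abs_cas_coeff_le[OF measurable_partial[OF f] abs_partial_le_SUP[OF f]])
 have "sqw k ^ 2 * \<bar>cas_coeff (partial a b f) k\<bar>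
   \<le> 6 * ((SUP z. \<bar>partial a b f z\<bar>) + (SUP z. \<bar>partial (a + 4) b f z\<bar>) + (SUP z. \<bar>partial a (b + 4) f z\<bar>))" for k
 proof -
  have "of_int (fst k) ^ 4 * \<bar>cas_coeff (partial a b f) k\<bar> \<le> \<bar>cas_coeff (partial (a + 4) b f) k\<bar>"
  proof -
   have "of_int (fst k) ^ 4 * \<bar>cas_coeff (partial a b f) k\<bar> \<le> \<bar>2 * pi * of_int (fst k)\<bar> ^ 4 * \<bar>cas_coeff (partial a b f) k\<bar>"
    using power2_le_abs_pi[of "of_int (fst k)" 4] by (intro mult_right_mono) auto
   also have "... = \<bar>cas_coeff (partial (a + 4) b f) k\<bar>"
    unfolding abs_cas_coeff_partial[OF f] by (simp add: power_add mult_ac)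
   finally show ?thesis .
  qed
  moreover have "of_int (snd k) ^ 4 * \<bar>cas_coeff (partial a b f) k\<bar> \<le> \<bar>cas_coeff (partial a (b + 4) f) k\<bar>"
  proof -
   have "of_int (snd k) ^ 4 * \<bar>cas_coeff (partial a b f) k\<bar> \<le> \<bar>2 * pi * of_int (snd k)\<bar> ^ 4 * \<bar>cas_coeff (partial a b f) k\<bar>"
    using power2_le_abs_pi[of "of_int (snd k)" 4] by (intro mult_right_mono) auto
   also have "... = \<bar>cas_coeff (partial a (b + 4) f) k\<bar>"
    unfolding abs_cas_coeff_partial[OF f] by (simp add: power_add mult_ac)
   finally show ?thesis .
  qed
  moreover have "sqw k ^ 2 * \<bar>cas_coeff (partial a b f) k\<bar> \<le> 3 * (1 + of_int (fst k) ^ 4 + of_int (snd k) ^ 4) * \<bar>cas_coeff (partial a b f) k\<bar>"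
   by (intro mult_right_mono sqw_power_le) simp
  ultimately show ?thesis using le[of a b k] le[of "a + 4" b k] le[of a "b + 4" k] by (simp add: algebra_simps)
 qed
 then show ?thesis by blast
qed

lemma sum_symmetric_interval:
 fixes f :: "int \<Rightarrow> 'a::comm_monoid_add"
 shows "sum f {- int n..int n} = f 0 + (\<Sum>i=1..n. f (int i) + f (- int i))"
proof (induction n)
 case (Suc n)
 have "{- int (Suc n)..int (Suc n)} = insert (int (Suc n)) (insert (- int (Suc n)) {- int n..int n})"
  by auto
 then have "sum f {- int (Suc n)..int (Suc n)} = f (int (Suc n)) + (f (- int (Suc n)) + sum f {- int n..int n})"
  by (simp only:) (subst sum.insert; simp)+
 then show ?case by (simp add: Suc.IH add_ac)
qed simp

lemma sum_powr_int_le: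
 fixes s :: real
 assumes "s > 1 / 2"
 shows "(\<Sum>i\<in>{- int n..int n}. (1 + (of_int i)^2) powr - s) \<le> 1 + 2 * (\<Sum>i. real i powr (- 2 * s))"
proof -
 have summ: "summable (\<lambda>i. real i powr (- 2 * s))" using assms by (simp add: summable_real_powr_iff)
 define f where "f i = (1 + (of_int i)^2) powr - s" for i :: int
 have le: "f (int i) \<le> real i powr (- 2 * s)" if "i > 0" for i
 proof -
  have "f (int i) \<le> ((real i)^2) powr - s"
   unfolding f_def using that assms by (intro powr_mono2') auto
  also have "((real i)^2) powr - s = real i powr (- 2 * s)"
  proof -
   have "real i powr (- 2 * s) = (real i powr 2) powr - s" by (subst powr_powr) simp
   also have "real i powr 2 = (real i)^2" using that by (intro powr_numeral) simp
   finally show ?thesis ..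
  qed
  finally show ?thesis .
 qed
 have "sum f {- int n..int n} = f 0 + 2 * (\<Sum>i=1..n. f (int i))"
  unfolding sum_symmetric_interval by (simp add: f_def sum_distrib_left)
 also have "... \<le> 1 + 2 * (\<Sum>i=1..n. real i powr (- 2 * s))"
  using le by (intro add_mono mult_left_mono sum_mono) (auto simp: f_def)
 also have "(\<Sum>i=1..n. real i powr (- 2 * s)) \<le> (\<Sum>i. real i powr (- 2 * s))"
  by (rule sum_le_suminf[OF summ]) auto
 finally show ?thesis by (simp add: f_def)
qed

text \<open>The summand factorises, so its sum over a grid is the square of a one-dimensional sum.
  By \<open>sqw_square_ge\<close> the exponent s here corresponds to 2 * s for \<open>sqw\<close>,
  which gives the threshold 1 in \<open>summable_on_sqw_powr\<close>.\<close>

lemma summable_on_lattice_powr: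
 fixes s :: real
 assumes s: "s > 1 / 2"
 shows "(\<lambda>k::freq. ((1 + (of_int (fst k))^2) * (1 + (of_int (snd k))^2)) powr - s) summable_on UNIV"
proof (rule nonneg_bdd_above_summable_on)
 define f where "f i = (1 + (of_int i)^2) powr - s" for i :: int
 define B where "B = 1 + 2 * (\<Sum>i. real i powr (- 2 * s))"
 have eq: "((1 + (of_int (fst k))^2) * (1 + (of_int (snd k))^2)) powr - s = f (fst k) * f (snd k)" for k :: "freq"
  unfolding f_def by (rule powr_mult)
 have sumf: "sum f {- int n..int n} \<le> B" for n
  using sum_powr_int_le[OF s, of n] by (simp add: f_def B_def)
 have f0: "f i \<ge> 0" for i by (simp add: f_def)
 show "bdd_above (sum (\<lambda>k::freq. ((1 + (of_int (fst k))^2) * (1 + (of_int (snd k))^2)) powr - s) ` {F. F \<subseteq> UNIV \<and> finite F})"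
 proof (rule bdd_aboveI2)
  fix F :: "freq set" assume "F \<in> {F. F \<subseteq> UNIV \<and> finite F}"
  then obtain n where n: "F \<subseteq> grid n" using finite_subset_grid by auto
  have "(\<Sum>k\<in>F. f (fst k) * f (snd k)) \<le> (\<Sum>k\<in>grid n. f (fst k) * f (snd k))"
   using n f0 by (intro sum_mono2) auto
  also have "... = sum f {- int n..int n} * sum f {- int n..int n}"
   by (simp add: grid_def sum_product sum.cartesian_product case_prod_beta)
  also have "... \<le> B * B"
   using sumf[of n] f0 by (intro mult_mono) (auto simp: sum_nonneg intro: order.trans[OF sum_nonneg])
  finally show "(\<Sum>k\<in>F. ((1 + (of_int (fst k))^2) * (1 + (of_int (snd k))^2)) powr - s) \<le> B * B"
   by (simp add: eq)
 qed
qed auto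

lemma sqw_square_ge: "(1 + (of_int (fst k))^2) * (1 + (of_int (snd k))^2) \<le> (sqw k)^2"
proof -
 define x y :: real where "x = (of_int (fst k))^2" and "y = (of_int (snd k))^2"
 have "0 \<le> x" "0 \<le> y" by (simp_all add: x_def y_def)
 then have "(1 + x) * (1 + y) \<le> (1 + x + y) * (1 + x + y)" by (intro mult_mono) auto
 then show ?thesis by (simp add: x_def y_def sqw_def power2_eq_square)
qed

lemma summable_on_inverse_sqw_square: "(\<lambda>k. 1 / (sqw k)^2) summable_on UNIV"
proof (rule summable_on_comparison_test[OF summable_on_lattice_powr[of 1]])
 fix k :: "freq"
 have "(1 + (of_int (fst k))^2) * (1 + (of_int (snd k))^2) > (0::real)"
  by (intro mult_pos_pos add_pos_nonneg) auto
 then show "1 / (sqw k)^2 \<le> ((1 + (of_int (fst k))^2) * (1 + (of_int (snd k))^2)) powr - 1"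
  using sqw_square_ge[of k] by (simp add: powr_minus_divide frac_le)
qed auto

section \<open>Uniformly convergent Fourier series\<close>

lemma continuous_AE_zero_imp_zero:
 fixes h :: "plane \<Rightarrow> real"
 assumes per: "periodic h" and cont: "continuous_on UNIV h" and ae: "AE z in \<T>. h z = 0"
 shows "h z = 0"
proof (rule ccontr)
 assume nz: "h z \<noteq> 0"
 define U where "U = {w. h w \<noteq> 0}"
 have U: "open U" unfolding U_def using cont by (intro open_Collect_neq continuous_on_const)
 have w: "wrap z \<in> U" using nz per by (simp add: U_def)
 then obtain e where e: "e > 0" "ball (wrap z) e \<subseteq> U" using U by (meson open_contains_ball)
 define V where "V = U \<inter> ({0<..<1} \<times> {0<..<1})"
 have "open V" unfolding V_def using U by (intro open_Int open_Times) auto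
 have "V \<noteq> {}"
 proof -
  obtain x y where xy: "wrap z = (x, y)" "0 \<le> x" "x < 1" "0 \<le> y" "y < 1"
   using wrap_in_square[of z] by (cases "wrap z") auto
  \<comment> \<open>The wrapped point may lie on the left or lower edge of the half-open square;
    this diagonal shift moves it to the interior without leaving the ball or crossing the other
    edges.\<close>
  define d where "d = min (e / 4) (min ((1 - x) / 2) ((1 - y) / 2))"
  have d: "d \<le> e / 4" "d \<le> (1 - x) / 2" "d \<le> (1 - y) / 2"
   unfolding d_def by (meson min.cobounded1 min.cobounded2 order_trans)+
  have d0: "0 < d" using e xy by (simp add: d_def)
  have "dist (x, y) (x + d, y + d) \<le> \<bar>d\<bar> + \<bar>d\<bar>"
   unfolding dist_Pair_Pair dist_real_def using sqrt_sum_squares_le_sum_abs[of d d] by simp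
  also have "... < e" using d d0 e by simp
  finally have "(x + d, y + d) \<in> ball (wrap z) e" unfolding xy by simp
  moreover have "(x + d, y + d) \<in> {0<..<1} \<times> {0<..<1}"
   using d d0 xy by auto
  ultimately have "(x + d, y + d) \<in> V" using e(2) unfolding V_def by blast
  then show ?thesis by blast
 qed
 have "AE w in lborel. w \<in> {0..<1} \<times> {0..<1} \<longrightarrow> h w = 0"
  using ae unfolding torus_measure_def by (subst (asm) AE_uniform_measure) (auto simp: emeasure_unit_square)
 then have "AE w in lborel. w \<notin> V"
  by eventually_elim (auto simp: V_def U_def)
 then have "V \<in> null_sets lborel"
  using \<open>open V\<close> by (subst (asm) AE_iff_null_sets[symmetric]) auto
 then have "negligible V"
  using null_sets_completionI negligible_iff_null_sets by blast
 then show False using open_not_negligible[OF \<open>open V\<close> \<open>V \<noteq> {}\<close>] by simp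
qed

text \<open>The Weierstrass test gives a continuous sum g. Uniform convergence implies L2
  convergence, so g has the coefficients of f; then f - g vanishes almost everywhere by
  \<open>torus_uniqueness\<close> and everywhere by continuity.\<close>

lemma uniform_Fourier_series:
 fixes f :: "plane \<Rightarrow> real"
 assumes per: "periodic f" and cont: "continuous_on UNIV f"
  and K: "\<And>k. sqw k ^ 2 * \<bar>cas_coeff f k\<bar> \<le> K"
 shows "uniform_limit UNIV (\<lambda>n z. \<Sum>k\<in>grid n. cas_coeff f k * cas k z) f sequentially"
  and "(\<lambda>k. cas_coeff f k * cas k z) summable_on UNIV"
  and "f z = (\<Sum>\<^sub>\<infinity>k. cas_coeff f k * cas k z)"
proof -
 let ?A = "\<lambda>n z. \<Sum>k\<in>grid n. cas_coeff f k * cas k z"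
 define g where "g z = (\<Sum>\<^sub>\<infinity>k. cas_coeff f k * cas k z)" for z
 define M where "M k = 2 * K * (1 / (sqw k)^2)" for k
 have M: "M summable_on UNIV"
  unfolding M_def by (intro summable_on_cmult_right summable_on_inverse_sqw_square)
 have le: "norm (cas_coeff f k * cas k z) \<le> M k" for k z
 proof -
  have "\<bar>cas_coeff f k\<bar> \<le> K / (sqw k)^2"
   using K[of k] sqw_pos[of k] by (simp add: field_simps)
  then have "\<bar>cas_coeff f k\<bar> * \<bar>cas k z\<bar> \<le> K / (sqw k)^2 * 2"
   by (intro mult_mono abs_cas_le) (auto intro: order.trans[OF abs_ge_zero])
  then show ?thesis by (simp add: M_def abs_mult mult.commute)
 qed
 have "uniform_limit UNIV (\<lambda>X z. \<Sum>k\<in>X. cas_coeff f k * cas k z) g (finite_subsets_at_top UNIV)"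
  unfolding g_def by (rule Weierstrass_m_test_general[OF le M])
 then have ul: "uniform_limit UNIV ?A g sequentially"
  by (rule filterlim_compose[OF _ filterlim_grid, unfolded o_def])
 have contg: "continuous_on UNIV g"
  using ul by (rule uniform_limit_theorem[rotated]) (auto intro!: always_eventually continuous_intros)
 have perg: "periodic g" using periodic_cas by (simp add: periodic_def g_def)
 have gm: "g \<in> borel_measurable borel" "f \<in> borel_measurable borel"
  using contg cont by (auto intro: borel_measurable_continuous_onI)
 obtain B C where B: "\<And>z. \<bar>g z\<bar> \<le> B" and C: "\<And>z. \<bar>f z\<bar> \<le> C"
  using periodic_continuous_bounded[OF perg contg] periodic_continuous_bounded[OF per cont] by blast
 have coeff: "cas_coeff g k = cas_coeff f k" for k
 proof (rule cas_coeff_of_L2_limit[OF gm(1)])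
  show "integrable \<T> (\<lambda>z. (g z)^2)"
  proof (rule integrable_torus_bounded[of _ "B\<^sup>2"])
   show "norm ((g z)^2) \<le> B\<^sup>2" for z
    using power_mono[OF B[of z] abs_ge_zero, of 2] by simp
  qed (use gm in simp)
  show "(\<lambda>n. \<integral>z. ((\<Sum>k\<in>grid n. cas_coeff f k * cas k z) - g z)^2 \<partial>\<T>) \<longlonglongrightarrow> 0"
  proof (rule LIMSEQ_I)
   fix e :: real assume e: "e > 0"
   define d where "d = sqrt (e / 2)"
   have d: "d > 0" "d\<^sup>2 = e / 2" using e by (auto simp: d_def)
   have "\<forall>\<^sub>F n in sequentially. \<forall>z. dist (\<Sum>k\<in>grid n. cas_coeff f k * cas k z) (g z) < d"
    using ul d(1) unfolding uniform_limit_iff by auto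
   then obtain N where N: "\<And>n z. n \<ge> N \<Longrightarrow> \<bar>(\<Sum>k\<in>grid n. cas_coeff f k * cas k z) - g z\<bar> < d"
    unfolding eventually_sequentially dist_real_def by blast
   have "norm ((\<integral>z. ((\<Sum>k\<in>grid n. cas_coeff f k * cas k z) - g z)^2 \<partial>\<T>) - 0) < e" if "n \<ge> N" for n
   proof -
    have sq: "((\<Sum>k\<in>grid n. cas_coeff f k * cas k z) - g z)^2 \<le> d\<^sup>2" for z
     using N[OF that, of z] by (simp add: abs_le_square_iff[symmetric])
    have "(\<integral>z. ((\<Sum>k\<in>grid n. cas_coeff f k * cas k z) - g z)^2 \<partial>\<T>) \<le> (\<integral>z. d\<^sup>2 \<partial>\<T>)"
     using sq gm by (intro integral_mono integrable_torus_bounded[of _ "d\<^sup>2"]) auto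
    then show ?thesis using d e torus.prob_space by simp
   qed
   then show "\<exists>N. \<forall>n\<ge>N. norm ((\<integral>z. ((\<Sum>k\<in>grid n. cas_coeff f k * cas k z) - g z)^2 \<partial>\<T>) - 0) < e"
    by blast
  qed
 qed
 have int: "integrable \<T> f" "integrable \<T> g"
  using gm B C by (auto intro!: integrable_torus_bounded)
 have "AE z in \<T>. f z - g z = 0"
 proof (rule torus_uniqueness)
  fix k
  show "cas_coeff (\<lambda>z. f z - g z) k = 0"
   using coeff[of k] integrable_cas_mult[OF int(1)] integrable_cas_mult[OF int(2)]
   by (simp add: cas_coeff_def left_diff_distrib)
 qed (use int in simp)
 moreover have "periodic (\<lambda>z. f z - g z)" using per perg by (simp add: periodic_def)
 moreover have "continuous_on UNIV (\<lambda>z. f z - g z)" by (intro continuous_intros cont contg)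
 ultimately have fg: "f z = g z" for z
  using continuous_AE_zero_imp_zero[of "\<lambda>z. f z - g z" z] by simp
 show "uniform_limit UNIV ?A f sequentially"
 proof -
  have "g = f" by (rule ext) (rule fg[symmetric])
  then show ?thesis using ul by (simp only:)
 qed
 show "(\<lambda>k. cas_coeff f k * cas k z) summable_on UNIV"
  by (rule abs_summable_summable, rule summable_on_comparison_test[OF M]) (use le in auto)
 show "f z = (\<Sum>\<^sub>\<infinity>k. cas_coeff f k * cas k z)" using fg by (simp add: g_def)
qed

lemma partial_lincomb:
 assumes f: "f \<in> \<D>" and g: "g \<in> \<D>"
 shows "partial a b (\<lambda>z. c * f z + d * g z) = (\<lambda>z. c * partial a b f z + d * partial a b g z)"
proof (induction a)
 case 0
 show ?case
 proof (induction b)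
  case (Suc b)
  show ?case unfolding partial_Suc2 Suc.IH
   by (intro ext deriv2_lincomb test_functionsD(2)[OF f] test_functionsD(2)[OF g])
 qed simp
next
 case (Suc a)
 show ?case unfolding partial_Suc1 Suc.IH
  by (intro ext deriv1_lincomb test_functionsD(2)[OF f] test_functionsD(2)[OF g])
qed

lemma test_functions_lincomb:
 assumes f: "f \<in> \<D>" and g: "g \<in> \<D>"
 shows "(\<lambda>z. c * f z + d * g z) \<in> \<D>"
 using test_functionsD[OF f] test_functionsD[OF g]
 by (auto simp: test_functions_def partial_lincomb[OF f g] periodic_lincomb
   intro!: differentiable_add differentiable_mult differentiable_const)

lemma partial_cas: "\<exists>c l. partial a b (cas k) = (\<lambda>z. c * cas l z)"
proof -
 have d1: "deriv1 (\<lambda>z. c * cas l z) = (\<lambda>z. c * (2 * pi * of_int (fst l)) * cas (- l) z)" for c l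
  using deriv1_lincomb[of "cas l" _ "cas l" c 0] by (intro ext) (simp add: deriv1_cas differentiable_cas mult.assoc)
 have d2: "deriv2 (\<lambda>z. c * cas l z) = (\<lambda>z. c * (2 * pi * of_int (snd l)) * cas (- l) z)" for c l
  using deriv2_lincomb[of "cas l" _ "cas l" c 0] by (intro ext) (simp add: deriv2_cas differentiable_cas mult.assoc)
 have "\<exists>c l. partial 0 b (cas k) = (\<lambda>z. c * cas l z)"
 proof (induction b)
  case 0 then show ?case by (intro exI[of _ 1] exI[of _ k]) simp
 next
  case (Suc b) then show ?case unfolding partial_Suc2 using d2 by metis
 qed
 then show ?thesis
 proof (induction a)
  case (Suc a) then show ?case unfolding partial_Suc1 using d1 by metis
 qed
qed

lemma cas_test_function [simp]: "cas k \<in> \<D>"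
proof -
 have "partial a b (cas k) differentiable (at z)" for a b z
  using partial_cas[of a b k]
  by (auto intro!: differentiable_mult differentiable_const differentiable_cas)
 then show ?thesis by (simp add: test_functions_def periodic_cas)
qed

lemma const_test_function [simp]: "(\<lambda>_. c) \<in> \<D>"
 using test_functions_lincomb[OF cas_test_function cas_test_function, of c 0 0 0] by simp

lemma test_functions_scale: "f \<in> \<D> \<Longrightarrow> (\<lambda>z. c * f z) \<in> \<D>"
 using test_functions_lincomb[of f f c 0] by simp

lemma test_functions_add: "f \<in> \<D> \<Longrightarrow> g \<in> \<D> \<Longrightarrow> (\<lambda>z. f z + g z) \<in> \<D>"
 using test_functions_lincomb[of f g 1 1] by simp

lemma test_functions_diff: "f \<in> \<D> \<Longrightarrow> g \<in> \<D> \<Longrightarrow> (\<lambda>z. f z - g z) \<in> \<D>"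
 using test_functions_lincomb[of f g 1 "-1"] by simp

lemma test_functions_sum:
 "(\<And>i. i \<in> I \<Longrightarrow> f i \<in> \<D>) \<Longrightarrow> (\<lambda>z. \<Sum>i\<in>I. f i z) \<in> \<D>"
 by (induction I rule: infinite_finite_induct) (auto intro: test_functions_add)

lemma cas_sum_test_function [simp]: "(\<lambda>z. \<Sum>k\<in>J. c k * cas k z) \<in> \<D>"
 by (intro test_functions_sum test_functions_scale cas_test_function)

lemma deriv1_cas_sum:
 "deriv1 (\<lambda>z. \<Sum>k\<in>grid n. c k * cas k z) = (\<lambda>z. \<Sum>k\<in>grid n. (- 2 * pi * of_int (fst k) * c (- k)) * cas k z)"
proof
 let ?A = "\<lambda>z. \<Sum>k\<in>grid n. c k * cas k z"
 fix z
 have "deriv1 ?A z = (\<Sum>k\<in>grid n. c k * deriv1 (cas k) z)"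
 proof (subst deriv1_def, intro DERIV_imp_deriv DERIV_sum DERIV_cmult)
  show "((\<lambda>s. cas k (s, snd z)) has_field_derivative deriv1 (cas k) z) (at (fst z))" for k
   using has_deriv1[of "cas k" "fst z" "snd z"] by (simp add: differentiable_cas)
 qed
 also have "... = (\<Sum>k\<in>grid n. c (- k) * deriv1 (cas (- k)) z)"
  by (rule sum_grid_uminus[symmetric])
 finally show "deriv1 ?A z = (\<Sum>k\<in>grid n. (- 2 * pi * of_int (fst k) * c (- k)) * cas k z)"
  by (simp add: deriv1_cas mult_ac)
qed

lemma deriv2_cas_sum:
 "deriv2 (\<lambda>z. \<Sum>k\<in>grid n. c k * cas k z) = (\<lambda>z. \<Sum>k\<in>grid n. (- 2 * pi * of_int (snd k) * c (- k)) * cas k z)"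
proof
 let ?A = "\<lambda>z. \<Sum>k\<in>grid n. c k * cas k z"
 fix z
 have "deriv2 ?A z = (\<Sum>k\<in>grid n. c k * deriv2 (cas k) z)"
 proof (subst deriv2_def, intro DERIV_imp_deriv DERIV_sum DERIV_cmult)
  show "((\<lambda>s. cas k (fst z, s)) has_field_derivative deriv2 (cas k) z) (at (snd z))" for k
   using has_deriv2[of "cas k" "fst z" "snd z"] by (simp add: differentiable_cas)
 qed
 also have "... = (\<Sum>k\<in>grid n. c (- k) * deriv2 (cas (- k)) z)"
  by (rule sum_grid_uminus[symmetric])
 finally show "deriv2 ?A z = (\<Sum>k\<in>grid n. (- 2 * pi * of_int (snd k) * c (- k)) * cas k z)"
  by (simp add: deriv2_cas mult_ac)
qed

definition fourier_sum :: "nat \<Rightarrow> (plane \<Rightarrow> real) \<Rightarrow> plane \<Rightarrow> real"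
 where "fourier_sum n f z = (\<Sum>k\<in>grid n. cas_coeff f k * cas k z)"

lemma fourier_sum_test_function [simp]: "fourier_sum n f \<in> \<D>"
 unfolding fourier_sum_def[abs_def] by simp

lemma partial_fourier_sum:
 assumes f: "f \<in> \<D>"
 shows "partial a b (fourier_sum n f) = fourier_sum n (partial a b f)"
proof (induction a)
 case 0
 show ?case
  by (induction b) (simp_all add: partial_Suc2, simp add: fourier_sum_def[abs_def] deriv2_cas_sum cas_coeff_partial_Suc2[OF f, unfolded partial_Suc2])
next
 case (Suc a)
 then show ?case
  by (simp add: partial_Suc1) (simp add: fourier_sum_def[abs_def] deriv1_cas_sum cas_coeff_partial_Suc1[OF f, unfolded partial_Suc1])
qed

lemma uniform_limit_fourier_sum_partial:
 assumes f: "f \<in> \<D>"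
 shows "uniform_limit UNIV (\<lambda>n. fourier_sum n (partial a b f)) (partial a b f) sequentially"
proof -
 obtain K where "\<And>k. sqw k ^ 2 * \<bar>cas_coeff (partial a b f) k\<bar> \<le> K"
  using sqw_square_cas_coeff_partial_bounded[OF f] by blast
 then show ?thesis
  unfolding fourier_sum_def
  by (intro uniform_Fourier_series(1) periodic_partial continuous_partial test_functionsD f)
qed

text \<open>Partial derivatives commute with Fourier partial sums, so uniform convergence passes to
  every seminorm. A distribution is thereby determined by its values on the
  \<open>cas k\<close>.\<close>

lemma Ck_norm_fourier_sum_tendsto:
 assumes f: "f \<in> \<D>"
 shows "(\<lambda>n. Ck_norm m (\<lambda>z. f z - fourier_sum n f z)) \<longlonglongrightarrow> 0"
proof -
 have eq: "partial a b (\<lambda>z. f z - fourier_sum n f z) z = partial a b f z - fourier_sum n (partial a b f) z" for a b n z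
  using partial_lincomb[OF f fourier_sum_test_function, of a b 1 "-1" n f] by (simp add: partial_fourier_sum[OF f])
 have "(\<lambda>n. SUP z. \<bar>partial a b (\<lambda>z. f z - fourier_sum n f z) z\<bar>) \<longlonglongrightarrow> 0" for a b
 proof (rule LIMSEQ_I)
  fix e :: real assume e: "e > 0"
  have "\<forall>\<^sub>F n in sequentially. \<forall>z\<in>UNIV. dist (fourier_sum n (partial a b f) z) (partial a b f z) < e / 2"
   by (rule uniform_limitD[OF uniform_limit_fourier_sum_partial[OF f] half_gt_zero[OF e]])
  then obtain N where N: "\<And>n z. n \<ge> N \<Longrightarrow> \<bar>partial a b f z - fourier_sum n (partial a b f) z\<bar> < e / 2"
   unfolding eventually_sequentially dist_real_def by (metis abs_minus_commute UNIV_I)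
  have "norm ((SUP z. \<bar>partial a b (\<lambda>z. f z - fourier_sum n f z) z\<bar>) - 0) < e" if "n \<ge> N" for n
  proof -
   have "(SUP z. \<bar>partial a b (\<lambda>z. f z - fourier_sum n f z) z\<bar>) \<le> e / 2"
    unfolding eq using N[OF that] by (intro cSUP_least) (auto intro: less_imp_le)
   moreover have "0 \<le> (SUP z. \<bar>partial a b (\<lambda>z. f z - fourier_sum n f z) z\<bar>)"
    by (intro SUP_abs_partial_nonneg test_functions_diff f fourier_sum_test_function)
   ultimately show ?thesis using e by simp
  qed
  then show "\<exists>N. \<forall>n\<ge>N. norm ((SUP z. \<bar>partial a b (\<lambda>z. f z - fourier_sum n f z) z\<bar>) - 0) < e" by blast
 qed
 then have "(\<lambda>n. Ck_norm m (\<lambda>z. f z - fourier_sum n f z)) \<longlonglongrightarrow> (\<Sum>a\<le>m. \<Sum>b\<le>m - a. 0)"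
  unfolding Ck_norm_def by (intro tendsto_sum)
 then show ?thesis by simp
qed

lemma test_function_bounded: "f \<in> \<D> \<Longrightarrow> \<exists>B. \<forall>z. \<bar>f z\<bar> \<le> B"
 by (intro periodic_continuous_bounded test_functionsD continuous_test_function)

lemma integrable_test_function: "f \<in> \<D> \<Longrightarrow> integrable \<T> f"
 by (intro integrable_periodic_continuous test_functionsD continuous_test_function)

lemma integrable_test_function_mult:
 "f \<in> \<D> \<Longrightarrow> g \<in> \<D> \<Longrightarrow> integrable \<T> (\<lambda>z. f z * g z)"
 by (intro integrable_periodic_continuous periodic_mult test_functionsD continuous_on_mult continuous_test_function)

lemma fourier_sum_tendsto:
 assumes "f \<in> \<D>"
 shows "(\<lambda>n. fourier_sum n f z) \<longlonglongrightarrow> f z"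
 using uniform_limit_fourier_sum_partial[OF assms, of 0 0] by (auto dest: tendsto_uniform_limitI)

lemma Parseval_test_functions:
 assumes f: "f \<in> \<D>" and g: "g \<in> \<D>"
 shows "(\<lambda>n. \<Sum>k\<in>grid n. cas_coeff f k * cas_coeff g k) \<longlonglongrightarrow> (\<integral>z. f z * g z \<partial>\<T>)"
proof (rule LIMSEQ_I)
 let ?A = "\<integral>z. f z * g z \<partial>\<T>"
 fix e :: real assume e: "e > 0"
 obtain C where C: "\<And>z. \<bar>g z\<bar> \<le> C" using test_function_bounded g by meson
 have C0: "0 \<le> C" using order.trans[OF abs_ge_zero C] .
 define d where "d = e / (2 * (C + 1))"
 have d: "d > 0" using e C0 by (simp add: d_def)
 have "d * C \<le> d * (C + 1)" using d by (intro mult_left_mono) auto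
 also have "... = e / 2" using C0 by (simp add: d_def field_simps)
 also have "... < e" using e by simp
 finally have dC: "d * C < e" .
 have "\<forall>\<^sub>F n in sequentially. \<forall>z. dist (fourier_sum n f z) (f z) < d"
  using uniform_limit_fourier_sum_partial[OF f, of 0 0] d unfolding uniform_limit_iff by simp
 then obtain N where N: "\<And>n z. n \<ge> N \<Longrightarrow> \<bar>fourier_sum n f z - f z\<bar> < d"
  unfolding eventually_sequentially dist_real_def by blast
 have "norm ((\<Sum>k\<in>grid n. cas_coeff f k * cas_coeff g k) - ?A) < e" if "n \<ge> N" for n
 proof -
  have "fourier_sum n f z * g z = (\<Sum>k\<in>grid n. cas_coeff f k * (g z * cas k z))" for z
   unfolding fourier_sum_def sum_distrib_right by (rule sum.cong) auto
  then have "(\<Sum>k\<in>grid n. cas_coeff f k * cas_coeff g k) = (\<integral>z. fourier_sum n f z * g z \<partial>\<T>)"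
   using integrable_cas_mult[OF integrable_test_function[OF g]] by (simp add: cas_coeff_def)
  then have "(\<Sum>k\<in>grid n. cas_coeff f k * cas_coeff g k) - ?A
    = (\<integral>z. (fourier_sum n f z - f z) * g z \<partial>\<T>)"
   using integrable_test_function_mult[OF f g] integrable_test_function_mult[OF fourier_sum_test_function g]
   by (simp add: left_diff_distrib)
  also have "\<bar>...\<bar> \<le> (\<integral>z. \<bar>(fourier_sum n f z - f z) * g z\<bar> \<partial>\<T>)"
   by (rule integral_abs_bound)
  also have "... \<le> (\<integral>z. d * C \<partial>\<T>)"
  proof (rule integral_mono)
   show "integrable \<T> (\<lambda>z. \<bar>(fourier_sum n f z - f z) * g z\<bar>)"
    by (intro integrable_abs integrable_test_function_mult test_functions_diff f g fourier_sum_test_function)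
   show "\<bar>(fourier_sum n f z - f z) * g z\<bar> \<le> d * C" for z
    unfolding abs_mult using N[OF that, of z] C d by (intro mult_mono) auto
  qed simp
  also have "... < e" using dC torus.prob_space by simp
  finally show ?thesis by simp
 qed
 then show "\<exists>N. \<forall>n\<ge>N. norm ((\<Sum>k\<in>grid n. cas_coeff f k * cas_coeff g k) - ?A) < e"
  by blast
qed

subsection \<open>The Green function\<close>

text \<open>The eigenvalues of the Green operator. As \<open>1 / 0 = 0\<close>, the mode \<open>k = 0\<close> drops out of all sums.\<close>

definition lam :: "freq \<Rightarrow> real"
 where "lam k = 1 / (4 * pi\<^sup>2 * ((of_int (fst k))^2 + (of_int (snd k))^2))"

lemma lam_0 [simp]: "lam 0 = 0"
 by (simp add: lam_def)

lemma lam_nonneg [simp]: "0 \<le> lam k"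
 by (simp add: lam_def)

lemma lam_uminus [simp]: "lam (- k) = lam k"
 by (simp add: lam_def)

lemma four_pi_squared: "36 \<le> 4 * pi\<^sup>2"
proof -
 have "3 ^ 2 \<le> pi ^ 2" using pi_gt3 by (intro power_mono) auto
 then show ?thesis by simp
qed

lemma normsq_ge_1:
 assumes "k \<noteq> 0"
 shows "(of_int (fst k))^2 + (of_int (snd k))^2 \<ge> (1::real)"
proof -
 have "fst k \<noteq> 0 \<or> snd k \<noteq> 0" using assms by (auto simp: prod_eq_iff)
 then have "(fst k)^2 + (snd k)^2 \<ge> 1"
  by (smt (verit) zero_le_power2 zero_less_power2)
 then have "real_of_int ((fst k)^2 + (snd k)^2) \<ge> 1" by linarith
 then show ?thesis by simp
qed

lemma lam_pos: "k \<noteq> 0 \<Longrightarrow> 0 < lam k"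
 using normsq_ge_1[of k] by (simp add: lam_def)

lemma lam_le: "lam k \<le> 1 / sqw k"
proof (cases "k = 0")
 case False
 have "1 * sqw k \<le> 36 * ((of_int (fst k))^2 + (of_int (snd k))^2)"
  using normsq_ge_1[OF False] by (simp add: sqw_def)
 also have "... \<le> 4 * pi\<^sup>2 * ((of_int (fst k))^2 + (of_int (snd k))^2)"
  using four_pi_squared by (intro mult_right_mono) auto
 finally show ?thesis unfolding lam_def using sqw_pos[of k] by (intro divide_left_mono) auto
qed (simp add: sqw_pos less_imp_le)

lemma lam_le_1: "lam k \<le> 1"
 using lam_le[of k] sqw_ge_1[of k] by (smt (verit) divide_le_eq_1 sqw_pos)

lemma summable_on_lam_square: "(\<lambda>k. (lam k)^2) summable_on UNIV"
proof (rule summable_on_comparison_test[OF summable_on_inverse_sqw_square])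
 show "(lam k)^2 \<le> 1 / (sqw k)^2" for k
  using power_mono[OF lam_le lam_nonneg, of k 2] by (simp add: power_divide)
qed auto

definition green_trunc :: "nat \<Rightarrow> plane \<Rightarrow> real"
 where "green_trunc n z = (\<Sum>k\<in>grid n. lam k * cas k z)"

lemma green_trunc_cos: "green_trunc n z = (\<Sum>k\<in>grid n. lam k * cos (phase k z))"
proof -
 let ?A = "\<Sum>k\<in>grid n. lam k * sin (phase k z)"
 have "?A = (\<Sum>k\<in>grid n. lam (- k) * sin (phase (- k) z))"
  by (rule sum_grid_uminus[symmetric])
 then have "?A = 0"
  by (simp add: phase_minus_left sum_negf)
 then show ?thesis by (simp add: green_trunc_def cas_def distrib_left sum.distrib)
qed

lemma green_trunc_minus: "green_trunc n (- z) = green_trunc n z"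
 by (simp add: green_trunc_cos phase_minus_right)

lemma green_trunc_swap: "green_trunc n (x - y) = green_trunc n (y - x)"
 using green_trunc_minus[of n "x - y"] by simp

lemma continuous_green_trunc: "continuous_on UNIV (green_trunc n)"
 unfolding green_trunc_def by (intro continuous_intros)

lemma measurable_green_trunc [measurable]: "green_trunc n \<in> borel_measurable borel"
 by (rule borel_measurable_continuous_onI[OF continuous_green_trunc])

lemma periodic_green_trunc: "periodic (green_trunc n)"
 using periodic_cas by (simp add: periodic_def green_trunc_def)

section \<open>A logarithmic bound uniform in the cut-off\<close>

text \<open>Two crude ranges: up to pi/3 the cosine is at least 1/2, beyond it the sine is at least
  sqrt 3 / 2. Since pi > 3, the slope 1/3 is just enough for sin (pi y) \<ge> y on [0, 1/2], as used
  in \<open>abs_sin_pi_ge\<close>.\<close>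

lemma sin_ge_third:
 assumes "0 \<le> x" "x \<le> pi / 2"
 shows "x / 3 \<le> sin x"
proof (cases "x \<le> pi / 3")
 case True
 show ?thesis
 proof (cases "x = 0")
  case False
  then obtain t where t: "0 < t" "t < x" "sin x - sin 0 = (x - 0) * cos t"
   using MVT2[of 0 x sin cos] assms by auto
  have "cos (pi / 3) \<le> cos t"
   using t True by (intro cos_monotone_0_pi_le) auto
  then have "x * (1 / 3) \<le> x * cos t" using assms by (intro mult_left_mono) (auto simp: cos_60)
  then show ?thesis using t by simp
 qed simp
next
 case False
 have "sin (pi / 3) \<le> sin x"
  using False assms by (intro sin_monotone_2pi_le) auto
 moreover have "(17 / 10)^2 \<le> (3::real)" by (simp add: power2_eq_square)
 then have "17 / 10 \<le> sqrt 3" by (rule real_le_rsqrt)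
 ultimately show ?thesis using assms pi_less_4 by (simp add: sin_60)
qed

lemma abs_sin_pi_ge:
 assumes "0 \<le> y" "y \<le> 1"
 shows "min y (1 - y) \<le> \<bar>sin (pi * y)\<bar>"
proof (cases "y \<le> 1 / 2")
 case True
 have "pi * y / 3 \<le> sin (pi * y)"
  using assms True by (intro sin_ge_third) auto
 moreover have "y * 3 \<le> y * pi" using pi_gt3 assms by (intro mult_left_mono) auto
 ultimately show ?thesis by (simp add: mult.commute)
next
 case False
 have "pi * (1 - y) / 3 \<le> sin (pi * (1 - y))"
  using assms False by (intro sin_ge_third) auto
 moreover have "sin (pi * (1 - y)) = sin (pi * y)" by (simp add: right_diff_distrib sin_diff)
 moreover have "(1 - y) * 3 \<le> (1 - y) * pi" using pi_gt3 assms by (intro mult_left_mono) auto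
 ultimately show ?thesis by (simp add: mult.commute)
qed

text \<open>Summation by parts: the Dirichlet kernels \<open>s l / sin (pi y)\<close> are bounded, uniformly in the
 cut-off.\<close>

lemma abs_cos_sum_le:
 fixes c :: "nat \<Rightarrow> real"
 assumes dec: "\<And>l. c (Suc l) \<le> c l" and c0: "\<And>l. 0 \<le> c l"
 shows "\<bar>sin (pi * y)\<bar> * \<bar>c 0 + 2 * (\<Sum>l=1..n. c l * cos (2 * pi * real l * y))\<bar> \<le> c 0"
proof -
 define s where "s l = sin ((2 * real l + 1) * (pi * y))" for l :: nat
 have step: "2 * sin (pi * y) * cos (2 * pi * real (Suc l) * y) = s (Suc l) - s l" for l
 proof -
  have "s (Suc l) = sin (2 * pi * real (Suc l) * y + pi * y)"
   "s l = sin (2 * pi * real (Suc l) * y - pi * y)"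
   unfolding s_def by (rule arg_cong[of _ _ sin], simp add: algebra_simps)+
  then show ?thesis by (simp add: sin_add sin_diff)
 qed
 have sum: "sin (pi * y) * (c 0 + 2 * (\<Sum>l=1..n. c l * cos (2 * pi * real l * y)))
   = (\<Sum>l<n. (c l - c (Suc l)) * s l) + c n * s n"
 proof (induction n)
  case (Suc n)
  have "sin (pi * y) * (c 0 + 2 * (\<Sum>l=1..Suc n. c l * cos (2 * pi * real l * y)))
    = sin (pi * y) * (c 0 + 2 * (\<Sum>l=1..n. c l * cos (2 * pi * real l * y)))
     + c (Suc n) * (2 * sin (pi * y) * cos (2 * pi * real (Suc n) * y))"
   by (simp add: algebra_simps)
  also have "... = (\<Sum>l<n. (c l - c (Suc l)) * s l) + c n * s n + c (Suc n) * (s (Suc n) - s n)"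
   unfolding Suc.IH step ..
  finally show ?case by (simp add: algebra_simps)
 qed (simp add: s_def)
 have s1: "\<bar>s l\<bar> \<le> 1" for l by (simp add: s_def)
 have tel: "(\<Sum>l<n. c l - c (Suc l)) = c 0 - c n" by (rule sum_lessThan_telescope')
 have "\<bar>(\<Sum>l<n. (c l - c (Suc l)) * s l) + c n * s n\<bar> \<le> (\<Sum>l<n. \<bar>(c l - c (Suc l)) * s l\<bar>) + \<bar>c n * s n\<bar>"
  by (rule order.trans[OF abs_triangle_ineq]) (intro add_right_mono sum_abs)
 also have "... \<le> (\<Sum>l<n. c l - c (Suc l)) + c n"
 proof (intro add_mono sum_mono)
  show "\<bar>(c l - c (Suc l)) * s l\<bar> \<le> c l - c (Suc l)" for l
   using dec[of l] s1[of l] mult_left_mono[OF s1[of l], of "\<bar>c l - c (Suc l)\<bar>"] by (simp add: abs_mult)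
  show "\<bar>c n * s n\<bar> \<le> c n"
   using c0[of n] mult_left_mono[OF s1[of n], of "\<bar>c n\<bar>"] by (simp add: abs_mult)
 qed
 also have "... = c 0" by (simp add: tel)
 finally show ?thesis unfolding sum[symmetric] by (simp add: abs_mult)
qed

lemma sum_inverse_squares_tail_le:
 assumes "1 \<le> m"
 shows "(\<Sum>l=Suc m..n. 1 / (real l)^2) \<le> 1 / real m"
proof -
 have "(\<Sum>l=Suc m..n. 1 / (real l)^2) \<le> 1 / real m - 1 / real n" if "m \<le> n"
  using that
 proof (induction n rule: dec_induct)
  case (step n)
  have "0 < real n" using assms step by linarith
  then have "1 / (real (Suc n))^2 \<le> 1 / real n - 1 / real (Suc n)"
   by (simp add: divide_simps power2_eq_square)
  then show ?case using step by simp
 qed simp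
 moreover have "1 / real m - 1 / real n \<le> 1 / real m" by simp
 ultimately show ?thesis by (cases "m \<le> n") (auto intro: order.trans)
qed

lemma sum_inverse_squares_le: "(\<Sum>l=1..n. 1 / (real l)^2) \<le> 2"
proof (cases "1 \<le> n")
 case True
 then show ?thesis
  using sum.atLeast_Suc_atMost[of 1 n "\<lambda>l. 1 / (real l)^2"] sum_inverse_squares_tail_le[of 1 n] by simp
qed simp

text \<open>Comparison with 1/m^2 for l \<le> m and with 1/l^2 beyond; each half contributes at most
  1/m.\<close>

lemma sum_inverse_sum_squares_le:
 assumes "1 \<le> m"
 shows "(\<Sum>l=1..n. 1 / ((real m)^2 + (real l)^2)) \<le> 2 / real m"
proof -
 have m: "0 < real m" using assms by simp
 have le: "1 / ((real m)^2 + (real l)^2) \<le> (if l \<le> m then 1 / (real m)^2 else 1 / (real l)^2)" for l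
  using m by (auto intro!: divide_left_mono mult_pos_pos add_pos_nonneg)
 have "(\<Sum>l=1..n. 1 / ((real m)^2 + (real l)^2)) \<le> (\<Sum>l=1..n. if l \<le> m then 1 / (real m)^2 else 1 / (real l)^2)"
  by (intro sum_mono le)
 also have "... \<le> (\<Sum>l\<in>{1..m} \<union> {Suc m..n}. if l \<le> m then 1 / (real m)^2 else 1 / (real l)^2)"
  by (intro sum_mono2) auto
 also have "... = (\<Sum>l=1..m. 1 / (real m)^2) + (\<Sum>l=Suc m..n. 1 / (real l)^2)"
  by (subst sum.union_disjoint) (auto intro!: sum.cong arg_cong2[of _ _ _ _ "(+)"])
 also have "... \<le> 1 / real m + 1 / real m"
  using sum_inverse_squares_tail_le[OF assms, of n] m by (intro add_mono) (auto simp: power2_eq_square)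
 finally show ?thesis by simp
qed

lemma sum_min_inverse_le:
 fixes d :: real
 assumes d: "0 < d" "d \<le> 1"
 shows "(\<Sum>m=1..n. min (1 / real m) (1 / ((real m)^2 * d))) \<le> 3 + ln (1 / d)"
proof -
 \<comment> \<open>The two bounds cross at m = 1/d. The harmonic sum up to M produces the logarithm,
   the tail beyond it a constant.\<close>
 define M where "M = nat \<lfloor>1 / d\<rfloor>"
 have d1: "1 \<le> 1 / d" using d by simp
 have M: "1 \<le> M" "real M \<le> 1 / d" "1 / d < real M + 1"
  using d1 unfolding M_def by linarith+
 have "(\<Sum>m=1..n. min (1 / real m) (1 / ((real m)^2 * d)))
   \<le> (\<Sum>m=1..n. if m \<le> M then 1 / real m else 1 / (real m)^2 * (1 / d))"
  by (intro sum_mono) auto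
 also have "... \<le> (\<Sum>m\<in>{1..M} \<union> {Suc M..n}. if m \<le> M then 1 / real m else 1 / (real m)^2 * (1 / d))"
  using d by (intro sum_mono2) auto
 also have "... = (\<Sum>m=1..M. 1 / real m) + (\<Sum>m=Suc M..n. 1 / (real m)^2) * (1 / d)"
  unfolding sum_distrib_right by (subst sum.union_disjoint) (auto intro!: sum.cong arg_cong2[of _ _ _ _ "(+)"])
 also have "... \<le> (1 + ln (1 / d)) + 2"
 proof (intro add_mono)
  obtain j where j: "M = Suc j" using M(1) by (cases M) auto
  have "harm (Suc j) - ln (real (Suc j)) \<le> harm (Suc 0) - ln (real (Suc 0))"
   using decseq_harm_diff_ln unfolding decseq_def by blast
  then have "harm M \<le> 1 + ln (real M)" by (simp add: j harm_def)
  moreover have "ln (real M) \<le> ln (1 / d)" using M d by (subst ln_le_cancel_iff) auto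
  ultimately show "(\<Sum>m=1..M. 1 / real m) \<le> 1 + ln (1 / d)"
   by (simp add: harm_def inverse_eq_divide)
  have "(\<Sum>m=Suc M..n. 1 / (real m)^2) * (1 / d) \<le> 1 / real M * (1 / d)"
   using sum_inverse_squares_tail_le[OF M(1)] d by (intro mult_right_mono) auto
  also have "... \<le> 1 / real M * (2 * real M)"
  proof (rule mult_left_mono)
   show "1 / d \<le> 2 * real M" using M by linarith
  qed simp
  finally show "(\<Sum>m=Suc M..n. 1 / (real m)^2) * (1 / d) \<le> 2" using M(1) by simp
 qed
 finally show ?thesis by simp
qed

definition row_sum :: "nat \<Rightarrow> int \<Rightarrow> real \<Rightarrow> real"
 where "row_sum n m y = (\<Sum>l\<in>{- int n..int n}. lam (m, l) * cos (2 * pi * of_int l * y))"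

lemma green_trunc_row_sum:
 "green_trunc n (x, y) = (\<Sum>m\<in>{- int n..int n}. cos (2 * pi * of_int m * x) * row_sum n m y)"
proof -
 have lam: "lam (m, - l) = lam (m, l)" for m l by (simp add: lam_def)
 have odd: "(\<Sum>l\<in>{- int n..int n}. lam (m, l) * sin (2 * pi * of_int l * y)) = 0" for m
 proof -
  have "(\<Sum>l\<in>{- int n..int n}. lam (m, l) * sin (2 * pi * of_int l * y))
    = (\<Sum>l\<in>{- int n..int n}. lam (m, - l) * sin (2 * pi * of_int (- l) * y))"
   by (rule sum.reindex_bij_witness[of _ uminus uminus]) auto
  also have "... = - (\<Sum>l\<in>{- int n..int n}. lam (m, l) * sin (2 * pi * of_int l * y))"
   by (simp add: lam sum_negf)
  finally show ?thesis by simp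
 qed
 have "green_trunc n (x, y) = (\<Sum>m\<in>{- int n..int n}. \<Sum>l\<in>{- int n..int n}. lam (m, l) * cos (phase (m, l) (x, y)))"
  by (simp add: green_trunc_cos grid_def sum.cartesian_product case_prod_beta)
 also have "... = (\<Sum>m\<in>{- int n..int n}. cos (2 * pi * of_int m * x) * row_sum n m y)"
 proof (rule sum.cong[OF refl])
  fix m
  have "(\<Sum>l\<in>{- int n..int n}. lam (m, l) * cos (phase (m, l) (x, y)))
   = (\<Sum>l\<in>{- int n..int n}. cos (2 * pi * of_int m * x) * (lam (m, l) * cos (2 * pi * of_int l * y))
     - sin (2 * pi * of_int m * x) * (lam (m, l) * sin (2 * pi * of_int l * y)))"
   by (rule sum.cong[OF refl]) (simp add: phase_def distrib_left cos_add algebra_simps)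
  also have "... = cos (2 * pi * of_int m * x) * row_sum n m y
    - sin (2 * pi * of_int m * x) * (\<Sum>l\<in>{- int n..int n}. lam (m, l) * sin (2 * pi * of_int l * y))"
   by (simp add: sum_subtractf sum_distrib_left row_sum_def)
  finally show "(\<Sum>l\<in>{- int n..int n}. lam (m, l) * cos (phase (m, l) (x, y))) = cos (2 * pi * of_int m * x) * row_sum n m y"
   by (simp add: odd)
 qed
 finally show ?thesis .
qed

lemma row_sum_uminus: "row_sum n (- m) y = row_sum n m y"
 by (simp add: row_sum_def lam_def)

lemma row_sum_nat:
 "row_sum n m y = lam (m, 0) + 2 * (\<Sum>l=1..n. lam (m, int l) * cos (2 * pi * real l * y))"
 unfolding row_sum_def sum_symmetric_interval by (simp add: lam_def sum_distrib_left)

lemma abs_row_sum_0_le: "\<bar>row_sum n 0 y\<bar> \<le> 1"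
proof -
 have lam0: "lam (0, 0) = 0" by (simp add: lam_def)
 have "\<bar>row_sum n 0 y\<bar> \<le> 2 * (\<Sum>l=1..n. \<bar>lam (0, int l) * cos (2 * pi * real l * y)\<bar>)"
 proof -
  have "\<bar>row_sum n 0 y\<bar> = 2 * \<bar>\<Sum>l=1..n. lam (0, int l) * cos (2 * pi * real l * y)\<bar>"
   by (simp add: row_sum_nat lam0 abs_mult)
  also have "... \<le> 2 * (\<Sum>l=1..n. \<bar>lam (0, int l) * cos (2 * pi * real l * y)\<bar>)"
   by (intro mult_left_mono sum_abs) simp
  finally show ?thesis .
 qed
 also have "... \<le> 2 * (\<Sum>l=1..n. 1 / 36 * (1 / (real l)^2))"
 proof (intro mult_left_mono sum_mono)
  fix l assume l: "l \<in> {1..n}"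
  have "\<bar>lam (0, int l) * cos (2 * pi * real l * y)\<bar> \<le> lam (0, int l) * 1"
   unfolding abs_mult by (intro mult_mono) auto
  also have "... = 1 / (4 * pi\<^sup>2) * (1 / (real l)^2)" by (simp add: lam_def)
  also have "... \<le> 1 / 36 * (1 / (real l)^2)"
   using four_pi_squared by (intro mult_right_mono divide_left_mono) auto
  finally show "\<bar>lam (0, int l) * cos (2 * pi * real l * y)\<bar> \<le> 1 / 36 * (1 / (real l)^2)" .
 qed simp
 also have "... = 1 / 18 * (\<Sum>l=1..n. 1 / (real l)^2)" by (simp only: sum_distrib_left[symmetric])
 also have "... \<le> 1" using sum_inverse_squares_le[of n] by simp
 finally show ?thesis .
qed

text \<open>Absolute summation over l gives the bound of order 1/m, summation by parts the bound
  with m^2 and the sine; the second takes over for large m. With 4 pi^2 \<ge> 36 the constants 1/36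
  + 1/9 of the first bound stay below 1/6.\<close>

lemma abs_row_sum_le:
 assumes m: "1 \<le> m" and y: "sin (pi * y) \<noteq> 0"
 shows "\<bar>row_sum n (int m) y\<bar> \<le> 1 / 6 * min (1 / real m) (1 / ((real m)^2 * \<bar>sin (pi * y)\<bar>))"
proof -
 have m0: "0 < real m" using m by simp
 have "\<bar>row_sum n (int m) y\<bar> \<le> 1 / 6 * (1 / real m)"
 proof -
  have "\<bar>row_sum n (int m) y\<bar> \<le> \<bar>lam (int m, 0)\<bar> + 2 * (\<Sum>l=1..n. \<bar>lam (int m, int l) * cos (2 * pi * real l * y)\<bar>)"
  proof -
   have "\<bar>2 * (\<Sum>l=1..n. lam (int m, int l) * cos (2 * pi * real l * y))\<bar>
     = 2 * \<bar>\<Sum>l=1..n. lam (int m, int l) * cos (2 * pi * real l * y)\<bar>"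
    by (simp only: abs_mult abs_numeral)
   also have "... \<le> 2 * (\<Sum>l=1..n. \<bar>lam (int m, int l) * cos (2 * pi * real l * y)\<bar>)"
    by (intro mult_left_mono sum_abs) simp
   finally show ?thesis
    unfolding row_sum_nat by (intro order.trans[OF abs_triangle_ineq] add_left_mono)
  qed
  also have "... \<le> 1 / 36 * (1 / (real m)^2) + 2 * (\<Sum>l=1..n. 1 / 36 * (1 / ((real m)^2 + (real l)^2)))"
  proof (intro add_mono mult_left_mono sum_mono)
   have "\<bar>lam (int m, 0)\<bar> = 1 / (4 * pi\<^sup>2) * (1 / (real m)^2)" by (simp add: lam_def)
   also have "... \<le> 1 / 36 * (1 / (real m)^2)"
    using four_pi_squared by (intro mult_right_mono divide_left_mono) auto
   finally show "\<bar>lam (int m, 0)\<bar> \<le> 1 / 36 * (1 / (real m)^2)" .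
   fix l
   have "\<bar>lam (int m, int l) * cos (2 * pi * real l * y)\<bar> \<le> lam (int m, int l) * 1"
    unfolding abs_mult by (intro mult_mono) auto
   also have "... = 1 / (4 * pi\<^sup>2) * (1 / ((real m)^2 + (real l)^2))" by (simp add: lam_def)
   also have "... \<le> 1 / 36 * (1 / ((real m)^2 + (real l)^2))"
    using four_pi_squared by (intro mult_right_mono divide_left_mono) auto
   finally show "\<bar>lam (int m, int l) * cos (2 * pi * real l * y)\<bar> \<le> 1 / 36 * (1 / ((real m)^2 + (real l)^2))" .
  qed simp
  also have "... = 1 / 36 * (1 / (real m)^2) + 1 / 18 * (\<Sum>l=1..n. 1 / ((real m)^2 + (real l)^2))"
   by (simp only: sum_distrib_left[symmetric])
  also have "... \<le> 1 / 36 * (1 / real m) + 1 / 18 * (2 / real m)"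
   using sum_inverse_sum_squares_le[OF m, of n] m
   by (intro add_mono mult_left_mono) (auto simp: power2_eq_square divide_simps)
  also have "... \<le> 1 / 6 * (1 / real m)" using m0 by (simp add: field_simps)
  finally show ?thesis .
 qed
 moreover have "\<bar>row_sum n (int m) y\<bar> \<le> 1 / 6 * (1 / ((real m)^2 * \<bar>sin (pi * y)\<bar>))"
 proof -
  have "\<bar>sin (pi * y)\<bar> * \<bar>lam (int m, int 0) + 2 * (\<Sum>l=1..n. lam (int m, int l) * cos (2 * pi * real l * y))\<bar>
    \<le> lam (int m, int 0)"
  proof (rule abs_cos_sum_le)
   show "lam (int m, int (Suc l)) \<le> lam (int m, int l)" for l
    unfolding lam_def using m0 four_pi_squared
    by (intro divide_left_mono mult_left_mono add_left_mono power_mono mult_pos_pos add_pos_nonneg) auto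
  qed simp
  then have "\<bar>sin (pi * y)\<bar> * \<bar>row_sum n (int m) y\<bar> \<le> 1 / (4 * pi\<^sup>2) * (1 / (real m)^2)"
   by (simp add: row_sum_nat) (simp add: lam_def)
  also have "... \<le> 1 / 6 * (1 / (real m)^2)"
   using four_pi_squared by (intro mult_right_mono divide_left_mono) auto
  finally show ?thesis using y m0 by (simp add: field_simps)
 qed
 ultimately show ?thesis by simp
qed

text \<open>Summation by rows yields a singularity along the lines where the second coordinate is an
  integer, instead of at the lattice points. This loses sharpness but not integrability of the
  exponential, because the factor of the logarithm, 2 * 1/6, is less than 1.\<close>

lemma abs_green_trunc_le:
 assumes y: "sin (pi * snd z) \<noteq> 0"
 shows "\<bar>green_trunc n z\<bar> \<le> 2 + 1 / 3 * ln (1 / \<bar>sin (pi * snd z)\<bar>)"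
proof -
 obtain x y where z: "z = (x, y)" by (cases z)
 have sy: "sin (pi * y) \<noteq> 0" using y z by simp
 have "\<bar>green_trunc n z\<bar> \<le> (\<Sum>m\<in>{- int n..int n}. \<bar>row_sum n m y\<bar>)"
  unfolding z green_trunc_row_sum
 proof (rule order.trans[OF sum_abs], rule sum_mono)
  fix m :: int
  show "\<bar>cos (2 * pi * of_int m * x) * row_sum n m y\<bar> \<le> \<bar>row_sum n m y\<bar>"
   unfolding abs_mult using mult_right_mono[OF abs_cos_le_one[of "2 * pi * of_int m * x"], of "\<bar>row_sum n m y\<bar>"] by simp
 qed
 also have "... = \<bar>row_sum n 0 y\<bar> + 2 * (\<Sum>m=1..n. \<bar>row_sum n (int m) y\<bar>)"
  unfolding sum_symmetric_interval by (simp add: row_sum_uminus sum_distrib_left)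
 also have "... \<le> 1 + 2 * (\<Sum>m=1..n. 1 / 6 * min (1 / real m) (1 / ((real m)^2 * \<bar>sin (pi * y)\<bar>)))"
  using sy by (intro add_mono mult_left_mono sum_mono abs_row_sum_0_le abs_row_sum_le) auto
 also have "... = 1 + 1 / 3 * (\<Sum>m=1..n. min (1 / real m) (1 / ((real m)^2 * \<bar>sin (pi * y)\<bar>)))"
  by (simp add: sum_distrib_left)
 also have "... \<le> 1 + 1 / 3 * (3 + ln (1 / \<bar>sin (pi * y)\<bar>))"
  using sum_min_inverse_le[of "\<bar>sin (pi * y)\<bar>" n] sy by (intro add_left_mono mult_left_mono) auto
 finally show ?thesis by (simp add: z add_divide_distrib)
qed

lemma nn_integral_torus_snd:
 assumes [measurable]: "f \<in> borel_measurable borel"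
 shows "(\<integral>\<^sup>+z. f (snd z) \<partial>\<T>) = (\<integral>\<^sup>+y. f y * indicator {0..<1} y \<partial>lborel)"
proof -
 have [measurable]: "snd \<in> borel_measurable (borel :: plane measure)"
  by (intro borel_measurable_continuous_onI continuous_intros)
 have "(\<integral>\<^sup>+z. f (snd z) \<partial>\<T>)
   = (\<integral>\<^sup>+z. indicator {0..<1} (fst z) * (f (snd z) * indicator {0..<1} (snd z)) \<partial>((lborel :: real measure) \<Otimes>\<^sub>M (lborel :: real measure)))"
  by (subst nn_integral_torus) (auto simp: lborel_prod indicator_times mult_ac)
 also have "... = (\<integral>\<^sup>+x. \<integral>\<^sup>+y. indicator {0..<1} x * (f y * indicator {0..<1} y) \<partial>lborel \<partial>(lborel :: real measure))"
  by (subst lborel.nn_integral_fst[symmetric]) simp_all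
 also have "... = (\<integral>\<^sup>+y. f y * indicator {0..<1} y \<partial>lborel)"
  by (simp add: nn_integral_cmult nn_integral_multc)
 finally show ?thesis .
qed

lemma nn_integral_powr_le:
 "(\<integral>\<^sup>+y. ennreal (y powr (- 1 / 3)) * indicator {0..1} y \<partial>lborel) \<le> 2"
proof -
 have "((\<lambda>x. x powr (- 1 / 3)) has_integral (1 powr (- 1 / 3 + 1) / (- 1 / 3 + 1))) {0..1::real}"
  by (rule has_integral_powr_from_0) auto
 then have "((\<lambda>x. if x \<in> {0..1} then x powr (- 1 / 3) else 0) has_integral (3 / 2 :: real)) UNIV"
  by (subst has_integral_restrict_UNIV) simp
 then have "(\<integral>\<^sup>+x. ennreal (if x \<in> {0..1} then x powr (- 1 / 3) else 0) \<partial>lborel) = ennreal (3 / 2)"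
  by (intro nn_integral_has_integral_lborel) auto
 moreover have "ennreal (y powr (- 1 / 3)) * indicator {0..1} y = ennreal (if y \<in> {0..1} then y powr (- 1 / 3) else 0)" for y :: real
  by (simp add: indicator_def)
 moreover have "ennreal (3 / 2) \<le> 2"
 proof -
  have "ennreal (3 / 2) \<le> ennreal 2" by (rule ennreal_leI) simp
  then show ?thesis by simp
 qed
 ultimately show ?thesis by (simp only:)
qed

lemma sin_pi_nonzero: "0 < y \<Longrightarrow> y < 1 \<Longrightarrow> sin (pi * y) \<noteq> 0"
 using sin_gt_zero[of "pi * y"] by simp

lemma exp_abs_green_trunc_le:
 assumes z: "0 < snd z" "snd z < 1"
 shows "exp \<bar>green_trunc n z\<bar> \<le> exp 2 * (snd z powr (- 1 / 3) + (1 - snd z) powr (- 1 / 3))"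
proof -
 define y where "y = snd z"
 have y: "0 < y" "y < 1" using z by (auto simp: y_def)
 have s: "sin (pi * y) \<noteq> 0" by (rule sin_pi_nonzero[OF y])
 have "exp \<bar>green_trunc n z\<bar> \<le> exp (2 + 1 / 3 * ln (1 / \<bar>sin (pi * y)\<bar>))"
  using abs_green_trunc_le[of z n] s by (simp add: y_def)
 also have "... = exp 2 * \<bar>sin (pi * y)\<bar> powr (- 1 / 3)"
 proof -
  have "1 / 3 * ln (1 / \<bar>sin (pi * y)\<bar>) = - 1 / 3 * ln \<bar>sin (pi * y)\<bar>" using s by (simp add: ln_div)
  then show ?thesis using s by (simp only: exp_add) (simp add: powr_def)
 qed
 also have "... \<le> exp 2 * (min y (1 - y)) powr (- 1 / 3)"
  using abs_sin_pi_ge[of y] y by (intro mult_left_mono powr_mono2') auto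
 also have "... \<le> exp 2 * (y powr (- 1 / 3) + (1 - y) powr (- 1 / 3))"
  by (intro mult_left_mono) (auto simp: min_def)
 finally show ?thesis by (simp add: y_def)
qed

lemma AE_torus_snd_pos: "AE z in \<T>. 0 < snd z \<and> snd z < 1"
proof -
 have "(\<integral>\<^sup>+z. indicator {0} (snd z) \<partial>\<T>) = (\<integral>\<^sup>+y. indicator {0} y * indicator {0..<1} y \<partial>(lborel :: real measure))"
  by (rule nn_integral_torus_snd) auto
 also have "... = (\<integral>\<^sup>+y. indicator {0} y \<partial>(lborel :: real measure))"
  by (intro nn_integral_cong) (auto simp: indicator_def)
 also have "... = 0" by simp
 finally have z: "(\<integral>\<^sup>+z. indicator {0::real} (snd z) \<partial>\<T>) = (0::ennreal)" .
 have [measurable]: "snd \<in> borel_measurable (borel :: plane measure)"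
  by (intro borel_measurable_continuous_onI continuous_intros)
 have "AE z in \<T>. indicator {0::real} (snd z) = (0::ennreal)"
  using z by (subst (asm) nn_integral_0_iff_AE) auto
 then show ?thesis
  using AE_torus_in_square by eventually_elim (auto simp: indicator_def split: if_splits)
qed

text \<open>The bound of \<open>exp_abs_green_trunc_le\<close> is the same for all n. It is singular
  at the two edges y = 0 and y = 1; each power has integral 3/2, rounded up to 2.\<close>

lemma nn_integral_exp_green_trunc_le:
 "(\<integral>\<^sup>+z. ennreal (exp \<bar>green_trunc n z\<bar>) \<partial>\<T>) \<le> ennreal (4 * exp 2)"
proof -
 let ?A = "\<integral>\<^sup>+z. ennreal ((1 - snd z) powr (- 1 / 3)) \<partial>\<T>"
 let ?B = "\<integral>\<^sup>+z. ennreal (snd z powr (- 1 / 3)) \<partial>\<T>"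
 let ?C = "\<integral>\<^sup>+y. ennreal (y powr (- 1 / 3)) * indicator {0..1} y \<partial>lborel"
 let ?D = "\<integral>\<^sup>+z. ennreal (exp \<bar>green_trunc n z\<bar>) \<partial>\<T>"
 have [measurable]: "snd \<in> borel_measurable (borel :: plane measure)"
  by (intro borel_measurable_continuous_onI continuous_intros)
 have "?D
   \<le> (\<integral>\<^sup>+z. ennreal (exp 2) * (ennreal (snd z powr (- 1 / 3)) + ennreal ((1 - snd z) powr (- 1 / 3))) \<partial>\<T>)"
 proof (rule nn_integral_mono_AE, use AE_torus_snd_pos in eventually_elim)
  case (elim z)
  have "ennreal (exp \<bar>green_trunc n z\<bar>) \<le> ennreal (exp 2 * (snd z powr (- 1 / 3) + (1 - snd z) powr (- 1 / 3)))"
   using elim by (intro ennreal_leI exp_abs_green_trunc_le) auto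
  then show ?case by (simp only: ennreal_mult ennreal_plus powr_ge_zero exp_ge_zero add_nonneg_nonneg)
 qed
 also have "... = ennreal (exp 2) * (?B + ?A)"
  by (simp add: nn_integral_cmult nn_integral_add)
 also have "?B \<le> 2"
 proof -
  have "?B = (\<integral>\<^sup>+y. ennreal (y powr (- 1 / 3)) * indicator {0..<1} y \<partial>lborel)"
   by (rule nn_integral_torus_snd) auto
  also have "... \<le> ?C"
   by (intro nn_integral_mono mult_left_mono) (auto simp: indicator_def)
  finally show ?thesis using nn_integral_powr_le by (rule order.trans)
 qed
 also have "?A \<le> 2"
 proof -
  have "?A = (\<integral>\<^sup>+y. ennreal ((1 - y) powr (- 1 / 3)) * indicator {0..<1} y \<partial>lborel)"
   by (rule nn_integral_torus_snd[of "\<lambda>y. ennreal ((1 - y) powr (- 1 / 3))"]) auto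
  also have "... \<le> (\<integral>\<^sup>+y. ennreal ((1 - y) powr (- 1 / 3)) * indicator {0..1} (1 - y) \<partial>lborel)"
   by (intro nn_integral_mono mult_left_mono) (auto simp: indicator_def)
  also have "... = ?C"
   using nn_integral_real_affine[of "\<lambda>y. ennreal (y powr (- 1 / 3)) * indicator {0..1} y" "-1" 1] by simp
  finally show ?thesis using nn_integral_powr_le by (rule order.trans)
 qed
 finally have "?D \<le> ennreal (exp 2) * (2 + 2)"
  by (simp add: add_mono mult_left_mono)
 also have "... = ennreal (4 * exp 2)" by (simp add: ennreal_mult mult.commute)
 finally show ?thesis .
qed

section \<open>Existence and Fourier coefficients of the Green function\<close>

lemma cas_coeff_laplacian:
 assumes f: "f \<in> \<D>"
 shows "cas_coeff (laplacian f) k = - (4 * pi\<^sup>2 * ((of_int (fst k))^2 + (of_int (snd k))^2)) * cas_coeff f k"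
proof -
 have "cas_coeff (laplacian f) k = cas_coeff (partial 2 0 f) k + cas_coeff (partial 0 2 f) k"
  unfolding laplacian_def cas_coeff_def distrib_right
  by (intro Bochner_Integration.integral_add integrable_cas_mult integrable_periodic_continuous periodic_partial continuous_partial f test_functionsD(1)[OF f])
 moreover have "cas_coeff (partial 2 0 f) k = - 4 * pi\<^sup>2 * (of_int (fst k))^2 * cas_coeff f k"
  using cas_coeff_partial_Suc1[OF f, of 1 0] cas_coeff_partial_Suc1[OF f, of 0 0]
  by (simp add: numeral_2_eq_2 power2_eq_square)
 moreover have "cas_coeff (partial 0 2 f) k = - 4 * pi\<^sup>2 * (of_int (snd k))^2 * cas_coeff f k"
  using cas_coeff_partial_Suc2[OF f, of 1] cas_coeff_partial_Suc2[OF f, of 0]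
  by (simp add: numeral_2_eq_2 power2_eq_square)
 ultimately show ?thesis by (simp add: algebra_simps)
qed

lemma laplacian_cas: "laplacian (cas k) z = - (4 * pi\<^sup>2 * ((of_int (fst k))^2 + (of_int (snd k))^2)) * cas k z"
proof -
 have d1: "deriv1 (\<lambda>z. c * cas l z) = (\<lambda>z. c * (2 * pi * of_int (fst l)) * cas (- l) z)" for c l
  using deriv1_lincomb[of "cas l" _ "cas l" c 0] by (intro ext) (simp add: deriv1_cas differentiable_cas mult.assoc)
 have d2: "deriv2 (\<lambda>z. c * cas l z) = (\<lambda>z. c * (2 * pi * of_int (snd l)) * cas (- l) z)" for c l
  using deriv2_lincomb[of "cas l" _ "cas l" c 0] by (intro ext) (simp add: deriv2_cas differentiable_cas mult.assoc)
 have e1: "deriv1 (cas k) = (\<lambda>z. 2 * pi * of_int (fst k) * cas (- k) z)"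
  and e2: "deriv2 (cas k) = (\<lambda>z. 2 * pi * of_int (snd k) * cas (- k) z)"
  by (auto simp: deriv1_cas deriv2_cas)
 have "partial 2 0 (cas k) = (\<lambda>z. 2 * pi * of_int (fst k) * (2 * pi * of_int (fst (- k))) * cas (- (- k)) z)"
  by (simp only: numeral_2_eq_2 partial_Suc1 partial_0_0 e1 d1)
 moreover have "partial 0 2 (cas k) = (\<lambda>z. 2 * pi * of_int (snd k) * (2 * pi * of_int (snd (- k))) * cas (- (- k)) z)"
  by (simp only: numeral_2_eq_2 partial_Suc2 partial_0_0 e2 d2)
 ultimately show ?thesis
  by (simp add: laplacian_def power2_eq_square algebra_simps)
qed

lemma green_function_exists:
 "\<exists>G r. is_green_function G \<and> integrable \<T> (\<lambda>z. (G z)^2) \<and> (\<forall>k. cas_coeff G k = lam k)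
   \<and> (\<lambda>n. \<integral>z. (green_trunc n z - G z)^2 \<partial>\<T>) \<longlonglongrightarrow> 0
   \<and> strict_mono r \<and> (AE z in \<T>. (\<lambda>n. green_trunc (r n) z) \<longlonglongrightarrow> G z)"
proof -
 obtain r G where r: "strict_mono r" and G: "G = (\<lambda>z. lim (\<lambda>n. \<Sum>k\<in>grid (r n). lam k * cas k z))"
  "G \<in> borel_measurable borel" and AE: "AE z in \<T>. (\<lambda>n. \<Sum>k\<in>grid (r n). lam k * cas k z) \<longlonglongrightarrow> G z"
  and sq: "integrable \<T> (\<lambda>z. (G z)^2)"
  and lim: "(\<lambda>n. \<integral>z. ((\<Sum>k\<in>grid n. lam k * cas k z) - G z)^2 \<partial>\<T>) \<longlonglongrightarrow> 0"
  by (rule L2_synthesis[OF summable_on_lam_square])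
 have int: "integrable \<T> G"
  by (rule torus.square_integrable_imp_integrable) (simp_all add: G(2) sq)
 have coeff: "cas_coeff G k = lam k" for k
  by (rule cas_coeff_of_L2_limit[OF G(2) sq lim])
 have per: "periodic G"
  using periodic_cas unfolding G(1) by (simp add: periodic_def)
 have "(\<integral>z. G z * (- laplacian f z) \<partial>\<T>) = f 0 - (\<integral>z. f z \<partial>\<T>)" if f: "f \<in> \<D>" for f
 proof -
  have lap: "periodic (laplacian f)" "continuous_on UNIV (laplacian f)"
   using periodic_partial[OF test_functionsD(1)[OF f], of 2 0] periodic_partial[OF test_functionsD(1)[OF f], of 0 2]
   by (auto simp: periodic_def laplacian_def[abs_def] intro!: continuous_on_add continuous_partial f)
  have "(\<lambda>n. \<Sum>k\<in>grid n. lam k * cas_coeff (laplacian f) k) \<longlonglongrightarrow> (\<integral>z. G z * laplacian f z \<partial>\<T>)"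
  proof (rule cas_coeff_L2_limit[OF G(2) sq lim])
   show "laplacian f \<in> borel_measurable borel" using lap(2) by (rule borel_measurable_continuous_onI)
   show "integrable \<T> (\<lambda>z. (laplacian f z)^2)"
    unfolding power2_eq_square by (intro integrable_periodic_continuous periodic_mult continuous_on_mult lap)
  qed
  \<comment> \<open>\<open>lam\<close> inverts the symbol of minus the Laplacian except at k = 0. Up
    to that missing mode, which is the average of f, the sum is minus the partial Fourier series of
    f at the origin.\<close>
  moreover have "(\<Sum>k\<in>grid n. lam k * cas_coeff (laplacian f) k) = cas_coeff f 0 - fourier_sum n f 0" for n
  proof -
   have "lam k * cas_coeff (laplacian f) k = (if k = 0 then cas_coeff f 0 else 0) - cas_coeff f k" for k
    using normsq_ge_1[of k] by (cases "k = 0") (auto simp: cas_coeff_laplacian[OF f] lam_def)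
   moreover have "0 \<in> grid n" by (simp add: grid_def zero_prod_def)
   moreover have "cas k 0 = 1" for k by (simp add: cas_def)
   ultimately show ?thesis by (simp add: sum_subtractf fourier_sum_def sum.delta)
  qed
  moreover have "(\<lambda>n. cas_coeff f 0 - fourier_sum n f 0) \<longlonglongrightarrow> cas_coeff f 0 - f 0"
   by (intro tendsto_intros fourier_sum_tendsto f)
  ultimately have "(\<integral>z. G z * laplacian f z \<partial>\<T>) = cas_coeff f 0 - f 0"
   using LIMSEQ_unique by fastforce
  then show ?thesis by (simp add: cas_coeff_def)
 qed
 moreover have "(\<integral>z. G z \<partial>\<T>) = 0"
  using coeff[of 0] by (simp add: cas_coeff_def)
 ultimately have "is_green_function G"
  using per G(2) int by (auto simp: is_green_function_def)
 then show ?thesis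
  using sq coeff lim r AE by (auto simp: green_trunc_def)
qed

lemma is_green_function_green: "is_green_function green"
 using green_function_exists someI_ex[of is_green_function] unfolding green_def by blast

lemma measurable_green [measurable]: "green \<in> borel_measurable borel"
 and periodic_green: "periodic green"
 and integrable_green: "integrable \<T> green"
 using is_green_function_green by (auto simp: is_green_function_def)

lemma cas_coeff_green: "cas_coeff green k = lam k"
proof (cases "k = 0")
 case True
 then show ?thesis using is_green_function_green by (simp add: is_green_function_def cas_coeff_def)
next
 case False
 have "(\<integral>z. green z * (- laplacian (cas k) z) \<partial>\<T>) = cas k 0 - (\<integral>z. cas k z \<partial>\<T>)"
  using is_green_function_green unfolding is_green_function_def by auto
 moreover define A where "A = 4 * pi\<^sup>2 * ((of_int (fst k))^2 + (of_int (snd k))^2)"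
 ultimately have "A * cas_coeff green k = 1"
  using False by (simp add: laplacian_cas integral_cas cas_coeff_def mult.left_commute[of "green _"]) (simp add: cas_def)
 moreover have "A \<noteq> 0" using normsq_ge_1[OF False] by (auto simp: A_def)
 ultimately have "cas_coeff green k = 1 / A" by (simp add: eq_divide_eq mult.commute)
 then show ?thesis by (simp add: lam_def A_def)
qed

text \<open>\<open>green\<close> is an unspecified solution of the weak equation. Tested with
  \<open>cas k\<close>, the equation determines all coefficients (\<open>cas_coeff_green\<close>),
  and \<open>torus_uniqueness\<close> identifies \<open>green\<close> almost everywhere with the L2
  solution constructed above.\<close>

lemma green_properties:
 shows integrable_green_square: "integrable \<T> (\<lambda>z. (green z)^2)"
  and green_trunc_L2: "(\<lambda>n. \<integral>z. (green_trunc n z - green z)^2 \<partial>\<T>) \<longlonglongrightarrow> 0"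
proof -
 obtain G r where G: "is_green_function G" "integrable \<T> (\<lambda>z. (G z)^2)" "\<And>k. cas_coeff G k = lam k"
  "(\<lambda>n. \<integral>z. (green_trunc n z - G z)^2 \<partial>\<T>) \<longlonglongrightarrow> 0"
  "strict_mono r" "AE z in \<T>. (\<lambda>n. green_trunc (r n) z) \<longlonglongrightarrow> G z"
  using green_function_exists by blast
 have [measurable]: "G \<in> borel_measurable borel" and int: "integrable \<T> G"
  using G(1) by (auto simp: is_green_function_def)
 have "AE z in \<T>. green z - G z = 0"
 proof (rule torus_uniqueness)
  show "integrable \<T> (\<lambda>z. green z - G z)" using int integrable_green by simp
  show "cas_coeff (\<lambda>z. green z - G z) k = 0" for k
   using G(3)[of k] cas_coeff_green[of k] integrable_cas_mult[OF int, of k] integrable_cas_mult[OF integrable_green, of k]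
   by (simp add: cas_coeff_def left_diff_distrib)
 qed
 then have AE: "AE z in \<T>. green z = G z" by simp
 show "integrable \<T> (\<lambda>z. (green z)^2)"
  using G(2) by (subst integrable_cong_AE[of _ _ "\<lambda>z. (G z)^2"]) (use AE in auto)
 have "(\<integral>z. (green_trunc n z - green z)^2 \<partial>\<T>) = (\<integral>z. (green_trunc n z - G z)^2 \<partial>\<T>)" for n
  by (rule integral_cong_AE) (use AE in auto)
 then show "(\<lambda>n. \<integral>z. (green_trunc n z - green z)^2 \<partial>\<T>) \<longlonglongrightarrow> 0"
  using G(4) by simp
qed

subsection \<open>A uniform exponential bound for the point vortex energy\<close>

lemma integral_norm_trig_sum_squared:
 fixes c :: "freq \<Rightarrow> complex"
 assumes "finite J"
 shows "(\<integral>z. (cmod (\<Sum>k\<in>J. c k * cis (phase k z)))^2 \<partial>\<T>) = (\<Sum>k\<in>J. (cmod (c k))^2)"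
proof -
 have eq: "complex_of_real ((cmod (\<Sum>k\<in>J. c k * cis (phase k z)))^2)
   = (\<Sum>k\<in>J. \<Sum>l\<in>J. c k * cnj (c l) * cis (phase (k - l) z))" for z
  unfolding complex_norm_square
  by (simp add: sum_product phase_diff_left cis_cnj cis_mult mult_ac)
 have "complex_of_real (\<integral>z. (cmod (\<Sum>k\<in>J. c k * cis (phase k z)))^2 \<partial>\<T>)
   = (\<integral>z. (\<Sum>k\<in>J. \<Sum>l\<in>J. c k * cnj (c l) * cis (phase (k - l) z)) \<partial>\<T>)"
  unfolding integral_complex_of_real[symmetric] eq ..
 also have "... = (\<Sum>k\<in>J. \<Sum>l\<in>J. c k * cnj (c l) * (if k = l then 1 else 0))"
  by (simp add: integrable_cis_phase integral_cis_phase)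
 also have "... = (\<Sum>k\<in>J. c k * cnj (c k))"
  using assms by (simp add: if_distrib[of "\<lambda>x. _ * x"] sum.delta cong: if_cong)
 also have "... = complex_of_real (\<Sum>k\<in>J. (cmod (c k))^2)"
  by (simp only: of_real_sum complex_norm_square)
 finally show ?thesis by (simp only: of_real_eq_iff)
qed

text \<open>The square of the sum has the convolution of v with itself as coefficients.
  Cauchy-Schwarz on each fibre k + l = m, with weights u k * u l, costs at most U by the
  arithmetic-geometric mean. The form of the bound is what matters: its square root is a weighted
  sum of the |v k|^2, hence additive in the modes.\<close>

lemma integral_trig_sum_fourth_power_le:
 fixes v :: "freq \<Rightarrow> complex" and u :: "freq \<Rightarrow> real"
 assumes F: "finite F" and u: "\<And>k. k \<in> F \<Longrightarrow> 0 < u k" and U: "(\<Sum>k\<in>F. (u k)^2) \<le> U"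
 shows "(\<integral>z. (cmod (\<Sum>k\<in>F. v k * cis (phase k z))) ^ 4 \<partial>\<T>) \<le> U * (\<Sum>k\<in>F. (cmod (v k))^2 / u k)^2"
proof -
 define add where "add = (\<lambda>p :: freq \<times> (freq). fst p + snd p)"
 define M where "M = add ` (F \<times> F)"
 define fib where "fib m = {p \<in> F \<times> F. add p = m}" for m
 define c where "c m = (\<Sum>p\<in>fib m. v (fst p) * v (snd p))" for m
 have fin: "finite M" "finite (fib m)" for m using F by (auto simp: M_def fib_def)
 have sq: "(\<Sum>k\<in>F. v k * cis (phase k z))^2 = (\<Sum>m\<in>M. c m * cis (phase m z))" for z
 proof -
  have "(\<Sum>k\<in>F. v k * cis (phase k z))^2 = (\<Sum>p\<in>F \<times> F. v (fst p) * v (snd p) * cis (phase (add p) z))"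
   by (simp add: power2_eq_square sum_product sum.cartesian_product case_prod_beta add_def phase_add_left cis_mult[symmetric] mult_ac)
  also have "... = (\<Sum>m\<in>M. \<Sum>p\<in>fib m. v (fst p) * v (snd p) * cis (phase (add p) z))"
   unfolding M_def fib_def using F by (intro sum.image_gen) auto
  also have "... = (\<Sum>m\<in>M. c m * cis (phase m z))"
   unfolding c_def sum_distrib_right by (intro sum.cong) (auto simp: fib_def)
  finally show ?thesis .
 qed
 have "(\<integral>z. (cmod (\<Sum>k\<in>F. v k * cis (phase k z))) ^ 4 \<partial>\<T>)
   = (\<integral>z. (cmod (\<Sum>m\<in>M. c m * cis (phase m z)))^2 \<partial>\<T>)"
  unfolding sq[symmetric] by (simp add: norm_power power_mult[symmetric])
 also have "... = (\<Sum>m\<in>M. (cmod (c m))^2)" by (rule integral_norm_trig_sum_squared[OF fin(1)])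
 also have "... \<le> (\<Sum>m\<in>M. U * (\<Sum>p\<in>fib m. (cmod (v (fst p)))^2 / u (fst p) * ((cmod (v (snd p)))^2 / u (snd p))))"
 proof (rule sum_mono)
  fix m
  have up: "0 < u (fst p)" "0 < u (snd p)" if "p \<in> fib m" for p using that u by (auto simp: fib_def)
  define a where "a p = sqrt (u (fst p) * u (snd p))" for p
  define b where "b p = cmod (v (fst p)) * cmod (v (snd p)) / a p" for p
  have a: "0 < a p" if "p \<in> fib m" for p using up[OF that] by (simp add: a_def)
  have "cmod (c m) \<le> (\<Sum>p\<in>fib m. a p * b p)"
   unfolding c_def
  proof (rule order.trans[OF norm_sum], rule sum_mono)
   fix p assume "p \<in> fib m"
   from a[OF this] show "cmod (v (fst p) * v (snd p)) \<le> a p * b p" by (simp add: b_def norm_mult)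
  qed
  then have "(cmod (c m))^2 \<le> (\<Sum>p\<in>fib m. a p * b p)^2" by (intro power_mono) auto
  also have "... \<le> (\<Sum>p\<in>fib m. (a p)^2) * (\<Sum>p\<in>fib m. (b p)^2)" by (rule Cauchy_Schwarz_ineq_sum)
  also have "... \<le> U * (\<Sum>p\<in>fib m. (b p)^2)"
  proof (rule mult_right_mono)
   have "(\<Sum>p\<in>fib m. (a p)^2) \<le> (\<Sum>p\<in>fib m. ((u (fst p))^2 + (u (snd p))^2) / 2)"
   proof (rule sum_mono)
    fix p assume "p \<in> fib m"
    then show "(a p)^2 \<le> ((u (fst p))^2 + (u (snd p))^2) / 2"
     using up[of p] sum_squares_bound[of "u (fst p)" "u (snd p)"] by (simp add: a_def)
   qed
   also have "... = ((\<Sum>p\<in>fib m. (u (fst p))^2) + (\<Sum>p\<in>fib m. (u (snd p))^2)) / 2"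
    by (simp only: sum_divide_distrib[symmetric] sum.distrib)
   also have "... \<le> (U + U) / 2"
   proof (intro divide_right_mono add_mono)
    \<comment> \<open>On a fibre either component determines the pair, so each frequency is counted
      at most once.\<close>
    have "(\<Sum>p\<in>fib m. (u (fst p))^2) = (\<Sum>k\<in>fst ` fib m. (u k)^2)"
     by (subst sum.reindex) (auto simp: inj_on_def fib_def add_def)
    also have "... \<le> (\<Sum>k\<in>F. (u k)^2)" using F by (intro sum_mono2) (auto simp: fib_def)
    finally show "(\<Sum>p\<in>fib m. (u (fst p))^2) \<le> U" using U by simp
    have "(\<Sum>p\<in>fib m. (u (snd p))^2) = (\<Sum>k\<in>snd ` fib m. (u k)^2)"
     by (subst sum.reindex) (auto simp: inj_on_def fib_def add_def)
    also have "... \<le> (\<Sum>k\<in>F. (u k)^2)" using F by (intro sum_mono2) (auto simp: fib_def)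
    finally show "(\<Sum>p\<in>fib m. (u (snd p))^2) \<le> U" using U by simp
   qed simp
   finally show "(\<Sum>p\<in>fib m. (a p)^2) \<le> U" by simp
  qed (simp add: sum_nonneg)
  also have "(\<Sum>p\<in>fib m. (b p)^2) = (\<Sum>p\<in>fib m. (cmod (v (fst p)))^2 / u (fst p) * ((cmod (v (snd p)))^2 / u (snd p)))"
  proof (rule sum.cong[OF refl])
   fix p assume "p \<in> fib m"
   then show "(b p)^2 = (cmod (v (fst p)))^2 / u (fst p) * ((cmod (v (snd p)))^2 / u (snd p))"
    using up[of p] by (simp add: b_def a_def power_divide power_mult_distrib)
  qed
  finally show "(cmod (c m))^2 \<le> U * (\<Sum>p\<in>fib m. (cmod (v (fst p)))^2 / u (fst p) * ((cmod (v (snd p)))^2 / u (snd p)))" .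
 qed
 also have "... = U * (\<Sum>p\<in>F \<times> F. (cmod (v (fst p)))^2 / u (fst p) * ((cmod (v (snd p)))^2 / u (snd p)))"
  unfolding sum_distrib_left[symmetric] M_def fib_def using F by (subst sum.image_gen[of "F \<times> F" _ add]) auto
 also have "... = U * (\<Sum>k\<in>F. (cmod (v k))^2 / u k)^2"
  by (simp add: power2_eq_square sum_product sum.cartesian_product case_prod_beta)
 finally show ?thesis .
qed

lemma exp_le_quadratic: "exp t \<le> 1 + t + t\<^sup>2 / 2 * exp \<bar>t\<bar>" for t :: real
proof -
 obtain s where s: "\<bar>s\<bar> \<le> \<bar>t\<bar>" "exp t = (\<Sum>m<2. (t ^ m) / fact m) + (exp s / fact 2) * t ^ 2"
  using Maclaurin_exp_le[of t 2] by blast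
 have "exp s \<le> exp \<bar>t\<bar>" using s(1) by simp
 then have "exp s * (t\<^sup>2 / 2) \<le> exp \<bar>t\<bar> * (t\<^sup>2 / 2)" by (intro mult_right_mono) auto
 then show ?thesis using s(2) by (simp add: numeral_2_eq_2 lessThan_Suc mult.commute)
qed

definition sub_potential :: "nat \<Rightarrow> nat \<Rightarrow> nat set \<Rightarrow> (nat \<Rightarrow> plane) \<Rightarrow> plane \<Rightarrow> real"
 where "sub_potential n N A x y = (\<Sum>i\<in>A. green_trunc n (x i - y)) / real N"

definition wave_sum :: "nat set \<Rightarrow> (nat \<Rightarrow> plane) \<Rightarrow> freq \<Rightarrow> complex"
 where "wave_sum A x k = (\<Sum>i\<in>A. cis (- phase k (x i)))"

lemma of_real_green_trunc: "complex_of_real (green_trunc n z) = (\<Sum>k\<in>grid n. of_real (lam k) * cis (phase k z))"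
proof -
 let ?A = "\<Sum>k\<in>grid n. lam k * sin (phase k z)"
 have "?A = (\<Sum>k\<in>grid n. lam (- k) * sin (phase (- k) z))"
  by (rule sum_grid_uminus[symmetric])
 then have "?A = 0"
  by (simp add: phase_minus_left sum_negf)
 then show ?thesis by (simp add: complex_eq_iff green_trunc_cos)
qed

lemma of_real_sub_potential:
 "complex_of_real (sub_potential n N A x y) = (\<Sum>k\<in>grid n. (of_real (lam k / real N) * wave_sum A x k) * cis (phase k y))"
proof -
 have "complex_of_real (sub_potential n N A x y)
   = (\<Sum>i\<in>A. \<Sum>k\<in>grid n. of_real (lam k / real N) * cis (phase k (y - x i)))"
  unfolding sub_potential_def of_real_divide of_real_sum
  by (simp add: green_trunc_swap[of n _ y] of_real_green_trunc sum_divide_distrib)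
 also have "... = (\<Sum>k\<in>grid n. \<Sum>i\<in>A. of_real (lam k / real N) * cis (phase k (y - x i)))"
  by (rule sum.swap)
 also have "... = (\<Sum>k\<in>grid n. (of_real (lam k / real N) * wave_sum A x k) * cis (phase k y))"
  unfolding wave_sum_def sum_distrib_left sum_distrib_right
  by (intro sum.cong) (auto simp: phase_diff_right cis_mult mult_ac)
 finally show ?thesis .
qed

lemma continuous_sub_potential: "continuous_on UNIV (sub_potential n N A x)"
 unfolding sub_potential_def divide_inverse
 by (intro continuous_intros continuous_on_compose2[OF continuous_green_trunc]) auto

lemma periodic_sub_potential: "periodic (sub_potential n N A x)"
proof -
 have "green_trunc n (x i - (a + 1, b)) = green_trunc n (x i - (a, b))"
  "green_trunc n (x i - (a, b + 1)) = green_trunc n (x i - (a, b))" for i a b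
  using periodic_int[OF periodic_green_trunc, of n "fst (x i) - a" "-1" "snd (x i) - b" 0]
   periodic_int[OF periodic_green_trunc, of n "fst (x i) - a" 0 "snd (x i) - b" "-1"]
  by (cases "x i"; simp add: algebra_simps)+
 then show ?thesis by (simp add: periodic_def sub_potential_def)
qed

lemma integral_green_trunc: "(\<integral>z. green_trunc n z \<partial>\<T>) = 0"
 unfolding green_trunc_def by (simp add: integral_cas if_distrib[of "\<lambda>x. _ * x"] cong: if_cong)

lemma integrable_green_trunc: "integrable \<T> (green_trunc n)"
 by (intro integrable_periodic_continuous periodic_green_trunc continuous_green_trunc)

lemma integral_sub_potential: "(\<integral>y. sub_potential n N A x y \<partial>\<T>) = 0"
proof -
 have "integrable \<T> (\<lambda>y. green_trunc n (x i - y))" for i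
  using periodic_sub_potential[of n 1 "{i}" x] continuous_sub_potential[of n 1 "{i}" x]
  by (intro integrable_periodic_continuous) (auto simp: sub_potential_def[abs_def])
 then show ?thesis
  by (simp add: sub_potential_def integral_torus_reflect[OF periodic_green_trunc] integral_green_trunc)
qed

text \<open>Jensen's inequality for the average over all N indices; an index outside A has exponent
  0 and contributes 1.\<close>

lemma exp_abs_sub_potential_le:
 assumes A: "A \<subseteq> {..<N}" and N: "0 < N"
 shows "exp \<bar>sub_potential n N A x y\<bar> \<le> (\<Sum>i<N. 1 / real N * (if i \<in> A then exp \<bar>green_trunc n (x i - y)\<bar> else 1))"
proof -
 let ?A = "\<Sum>i\<in>A. \<bar>green_trunc n (x i - y)\<bar>"
 define b where "b i = (if i \<in> A then \<bar>green_trunc n (x i - y)\<bar> else 0)" for i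
 have "\<bar>sub_potential n N A x y\<bar> \<le> ?A / real N"
  unfolding sub_potential_def by (simp add: divide_right_mono sum_abs)
 also have "... = (\<Sum>i<N. 1 / real N * b i)"
 proof -
  have "(\<Sum>i<N. b i) = (\<Sum>i\<in>A. b i)" using A by (intro sum.mono_neutral_right) (auto simp: b_def)
  also have "... = ?A" by (intro sum.cong) (auto simp: b_def)
  finally have eq: "?A = (\<Sum>i<N. b i)" ..
  show ?thesis unfolding eq by (simp add: sum_divide_distrib)
 qed
 finally have "exp \<bar>sub_potential n N A x y\<bar> \<le> exp (\<Sum>i<N. (1 / real N) *\<^sub>R b i)" by simp
 also have "... \<le> (\<Sum>i<N. 1 / real N * exp (b i))"
  using N by (intro convex_on_sum[OF _ _ exp_convex]) auto
 also have "... = (\<Sum>i<N. 1 / real N * (if i \<in> A then exp \<bar>green_trunc n (x i - y)\<bar> else 1))"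
  by (intro sum.cong) (auto simp: b_def)
 finally show ?thesis .
qed

lemma nn_integral_exp_abs_sub_potential_le:
 assumes A: "A \<subseteq> {..<N}" and N: "0 < N"
 shows "(\<integral>\<^sup>+y. ennreal (exp \<bar>sub_potential n N A x y\<bar>) \<partial>\<T>) \<le> ennreal (4 * exp 2)"
proof -
 define E where "E = (\<lambda>z. ennreal (exp \<bar>green_trunc n z\<bar>))"
 have Em [measurable]: "E \<in> borel_measurable borel" unfolding E_def by measurable
 have per: "periodic E" using periodic_green_trunc[of n] by (simp add: periodic_def E_def)
 have "(\<integral>\<^sup>+y. ennreal (exp \<bar>sub_potential n N A x y\<bar>) \<partial>\<T>)
   \<le> (\<integral>\<^sup>+y. (\<Sum>i<N. ennreal (1 / real N) * (if i \<in> A then E (x i - y) else 1)) \<partial>\<T>)"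
 proof (rule nn_integral_mono)
  fix y
  have "ennreal (exp \<bar>sub_potential n N A x y\<bar>) \<le> ennreal (\<Sum>i<N. 1 / real N * (if i \<in> A then exp \<bar>green_trunc n (x i - y)\<bar> else 1))"
   by (intro ennreal_leI exp_abs_sub_potential_le A N)
  also have "... = (\<Sum>i<N. ennreal (1 / real N) * (if i \<in> A then E (x i - y) else 1))"
  proof -
   have "ennreal (1 / real N * (if i \<in> A then exp \<bar>green_trunc n (x i - y)\<bar> else 1))
     = ennreal (1 / real N) * (if i \<in> A then E (x i - y) else 1)" for i
    by (auto simp: E_def ennreal_mult[symmetric])
   then show ?thesis by (subst sum_ennreal[symmetric]) auto
  qed
  finally show "ennreal (exp \<bar>sub_potential n N A x y\<bar>) \<le> (\<Sum>i<N. ennreal (1 / real N) * (if i \<in> A then E (x i - y) else 1))" .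
 qed
 also have "... = (\<Sum>i<N. ennreal (1 / real N) * (\<integral>\<^sup>+y. (if i \<in> A then E (x i - y) else 1) \<partial>\<T>))"
  by (subst nn_integral_sum) (auto intro!: sum.cong nn_integral_cmult)
 also have "... \<le> (\<Sum>i<N. ennreal (1 / real N) * ennreal (4 * exp 2))"
 proof (intro sum_mono mult_left_mono)
  fix i
  have "1 \<le> ennreal (4 * exp 2)"
   using exp_ge_add_one_self[of 2] by (simp add: ennreal_leI flip: ennreal_1)
  moreover have "(\<integral>\<^sup>+y. E (x i - y) \<partial>\<T>) \<le> ennreal (4 * exp 2)"
   unfolding nn_integral_torus_reflect[OF per Em] unfolding E_def by (rule nn_integral_exp_green_trunc_le)
  ultimately show "(\<integral>\<^sup>+y. (if i \<in> A then E (x i - y) else 1) \<partial>\<T>) \<le> ennreal (4 * exp 2)"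
   using torus.emeasure_space_1 by (cases "i \<in> A") auto
 qed simp
 also have "... = (\<Sum>i<N. ennreal (1 / real N * (4 * exp 2)))"
  by (intro sum.cong refl ennreal_mult[symmetric]) auto
 also have "... = ennreal (\<Sum>i<N. 1 / real N * (4 * exp 2))"
  by (rule sum_ennreal) simp
 also have "(\<Sum>i<N. 1 / real N * (4 * exp 2)) = 4 * exp (2::real)" using N by simp
 finally show ?thesis .
qed

section \<open>Weights and constants for the quadratic form in the wave sums\<close>

text \<open>With wt = sqw^(-p), both wt^2 and lam^2 / wt have to be summable, that is 2 p > 1 and 2
  - p > 1; 3/4 is the midpoint of the interval of possible p.\<close>

definition wt :: "freq \<Rightarrow> real"
 where "wt k = sqw k powr (- 3 / 4)"

lemma wt_pos: "0 < wt k"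
 using sqw_pos[of k] by (simp add: wt_def)

lemma sqw_powr_le:
 assumes "0 < s"
 shows "sqw k powr - s \<le> ((1 + (of_int (fst k))^2) * (1 + (of_int (snd k))^2)) powr - (s / 2)"
proof -
 have "((sqw k)^2) powr - (s / 2) \<le> ((1 + (of_int (fst k))^2) * (1 + (of_int (snd k))^2)) powr - (s / 2)"
  using assms sqw_square_ge[of k] by (intro powr_mono2') (auto intro!: mult_pos_pos add_pos_nonneg)
 moreover have "((sqw k)^2) powr - (s / 2) = sqw k powr - s"
 proof -
  have "(sqw k)^2 = sqw k powr 2" using sqw_pos[of k] by (simp add: powr_numeral)
  then show ?thesis by (simp add: powr_powr)
 qed
 ultimately show ?thesis by simp
qed

lemma summable_on_sqw_powr:
 assumes "1 < s"
 shows "(\<lambda>k. sqw k powr - s) summable_on UNIV"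
 by (rule summable_on_comparison_test[OF summable_on_lattice_powr[of "s / 2"]])
   (use assms sqw_powr_le[of s] in auto)

lemma summable_on_wt_square: "(\<lambda>k. (wt k)^2) summable_on UNIV"
proof -
 have "(wt k)^2 = sqw k powr - (3 / 2)" for k
 proof -
  have "(wt k)^2 = wt k powr 2" using wt_pos[of k] by (simp add: powr_numeral)
  then show ?thesis by (simp add: wt_def powr_powr)
 qed
 then show ?thesis using summable_on_sqw_powr[of "3 / 2"] by simp
qed

lemma summable_on_lam_square_wt: "(\<lambda>k. (lam k)^2 / wt k) summable_on UNIV"
proof (rule summable_on_comparison_test[OF summable_on_sqw_powr[of "5 / 4"]])
 fix k :: "freq"
 have "(lam k)^2 \<le> (1 / sqw k)^2" by (intro power_mono lam_le) simp
 also have "... = sqw k powr - 2"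
  using sqw_pos[of k] by (simp add: powr_minus powr_numeral power_divide inverse_eq_divide)
 finally have "(lam k)^2 / wt k \<le> sqw k powr - 2 / wt k"
  using wt_pos[of k] by (intro divide_right_mono) auto
 also have "... = sqw k powr - (5 / 4)"
  by (simp add: wt_def powr_diff[symmetric])
 finally show "(lam k)^2 / wt k \<le> sqw k powr - (5 / 4)" .
qed (use wt_pos in \<open>auto intro!: divide_nonneg_pos\<close>)

lemma sum_le_infsum:
 fixes f :: "'a \<Rightarrow> real"
 assumes "f summable_on UNIV" "\<And>k. 0 \<le> f k" "finite J"
 shows "sum f J \<le> infsum f UNIV"
 using assms by (intro finite_sum_le_infsum) auto

definition U_const :: real where "U_const = (\<Sum>\<^sub>\<infinity>k. (wt k)^2)"
text \<open>The summand 1 makes the constant positive, so that it can be divided by.\<close>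

definition W_const :: real where "W_const = (\<Sum>\<^sub>\<infinity>k. (lam k)^2 / wt k) + 1"

lemma U_const_ge: "(\<Sum>k\<in>grid n. (wt k)^2) \<le> U_const"
 unfolding U_const_def by (intro sum_le_infsum summable_on_wt_square) auto

lemma U_const_nonneg: "0 \<le> U_const"
 using order.trans[OF _ U_const_ge[of 0]] by (simp add: sum_nonneg)

lemma W_const_ge: "(\<Sum>k\<in>grid n. (lam k)^2 / wt k) \<le> W_const"
 unfolding W_const_def using wt_pos sum_le_infsum[OF summable_on_lam_square_wt _ finite_grid[of n]]
 by (smt (verit) divide_nonneg_pos zero_le_power2)

lemma W_const_pos: "0 < W_const"
 unfolding W_const_def using wt_pos infsum_nonneg[of UNIV "\<lambda>k. (lam k)^2 / wt k"]
 by (smt (verit) divide_nonneg_pos zero_le_power2)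

text \<open>The linear term of the expansion integrates to zero, so only the quadratic remainder
  counts. Cauchy-Schwarz separates the fourth moment of the potential, which
  \<open>integral_trig_sum_fourth_power_le\<close> turns into a quadratic form in the wave sums,
  from an exponential moment, which is at most 4 * exp 2 because 2 * c \<le> 1.\<close>

lemma integral_exp_sub_potential_le:
 assumes A: "A \<subseteq> {..<N}" and N: "0 < N" and c: "0 \<le> c" "c \<le> 1 / 2"
 shows "(\<integral>y. exp (c * sub_potential n N A x y) \<partial>\<T>)
  \<le> exp (c\<^sup>2 * exp 1 * sqrt U_const * (\<Sum>k\<in>grid n. (lam k)^2 / wt k * (cmod (wave_sum A x k))^2) / (real N)^2)"
proof -
 let ?A = "\<Sum>k\<in>grid n. (lam k)^2 / wt k * (cmod (wave_sum A x k))^2"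
 let ?B = "\<Sum>k\<in>grid n. (cmod (of_real (lam k / real N) * wave_sum A x k))^2 / wt k"
 define V where "V = sub_potential n N A x"
 have per: "periodic V" and cont: "continuous_on UNIV V"
  by (auto simp: V_def periodic_sub_potential continuous_sub_potential)
 have Vm [measurable]: "V \<in> borel_measurable borel" by (rule borel_measurable_continuous_onI[OF cont])
 have int: "integrable \<T> (\<lambda>y. h (V y))" if "continuous_on UNIV h" for h :: "real \<Rightarrow> real"
  using per by (intro integrable_periodic_continuous continuous_on_compose2[OF that cont]) (auto simp: periodic_def)
 have "(\<integral>y. exp (c * V y) \<partial>\<T>) \<le> (\<integral>y. 1 + c * V y + c\<^sup>2 / 2 * ((V y)^2 * exp (c * \<bar>V y\<bar>)) \<partial>\<T>)"
 proof (rule integral_mono)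
  show "exp (c * V y) \<le> 1 + c * V y + c\<^sup>2 / 2 * ((V y)^2 * exp (c * \<bar>V y\<bar>))" for y
   using exp_le_quadratic[of "c * V y"] c by (simp add: abs_mult power_mult_distrib)
 qed (intro int continuous_intros)+
 also have "... = 1 + c\<^sup>2 / 2 * (\<integral>y. (V y)^2 * exp (c * \<bar>V y\<bar>) \<partial>\<T>)"
 proof -
  have "integrable \<T> V" using int[of "\<lambda>t. t"] by (simp add: continuous_on_id)
  moreover have "integrable \<T> (\<lambda>y. (V y)^2 * exp (c * \<bar>V y\<bar>))"
   by (rule int[of "\<lambda>t. t\<^sup>2 * exp (c * \<bar>t\<bar>)"]) (intro continuous_intros)
  moreover have "(\<integral>y. V y \<partial>\<T>) = 0" unfolding V_def by (rule integral_sub_potential)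
  ultimately show ?thesis using torus.prob_space by simp
 qed
 also have "... \<le> 1 + c\<^sup>2 / 2 * (sqrt (\<integral>y. (V y) ^ 4 \<partial>\<T>) * (2 * exp 1))"
 proof (intro add_left_mono mult_left_mono)
  have "(\<integral>y. (V y)^2 * exp (c * \<bar>V y\<bar>) \<partial>\<T>) = (\<integral>y. \<bar>(V y)\<^sup>2 * exp (c * \<bar>V y\<bar>)\<bar> \<partial>\<T>)"
   by (simp add: abs_mult)
  also have "... \<le> sqrt (\<integral>y. ((V y)^2)^2 \<partial>\<T>) * sqrt (\<integral>y. (exp (c * \<bar>V y\<bar>))^2 \<partial>\<T>)"
   by (rule Cauchy_Schwarz_integral) ((measurable; fail) | rule int[of "\<lambda>t. (t\<^sup>2)^2"] int[of "\<lambda>t. (exp (c * \<bar>t\<bar>))^2"], intro continuous_intros)+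
  also have "... \<le> sqrt (\<integral>y. ((V y)^2)^2 \<partial>\<T>) * (2 * exp 1)"
  proof (rule mult_left_mono)
   have "(\<integral>y. (exp (c * \<bar>V y\<bar>))^2 \<partial>\<T>) \<le> (\<integral>y. exp \<bar>V y\<bar> \<partial>\<T>)"
   proof (rule integral_mono)
    fix y
    have "2 * (c * \<bar>V y\<bar>) \<le> 1 * \<bar>V y\<bar>" using c mult_right_mono[of "2 * c" 1 "\<bar>V y\<bar>"] by simp
    then show "(exp (c * \<bar>V y\<bar>))^2 \<le> exp \<bar>V y\<bar>" by (simp add: exp_double[symmetric])
   qed (intro int continuous_intros)+
   also have "... \<le> 4 * exp 2"
   proof -
    have "ennreal (\<integral>y. exp \<bar>V y\<bar> \<partial>\<T>) = (\<integral>\<^sup>+y. ennreal (exp \<bar>V y\<bar>) \<partial>\<T>)"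
     by (rule nn_integral_eq_integral[symmetric]) (auto intro!: int[of "\<lambda>t. exp \<bar>t\<bar>"] continuous_intros)
    also have "... \<le> ennreal (4 * exp 2)"
     unfolding V_def by (rule nn_integral_exp_abs_sub_potential_le[OF A N])
    finally show ?thesis by (simp add: ennreal_le_iff)
   qed
   also have "... = (2 * exp 1)^2" by (simp add: power_mult_distrib exp_double[symmetric])
   finally show "sqrt (\<integral>y. (exp (c * \<bar>V y\<bar>))^2 \<partial>\<T>) \<le> 2 * exp 1"
    by (intro real_le_lsqrt) auto
  qed simp
  finally show "(\<integral>y. (V y)^2 * exp (c * \<bar>V y\<bar>) \<partial>\<T>) \<le> sqrt (\<integral>y. (V y) ^ 4 \<partial>\<T>) * (2 * exp 1)"
   by (simp add: power_mult[symmetric])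
 qed simp
 also have "... \<le> 1 + c\<^sup>2 / 2 * (sqrt U_const * ?A / (real N)^2 * (2 * exp 1))"
 proof (intro add_left_mono mult_left_mono mult_right_mono)
  have "(\<integral>y. (V y) ^ 4 \<partial>\<T>)
    = (\<integral>y. (cmod (\<Sum>k\<in>grid n. (of_real (lam k / real N) * wave_sum A x k) * cis (phase k y))) ^ 4 \<partial>\<T>)"
   unfolding of_real_sub_potential[symmetric] V_def by (simp add: power_even_abs)
  also have "... \<le> U_const * ?B^2"
   by (intro integral_trig_sum_fourth_power_le wt_pos U_const_ge) simp
  also have "?B
    = ?A / (real N)^2"
   unfolding sum_divide_distrib by (intro sum.cong) (auto simp: norm_mult norm_divide power_mult_distrib power_divide)
  finally have "sqrt (\<integral>y. (V y) ^ 4 \<partial>\<T>)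
    \<le> sqrt (U_const * (?A / (real N)^2)^2)"
   by simp
  also have "... = sqrt U_const * ?A / (real N)^2"
   using wt_pos by (simp add: real_sqrt_mult abs_of_nonneg sum_nonneg less_imp_le)
  finally show "sqrt (\<integral>y. (V y) ^ 4 \<partial>\<T>)
    \<le> sqrt U_const * ?A / (real N)^2" .
 qed auto
 also have "... = 1 + c\<^sup>2 * exp 1 * sqrt U_const * ?A / (real N)^2"
  by simp
 also have "... \<le> exp (c\<^sup>2 * exp 1 * sqrt U_const * ?A / (real N)^2)"
  by (rule exp_ge_add_one_self)
 finally show ?thesis by (simp add: V_def)
qed


section \<open>Exponential moments of the wave sums\<close>

text \<open>Hoeffding's lemma for positive s, extended to negative s by reflecting f.\<close>

lemma nn_integral_exp_bounded_le:
 fixes f :: "plane \<Rightarrow> real"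
 assumes [measurable]: "f \<in> borel_measurable borel" and b: "\<And>z. \<bar>f z\<bar> \<le> 1"
  and 0: "(\<integral>z. f z \<partial>\<T>) = 0"
 shows "(\<integral>\<^sup>+z. ennreal (exp (s * f z)) \<partial>\<T>) \<le> ennreal (exp (s\<^sup>2 / 2))"
proof -
 have pos: "(\<integral>\<^sup>+z. ennreal (exp (s * f z)) \<partial>\<T>) \<le> ennreal (exp (s\<^sup>2 / 2))"
  if "s > 0" and [measurable]: "f \<in> borel_measurable borel" and b: "\<And>z. \<bar>f z\<bar> \<le> 1"
   and "(\<integral>z. f z \<partial>\<T>) = 0" for f s
 proof -
  interpret interval_bounded_random_variable \<T> f "-1" 1
  proof
   have "f z \<in> {-1..1}" for z using b[of z] by (auto simp: abs_le_iff)
   then show "AE z in \<T>. f z \<in> {-1..1}" by simp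
  qed simp
  show ?thesis using Hoeffdings_lemma_nn_integral_0[OF that(1) that(4)] by (simp add: power2_eq_square)
 qed
 consider "s > 0" | "s = 0" | "s < 0" by linarith
 then show ?thesis
 proof cases
  case 1
  then show ?thesis using pos[of s f] b 0 by simp
 next
  case 2
  then show ?thesis using torus.emeasure_space_1 by simp
 next
  case 3
  then show ?thesis using pos[of "- s" "\<lambda>z. - f z"] b 0 by simp
 qed
qed

interpretation torus_product: product_prob_space "\<lambda>_. \<T>" I for I :: "nat set"
 by unfold_locales

lemma measurable_torus_component:
 "i \<in> I \<Longrightarrow> (\<lambda>x. x i) \<in> borel_measurable (\<P> I)"
 using measurable_component_singleton[of i I "\<lambda>_. \<T>"]
 by (simp add: measurable_cong_sets[OF refl sets_torus_measure])

lemma measurable_pair_difference: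
 assumes "g \<in> borel_measurable borel" "i \<in> I" "j \<in> I"
 shows "(\<lambda>x. g (x i - x j)) \<in> borel_measurable (\<P> I)"
 by (rule measurable_compose[OF borel_measurable_diff[OF measurable_torus_component[OF assms(2)] measurable_torus_component[OF assms(3)]] assms(1)])

lemma std_normal_exp_square:
 "(\<integral>\<^sup>+g. ennreal (std_normal_density g) * ennreal (exp (g\<^sup>2 / 4)) \<partial>lborel) = ennreal (sqrt 2)"
proof -
 let ?A = "\<integral>\<^sup>+g. ennreal (normal_density 0 (sqrt 2) g) \<partial>lborel"
 have eq: "std_normal_density g * exp (g\<^sup>2 / 4) = sqrt 2 * normal_density 0 (sqrt 2) g" for g
 proof -
  have "exp (- g\<^sup>2 / 2) * exp (g\<^sup>2 / 4) = exp (- g\<^sup>2 / 4)" by (simp add: exp_add[symmetric] field_simps)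
  then show ?thesis by (simp add: normal_density_def real_sqrt_mult field_simps)
 qed
 have "(\<integral>\<^sup>+g. ennreal (std_normal_density g) * ennreal (exp (g\<^sup>2 / 4)) \<partial>lborel)
   = (\<integral>\<^sup>+g. ennreal (sqrt 2) * ennreal (normal_density 0 (sqrt 2) g) \<partial>lborel)"
  by (simp add: ennreal_mult'[symmetric] eq)
 also have "... = ennreal (sqrt 2) * ?A"
  by (rule nn_integral_cmult) auto
 also have "?A = 1"
  by (subst nn_integral_eq_integral) auto
 finally show ?thesis by simp
qed

lemma std_normal_mgf:
 "(\<integral>\<^sup>+g. ennreal (std_normal_density g) * ennreal (exp (s * g)) \<partial>lborel) = ennreal (exp (s\<^sup>2 / 2))"
proof -
 let ?A = "\<integral>\<^sup>+g. ennreal (normal_density s 1 g) \<partial>lborel"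
 have eq: "std_normal_density g * exp (s * g) = exp (s\<^sup>2 / 2) * normal_density s 1 g" for g
 proof -
  have "exp (- g\<^sup>2 / 2) * exp (s * g) = exp (s\<^sup>2 / 2) * exp (- (g - s)\<^sup>2 / 2)"
   by (simp add: exp_add[symmetric] power2_eq_square field_simps)
  then show ?thesis by (simp add: normal_density_def field_simps)
 qed
 have "(\<integral>\<^sup>+g. ennreal (std_normal_density g) * ennreal (exp (s * g)) \<partial>lborel)
   = (\<integral>\<^sup>+g. ennreal (exp (s\<^sup>2 / 2)) * ennreal (normal_density s 1 g) \<partial>lborel)"
  by (simp add: ennreal_mult'[symmetric] eq)
 also have "... = ennreal (exp (s\<^sup>2 / 2)) * ?A"
  by (rule nn_integral_cmult) auto
 also have "?A = 1"
  by (subst nn_integral_eq_integral) auto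
 finally show ?thesis by simp
qed

text \<open>Gaussian linearisation: \<open>exp (t\<^sup>2 / 4)\<close> is an average of exponentials of \<open>t\<close>, and those
 factorise over the independent positions.\<close>

lemma nn_integral_exp_square_sum_le:
 fixes f :: "plane \<Rightarrow> real"
 assumes [measurable]: "f \<in> borel_measurable borel" and b: "\<And>z. \<bar>f z\<bar> \<le> 1"
  and 0: "(\<integral>z. f z \<partial>\<T>) = 0" and A: "A \<subseteq> {..<N}" and N: "0 < N"
 shows "(\<integral>\<^sup>+x. ennreal (exp ((\<Sum>i\<in>A. f (x i))^2 / (4 * real N))) \<partial>(\<P> A)) \<le> ennreal (sqrt 2)"
proof -
 have finA: "finite A" using A finite_subset by blast
 interpret finite_product_prob_space "\<lambda>_. \<T>" A
  by unfold_locales (rule finA)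
 interpret pair_sigma_finite lborel "\<Pi>\<^sub>M i\<in>A. \<T>" ..
 define P where "P = (\<P> A)"
 have [measurable]: "(\<lambda>x. f (x i)) \<in> borel_measurable P" if "i \<in> A" for i
  unfolding P_def using that by measurable
 have Sm [measurable]: "(\<lambda>x. \<Sum>i\<in>A. f (x i)) \<in> borel_measurable P"
  by (rule borel_measurable_sum) measurable
 have "(\<integral>\<^sup>+x. ennreal (exp ((\<Sum>i\<in>A. f (x i))^2 / (4 * real N))) \<partial>P)
   = (\<integral>\<^sup>+x. \<integral>\<^sup>+g. ennreal (std_normal_density g) * ennreal (exp ((\<Sum>i\<in>A. f (x i)) / sqrt (2 * real N) * g)) \<partial>lborel \<partial>P)"
  unfolding std_normal_mgf using N by (simp add: power_divide)
 also have "... = (\<integral>\<^sup>+g. \<integral>\<^sup>+x. ennreal (std_normal_density g) * ennreal (exp ((\<Sum>i\<in>A. f (x i)) / sqrt (2 * real N) * g)) \<partial>P \<partial>lborel)"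
 proof -
  have [measurable]: "(\<lambda>p. \<Sum>i\<in>A. f (snd p i)) \<in> borel_measurable (lborel \<Otimes>\<^sub>M P)"
   by (rule measurable_compose[OF measurable_snd Sm])
  have "(\<lambda>p. ennreal (std_normal_density (fst p)) * ennreal (exp ((\<Sum>i\<in>A. f (snd p i)) / sqrt (2 * real N) * fst p)))
    \<in> borel_measurable (lborel \<Otimes>\<^sub>M P)"
   by measurable
  then show ?thesis unfolding P_def by (intro Fubini') (simp add: case_prod_beta')
 qed
 also have "... \<le> (\<integral>\<^sup>+g. ennreal (std_normal_density g) * ennreal (exp (g\<^sup>2 / 4)) \<partial>lborel)"
 proof (rule nn_integral_mono)
  fix g :: real
  \<comment> \<open>Scaled so that at most N exponents s^2 / 2 add up to at most g^2 / 4, half of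
    the exponent in the Gaussian weight, whose integral therefore stays finite.\<close>
  define s where "s = g / sqrt (2 * real N)"
  have "(\<integral>\<^sup>+x. ennreal (exp ((\<Sum>i\<in>A. f (x i)) / sqrt (2 * real N) * g)) \<partial>P)
    = (\<integral>\<^sup>+x. (\<Prod>i\<in>A. ennreal (exp (s * f (x i)))) \<partial>P)"
   using finA by (intro nn_integral_cong) (simp add: prod_ennreal exp_sum[symmetric] s_def sum_divide_distrib sum_distrib_left sum_distrib_right mult.commute)
  also have "... = (\<Prod>i\<in>A. \<integral>\<^sup>+z. ennreal (exp (s * f z)) \<partial>\<T>)"
   unfolding P_def using finA by (intro torus_product.product_nn_integral_prod) auto
  also have "... \<le> (\<Prod>i\<in>A. ennreal (exp (s\<^sup>2 / 2)))"
   by (intro prod_mono_ennreal nn_integral_exp_bounded_le b 0) auto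
  also have "... = ennreal (exp (s\<^sup>2 / 2 * real (card A)))"
   by (simp add: ennreal_power exp_of_nat_mult[symmetric] mult.commute)
  also have "... \<le> ennreal (exp (g\<^sup>2 / 4))"
  proof (intro ennreal_leI iffD2[OF exp_le_cancel_iff])
   have "s\<^sup>2 / 2 * real (card A) \<le> s\<^sup>2 / 2 * real N"
    using card_mono[OF _ A] by (intro mult_left_mono) auto
   also have "... = g\<^sup>2 / 4" using N by (simp add: s_def power_divide)
   finally show "s\<^sup>2 / 2 * real (card A) \<le> g\<^sup>2 / 4" .
  qed
  finally have "(\<integral>\<^sup>+x. ennreal (exp ((\<Sum>i\<in>A. f (x i)) / sqrt (2 * real N) * g)) \<partial>P) \<le> ennreal (exp (g\<^sup>2 / 4))" .
  then show "(\<integral>\<^sup>+x. ennreal (std_normal_density g) * ennreal (exp ((\<Sum>i\<in>A. f (x i)) / sqrt (2 * real N) * g)) \<partial>P)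
    \<le> ennreal (std_normal_density g) * ennreal (exp (g\<^sup>2 / 4))"
   by (subst nn_integral_cmult) (auto intro!: mult_left_mono)
 qed
 also have "... = ennreal (sqrt 2)" by (rule std_normal_exp_square)
 finally show ?thesis by (simp add: P_def)
qed

text \<open>Jensen's inequality with the missing mass 1 - \<open>sum p J\<close> placed at the value
  0. The constructor \<open>None\<close> carries it, and it accounts for the summand 1.\<close>

lemma exp_convex_combination_le:
 fixes p a :: "'a \<Rightarrow> real"
 assumes "finite J" and p: "\<And>k. k \<in> J \<Longrightarrow> 0 \<le> p k" and s: "sum p J \<le> 1"
 shows "exp (\<Sum>k\<in>J. p k * a k) \<le> 1 + (\<Sum>k\<in>J. p k * exp (a k))"
proof -
 define q where "q x = (case x of None \<Rightarrow> 1 - sum p J | Some k \<Rightarrow> p k)" for x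
 define b where "b x = (case x of None \<Rightarrow> 0 | Some k \<Rightarrow> a k)" for x
 have sumeq: "(\<Sum>x\<in>insert None (Some ` J). h x) = h None + (\<Sum>k\<in>J. h (Some k))" for h :: "'a option \<Rightarrow> real"
  using assms(1) by (subst sum.insert) (auto simp: sum.reindex)
 have "exp (\<Sum>x\<in>insert None (Some ` J). q x *\<^sub>R b x) \<le> (\<Sum>x\<in>insert None (Some ` J). q x * exp (b x))"
  using assms by (intro convex_on_sum[OF _ _ exp_convex]) (auto simp: sumeq q_def)
 then have "exp (\<Sum>k\<in>J. p k * a k) \<le> (1 - sum p J) + (\<Sum>k\<in>J. p k * exp (a k))"
  unfolding sumeq by (simp add: q_def b_def)
 also have "... \<le> 1 + (\<Sum>k\<in>J. p k * exp (a k))" using sum_nonneg[of J p] p by simp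
 finally show ?thesis .
qed

text \<open>The squared modulus splits into the squares of a cosine sum and a sine sum. Midpoint
  convexity separates them at the price of doubling 4 * N to 8 * N.\<close>

lemma nn_integral_exp_wave_sum_le:
 assumes k: "k \<noteq> 0" and A: "A \<subseteq> {..<N}" and N: "0 < N"
 shows "(\<integral>\<^sup>+x. ennreal (exp ((cmod (wave_sum A x k))^2 / (8 * real N))) \<partial>(\<P> A)) \<le> ennreal (sqrt 2)"
proof -
 define C where "C x = (\<Sum>i\<in>A. cos (phase k (x i)))" for x
 define S where "S x = (\<Sum>i\<in>A. sin (phase k (x i)))" for x
 define P where "P = (\<P> A)"
 have [measurable]: "(\<lambda>x. cos (phase k (x i))) \<in> borel_measurable P" "(\<lambda>x. sin (phase k (x i))) \<in> borel_measurable P" if "i \<in> A" for i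
  unfolding P_def using that by measurable
 have Cm [measurable]: "C \<in> borel_measurable P" "S \<in> borel_measurable P"
  unfolding C_def S_def by (rule borel_measurable_sum; measurable)+
 have norm: "(cmod (wave_sum A x k))^2 = (C x)^2 + (S x)^2" for x
  by (simp add: cmod_power2 wave_sum_def C_def S_def sum_negf)
 have half: "exp ((a + b) / 2) \<le> (exp a + exp b) / 2" for a b :: real
  using convex_onD[OF exp_convex, of "1 / 2" a b] by (simp add: field_simps)
 have "(\<integral>\<^sup>+x. ennreal (exp ((cmod (wave_sum A x k))^2 / (8 * real N))) \<partial>P)
   \<le> (\<integral>\<^sup>+x. ennreal (1 / 2) * (ennreal (exp ((C x)^2 / (4 * real N))) + ennreal (exp ((S x)^2 / (4 * real N)))) \<partial>P)"
 proof (rule nn_integral_mono)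
  fix x
  have "exp ((cmod (wave_sum A x k))^2 / (8 * real N)) = exp (((C x)^2 / (4 * real N) + (S x)^2 / (4 * real N)) / 2)"
   by (simp add: norm add_divide_distrib)
  also have "... \<le> 1 / 2 * (exp ((C x)^2 / (4 * real N)) + exp ((S x)^2 / (4 * real N)))"
   using half[of "(C x)^2 / (4 * real N)" "(S x)^2 / (4 * real N)"] by simp
  finally show "ennreal (exp ((cmod (wave_sum A x k))^2 / (8 * real N)))
    \<le> ennreal (1 / 2) * (ennreal (exp ((C x)^2 / (4 * real N))) + ennreal (exp ((S x)^2 / (4 * real N))))"
   by (subst ennreal_plus[symmetric], simp, simp) (subst ennreal_mult[symmetric], auto intro!: ennreal_leI)
 qed
 also have "... = ennreal (1 / 2) * ((\<integral>\<^sup>+x. ennreal (exp ((C x)^2 / (4 * real N))) \<partial>P) + (\<integral>\<^sup>+x. ennreal (exp ((S x)^2 / (4 * real N))) \<partial>P))"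
  by (subst nn_integral_cmult) (auto simp: nn_integral_add)
 also have "... \<le> ennreal (1 / 2) * (ennreal (sqrt 2) + ennreal (sqrt 2))"
 proof (intro mult_left_mono add_mono)
  show "(\<integral>\<^sup>+x. ennreal (exp ((C x)^2 / (4 * real N))) \<partial>P) \<le> ennreal (sqrt 2)"
   unfolding C_def P_def
   by (rule nn_integral_exp_square_sum_le[OF _ _ _ A N]) (use k in \<open>auto simp: integral_cos_phase\<close>)
  show "(\<integral>\<^sup>+x. ennreal (exp ((S x)^2 / (4 * real N))) \<partial>P) \<le> ennreal (sqrt 2)"
   unfolding S_def P_def
   by (rule nn_integral_exp_square_sum_le[OF _ _ _ A N]) (auto simp: integral_sin_phase)
 qed simp
 also have "... = ennreal (sqrt 2)"
 proof -
  have e: "ennreal (sqrt 2) + ennreal (sqrt 2) = ennreal (sqrt 2 + sqrt 2)"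
   by (rule ennreal_plus[symmetric]) auto
  show ?thesis unfolding e by (subst ennreal_mult[symmetric]) auto
 qed
 finally show ?thesis by (simp add: P_def)
qed

text \<open>Small enough for the exponent of the conditional expectation given one half of the particles
 to be a convex combination of the \<open>\<bar>wave_sum A x k\<bar>\<^sup>2 / (8 N)\<close>, which have exponential moments.\<close>

definition coupling :: real
 where "coupling = min (1 / 2) (1 / sqrt (8 * exp 1 * (sqrt U_const + 1) * W_const))"

lemma coupling_pos: "0 < coupling" and coupling_le: "coupling \<le> 1 / 2"
 and coupling_sq: "coupling\<^sup>2 * exp 1 * sqrt U_const * W_const \<le> 1 / 8"
proof -
 let ?A = "8 * exp 1 * (sqrt U_const + 1) * W_const"
 define D where "D = 8 * exp 1 * (sqrt U_const + 1) * W_const"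
 have D: "0 < D" using W_const_pos U_const_nonneg by (simp add: D_def add_nonneg_pos)
 show "0 < coupling" "coupling \<le> 1 / 2" using D by (simp_all add: coupling_def D_def[symmetric])
 have "coupling\<^sup>2 \<le> (1 / sqrt D)^2"
  using D by (intro power_mono) (auto simp: coupling_def D_def[symmetric])
 also have "... = 1 / D" using D by (simp add: power_divide)
 finally have "coupling\<^sup>2 * D \<le> 1" using D by (simp add: field_simps)
 then have "coupling\<^sup>2 * ?A \<le> 1" unfolding D_def .
 moreover have "coupling\<^sup>2 * (8 * exp 1 * sqrt U_const * W_const) \<le> coupling\<^sup>2 * ?A"
  using W_const_pos by (intro mult_left_mono mult_right_mono) auto
 ultimately show "coupling\<^sup>2 * exp 1 * sqrt U_const * W_const \<le> 1 / 8" by (simp add: mult_ac)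
qed

text \<open>Given the positions in A, the particles of B are independent in the field of A, and the
  inner integral is a product of equal factors. Each is bounded by the exponential of a form of size
  1/N^2; at most N of them leave a form of size 1/N, the scale on which the wave sums have
  exponential moments. The bound 3 majorises 1 + sqrt 2.\<close>

lemma nn_integral_bipartite_le:
 assumes A: "A \<subseteq> {..<N}" and N: "0 < N" and B: "B = {..<N} - A"
 shows "(\<integral>\<^sup>+x. ennreal (exp (coupling / real N * (\<Sum>i\<in>A. \<Sum>j\<in>B. green_trunc n (x i - x j)))) \<partial>particles N)
  \<le> ennreal 3"
proof -
 \<comment> \<open>Weights of total at most 1, and the exponents they combine. The zero frequency
   must be left out of the combination: its wave sum is the number of particles in A and has no
   bounded exponential moment. Its weight is 0, as \<open>lam_0\<close> shows.\<close>
 let ?q = "\<lambda>k. (lam k)^2 / wt k / W_const" and ?s = "\<lambda>x k. (cmod (wave_sum A x k))^2 / (8 * real N)"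
 have fin: "finite A" "finite B" and dis: "A \<inter> B = {}" and un: "{..<N} = A \<union> B"
  using A B finite_subset by auto
 define c where "c = coupling"
 have c: "0 \<le> c" "c \<le> 1 / 2" using coupling_pos coupling_le by (auto simp: c_def)
 define f where "f x = ennreal (exp (c / real N * (\<Sum>i\<in>A. \<Sum>j\<in>B. green_trunc n (x i - x j))))" for x
 have [measurable]: "(\<lambda>x. green_trunc n (x i - x j)) \<in> borel_measurable (\<P> (A \<union> B))" if "i \<in> A" "j \<in> B" for i j
  using that by (intro measurable_pair_difference) auto
 have fm: "f \<in> borel_measurable (\<P> (A \<union> B))"
  unfolding f_def
  by (intro measurable_compose[OF _ measurable_ennreal] borel_measurable_exp[THEN measurable_compose[rotated]] borel_measurable_times borel_measurable_const borel_measurable_sum) measurable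
 have "(\<integral>\<^sup>+x. f x \<partial>particles N)
   = (\<integral>\<^sup>+x. \<integral>\<^sup>+y. f (merge A B (x, y)) \<partial>(\<P> B) \<partial>(\<P> A))"
  unfolding un by (rule torus_product.product_nn_integral_fold[OF dis fin fm])
 also have "... \<le> (\<integral>\<^sup>+x. ennreal 1 + (\<Sum>k\<in>grid n - {0}. ennreal (?q k) * ennreal (exp (?s x k))) \<partial>(\<P> A))"
 proof (rule nn_integral_mono)
  fix x :: "nat \<Rightarrow> plane"
  define R where "R = (\<Sum>k\<in>grid n. (lam k)^2 / wt k * (cmod (wave_sum A x k))^2)"
  let ?b = "c\<^sup>2 * exp 1 * sqrt U_const * R / (real N)^2"
  have R0: "0 \<le> R" unfolding R_def using wt_pos by (intro sum_nonneg mult_nonneg_nonneg divide_nonneg_pos) auto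
  have "(\<integral>\<^sup>+y. f (merge A B (x, y)) \<partial>(\<P> B))
    = (\<integral>\<^sup>+y. (\<Prod>j\<in>B. ennreal (exp (c * sub_potential n N A x (y j)))) \<partial>(\<P> B))"
  proof (rule nn_integral_cong)
   fix y :: "nat \<Rightarrow> plane"
   have "(\<Sum>i\<in>A. \<Sum>j\<in>B. green_trunc n (merge A B (x, y) i - merge A B (x, y) j)) = (\<Sum>i\<in>A. \<Sum>j\<in>B. green_trunc n (x i - y j))"
    using dis by (intro sum.cong refl) (auto simp: merge_def)
   also have "... = (\<Sum>j\<in>B. \<Sum>i\<in>A. green_trunc n (x i - y j))" by (rule sum.swap)
   finally have eq: "(\<Sum>i\<in>A. \<Sum>j\<in>B. green_trunc n (merge A B (x, y) i - merge A B (x, y) j)) = (\<Sum>j\<in>B. \<Sum>i\<in>A. green_trunc n (x i - y j))" .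
   have "c / real N * (\<Sum>i\<in>A. \<Sum>j\<in>B. green_trunc n (merge A B (x, y) i - merge A B (x, y) j))
     = (\<Sum>j\<in>B. c * sub_potential n N A x (y j))"
    unfolding eq by (simp add: sub_potential_def sum_distrib_left sum_divide_distrib)
   then show "f (merge A B (x, y)) = (\<Prod>j\<in>B. ennreal (exp (c * sub_potential n N A x (y j))))"
    using fin by (simp add: f_def exp_sum prod_ennreal)
  qed
  also have "... = (\<Prod>j\<in>B. \<integral>\<^sup>+z. ennreal (exp (c * sub_potential n N A x z)) \<partial>\<T>)"
  proof (rule torus_product.product_nn_integral_prod[OF fin(2)])
   have [measurable]: "sub_potential n N A x \<in> borel_measurable borel"
    by (rule borel_measurable_continuous_onI[OF continuous_sub_potential])
   show "(\<lambda>z. ennreal (exp (c * sub_potential n N A x z))) \<in> borel_measurable \<T>" by simp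
  qed
  also have "... \<le> (\<Prod>j\<in>B. ennreal (exp ?b))"
  proof (rule prod_mono_ennreal)
   have "integrable \<T> (\<lambda>z. exp (c * sub_potential n N A x z))"
    using periodic_sub_potential[of n N A x]
    by (intro integrable_periodic_continuous continuous_intros continuous_sub_potential) (auto simp: periodic_def)
   then have "(\<integral>\<^sup>+z. ennreal (exp (c * sub_potential n N A x z)) \<partial>\<T>)
     = ennreal (\<integral>z. exp (c * sub_potential n N A x z) \<partial>\<T>)"
    by (rule nn_integral_eq_integral) simp
   then show "(\<integral>\<^sup>+z. ennreal (exp (c * sub_potential n N A x z)) \<partial>\<T>)
     \<le> ennreal (exp ?b)"
    using integral_exp_sub_potential_le[OF A N c, of n x] by (simp add: R_def ennreal_leI)
  qed
  also have "... = ennreal (exp (real (card B) * ?b))"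
   by (simp only: prod_constant ennreal_power exp_ge_zero exp_of_nat_mult)
  also have "... \<le> ennreal (exp (\<Sum>k\<in>grid n - {0}. ?q k * ?s x k))"
  proof (intro ennreal_leI iffD2[OF exp_le_cancel_iff])
   have "card B \<le> N" using card_mono[of "{..<N}" B] B by auto
   then have "real (card B) * ?b \<le> real N * ?b"
    using R0 U_const_nonneg by (intro mult_right_mono) auto
   also have "... = (c\<^sup>2 * exp 1 * sqrt U_const * W_const) * (R / (W_const * real N))"
    using N W_const_pos by (simp add: field_simps power2_eq_square)
   also have "... \<le> 1 / 8 * (R / (W_const * real N))"
    using coupling_sq R0 W_const_pos unfolding c_def by (intro mult_right_mono) auto
   also have "... = (\<Sum>k\<in>grid n. ?q k * ?s x k)"
    unfolding R_def by (simp add: sum_divide_distrib sum_distrib_left mult_ac)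
   also have "... = (\<Sum>k\<in>grid n - {0}. ?q k * ?s x k)"
    by (rule sum.mono_neutral_right) auto
   finally show "real (card B) * ?b
     \<le> (\<Sum>k\<in>grid n - {0}. ?q k * ?s x k)" .
  qed
  also have "... \<le> ennreal (1 + (\<Sum>k\<in>grid n - {0}. ?q k * exp (?s x k)))"
  proof (intro ennreal_leI exp_convex_combination_le)
   show "0 \<le> ?q k" for k using wt_pos[of k] W_const_pos by simp
   have "(\<Sum>k\<in>grid n - {0}. (lam k)^2 / wt k) \<le> (\<Sum>k\<in>grid n. (lam k)^2 / wt k)"
    using wt_pos by (intro sum_mono2) (auto intro!: divide_nonneg_pos)
   also have "... \<le> W_const" by (rule W_const_ge)
   finally show "(\<Sum>k\<in>grid n - {0}. ?q k) \<le> 1"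
    unfolding sum_divide_distrib[symmetric] using W_const_pos by simp
  qed simp
  also have "... = ennreal 1 + (\<Sum>k\<in>grid n - {0}. ennreal (?q k) * ennreal (exp (?s x k)))"
  proof -
   have nn: "0 \<le> ?q k" for k using wt_pos[of k] W_const_pos by simp
   have "ennreal (1 + (\<Sum>k\<in>grid n - {0}. ?q k * exp (?s x k)))
     = ennreal 1 + ennreal (\<Sum>k\<in>grid n - {0}. ?q k * exp (?s x k))"
    by (intro ennreal_plus sum_nonneg mult_nonneg_nonneg nn exp_ge_zero zero_le_one)
   also have "ennreal (\<Sum>k\<in>grid n - {0}. ?q k * exp (?s x k))
     = (\<Sum>k\<in>grid n - {0}. ennreal (?q k * exp (?s x k)))"
    by (intro sum_ennreal[symmetric] mult_nonneg_nonneg nn exp_ge_zero)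
   finally show ?thesis using nn by (simp only: ennreal_mult exp_ge_zero)
  qed
  finally show "(\<integral>\<^sup>+y. f (merge A B (x, y)) \<partial>(\<P> B))
    \<le> ennreal 1 + (\<Sum>k\<in>grid n - {0}. ennreal (?q k) * ennreal (exp (?s x k)))" .
 qed
 also have "... = 1 + (\<Sum>k\<in>grid n - {0}. ennreal (?q k) * (\<integral>\<^sup>+x. ennreal (exp (?s x k)) \<partial>(\<P> A)))"
 proof -
  have [measurable]: "(\<lambda>x. cmod (wave_sum A x k)) \<in> borel_measurable (\<P> A)" for k
  proof -
   have "(\<lambda>x. cis (- phase k (x i))) \<in> borel_measurable (\<P> A)" if "i \<in> A" for i
   proof -
    have 1: "(\<lambda>z. cis (- phase k z)) \<in> borel_measurable borel"
     by (intro borel_measurable_continuous_onI continuous_intros)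
    show ?thesis by (rule measurable_compose[OF measurable_torus_component[OF that] 1])
   qed
   then show ?thesis unfolding wave_sum_def by (intro measurable_compose[OF borel_measurable_sum borel_measurable_norm])
  qed
  have "emeasure (\<P> A) (space (\<P> A)) = 1"
   by (rule prob_space.emeasure_space_1[OF prob_space_PiM[OF torus.prob_space_axioms]])
  then show ?thesis
   by (subst nn_integral_add) (auto simp: nn_integral_sum nn_integral_cmult)
 qed
 also have "... \<le> 1 + (\<Sum>k\<in>grid n - {0}. ennreal (?q k) * ennreal (sqrt 2))"
  by (intro add_left_mono sum_mono mult_left_mono nn_integral_exp_wave_sum_le A N) auto
 also have "... = 1 + ennreal ((\<Sum>k\<in>grid n - {0}. ?q k) * sqrt 2)"
 proof -
  have nn: "0 \<le> ?q k" for k using wt_pos[of k] W_const_pos by simp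
  have "ennreal ((\<Sum>k\<in>grid n - {0}. ?q k) * sqrt 2)
    = (\<Sum>k\<in>grid n - {0}. ennreal (?q k * sqrt 2))"
   unfolding sum_distrib_right by (intro sum_ennreal[symmetric] mult_nonneg_nonneg nn) simp
  moreover have "ennreal (?q k * sqrt 2) = ennreal (?q k) * ennreal (sqrt 2)" for k
   by (intro ennreal_mult nn) simp
  ultimately show ?thesis by (simp only:)
 qed
 also have "... \<le> 1 + ennreal 2"
 proof (intro add_left_mono ennreal_leI)
  have "(\<Sum>k\<in>grid n - {0}. (lam k)^2 / wt k) \<le> (\<Sum>k\<in>grid n. (lam k)^2 / wt k)"
   using wt_pos by (intro sum_mono2) (auto intro!: divide_nonneg_pos)
  also have "... \<le> W_const" by (rule W_const_ge)
  finally have "(\<Sum>k\<in>grid n - {0}. ?q k) \<le> 1"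
   unfolding sum_divide_distrib[symmetric] using W_const_pos by simp
  then have "(\<Sum>k\<in>grid n - {0}. ?q k) * sqrt 2 \<le> 1 * sqrt 2"
   by (intro mult_right_mono) auto
  also have "... \<le> 2" using real_sqrt_le_mono[of 2 4] by simp
  finally show "(\<Sum>k\<in>grid n - {0}. ?q k) * sqrt 2 \<le> 2" .
 qed
 also have "... = ennreal 3" by simp
 finally show ?thesis by (simp add: f_def c_def)
qed

text \<open>For i \<noteq> j a quarter of all subsets contain i and omit j. Each unordered pair is
  met in both orders, so the average of the cross sum over all A is half of the pair sum. The
  compensating factor 2 is the reason for \<open>coupling / 2\<close> in the bound for the full
  energy.\<close>

lemma sum_bipartite:
 fixes a :: "nat \<Rightarrow> nat \<Rightarrow> real"
 assumes sym: "\<And>i j. a i j = a j i"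
 shows "(\<Sum>A\<in>Pow {..<N}. 1 / 2 ^ N * (2 * (\<Sum>i\<in>A. \<Sum>j\<in>{..<N} - A. a i j))) = (\<Sum>j<N. \<Sum>i<j. a i j)"
proof -
 let ?A = "\<Sum>j<N. \<Sum>i<j. a i j"
 define I where "I = {..<N}"
 have finI: "finite I" "card I = N" by (auto simp: I_def)
 have cardA: "4 * real (card {A \<in> Pow I. i \<in> A \<and> j \<notin> A}) = (if i = j then 0 else 2 ^ N)" if "i \<in> I" "j \<in> I" for i j
 proof (cases "i = j")
  case False
  have "{A \<in> Pow I. i \<in> A \<and> j \<notin> A} = insert i ` Pow (I - {i, j})"
  proof (intro equalityI subsetI)
   fix A assume "A \<in> {A \<in> Pow I. i \<in> A \<and> j \<notin> A}"
   then have "A = insert i (A - {i})" "A - {i} \<in> Pow (I - {i, j})" by auto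
   then show "A \<in> insert i ` Pow (I - {i, j})" by blast
  qed (use that False in auto)
  moreover have "inj_on (insert i) (Pow (I - {i, j}))"
   by (auto simp: inj_on_def)
  ultimately have "card {A \<in> Pow I. i \<in> A \<and> j \<notin> A} = 2 ^ card (I - {i, j})"
   using finI by (simp add: card_image card_Pow)
  also have "card (I - {i, j}) = N - 2"
   using that False finI by (subst card_Diff_subset) auto
  finally have "card {A \<in> Pow I. i \<in> A \<and> j \<notin> A} = 2 ^ (N - 2)" .
  moreover have "2 \<le> N" using that False card_mono[of I "{i, j}"] finI by auto
  then have "(2::real) ^ N = 2 ^ (N - 2) * 2 ^ 2" by (metis power_add le_add_diff_inverse2)
  ultimately show ?thesis using False by simp
 qed auto
 have "(\<Sum>A\<in>Pow I. \<Sum>i\<in>A. \<Sum>j\<in>I - A. a i j) = (\<Sum>A\<in>Pow I. \<Sum>i\<in>I. \<Sum>j\<in>I. if i \<in> A \<and> j \<notin> A then a i j else 0)"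
 proof (rule sum.cong[OF refl])
  fix A assume A: "A \<in> Pow I"
  have "(\<Sum>i\<in>A. \<Sum>j\<in>I - A. a i j) = (\<Sum>i\<in>I. if i \<in> A then (\<Sum>j\<in>I - A. a i j) else 0)"
   using A finI by (subst sum.inter_restrict[symmetric]) (auto simp: Int_absorb1)
  also have "... = (\<Sum>i\<in>I. \<Sum>j\<in>I. if i \<in> A \<and> j \<notin> A then a i j else 0)"
  proof (rule sum.cong[OF refl])
   fix i
   have "(\<Sum>j\<in>I - A. a i j) = (\<Sum>j\<in>I. if j \<notin> A then a i j else 0)"
    using finI by (intro sum.mono_neutral_cong_left) auto
   then show "(if i \<in> A then (\<Sum>j\<in>I - A. a i j) else 0) = (\<Sum>j\<in>I. if i \<in> A \<and> j \<notin> A then a i j else 0)" by simp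
  qed
  finally show "(\<Sum>i\<in>A. \<Sum>j\<in>I - A. a i j) = (\<Sum>i\<in>I. \<Sum>j\<in>I. if i \<in> A \<and> j \<notin> A then a i j else 0)" .
 qed
 also have "... = (\<Sum>i\<in>I. \<Sum>j\<in>I. \<Sum>A\<in>Pow I. if i \<in> A \<and> j \<notin> A then a i j else 0)"
  by (subst sum.swap, rule sum.cong[OF refl], subst sum.swap) simp
 also have "... = (\<Sum>i\<in>I. \<Sum>j\<in>I. real (card {A \<in> Pow I. i \<in> A \<and> j \<notin> A}) * a i j)"
  using finI by (simp add: sum.If_cases Int_def)
 finally have "4 * (\<Sum>A\<in>Pow I. \<Sum>i\<in>A. \<Sum>j\<in>I - A. a i j) = (\<Sum>i\<in>I. \<Sum>j\<in>I. (4 * real (card {A \<in> Pow I. i \<in> A \<and> j \<notin> A})) * a i j)"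
  by (simp add: sum_distrib_left mult.assoc)
 also have "... = (\<Sum>i\<in>I. \<Sum>j\<in>I. 2 ^ N * (if i = j then 0 else a i j))"
  by (intro sum.cong refl, subst cardA) auto
 also have "... = 2 ^ N * (\<Sum>i\<in>I. \<Sum>j\<in>I. (if i < j then a i j else 0) + (if j < i then a i j else 0))"
  unfolding sum_distrib_left by (intro sum.cong refl) auto
 also have "(\<Sum>i\<in>I. \<Sum>j\<in>I. (if i < j then a i j else 0) + (if j < i then a i j else 0))
   = (\<Sum>i\<in>I. \<Sum>j\<in>I. if i < j then a i j else 0) + (\<Sum>i\<in>I. \<Sum>j\<in>I. if j < i then a i j else 0)"
  by (simp add: sum.distrib)
 also have "(\<Sum>i\<in>I. \<Sum>j\<in>I. if i < j then a i j else 0) = ?A"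
  unfolding I_def by (subst sum.swap) (intro sum.cong refl sum.mono_neutral_cong_right, auto)
 also have "(\<Sum>i\<in>I. \<Sum>j\<in>I. if j < i then a i j else 0) = ?A"
  unfolding I_def by (intro sum.cong refl sum.mono_neutral_cong_right) (auto simp: sym)
 finally have "4 * (\<Sum>A\<in>Pow I. \<Sum>i\<in>A. \<Sum>j\<in>I - A. a i j) = 2 ^ N * (2 * ?A)" by simp
 then have "1 / 2 ^ N * (2 * (\<Sum>A\<in>Pow I. \<Sum>i\<in>A. \<Sum>j\<in>I - A. a i j)) = ?A"
  by (simp add: field_simps)
 then show ?thesis by (simp add: I_def sum_distrib_left)
qed

text \<open>Decoupling: the energy is the average over all bipartitions of twice the interaction energy
 between the two parts, so by convexity it suffices to bound one bipartition, where the particles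
 of one part are conditionally independent.\<close>

theorem nn_integral_exp_energy_trunc_le:
 assumes N: "0 < N"
 shows "(\<integral>\<^sup>+x. ennreal (exp (coupling / 2 / real N * (\<Sum>j<N. \<Sum>i<j. green_trunc n (x i - x j)))) \<partial>particles N)
  \<le> ennreal 3"
proof -
 define X where "X A x = (\<Sum>i\<in>A. \<Sum>j\<in>{..<N} - A. green_trunc n (x i - x j))" for A and x :: "nat \<Rightarrow> plane"
 have [measurable]: "(\<lambda>x. green_trunc n (x i - x j)) \<in> borel_measurable (particles N)" if "i < N" "j < N" for i j
  using that by (intro measurable_pair_difference) auto
 have Xm [measurable]: "X A \<in> borel_measurable (particles N)" if "A \<in> Pow {..<N}" for A
  unfolding X_def using that by (intro borel_measurable_sum) (auto simp: subset_eq)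
 have le: "exp (coupling / 2 / real N * (\<Sum>j<N. \<Sum>i<j. green_trunc n (x i - x j))) \<le> (\<Sum>A\<in>Pow {..<N}. 1 / 2 ^ N * exp (coupling / real N * X A x))" for x
 proof -
  have "coupling / 2 / real N * (\<Sum>j<N. \<Sum>i<j. green_trunc n (x i - x j)) = (\<Sum>A\<in>Pow {..<N}. (1 / 2 ^ N) *\<^sub>R (coupling / real N * X A x))"
   unfolding sum_bipartite[of "\<lambda>i j. green_trunc n (x i - x j)", OF green_trunc_swap, symmetric] sum_distrib_left X_def[symmetric]
   by (intro sum.cong refl) (simp add: field_simps)
  also have "exp ... \<le> (\<Sum>A\<in>Pow {..<N}. 1 / 2 ^ N * exp (coupling / real N * X A x))"
   by (intro convex_on_sum[OF _ _ exp_convex]) (auto simp: card_Pow)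
  finally show ?thesis .
 qed
 have "(\<integral>\<^sup>+x. ennreal (exp (coupling / 2 / real N * (\<Sum>j<N. \<Sum>i<j. green_trunc n (x i - x j)))) \<partial>particles N)
   \<le> (\<integral>\<^sup>+x. (\<Sum>A\<in>Pow {..<N}. ennreal (1 / 2 ^ N) * ennreal (exp (coupling / real N * X A x))) \<partial>particles N)"
 proof (rule nn_integral_mono)
  fix x
  have "(\<Sum>A\<in>Pow {..<N}. ennreal (1 / 2 ^ N) * ennreal (exp (coupling / real N * X A x))) = (\<Sum>A\<in>Pow {..<N}. ennreal (1 / 2 ^ N * exp (coupling / real N * X A x)))"
   by (simp add: ennreal_mult[symmetric])
  also have "... = ennreal (\<Sum>A\<in>Pow {..<N}. 1 / 2 ^ N * exp (coupling / real N * X A x))"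
   by (rule sum_ennreal) auto
  finally show "ennreal (exp (coupling / 2 / real N * (\<Sum>j<N. \<Sum>i<j. green_trunc n (x i - x j))))
    \<le> (\<Sum>A\<in>Pow {..<N}. ennreal (1 / 2 ^ N) * ennreal (exp (coupling / real N * X A x)))"
   using le[of x] by (simp add: ennreal_leI)
 qed
 also have "... = (\<Sum>A\<in>Pow {..<N}. ennreal (1 / 2 ^ N) * (\<integral>\<^sup>+x. ennreal (exp (coupling / real N * X A x)) \<partial>particles N))"
  by (subst nn_integral_sum) (auto intro!: sum.cong nn_integral_cmult)
 also have "... \<le> (\<Sum>A\<in>Pow {..<N}. ennreal (1 / 2 ^ N) * ennreal 3)"
  unfolding X_def by (intro sum_mono mult_left_mono nn_integral_bipartite_le N) auto
 also have "... = (\<Sum>A\<in>Pow {..<N}. ennreal (1 / 2 ^ N * 3))"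
  by (intro sum.cong refl ennreal_mult[symmetric]) auto
 also have "... = ennreal (\<Sum>A\<in>Pow {..<N}. 1 / 2 ^ N * 3)"
  by (rule sum_ennreal) simp
 also have "(\<Sum>A\<in>Pow {..<N}. 1 / 2 ^ N * 3) = (3::real)" by (simp add: card_Pow)
 finally show ?thesis .
qed

subsection \<open>Distributions and coefficient sequences\<close>

text \<open>Coefficient sequences carry the product topology. A sequence is synthesised to a
 distribution if it grows at most like \<open>sqw\<close>; the mode \<open>0\<close> is discarded.\<close>

definition admissible :: "(freq \<Rightarrow> real) \<Rightarrow> bool"
 where "admissible a \<longleftrightarrow> (\<exists>R. \<forall>k. \<bar>a k\<bar> \<le> R * sqw k)"

text \<open>The default value 0 makes every sequence yield a distribution, so that
  \<open>synth\<close> is a total map whose measurability can be asked for.\<close>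

definition synth_fun :: "(freq \<Rightarrow> real) \<Rightarrow> (plane \<Rightarrow> real) \<Rightarrow> real"
 where "synth_fun a f = (if admissible a \<and> f \<in> \<D>
  then \<Sum>\<^sub>\<infinity>k\<in>- {0}. a k * cas_coeff f k else 0)"

definition synth :: "(freq \<Rightarrow> real) \<Rightarrow> distribution"
 where "synth a = Abs_distribution (synth_fun a)"

lemma abs_cas_coeff_le_Ck:
 assumes "f \<in> \<D>"
 shows "\<bar>cas_coeff f k\<bar> \<le> 54 * Ck_norm 6 f / sqw k ^ 3"
 using sqw_cube_cas_coeff_le[OF assms, of k] sqw_pos[of k] by (simp add: field_simps)

text \<open>Growth of order \<open>sqw\<close> against decay of order sqw^(-3) leaves sqw^(-2),
  which is summable in dimension two. This balance lies behind the growth allowed in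
  \<open>admissible\<close>.\<close>

lemma abs_coeff_mult_le:
 assumes "f \<in> \<D>" "\<bar>a k\<bar> \<le> R * sqw k"
 shows "\<bar>a k * cas_coeff f k\<bar> \<le> R * (54 * Ck_norm 6 f) * (1 / (sqw k)^2)"
proof -
 have "\<bar>a k * cas_coeff f k\<bar> \<le> (R * sqw k) * (54 * Ck_norm 6 f / sqw k ^ 3)"
  unfolding abs_mult using order.trans[OF abs_ge_zero assms(2)]
  by (intro mult_mono assms abs_cas_coeff_le_Ck) auto
 also have "... = R * (54 * Ck_norm 6 f) * (1 / (sqw k)^2)"
  using sqw_pos[of k] by (simp add: field_simps power2_eq_square power3_eq_cube)
 finally show ?thesis .
qed

lemma summable_on_coeff_mult:
 assumes "f \<in> \<D>" "admissible a"
 shows "(\<lambda>k. a k * cas_coeff f k) summable_on A"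
proof -
 obtain R where R: "\<And>k. \<bar>a k\<bar> \<le> R * sqw k" using assms(2) by (auto simp: admissible_def)
 have le: "\<bar>a k * cas_coeff f k\<bar> \<le> R * (54 * Ck_norm 6 f) * (1 / (sqw k)^2)" for k
  by (rule abs_coeff_mult_le[of f a k R]) (use assms R in auto)
 have "(\<lambda>k. a k * cas_coeff f k) summable_on UNIV"
  by (rule abs_summable_summable,
    rule summable_on_comparison_test[OF summable_on_cmult_right[OF summable_on_inverse_sqw_square]])
    (use le in auto)
 then show ?thesis by (rule summable_on_subset_banach) simp
qed

lemma abs_infsum_le_mult:
 fixes f g :: "'a \<Rightarrow> real"
 assumes "\<And>k. \<bar>f k\<bar> \<le> C * g k" "g summable_on A"
 shows "\<bar>\<Sum>\<^sub>\<infinity>k\<in>A. f k\<bar> \<le> C * (\<Sum>\<^sub>\<infinity>k\<in>A. g k)"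
proof -
 let ?A = "\<Sum>\<^sub>\<infinity>k\<in>A. C * g k"
 have g: "(\<lambda>k. C * g k) summable_on A" by (rule summable_on_cmult_right[OF assms(2)])
 have "(\<lambda>k. norm (f k)) summable_on A"
  by (rule summable_on_comparison_test[OF g]) (simp_all add: assms(1))
 then have f: "f summable_on A" by (rule abs_summable_summable)
 have "infsum f A \<le> ?A"
  by (rule infsum_mono[OF f g]) (rule order.trans[OF abs_ge_self assms(1)])
 moreover have "(\<Sum>\<^sub>\<infinity>k\<in>A. - f k) \<le> ?A"
  using f by (intro infsum_mono[OF _ g] order.trans[OF abs_ge_minus_self assms(1)]) (simp add: summable_on_uminus)
 ultimately show ?thesis by (simp add: infsum_uminus infsum_cmult_right' abs_le_iff)
qed

lemma cas_coeff_lincomb: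
 assumes "f \<in> \<D>" "g \<in> \<D>"
 shows "cas_coeff (\<lambda>z. c * f z + d * g z) k = c * cas_coeff f k + d * cas_coeff g k"
proof -
 have "cas_coeff (\<lambda>z. c * f z + d * g z) k = (\<integral>z. c * (f z * cas k z) + d * (g z * cas k z) \<partial>\<T>)"
  unfolding cas_coeff_def by (intro Bochner_Integration.integral_cong refl) (simp add: algebra_simps)
 then show ?thesis
  using integrable_cas_mult[OF integrable_test_function[OF assms(1)], of k] integrable_cas_mult[OF integrable_test_function[OF assms(2)], of k]
  by (simp add: cas_coeff_def)
qed

lemma infsum_diff_real:
 fixes f g :: "'a \<Rightarrow> real"
 assumes "f summable_on A" "g summable_on A"
 shows "(\<Sum>\<^sub>\<infinity>k\<in>A. f k - g k) = infsum f A - infsum g A"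
 using infsum_add[OF assms(1) summable_on_cmult_right[OF assms(2), of "-1"]]
 by (simp add: infsum_cmult_right' infsum_uminus)

lemma synth_fun_distribution:
 "synth_fun a \<in> {T. (\<forall>f. f \<notin> \<D> \<longrightarrow> T f = 0) \<and>
   (\<forall>f\<in>\<D>. \<forall>g\<in>\<D>. \<forall>c d.
     T (\<lambda>z. c * f z + d * g z) = c * T f + d * T g) \<and>
   (\<exists>m C. \<forall>f\<in>\<D>. \<bar>T f\<bar> \<le> C * Ck_norm m f)}"
proof (cases "admissible a")
 case True
 obtain R where R: "\<And>k. \<bar>a k\<bar> \<le> R * sqw k" using True by (auto simp: admissible_def)
 have lin: "synth_fun a (\<lambda>z. c * f z + d * g z) = c * synth_fun a f + d * synth_fun a g"
  if "f \<in> \<D>" "g \<in> \<D>" for f g c d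
 proof -
  have "(\<Sum>\<^sub>\<infinity>k\<in>- {0}. a k * cas_coeff (\<lambda>z. c * f z + d * g z) k)
    = (\<Sum>\<^sub>\<infinity>k\<in>- {0}. c * (a k * cas_coeff f k) + d * (a k * cas_coeff g k))"
   by (intro infsum_cong) (simp add: cas_coeff_lincomb[OF that] algebra_simps)
  also have "... = c * (\<Sum>\<^sub>\<infinity>k\<in>- {0}. a k * cas_coeff f k) + d * (\<Sum>\<^sub>\<infinity>k\<in>- {0}. a k * cas_coeff g k)"
   using summable_on_coeff_mult[OF that(1) True] summable_on_coeff_mult[OF that(2) True]
   by (subst infsum_add) (auto intro!: summable_on_cmult_right simp: infsum_cmult_right')
  finally show ?thesis using True that by (simp add: synth_fun_def test_functions_lincomb)
 qed
 have bd: "\<bar>synth_fun a f\<bar> \<le> (R * 54 * (\<Sum>\<^sub>\<infinity>k\<in>- {0}. 1 / (sqw k)^2)) * Ck_norm 6 f" if f: "f \<in> \<D>" for f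
 proof -
  have le: "\<bar>a k * cas_coeff f k\<bar> \<le> R * (54 * Ck_norm 6 f) * (1 / (sqw k)^2)" for k
   by (rule abs_coeff_mult_le[of f a k R]) (use f R in auto)
  have "(\<lambda>k. 1 / (sqw k)^2) summable_on - {0}"
   by (rule summable_on_subset_banach[OF summable_on_inverse_sqw_square]) simp
  from abs_infsum_le_mult[of "\<lambda>k. a k * cas_coeff f k" "R * (54 * Ck_norm 6 f)" "\<lambda>k. 1 / (sqw k)^2", OF le this]
  show ?thesis using True f by (simp add: synth_fun_def mult_ac)
 qed
 have "synth_fun a f = 0" if "f \<notin> \<D>" for f using that by (simp add: synth_fun_def)
 then show ?thesis using lin bd by blast
next
 case False
 then show ?thesis by (auto simp: synth_fun_def intro!: exI[of _ 0])
qed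

lemma pairing_synth: "pairing (synth a) = synth_fun a"
 unfolding synth_def by (rule Abs_distribution_inverse[OF synth_fun_distribution])

lemma distribution_eqI:
 assumes "\<And>f. f \<in> \<D> \<Longrightarrow> pairing S f = pairing T f"
 shows "S = T"
proof -
 have "pairing S f = pairing T f" for f
  using assms[of f] pairing[of S] pairing[of T] by (cases "f \<in> \<D>") auto
 then show ?thesis by (metis ext pairing_inject)
qed

lemma pairing_lincomb:
 "f \<in> \<D> \<Longrightarrow> g \<in> \<D> \<Longrightarrow>
  pairing T (\<lambda>z. c * f z + d * g z) = c * pairing T f + d * pairing T g"
 using pairing[of T] by blast

lemma pairing_add: "f \<in> \<D> \<Longrightarrow> g \<in> \<D> \<Longrightarrow>
  pairing T (\<lambda>z. f z + g z) = pairing T f + pairing T g"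
 using pairing_lincomb[of f g T 1 1] by simp

lemma pairing_scale: "f \<in> \<D> \<Longrightarrow> pairing T (\<lambda>z. c * f z) = c * pairing T f"
 using pairing_lincomb[of f f T c 0] by simp

lemma pairing_zero [simp]: "pairing T (\<lambda>_. 0) = 0"
 using pairing_scale[of "\<lambda>_. 0" T 0] by simp

lemma pairing_sum:
 assumes "\<And>i. i \<in> I \<Longrightarrow> f i \<in> \<D>"
 shows "pairing T (\<lambda>z. \<Sum>i\<in>I. f i z) = (\<Sum>i\<in>I. pairing T (f i))"
 using assms
 by (induction I rule: infinite_finite_induct) (auto simp: pairing_add test_functions_sum)

section \<open>Continuity and measurability of synthesis\<close>

lemma continuous_pairing: "continuous_on UNIV (\<lambda>T. pairing T f)"
proof (cases "f \<in> \<D>")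
 case True
 have bt: "bounded_test_set {f}" using True by (simp add: bounded_test_set_def)
 have "open ((\<lambda>T. pairing T f) -` V)" if "open V" for V
  unfolding open_distribution_def
 proof
  fix T assume "T \<in> (\<lambda>T. pairing T f) -` V"
  then have "pairing T f \<in> V" by simp
  with \<open>open V\<close> obtain e where e: "e > 0" "cball (pairing T f) e \<subseteq> V"
   unfolding open_contains_cball by blast
  have "pairing S f \<in> V" if "\<bar>pairing S f - pairing T f\<bar> \<le> e" for S
  proof -
   have "pairing S f \<in> cball (pairing T f) e" using that by (simp add: dist_real_def abs_minus_commute)
   then show ?thesis using e(2) by blast
  qed
  then have "{S. \<forall>g\<in>{f}. \<bar>pairing S g - pairing T g\<bar> \<le> e} \<subseteq> (\<lambda>T. pairing T f) -` V" by blast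
  then show "\<exists>B d. bounded_test_set B \<and> 0 < d \<and> {S. \<forall>f\<in>B. \<bar>pairing S f - pairing T f\<bar> \<le> d} \<subseteq> (\<lambda>T. pairing T f) -` V"
   using bt e(1) by blast
 qed
 then show ?thesis by (simp add: continuous_on_open_vimage)
next
 case False
 then have "(\<lambda>T. pairing T f) = (\<lambda>_. 0)" using pairing by auto
 then show ?thesis by (simp only: continuous_on_const)
qed

lemma measurable_pairing [measurable]: "(\<lambda>T. pairing T f) \<in> borel_measurable borel"
 by (rule borel_measurable_continuous_onI[OF continuous_pairing])

definition coeffs :: "distribution \<Rightarrow> freq \<Rightarrow> real"
 where "coeffs T k = (if k = 0 then 0 else pairing T (cas k))"

lemma measurable_coeffs [measurable]: "coeffs \<in> borel_measurable borel"
 by (rule measurable_coordinatewise_then_product) (simp add: coeffs_def)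

text \<open>Coordinatewise projection onto the box. \<open>synth\<close> itself is not continuous
  for the product topology; after \<open>clip\<close> it is.\<close>

definition clip :: "real \<Rightarrow> (freq \<Rightarrow> real) \<Rightarrow> freq \<Rightarrow> real"
 where "clip R a k = max (- (R * sqw k)) (min (R * sqw k) (a k))"

definition box_bounded :: "real \<Rightarrow> (freq \<Rightarrow> real) \<Rightarrow> bool"
 where "box_bounded R a \<longleftrightarrow> (\<forall>k. \<bar>a k\<bar> \<le> R * sqw k)"

lemma clip_eq: "box_bounded R a \<Longrightarrow> clip R a = a"
proof
 fix k assume "box_bounded R a"
 then have "\<bar>a k\<bar> \<le> R * sqw k" by (simp add: box_bounded_def)
 then show "clip R a k = a k" by (auto simp: clip_def max_def min_def)
qed

lemma box_bounded_clip: "0 \<le> R \<Longrightarrow> box_bounded R (clip R a)"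
 using sqw_pos by (auto simp: box_bounded_def clip_def max_def min_def abs_le_iff mult_nonneg_nonneg less_imp_le)

lemma box_bounded_admissible: "box_bounded R a \<Longrightarrow> admissible a"
 by (auto simp: box_bounded_def admissible_def)

lemma admissible_iff: "admissible a \<longleftrightarrow> (\<exists>n::nat. box_bounded (real n) a)"
proof
 assume "admissible a"
 then obtain R where R: "\<And>k. \<bar>a k\<bar> \<le> R * sqw k" by (auto simp: admissible_def)
 obtain n :: nat where "R \<le> real n" using real_arch_simple by blast
 then have "\<bar>a k\<bar> \<le> real n * sqw k" for k
  using R[of k] mult_right_mono[of R "real n" "sqw k"] sqw_pos[of k] by linarith
 then have "box_bounded (real n) a" by (simp add: box_bounded_def)
 then show "\<exists>n::nat. box_bounded (real n) a" by blast
qed (auto intro: box_bounded_admissible)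

text \<open>A bounded test set has bounded \<open>Ck_norm 6\<close>, so on it two clipped syntheses
  differ by at most a multiple of D, the l1 distance of the clipped sequences weighted with
  sqw^(-3). D is a uniform limit of continuous functions of finitely many coordinates, hence
  continuous for the product topology, and its sublevel sets are the required
  neighbourhoods.\<close>

lemma continuous_synth_clip:
 assumes R: "0 \<le> R"
 shows "continuous_on UNIV (\<lambda>a. synth (clip R a))"
proof -
 let ?A = "\<lambda>a. synth (clip R a)"
 define D where "D b a = (\<Sum>\<^sub>\<infinity>k. \<bar>clip R a k - clip R b k\<bar> / sqw k ^ 3)" for a b
 have clip_bd: "\<bar>clip R a k\<bar> \<le> R * sqw k" for a k
  using box_bounded_clip[OF R, of a] by (simp add: box_bounded_def)
 have diff_bd: "\<bar>clip R a k - clip R b k\<bar> / sqw k ^ 3 \<le> 2 * R * (1 / (sqw k)^2)" for a b k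
 proof -
  have "\<bar>clip R a k - clip R b k\<bar> \<le> 2 * R * sqw k" using clip_bd[of a k] clip_bd[of b k] by linarith
  then have "\<bar>clip R a k - clip R b k\<bar> / sqw k ^ 3 \<le> 2 * R * sqw k / sqw k ^ 3"
   using sqw_pos[of k] by (intro divide_right_mono) auto
  also have "... = 2 * R * (1 / (sqw k)^2)" using sqw_pos[of k] by (simp add: field_simps power2_eq_square power3_eq_cube)
  finally show ?thesis .
 qed
 have summD: "(\<lambda>k. \<bar>clip R a k - clip R b k\<bar> / sqw k ^ 3) summable_on UNIV" for a b
  by (rule summable_on_comparison_test[OF summable_on_cmult_right[OF summable_on_inverse_sqw_square] diff_bd])
    (use sqw_pos in \<open>auto intro!: divide_nonneg_pos\<close>)
 have contD: "continuous_on UNIV (D b)" for b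
 proof -
  have "uniform_limit UNIV (\<lambda>X a. \<Sum>k\<in>X. \<bar>clip R a k - clip R b k\<bar> / sqw k ^ 3) (D b) (finite_subsets_at_top UNIV)"
   unfolding D_def
  proof (rule Weierstrass_m_test_general)
   show "(\<lambda>k. 2 * R * (1 / (sqw k)^2)) summable_on UNIV"
    by (intro summable_on_cmult_right summable_on_inverse_sqw_square)
   show "norm (\<bar>clip R a k - clip R b k\<bar> / sqw k ^ 3) \<le> 2 * R * (1 / (sqw k)^2)" for k a
    using diff_bd[of a k b] sqw_pos[of k] by simp
  qed
  moreover have "continuous_on UNIV (\<lambda>a. \<Sum>k\<in>X. \<bar>clip R a k - clip R b k\<bar> / sqw k ^ 3)" for X
   unfolding clip_def divide_inverse by (intro continuous_intros continuous_on_product_coordinates)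
  ultimately show ?thesis
   by (intro uniform_limit_theorem[of _ _ "finite_subsets_at_top UNIV"]) (auto intro!: always_eventually)
 qed
 have "open (?A -` U)" if U: "open U" for U
 proof (subst open_subopen, intro ballI)
  fix b assume "b \<in> ?A -` U"
  then have "synth (clip R b) \<in> U" by simp
  with U obtain B e where B: "bounded_test_set B" "0 < e"
   and sub: "{S. \<forall>f\<in>B. \<bar>pairing S f - pairing (synth (clip R b)) f\<bar> \<le> e} \<subseteq> U"
   unfolding open_distribution_def by meson
  obtain K where K: "\<And>f. f \<in> B \<Longrightarrow> Ck_norm 6 f \<le> K"
   using B(1) unfolding bounded_test_set_def bdd_above_def by blast
  have B_tf: "f \<in> \<D>" if "f \<in> B" for f using B(1) that by (auto simp: bounded_test_set_def)
  define K' where "K' = 54 * (max K 0 + 1)"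
  have K': "0 < K'" by (simp add: K'_def)
  define V where "V = {a. D b a < e / K'}"
  have "open V" unfolding V_def by (intro open_Collect_less contD continuous_on_const)
  moreover have "b \<in> V" using B(2) K' by (simp add: V_def D_def)
  moreover have "V \<subseteq> ?A -` U"
  proof
   fix a assume a: "a \<in> V"
   have adm: "admissible (clip R a)" "admissible (clip R b)"
    using box_bounded_clip[OF R] box_bounded_admissible by blast+
   have "\<bar>pairing (synth (clip R a)) f - pairing (synth (clip R b)) f\<bar> \<le> e" if f: "f \<in> B" for f
   proof -
    note tf = B_tf[OF f]
    have "pairing (synth (clip R a)) f - pairing (synth (clip R b)) f
      = (\<Sum>\<^sub>\<infinity>k\<in>- {0}. clip R a k * cas_coeff f k) - (\<Sum>\<^sub>\<infinity>k\<in>- {0}. clip R b k * cas_coeff f k)"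
     using adm tf by (simp add: pairing_synth synth_fun_def)
    also have "... = (\<Sum>\<^sub>\<infinity>k\<in>- {0}. clip R a k * cas_coeff f k - clip R b k * cas_coeff f k)"
     using adm tf by (intro infsum_diff_real[symmetric] summable_on_coeff_mult)
    also have "\<bar>...\<bar> \<le> K' * (\<Sum>\<^sub>\<infinity>k\<in>- {0}. \<bar>clip R a k - clip R b k\<bar> / sqw k ^ 3)"
    proof (rule abs_infsum_le_mult)
     fix k
     have "\<bar>cas_coeff f k\<bar> \<le> 54 * Ck_norm 6 f / sqw k ^ 3" by (rule abs_cas_coeff_le_Ck[OF tf])
     also have "... \<le> K' / sqw k ^ 3"
      using K[OF f] sqw_pos[of k] by (intro divide_right_mono) (auto simp: K'_def)
     finally have "\<bar>clip R a k - clip R b k\<bar> * \<bar>cas_coeff f k\<bar> \<le> \<bar>clip R a k - clip R b k\<bar> * (K' / sqw k ^ 3)"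
      by (rule mult_left_mono) simp
     then show "\<bar>clip R a k * cas_coeff f k - clip R b k * cas_coeff f k\<bar> \<le> K' * (\<bar>clip R a k - clip R b k\<bar> / sqw k ^ 3)"
      unfolding left_diff_distrib[symmetric] abs_mult by (simp add: mult.commute)
    qed (rule summable_on_subset_banach[OF summD], simp)
    also have "... \<le> K' * D b a"
     unfolding D_def using K'
     by (intro mult_left_mono infsum_mono_neutral summD summable_on_subset_banach[OF summD])
      (auto intro!: divide_nonneg_pos zero_less_power sqw_pos)
    also have "... \<le> e" using a K' by (simp add: V_def field_simps)
    finally show ?thesis .
   qed
   then show "a \<in> ?A -` U" using sub by auto
  qed
  ultimately show "\<exists>T. open T \<and> b \<in> T \<and> T \<subseteq> ?A -` U" by blast
 qed
 then show ?thesis by (simp add: continuous_on_open_vimage)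
qed

lemma closed_box_bounded: "closed {a. box_bounded R a}"
proof -
 have "{a. box_bounded R a} = (\<Inter>k. {a. \<bar>a k\<bar> \<le> R * sqw k})" by (auto simp: box_bounded_def)
 moreover have "closed {a. \<bar>a k\<bar> \<le> R * sqw k}" for k :: "freq"
  by (intro closed_Collect_le continuous_intros continuous_on_product_coordinates)
 ultimately show ?thesis by (auto intro: closed_INT)
qed

lemma measurable_box_bounded [measurable]: "{a. box_bounded R a} \<in> sets borel"
 using closed_box_bounded by (rule borel_closed)

text \<open>The admissible sequences are the countable union of the integer boxes, and on each box
  \<open>synth\<close> agrees with its continuous clipped version. All other sequences are sent to
  the zero distribution, which explains the second part of the union.\<close>

lemma measurable_synth [measurable]: "synth \<in> borel_measurable borel"
proof (rule borel_measurableI)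
 fix U :: "distribution set" assume U: "open U"
 have "synth -` U = (\<Union>n. {a. box_bounded (real n) a} \<inter> (\<lambda>a. synth (clip (real n) a)) -` U)
   \<union> (if Abs_distribution (\<lambda>_. 0) \<in> U then - (\<Union>n. {a. box_bounded (real n) a}) else {})" (is "_ = ?R")
 proof (intro set_eqI)
  fix a
  show "a \<in> synth -` U \<longleftrightarrow> a \<in> ?R"
  proof (cases "admissible a")
   case True
   then obtain n :: nat where n: "box_bounded (real n) a" by (auto simp: admissible_iff)
   show ?thesis
   proof
    assume "a \<in> synth -` U"
    then show "a \<in> ?R" using n clip_eq[OF n] by auto
   next
    assume "a \<in> ?R"
    then show "a \<in> synth -` U" using n by (auto simp: clip_eq split: if_splits)
   qed
  next
   case False
   then have "synth a = Abs_distribution (\<lambda>_. 0)" by (simp add: synth_def synth_fun_def[abs_def])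
   then show ?thesis using False by (auto simp: admissible_iff)
  qed
 qed
 moreover have "(\<lambda>a. synth (clip (real n) a)) -` U \<in> sets borel" for n :: nat
  using continuous_synth_clip[of "real n"] U by (intro borel_open) (simp add: continuous_on_open_vimage)
 ultimately have "synth -` U \<in> sets borel" by simp
 then show "synth -` U \<inter> space borel \<in> sets borel" by simp
qed

lemma has_sum_grid:
 fixes f :: "freq \<Rightarrow> real"
 assumes "f summable_on - {0}"
 shows "(\<lambda>n. \<Sum>k\<in>grid n - {0}. f k) \<longlonglongrightarrow> (\<Sum>\<^sub>\<infinity>k\<in>- {0}. f k)"
proof -
 have lim: "(sum f \<longlongrightarrow> (\<Sum>\<^sub>\<infinity>k\<in>- {0}. f k)) (finite_subsets_at_top (- {0}))"
  by (rule infsum_tendsto[OF assms])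
 have "filterlim (\<lambda>n. grid n - {0}) (finite_subsets_at_top (- {0})) sequentially"
  unfolding filterlim_finite_subsets_at_top
 proof (intro allI impI)
  fix X :: "freq set" assume X: "finite X \<and> X \<subseteq> - {0}"
  then have "\<forall>\<^sub>F n in sequentially. X \<subseteq> grid n"
   using filterlim_grid unfolding filterlim_finite_subsets_at_top by simp
  then show "\<forall>\<^sub>F n in sequentially. finite (grid n - {0}) \<and> X \<subseteq> grid n - {0} \<and> grid n - {0} \<subseteq> - {0}"
   by eventually_elim (use X in auto)
 qed
 with lim show ?thesis by (rule filterlim_compose)
qed

lemma zero_in_grid [simp]: "0 \<in> grid n"
 by (simp add: grid_def zero_prod_def)

text \<open>T has finite order and Fourier series converge in the corresponding
  \<open>Ck_norm\<close>, so T f is the limit of the values of T on partial sums. The mode 0,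
  discarded by \<open>coeffs\<close>, is covered by the assumption that T kills constants.\<close>

lemma synth_coeffs:
 assumes adm: "admissible (coeffs T)" and T1: "pairing T (\<lambda>z. 1) = 0"
 shows "synth (coeffs T) = T"
proof (rule distribution_eqI)
 fix f assume f: "f \<in> \<D>"
 obtain m C where C: "\<And>g. g \<in> \<D> \<Longrightarrow> \<bar>pairing T g\<bar> \<le> C * Ck_norm m g"
  using pairing[of T] by blast
 have "(\<lambda>n. pairing T (fourier_sum n f)) \<longlonglongrightarrow> pairing T f"
 proof -
  have "(\<lambda>n. pairing T (\<lambda>z. f z - fourier_sum n f z)) \<longlonglongrightarrow> 0"
  proof (rule Lim_null_comparison[OF always_eventually])
   show "\<forall>n. norm (pairing T (\<lambda>z. f z - fourier_sum n f z)) \<le> C * Ck_norm m (\<lambda>z. f z - fourier_sum n f z)"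
    using C[OF test_functions_diff[OF f fourier_sum_test_function]] by simp
   show "(\<lambda>n. C * Ck_norm m (\<lambda>z. f z - fourier_sum n f z)) \<longlonglongrightarrow> 0"
    using tendsto_mult_left[OF Ck_norm_fourier_sum_tendsto[OF f, of m], of C] by simp
  qed
  moreover have "pairing T (\<lambda>z. f z - fourier_sum n f z) = pairing T f - pairing T (fourier_sum n f)" for n
   using pairing_lincomb[OF f fourier_sum_test_function, of T 1 "-1"] by simp
  ultimately have "(\<lambda>n. pairing T f - (pairing T f - pairing T (fourier_sum n f))) \<longlonglongrightarrow> pairing T f - 0"
   by (intro tendsto_diff tendsto_const) simp
  then show ?thesis by simp
 qed
 moreover have "pairing T (fourier_sum n f) = (\<Sum>k\<in>grid n - {0}. coeffs T k * cas_coeff f k)" for n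
 proof -
  have "pairing T (fourier_sum n f) = (\<Sum>k\<in>grid n. cas_coeff f k * pairing T (cas k))"
   unfolding fourier_sum_def[abs_def] by (subst pairing_sum) (auto simp: pairing_scale test_functions_scale)
  also have "... = (\<Sum>k\<in>grid n - {0}. cas_coeff f k * pairing T (cas k))"
  proof (rule sum.mono_neutral_right)
   have "cas 0 = (\<lambda>z. 1)" by (simp add: fun_eq_iff)
   then show "\<forall>k\<in>grid n - (grid n - {0}). cas_coeff f k * pairing T (cas k) = 0" using T1 by auto
  qed auto
  finally show ?thesis by (simp add: coeffs_def mult.commute)
 qed
 moreover have "(\<lambda>n. \<Sum>k\<in>grid n - {0}. coeffs T k * cas_coeff f k) \<longlonglongrightarrow> pairing (synth (coeffs T)) f"
  using has_sum_grid[OF summable_on_coeff_mult[OF f adm]] adm f by (simp add: pairing_synth synth_fun_def)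
 ultimately show "pairing (synth (coeffs T)) f = pairing T f"
  using LIMSEQ_unique by fastforce
qed

section \<open>The empirical vorticity in coefficients\<close>

text \<open>For k \<noteq> 0 the uniform background is invisible, as \<open>cas k\<close> has
  average zero; at k = 0 background and particles cancel.\<close>

definition emp_coeffs :: "nat \<Rightarrow> (nat \<Rightarrow> plane) \<Rightarrow> freq \<Rightarrow> real"
 where "emp_coeffs N x k = (if k = 0 then 0 else (\<Sum>j<N. cas k (x j)) / sqrt (real N))"

text \<open>A crude bound depending on N, which gives admissibility; bounds uniform in N are
  probabilistic, see \<open>prob_not_box_bounded_le\<close>.\<close>

lemma box_bounded_emp_coeffs: "box_bounded (2 * real N) (emp_coeffs N x)"
 unfolding box_bounded_def
proof
 fix k
 have "\<bar>emp_coeffs N x k\<bar> \<le> 2 * real N"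
 proof (cases "k = 0 \<or> N = 0")
  case False
  then have N: "1 \<le> sqrt (real N)" by simp
  have "\<bar>emp_coeffs N x k\<bar> \<le> (\<Sum>j<N. \<bar>cas k (x j)\<bar>) / sqrt (real N)"
   using False by (simp add: emp_coeffs_def divide_right_mono sum_abs)
  also have "... \<le> (\<Sum>j<N. \<bar>cas k (x j)\<bar>) / 1"
   using N by (intro divide_left_mono) (auto simp: sum_nonneg)
  also have "... \<le> (\<Sum>j<N. 2)" unfolding div_by_1 by (intro sum_mono abs_cas_le)
  finally show ?thesis by simp
 qed (auto simp: emp_coeffs_def)
 also have "2 * real N \<le> 2 * real N * sqw k"
  using mult_left_mono[OF sqw_ge_1[of k], of "2 * real N"] by simp
 finally show "\<bar>emp_coeffs N x k\<bar> \<le> 2 * real N * sqw k" .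
qed

lemma empirical_vorticity_eq_synth:
 assumes N: "0 < N"
 shows "empirical_vorticity N x = synth (emp_coeffs N x)"
proof -
 have adm: "admissible (emp_coeffs N x)" using box_bounded_emp_coeffs box_bounded_admissible by blast
 have "(if f \<in> \<D>
   then 1 / sqrt (real N) * ((\<Sum>j<N. f (x j)) - real N * (\<integral>z. f z \<partial>\<T>))
   else 0) = synth_fun (emp_coeffs N x) f" for f
 proof (cases "f \<in> \<D>")
  case True
  have "(\<lambda>n. 1 / sqrt (real N) * ((\<Sum>j<N. fourier_sum n f (x j)) - real N * (\<integral>z. f z \<partial>\<T>)))
   \<longlonglongrightarrow> 1 / sqrt (real N) * ((\<Sum>j<N. f (x j)) - real N * (\<integral>z. f z \<partial>\<T>))"
   by (intro tendsto_intros fourier_sum_tendsto True)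
  moreover have "1 / sqrt (real N) * ((\<Sum>j<N. fourier_sum n f (x j)) - real N * (\<integral>z. f z \<partial>\<T>))
    = (\<Sum>k\<in>grid n - {0}. emp_coeffs N x k * cas_coeff f k)" for n
  proof -
   have "fourier_sum n f z = (\<integral>z. f z \<partial>\<T>) + (\<Sum>k\<in>grid n - {0}. cas_coeff f k * cas k z)" for z
    unfolding fourier_sum_def by (subst sum.remove[of _ 0]) (auto simp: cas_coeff_def)
   then have "(\<Sum>j<N. fourier_sum n f (x j)) - real N * (\<integral>z. f z \<partial>\<T>)
     = (\<Sum>j<N. \<Sum>k\<in>grid n - {0}. cas_coeff f k * cas k (x j))"
    by (simp add: sum.distrib)
   also have "... = (\<Sum>k\<in>grid n - {0}. \<Sum>j<N. cas_coeff f k * cas k (x j))" by (rule sum.swap)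
   finally show ?thesis
    by (simp add: sum_distrib_left emp_coeffs_def sum_divide_distrib sum_distrib_right mult.commute)
  qed
  ultimately have "(\<lambda>n. \<Sum>k\<in>grid n - {0}. emp_coeffs N x k * cas_coeff f k)
   \<longlonglongrightarrow> 1 / sqrt (real N) * ((\<Sum>j<N. f (x j)) - real N * (\<integral>z. f z \<partial>\<T>))" by simp
  from LIMSEQ_unique[OF this has_sum_grid[OF summable_on_coeff_mult[OF True adm]]]
  show ?thesis using True adm by (simp add: synth_fun_def)
 qed (simp add: synth_fun_def)
 then show ?thesis unfolding empirical_vorticity_def synth_def by (simp only:)
qed

lemma measurable_emp_coeffs [measurable]:
 "emp_coeffs N \<in> borel_measurable (particles N)"
proof (rule measurable_coordinatewise_then_product)
 fix k
 have "(\<lambda>x. cas k (x j)) \<in> borel_measurable (particles N)" if "j < N" for j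
  using that by (intro measurable_compose[OF measurable_torus_component measurable_cas]) simp
 then show "(\<lambda>x. emp_coeffs N x k) \<in> borel_measurable (particles N)"
  unfolding emp_coeffs_def by simp
qed

lemma measurable_empirical_vorticity:
 assumes "0 < N"
 shows "empirical_vorticity N \<in> borel_measurable (particles N)"
 unfolding empirical_vorticity_eq_synth[OF assms, abs_def] by measurable

section \<open>Tightness on boxes\<close>

lemma nn_integral_inverse_sqw: "(\<integral>\<^sup>+k. ennreal (1 / (sqw k)^2) \<partial>count_space UNIV) < \<infinity>"
proof -
 have "integrable (count_space UNIV) (\<lambda>k. 1 / (sqw k)^2)"
  using summable_on_inverse_sqw_square abs_summable_equivalent[of "\<lambda>k. 1 / (sqw k)^2" UNIV]
  by (simp add: Infinite_Set_Sum.abs_summable_on_def)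
 then show ?thesis by (subst nn_integral_eq_integral) auto
qed

definition sqw_total :: real
 where "sqw_total = enn2real (\<integral>\<^sup>+k. ennreal (1 / (sqw k)^2) \<partial>count_space UNIV)"

text \<open>Chebyshev's inequality for all coordinates at once: outside the box some (X w k)^2 / (R
  * sqw k)^2 exceeds 1, hence so does the sum over k, whose expectation is at most sqw_total / R^2.
  The input, second moments bounded by 1, is available for particles and white noise alike.\<close>

lemma (in prob_space) prob_not_box_bounded_le:
 assumes X [measurable]: "X \<in> borel_measurable M"
  and sq: "\<And>k. (\<integral>\<^sup>+w. ennreal ((X w k)^2) \<partial>M) \<le> 1" and R: "0 < R"
 shows "measure M {w \<in> space M. \<not> box_bounded R (X w)} \<le> sqw_total / R\<^sup>2"
proof -
 have Xk [measurable]: "(\<lambda>w. X w k) \<in> borel_measurable M" for k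
  by (rule measurable_product_then_coordinatewise[OF X])
 have [measurable]: "{w \<in> space M. \<not> box_bounded R (X w)} \<in> sets M"
  unfolding box_bounded_def by measurable
 have "emeasure M {w \<in> space M. \<not> box_bounded R (X w)} = (\<integral>\<^sup>+w. indicator {w \<in> space M. \<not> box_bounded R (X w)} w \<partial>M)"
  by simp
 also have "... \<le> (\<integral>\<^sup>+w. \<integral>\<^sup>+k. ennreal (1 / R\<^sup>2) * (ennreal (1 / (sqw k)^2) * ennreal ((X w k)^2)) \<partial>count_space UNIV \<partial>M)"
 proof (rule nn_integral_mono)
  fix w assume "w \<in> space M"
  show "indicator {w \<in> space M. \<not> box_bounded R (X w)} w
    \<le> (\<integral>\<^sup>+k. ennreal (1 / R\<^sup>2) * (ennreal (1 / (sqw k)^2) * ennreal ((X w k)^2)) \<partial>count_space UNIV)"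
  proof (cases "box_bounded R (X w)")
   case False
   then obtain k where k: "R * sqw k < \<bar>X w k\<bar>" by (auto simp: box_bounded_def not_le)
   then have "(R * sqw k)^2 \<le> \<bar>X w k\<bar>\<^sup>2" using R sqw_pos[of k] by (intro power_mono) auto
   then have "1 \<le> 1 / R\<^sup>2 * (1 / (sqw k)^2 * (X w k)^2)"
    using R sqw_pos[of k] by (simp add: field_simps power_mult_distrib)
   then have "ennreal 1 \<le> ennreal (1 / R\<^sup>2) * (ennreal (1 / (sqw k)^2) * ennreal ((X w k)^2))"
    by (simp only: ennreal_mult[symmetric] zero_le_divide_1_iff zero_le_power2 mult_nonneg_nonneg ennreal_leI)
   also have "... \<le> (\<integral>\<^sup>+k. ennreal (1 / R\<^sup>2) * (ennreal (1 / (sqw k)^2) * ennreal ((X w k)^2)) \<partial>count_space UNIV)"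
    by (rule nn_integral_ge_point) simp
   finally show ?thesis by (simp add: indicator_def)
  qed simp
 qed
 also have "... = (\<integral>\<^sup>+k. \<integral>\<^sup>+w. ennreal (1 / R\<^sup>2) * (ennreal (1 / (sqw k)^2) * ennreal ((X w k)^2)) \<partial>M \<partial>count_space UNIV)"
  by (rule nn_integral_count_space_nn_integral) auto
 also have "... \<le> (\<integral>\<^sup>+k. ennreal (1 / R\<^sup>2) * ennreal (1 / (sqw k)^2) \<partial>count_space UNIV)"
 proof (rule nn_integral_mono)
  fix k
  have "(\<integral>\<^sup>+w. ennreal (1 / R\<^sup>2) * (ennreal (1 / (sqw k)^2) * ennreal ((X w k)^2)) \<partial>M)
    = ennreal (1 / R\<^sup>2) * (ennreal (1 / (sqw k)^2) * (\<integral>\<^sup>+w. ennreal ((X w k)^2) \<partial>M))"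
   by (subst nn_integral_cmult, measurable, subst nn_integral_cmult) auto
  also have "... \<le> ennreal (1 / R\<^sup>2) * (ennreal (1 / (sqw k)^2) * 1)"
   by (intro mult_left_mono sq) auto
  finally show "(\<integral>\<^sup>+w. ennreal (1 / R\<^sup>2) * (ennreal (1 / (sqw k)^2) * ennreal ((X w k)^2)) \<partial>M)
    \<le> ennreal (1 / R\<^sup>2) * ennreal (1 / (sqw k)^2)" by simp
 qed
 also have "... = ennreal (1 / R\<^sup>2) * (\<integral>\<^sup>+k. ennreal (1 / (sqw k)^2) \<partial>count_space UNIV)"
  by (rule nn_integral_cmult) simp
 also have "... = ennreal (1 / R\<^sup>2) * ennreal sqw_total"
  using nn_integral_inverse_sqw by (simp add: sqw_total_def less_top)
 also have "... = ennreal (sqw_total / R\<^sup>2)"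
  by (subst ennreal_mult[symmetric]) (auto simp: sqw_total_def)
 finally show ?thesis
  by (simp add: emeasure_eq_measure sqw_total_def ennreal_le_iff)
qed

lemma sqw_total_nonneg: "0 \<le> sqw_total"
 by (simp add: sqw_total_def)

lemma (in prob_space) AE_admissible:
 assumes X [measurable]: "X \<in> borel_measurable M"
  and sq: "\<And>k. (\<integral>\<^sup>+w. ennreal ((X w k)^2) \<partial>M) \<le> 1"
 shows "AE w in M. admissible (X w)"
proof -
 have [measurable]: "(\<lambda>w. X w k) \<in> borel_measurable M" for k
  by (rule measurable_product_then_coordinatewise[OF X])
 have bm [measurable]: "Measurable.pred M (\<lambda>w. box_bounded R (X w))" for R
  unfolding box_bounded_def by measurable
 have am [measurable]: "Measurable.pred M (\<lambda>w. admissible (X w))"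
  unfolding admissible_iff by measurable
 have "measure M {w \<in> space M. \<not> admissible (X w)} \<le> sqw_total / (real (Suc n))^2" for n
 proof -
  have "measure M {w \<in> space M. \<not> admissible (X w)} \<le> measure M {w \<in> space M. \<not> box_bounded (real (Suc n)) (X w)}"
   by (intro finite_measure_mono) (auto intro: box_bounded_admissible)
  also have "... \<le> sqw_total / (real (Suc n))^2" by (rule prob_not_box_bounded_le[OF X sq]) simp
  finally show ?thesis .
 qed
 moreover have "(\<lambda>n. sqw_total / (real (Suc n))^2) \<longlonglongrightarrow> 0"
 proof -
  have "(\<lambda>n. sqw_total * (1 / real (Suc n)) * (1 / real (Suc n))) \<longlonglongrightarrow> sqw_total * 0 * 0"
   by (intro tendsto_intros LIMSEQ_inverse_real_of_nat[unfolded inverse_eq_divide])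
  then show ?thesis by (simp add: power2_eq_square)
 qed
 ultimately have "measure M {w \<in> space M. \<not> admissible (X w)} \<le> 0"
  by (intro LIMSEQ_le_const) auto
 then have "measure M {w \<in> space M. \<not> admissible (X w)} = 0" using measure_nonneg by (intro antisym) auto
 then have "emeasure M {w \<in> space M. \<not> admissible (X w)} = 0" by (simp add: emeasure_eq_measure)
 then show ?thesis by (subst AE_iff_measurable[OF _ refl]) auto
qed

subsection \<open>Convergence in law of coefficient sequences\<close>

definition lin_form :: "freq set \<Rightarrow> (freq \<Rightarrow> real) \<Rightarrow> (freq \<Rightarrow> real) \<Rightarrow> real"
 where "lin_form J t x = (\<Sum>k\<in>J. t k * x k)"

text \<open>The free phase s makes cosines alone sufficient: sines are included, and the
  product-to-sum formulas stay within the class. Convergence of characteristic functions is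
  convergence of expectations on these generators.\<close>

inductive_set trig_cyl :: "((freq \<Rightarrow> real) \<Rightarrow> real) set" where
 cos: "finite J \<Longrightarrow> (\<lambda>x. c * cos (lin_form J t x + s)) \<in> trig_cyl"
| add: "f \<in> trig_cyl \<Longrightarrow> g \<in> trig_cyl \<Longrightarrow> (\<lambda>x. f x + g x) \<in> trig_cyl"

lemma lin_form_combine:
 assumes "finite J" "finite L"
 shows "lin_form J t x + c * lin_form L s x
  = lin_form (J \<union> L) (\<lambda>k. (if k \<in> J then t k else 0) + c * (if k \<in> L then s k else 0)) x"
proof -
 have "lin_form J t x = (\<Sum>k\<in>J \<union> L. (if k \<in> J then t k else 0) * x k)"
  unfolding lin_form_def using assms by (intro sum.mono_neutral_cong_left) auto
 moreover have "lin_form L s x = (\<Sum>k\<in>J \<union> L. (if k \<in> L then s k else 0) * x k)"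
  unfolding lin_form_def using assms by (intro sum.mono_neutral_cong_left) auto
 ultimately show ?thesis
  by (simp add: lin_form_def sum_distrib_left distrib_right sum.distrib mult.assoc)
qed

lemma trig_cyl_mult:
 assumes "f \<in> trig_cyl" "g \<in> trig_cyl"
 shows "(\<lambda>x. f x * g x) \<in> trig_cyl"
 using assms(1)
proof induction
 case (cos J c t r)
 note J = cos
 show ?case using assms(2)
 proof induction
  case (cos L d s h)
  define t1 where "t1 k = (if k \<in> J then t k else 0) + - 1 * (if k \<in> L then s k else 0)" for k
  define t2 where "t2 k = (if k \<in> J then t k else 0) + 1 * (if k \<in> L then s k else 0)" for k
  have eq: "c * cos (lin_form J t x + r) * (d * cos (lin_form L s x + h))
   = c * d / 2 * cos (lin_form (J \<union> L) t1 x + (r - h)) + c * d / 2 * cos (lin_form (J \<union> L) t2 x + (r + h))" for x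
  proof -
   have "lin_form (J \<union> L) t1 x = lin_form J t x + - 1 * lin_form L s x"
    "lin_form (J \<union> L) t2 x = lin_form J t x + 1 * lin_form L s x"
    unfolding t1_def[abs_def] t2_def[abs_def] by (rule lin_form_combine[OF J cos(1), symmetric])+
   then have "(lin_form J t x + r) - (lin_form L s x + h) = lin_form (J \<union> L) t1 x + (r - h)"
    "(lin_form J t x + r) + (lin_form L s x + h) = lin_form (J \<union> L) t2 x + (r + h)" by simp_all
   then show ?thesis
    using cos_times_cos[of "lin_form J t x + r" "lin_form L s x + h"] by (simp add: field_simps)
  qed
  have "finite (J \<union> L)" using J cos(1) by simp
  then show ?case unfolding eq by (intro trig_cyl.add trig_cyl.cos)
 qed (simp add: distrib_left trig_cyl.add)
qed (simp add: distrib_right trig_cyl.add)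

lemma trig_cyl_const: "(\<lambda>_. c) \<in> trig_cyl"
 using trig_cyl.cos[of "{}" c "\<lambda>_. 0" 0] by (simp add: lin_form_def)

lemma continuous_lin_form: "continuous_on UNIV (lin_form J t)"
 unfolding lin_form_def[abs_def] by (intro continuous_intros continuous_on_product_coordinates)

lemma trig_cyl_continuous_bounded:
 assumes "f \<in> trig_cyl"
 shows "continuous_on UNIV f \<and> (\<exists>B. \<forall>x. \<bar>f x\<bar> \<le> B)"
 using assms
proof induction
 case (cos J c t s)
 have "\<bar>c * cos (lin_form J t x + s)\<bar> \<le> \<bar>c\<bar>" for x
  unfolding abs_mult using mult_left_mono[OF abs_cos_le_one, of "\<bar>c\<bar>"] by simp
 moreover have "continuous_on UNIV (\<lambda>x. c * cos (lin_form J t x + s))"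
  by (intro continuous_intros continuous_lin_form)
 ultimately show ?case by blast
next
 case (add f g)
 then obtain B C where "\<And>x. \<bar>f x\<bar> \<le> B" "\<And>x. \<bar>g x\<bar> \<le> C" by blast
 then have "\<bar>f x + g x\<bar> \<le> B + C" for x using abs_triangle_ineq[of "f x" "g x"] by (meson add_mono order_trans)
 moreover have "continuous_on UNIV (\<lambda>x. f x + g x)" using add by (intro continuous_intros) auto
 ultimately show ?case by blast
qed

lemma compact_unit_box: "compact {s :: freq \<Rightarrow> real. \<forall>k. s k \<in> {-1..1}}"
proof -
 have "{s :: freq \<Rightarrow> real. \<forall>k. s k \<in> {-1..1}} = PiE UNIV (\<lambda>_. {-1..1})" by auto
 moreover have "compactin (product_topology (\<lambda>_. euclidean) UNIV) (PiE UNIV (\<lambda>_ :: freq. {-1..1::real}))"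
  by (simp add: compactin_PiE)
 ultimately show ?thesis by (simp add: euclidean_product_topology)
qed

text \<open>Bounded continuous functions are approximated on a box by polynomials in the sines of the
 rescaled coordinates; such polynomials are bounded globally by their bound on the box, so no
 tail estimate for the polynomial is needed.\<close>

lemma trig_cyl_approximation:
 fixes f :: "(freq \<Rightarrow> real) \<Rightarrow> real"
 assumes f: "continuous_on UNIV f" and B: "\<And>x. \<bar>f x\<bar> \<le> B" and R: "0 < R" and e: "0 < e"
 obtains p where "p \<in> trig_cyl" "\<And>x. \<bar>p x\<bar> \<le> B + e" "\<And>x. box_bounded R x \<Longrightarrow> \<bar>f x - p x\<bar> \<le> e"
proof -
 define S where "S = {s :: freq \<Rightarrow> real. \<forall>k. s k \<in> {-1..1}}"
 \<comment> \<open>Scaled so that the box is sent into [-pi/2, pi/2] in every coordinate, where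
   \<open>arcsin\<close> inverts the sine.\<close>
 define d where "d k = pi / (2 * R * sqw k)" for k
 have d: "0 < d k" for k using R sqw_pos[of k] by (simp add: d_def)
 define sn where "sn x = (\<lambda>k. sin (d k * x k))" for x
 define F where "F s = f (\<lambda>k. arcsin (s k) / d k)" for s
 define Q where "Q = {g. continuous_on S g \<and> (\<lambda>x. g (sn x)) \<in> trig_cyl}"
 interpret function_ring_on Q S
 proof
  show "compact S" unfolding S_def by (rule compact_unit_box)
  show "(\<lambda>_. c) \<in> Q" for c by (simp add: Q_def trig_cyl_const)
  fix x y :: "freq \<Rightarrow> real" assume "x \<noteq> y"
  then obtain k where k: "x k \<noteq> y k" by blast
  have "(\<lambda>x. sn x k) \<in> trig_cyl"
   using trig_cyl.cos[of "{k}" 1 d "- (pi / 2)"] by (simp add: sn_def lin_form_def cos_diff)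
  then have "(\<lambda>s. s k) \<in> Q"
   by (auto simp: Q_def intro: continuous_on_subset[OF continuous_on_product_coordinates])
  then show "\<exists>f\<in>Q. f x \<noteq> f y" using k by (intro bexI[of _ "\<lambda>s. s k"])
 qed (auto simp: Q_def intro: continuous_on_add continuous_on_mult trig_cyl.add trig_cyl_mult)
 have snS: "sn x \<in> S" for x by (simp add: sn_def S_def)
 have "continuous_on S F"
  unfolding F_def
 proof (rule continuous_on_compose2[OF f])
  show "continuous_on S (\<lambda>s. (\<lambda>k. arcsin (s k) / d k))"
  proof (rule continuous_on_coordinatewise_then_product)
   fix k
   show "continuous_on S (\<lambda>s. arcsin (s k) / d k)"
    using d[of k] continuous_on_subset[OF continuous_on_product_coordinates, of S]
    by (intro continuous_on_divide continuous_on_const continuous_on_arcsin) (auto simp: S_def)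
  qed
 qed simp
 from Stone_Weierstrass_basic[OF this e] obtain g where g: "g \<in> Q" "\<And>s. s \<in> S \<Longrightarrow> \<bar>F s - g s\<bar> < e"
  by blast
 show thesis
 proof (rule that)
  show "(\<lambda>x. g (sn x)) \<in> trig_cyl" using g by (simp add: Q_def)
  show "\<bar>g (sn x)\<bar> \<le> B + e" for x
  proof -
   have "\<bar>F (sn x)\<bar> \<le> B" unfolding F_def by (rule B)
   then show ?thesis using g(2)[OF snS[of x]] by linarith
  qed
  fix x assume x: "box_bounded R x"
  have "arcsin (sn x k) / d k = x k" for k
  proof -
   have "\<bar>d k * x k\<bar> \<le> d k * (R * sqw k)"
    unfolding abs_mult using x d[of k] by (intro mult_mono) (auto simp: box_bounded_def)
   also have "... = pi / 2" using R sqw_pos[of k] by (simp add: d_def)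
   finally have "arcsin (sin (d k * x k)) = d k * x k" by (intro arcsin_sin) auto
   then show ?thesis using d[of k] by (simp add: sn_def)
  qed
  then have "F (sn x) = f x" by (simp add: F_def)
  then show "\<bar>f x - g (sn x)\<bar> \<le> e" using g(2)[OF snS[of x]] by simp
 qed
qed

lemma (in prob_space) integral_approx_on_box:
 assumes X [measurable]: "X \<in> borel_measurable M"
  and sq: "\<And>k. (\<integral>\<^sup>+u. ennreal ((X u k)^2) \<partial>M) \<le> 1"
  and f [measurable]: "f \<in> borel_measurable borel" and p [measurable]: "p \<in> borel_measurable borel"
  and B: "\<And>x. \<bar>f x\<bar> \<le> B" "\<And>x. \<bar>p x\<bar> \<le> C" and R: "0 < R"
  and fp: "\<And>x. box_bounded R x \<Longrightarrow> \<bar>f x - p x\<bar> \<le> e"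
 shows "\<bar>(\<integral>u. f (X u) \<partial>M) - (\<integral>u. p (X u) \<partial>M)\<bar> \<le> e + (B + C) * (sqw_total / R\<^sup>2)"
proof -
 have Xk [measurable]: "(\<lambda>u. X u k) \<in> borel_measurable M" for k
  by (rule measurable_product_then_coordinatewise[OF X])
 define A where "A = {u \<in> space M. \<not> box_bounded R (X u)}"
 have [measurable]: "A \<in> sets M" unfolding A_def box_bounded_def by measurable
 have e: "0 \<le> e" using fp[of "\<lambda>_. 0"] sqw_pos R by (auto simp: box_bounded_def less_imp_le)
 have BC: "0 \<le> B + C" using B(1)[of undefined] B(2)[of undefined] by linarith
 have int: "integrable M (\<lambda>u. f (X u))" "integrable M (\<lambda>u. p (X u))"
  by (rule integrable_const_bound[of _ B], simp add: B, simp)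
   (rule integrable_const_bound[of _ C], simp add: B, simp)
 have "\<bar>(\<integral>u. f (X u) \<partial>M) - (\<integral>u. p (X u) \<partial>M)\<bar> = \<bar>\<integral>u. f (X u) - p (X u) \<partial>M\<bar>"
  using int by simp
 also have "... \<le> (\<integral>u. \<bar>f (X u) - p (X u)\<bar> \<partial>M)" by (rule integral_abs_bound)
 also have "... \<le> (\<integral>u. e + (B + C) * indicator A u \<partial>M)"
 proof (rule integral_mono)
  fix u assume w: "u \<in> space M"
  show "\<bar>f (X u) - p (X u)\<bar> \<le> e + (B + C) * indicator A u"
  proof (cases "box_bounded R (X u)")
   case True
   then show ?thesis using fp[OF True] BC by (simp add: A_def)
  next
   case False
   then show ?thesis using w e B(1)[of "X u"] B(2)[of "X u"] by (simp add: A_def)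
  qed
 qed (use int in \<open>auto intro!: integrable_real_indicator simp: emeasure_eq_measure\<close>)
 also have "... = e + (B + C) * measure M A"
 proof -
  have "integrable M (\<lambda>u. (B + C) * indicator A u)"
   by (intro integrable_mult_right integrable_real_indicator) (auto simp: emeasure_eq_measure)
  then show ?thesis by (simp add: prob_space)
 qed
 also have "... \<le> e + (B + C) * (sqw_total / R\<^sup>2)"
  using BC prob_not_box_bounded_le[OF X sq R] by (intro add_left_mono mult_left_mono) (auto simp: A_def)
 finally show ?thesis .
qed

lemma tendsto_by_approximation:
 fixes a :: "nat \<Rightarrow> real"
 assumes "\<And>e. 0 < e \<Longrightarrow> \<exists>b c. (\<forall>\<^sub>F n in sequentially. \<bar>a n - b n\<bar> \<le> e) \<and> \<bar>l - c\<bar> \<le> e \<and> b \<longlonglongrightarrow> c"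
 shows "a \<longlonglongrightarrow> l"
proof (rule tendstoI)
 fix e :: real assume e: "0 < e"
 then obtain b c where b: "\<forall>\<^sub>F n in sequentially. \<bar>a n - b n\<bar> \<le> e / 4" "\<bar>l - c\<bar> \<le> e / 4" "b \<longlonglongrightarrow> c"
  using assms[of "e / 4"] by auto
 have "\<forall>\<^sub>F n in sequentially. dist (b n) c < e / 4" using b(3) e by (intro tendstoD) auto
 then show "\<forall>\<^sub>F n in sequentially. dist (a n) l < e"
  using b(1)
 proof eventually_elim
  case (elim n)
  then have "\<bar>b n - c\<bar> < e / 4" "\<bar>a n - b n\<bar> \<le> e / 4" by (auto simp: dist_real_def)
  then show ?case using b(2) e unfolding dist_real_def by linarith
 qed
qed

text \<open>Finite-dimensional characteristic functions determine weak limits once tightness is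
  known. Here boxes play the role of compact sets, and the uniform second moments give tightness
  with a rate, so the error outside a box is estimated directly from the sup bounds of f and of its
  trigonometric approximant.\<close>

theorem coeff_law_convergence:
 fixes f :: "(freq \<Rightarrow> real) \<Rightarrow> real"
 assumes prob: "\<And>n. prob_space (Mn n)" "prob_space M"
  and meas: "\<And>n. Xn n \<in> borel_measurable (Mn n)" "X \<in> borel_measurable M"
  and sq: "\<And>n k. (\<integral>\<^sup>+w. ennreal ((Xn n w k)^2) \<partial>Mn n) \<le> 1" "\<And>k. (\<integral>\<^sup>+w. ennreal ((X w k)^2) \<partial>M) \<le> 1"
  and char: "\<And>J t s. finite J \<Longrightarrow> (\<lambda>n. \<integral>w. cos (lin_form J t (Xn n w) + s) \<partial>Mn n)
    \<longlonglongrightarrow> (\<integral>w. cos (lin_form J t (X w) + s) \<partial>M)"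
  and f: "continuous_on UNIV f" and B: "\<And>x. \<bar>f x\<bar> \<le> B"
 shows "(\<lambda>n. \<integral>w. f (Xn n w) \<partial>Mn n) \<longlonglongrightarrow> (\<integral>w. f (X w) \<partial>M)"
proof (rule tendsto_by_approximation)
 fix e :: real assume e: "0 < e"
 have B0: "0 \<le> B" using order.trans[OF abs_ge_zero B] .
 define d where "d = min 1 (e / 2)"
 have d: "0 < d" "d \<le> 1" "d \<le> e / 2" using e by (auto simp: d_def)
 \<comment> \<open>With R = sqrt (K / e) the error outside the box is at most e / 2; the factor 2 *
   B + 1 bounds f and its approximant together, since d \<le> 1.\<close>
 define K where "K = 2 * (2 * B + 1) * (sqw_total + 1)"
 have K: "0 < K" using B0 sqw_total_nonneg by (simp add: K_def add_nonneg_pos)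
 define R where "R = sqrt (K / e)"
 have R: "0 < R" "R\<^sup>2 = K / e" using K e by (auto simp: R_def)
 have err: "d + (B + (B + d)) * (sqw_total / R\<^sup>2) \<le> e"
 proof -
  have "(B + (B + d)) * (sqw_total / R\<^sup>2) \<le> (2 * B + 1) * ((sqw_total + 1) / R\<^sup>2)"
   using d B0 sqw_total_nonneg by (intro mult_mono divide_right_mono) auto
  also have "... = e / 2" using K e sqw_total_nonneg B0 unfolding R(2) K_def by (simp add: field_simps add_nonneg_pos)
  finally show ?thesis using d by linarith
 qed
 obtain p where p: "p \<in> trig_cyl" "\<And>x. \<bar>p x\<bar> \<le> B + d" "\<And>x. box_bounded R x \<Longrightarrow> \<bar>f x - p x\<bar> \<le> d"
  using trig_cyl_approximation[OF f B R(1) d(1)] by blast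
 have pm: "p \<in> borel_measurable borel"
  using trig_cyl_continuous_bounded[OF p(1)] by (intro borel_measurable_continuous_onI) auto
 have fm: "f \<in> borel_measurable borel" by (rule borel_measurable_continuous_onI[OF f])
 have 1: "\<bar>(\<integral>w. f (Xn n w) \<partial>Mn n) - (\<integral>w. p (Xn n w) \<partial>Mn n)\<bar> \<le> e" for n
  by (rule order.trans[OF prob_space.integral_approx_on_box[OF prob(1) meas(1) sq(1) fm pm B p(2) R(1) p(3)] err])
 have 2: "\<bar>(\<integral>w. f (X w) \<partial>M) - (\<integral>w. p (X w) \<partial>M)\<bar> \<le> e"
  by (rule order.trans[OF prob_space.integral_approx_on_box[OF prob(2) meas(2) sq(2) fm pm B p(2) R(1) p(3)] err])
 have 3: "(\<lambda>n. \<integral>w. p (Xn n w) \<partial>Mn n) \<longlonglongrightarrow> (\<integral>w. p (X w) \<partial>M)"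
  using p(1)
 proof induction
  case (cos J c t s)
  then show ?case using tendsto_mult_left[OF char[OF cos], of c] by simp
 next
  case (add g h)
  have int: "integrable N (\<lambda>w. g (Y w))" if *: "prob_space N" "Y \<in> borel_measurable N" "g \<in> trig_cyl"
   for N :: "'x measure" and Y g
  proof -
   interpret prob_space N by fact
   obtain C where C: "\<And>x. \<bar>g x\<bar> \<le> C" using trig_cyl_continuous_bounded[OF *(3)] by blast
   have "g \<in> borel_measurable borel"
    using trig_cyl_continuous_bounded[OF *(3)] by (intro borel_measurable_continuous_onI) auto
   from measurable_compose[OF *(2) this] show ?thesis
    by (rule integrable_const_bound[rotated, of _ C]) (simp add: C)
  qed
  then show ?case
   using add int[OF prob(1) meas(1)] int[OF prob(2) meas(2)] by (simp add: tendsto_add)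
 qed
 from 1 2 3 show "\<exists>b c. (\<forall>\<^sub>F n in sequentially. \<bar>(\<integral>w. f (Xn n w) \<partial>Mn n) - b n\<bar> \<le> e)
   \<and> \<bar>(\<integral>w. f (X w) \<partial>M) - c\<bar> \<le> e \<and> b \<longlonglongrightarrow> c"
  by (intro exI[of _ "\<lambda>n. \<integral>w. p (Xn n w) \<partial>Mn n"] exI[of _ "\<integral>w. p (X w) \<partial>M"]) auto
qed

subsection \<open>Gaussian variables\<close>

lemma (in prob_space) integrable_cis:
 "Y \<in> borel_measurable M \<Longrightarrow> integrable M (\<lambda>w. cis (Y w))"
 by (rule integrable_const_bound[of _ 1])
   (auto intro!: measurable_compose[of Y M borel cis] borel_measurable_continuous_onI continuous_intros)

lemma (in prob_space) integral_cos_shift: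
 assumes [measurable]: "Y \<in> borel_measurable M"
 shows "(\<integral>w. cos (Y w + t) \<partial>M) = Re (cis t * (\<integral>w. cis (Y w) \<partial>M))"
proof -
 have "cis t * (\<integral>w. cis (Y w) \<partial>M) = (\<integral>w. cis (Y w + t) \<partial>M)"
  by (simp add: cis_mult add.commute flip: integral_mult_right_zero)
 moreover have "Re (\<integral>w. cis (Y w + t) \<partial>M) = (\<integral>w. Re (cis (Y w + t)) \<partial>M)"
  by (rule integral_Re[symmetric]) (rule integrable_cis, measurable)
 ultimately show ?thesis by simp
qed

lemma char_distr_cis:
 assumes "X \<in> borel_measurable M"
 shows "char (distr M borel X) t = (\<integral>w. cis (t * X w) \<partial>M)"
 using assms unfolding char_def by (subst integral_distr) (auto simp: cis_conv_exp)

lemma char_normal: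
 assumes "0 < \<sigma>"
 shows "char (density lborel (normal_density 0 \<sigma>)) t = complex_of_real (exp (- (t\<^sup>2 * \<sigma>\<^sup>2) / 2))"
proof -
 interpret N: prob_space \<N>
  using real_dist_normal_dist real_distribution_def by blast
 have d: "distributed \<N> lborel (\<lambda>x. x) std_normal_density"
  by (auto simp: distributed_def distr_id2)
 have "distributed \<N> lborel (\<lambda>x. 0 + \<sigma> * x) (normal_density (0 + \<sigma> * 0) (\<bar>\<sigma>\<bar> * 1))"
  using assms by (intro N.normal_density_affine d) auto
 then have "distr \<N> lborel (\<lambda>x. \<sigma> * x) = density lborel (normal_density 0 \<sigma>)"
  using assms by (simp add: distributed_distr_eq_density)
 moreover have "distr \<N> lborel (\<lambda>x. \<sigma> * x) = distr \<N> borel (\<lambda>x. \<sigma> * x)"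
  by (rule distr_cong) auto
 ultimately have "char (density lborel (normal_density 0 \<sigma>)) t = char (distr \<N> borel (\<lambda>x. \<sigma> * x)) t"
  by simp
 also have "... = (\<integral>x. cis (t * (\<sigma> * x)) \<partial>\<N>)"
  by (rule char_distr_cis) simp
 also have "... = char \<N> (t * \<sigma>)"
  by (simp add: char_def cis_conv_exp mult_ac)
 also have "... = complex_of_real (exp (- (t\<^sup>2 * \<sigma>\<^sup>2) / 2))"
  by (simp add: char_std_normal_distribution power_mult_distrib)
 finally show ?thesis .
qed

text \<open>A pairing may have variance 0, so the degenerate alternative of
  \<open>centered_gaussian\<close> is carried along; the formulas hold in both cases.\<close>

lemma (in prob_space) centered_gaussian_properties:
 assumes "centered_gaussian M X"
 shows "X \<in> borel_measurable M"
  and "integrable M (\<lambda>w. X w ^ n)"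
  and "(\<integral>w. X w ^ 4 \<partial>M) = 3 * (\<integral>w. (X w)^2 \<partial>M)^2"
  and "(\<integral>w. cis (t * X w) \<partial>M) = complex_of_real (exp (- (t\<^sup>2 * (\<integral>w. (X w)^2 \<partial>M)) / 2))"
proof -
 let ?A = "\<integral>w. (X w)^2 \<partial>M"
 let ?B = "\<integral>w. X w ^ 4 \<partial>M"
 let ?C = "\<integral>w. cis (t * X w) \<partial>M"
 show X [measurable]: "X \<in> borel_measurable M" using assms by (simp add: centered_gaussian_def)
 have "integrable M (\<lambda>w. X w ^ n) \<and> ?B = 3 * ?A^2
   \<and> ?C = complex_of_real (exp (- (t\<^sup>2 * ?A) / 2))"
 proof (cases "AE w in M. X w = 0")
  case True
  have "integrable M (\<lambda>w. X w ^ n) \<longleftrightarrow> integrable M (\<lambda>w. 0 ^ n :: real)"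
   using True by (intro integrable_cong_AE) auto
  moreover have "?B = (\<integral>w. 0 \<partial>M)" "?A = (\<integral>w. 0 \<partial>M)"
   using True by (intro integral_cong_AE; auto)+
  moreover have "?C = (\<integral>w. 1 \<partial>M)"
   using True by (intro integral_cong_AE) (auto intro!: measurable_compose[of "\<lambda>w. t * X w" M borel cis] borel_measurable_continuous_onI continuous_intros)
  ultimately show ?thesis by (simp add: prob_space)
 next
  case False
  then obtain \<sigma> where \<sigma>: "0 < \<sigma>" and D: "distributed M lborel X (normal_density 0 \<sigma>)"
   using assms by (auto simp: centered_gaussian_def)
  have Dn: "AE x in lborel. 0 \<le> normal_density 0 \<sigma> x" by simp
  have "integrable M (\<lambda>w. X w ^ n) = integrable lborel (\<lambda>x. normal_density 0 \<sigma> x * x ^ n)"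
   by (rule distributed_integrable[OF D, symmetric]) auto
  then have 1: "integrable M (\<lambda>w. X w ^ n)" using integrable_normal_moment[OF \<sigma>, of 0 n] by simp
  have mom: "(\<integral>w. X w ^ m \<partial>M) = (\<integral>x. normal_density 0 \<sigma> x * x ^ m \<partial>lborel)" for m
   by (rule distributed_integral[OF D, symmetric]) auto
  have 2: "?A = \<sigma>\<^sup>2" "?B = 3 * \<sigma> ^ 4"
  proof -
   have "(\<integral>x. normal_density 0 \<sigma> x * x\<^sup>2 \<partial>lborel) = \<sigma>\<^sup>2"
    using integral_normal_moment_even[OF \<sigma>, of 0 1] \<sigma> by (simp add: fact_numeral)
   moreover have "(\<integral>x. normal_density 0 \<sigma> x * x ^ 4 \<partial>lborel) = 3 * \<sigma> ^ 4"
    using integral_normal_moment_even[OF \<sigma>, of 0 2] \<sigma> by (simp add: fact_numeral power_divide power_mult[symmetric])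
   ultimately show "?A = \<sigma>\<^sup>2" "?B = 3 * \<sigma> ^ 4"
    unfolding mom by auto
  qed
  have "distr M lborel X = distr M borel X" by (rule distr_cong) auto
  then have "?C = char (density lborel (normal_density 0 \<sigma>)) t"
   using distributed_distr_eq_density[OF D] by (simp add: char_distr_cis[symmetric])
  with 1 2 \<sigma> show ?thesis by (simp add: char_normal[OF \<sigma>] power_mult[symmetric])
 qed
 then show "integrable M (\<lambda>w. X w ^ n)" "?B = 3 * ?A^2"
  "?C = complex_of_real (exp (- (t\<^sup>2 * ?A) / 2))" by auto
qed

text \<open>Levy's uniqueness theorem. For v = 0 the comparison is with the point mass at 0, as the
  normal density degenerates.\<close>

lemma (in prob_space) centered_gaussianI_char:
 assumes X [measurable]: "X \<in> borel_measurable M" and v: "0 \<le> v"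
  and char: "\<And>t. (\<integral>w. cis (t * X w) \<partial>M) = complex_of_real (exp (- (t\<^sup>2 * v) / 2))"
 shows "centered_gaussian M X" and "(\<integral>w. (X w)^2 \<partial>M) = v"
proof -
 let ?A = "\<integral>w. (X w)^2 \<partial>M"
 have rd: "real_distribution (distr M borel X)" by (rule real_distribution_distr) simp
 have *: "centered_gaussian M X \<and> ?A = v"
 proof (cases "v = 0")
  case True
  have "real_distribution (return borel (0::real))"
   by (simp add: real_distribution_def real_distribution_axioms_def prob_space_return)
  moreover have "char (return borel (0::real)) = char (distr M borel X)"
   by (rule ext) (simp add: char_distr_cis char True, simp add: char_def integral_return)
  ultimately have eq: "distr M borel X = return borel 0" using Levy_uniqueness[OF _ rd] by metis
  have "AE x in distr M borel X. x = 0" unfolding eq by (simp add: AE_return)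
  then have ae: "AE w in M. X w = 0" by (subst (asm) AE_distr_iff) auto
  moreover have "?A = (\<integral>w. 0 \<partial>M)" using ae by (intro integral_cong_AE) auto
  ultimately show ?thesis by (simp add: centered_gaussian_def True)
 next
  case False
  define \<sigma> where "\<sigma> = sqrt v"
  have \<sigma>: "0 < \<sigma>" "\<sigma>\<^sup>2 = v" using v False by (auto simp: \<sigma>_def)
  have "real_distribution (density lborel (normal_density 0 \<sigma>))"
   using prob_space_normal_density[OF \<sigma>(1)] by (simp add: real_distribution_def real_distribution_axioms_def)
  moreover have "char (density lborel (normal_density 0 \<sigma>)) = char (distr M borel X)"
   by (rule ext) (simp add: char_distr_cis char char_normal[OF \<sigma>(1)] \<sigma>(2))
  ultimately have "distr M borel X = density lborel (normal_density 0 \<sigma>)" using Levy_uniqueness[OF _ rd] by metis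
  moreover have "distr M lborel X = distr M borel X" by (rule distr_cong) auto
  ultimately have D: "distributed M lborel X (normal_density 0 \<sigma>)" by (simp add: distributed_def)
  have "?A = (\<integral>x. normal_density 0 \<sigma> x * x\<^sup>2 \<partial>lborel)"
   by (rule distributed_integral[OF D, symmetric]) auto
  also have "... = v" using integral_normal_moment_even[OF \<sigma>(1), of 0 1] \<sigma> by (simp add: fact_numeral)
  finally show ?thesis using D \<sigma>(1) by (auto simp: centered_gaussian_def)
 qed
 then show "centered_gaussian M X" "?A = v" by auto
qed

subsection \<open>White noise\<close>

lemma prob_space_std_normal: "prob_space \<N>"
 by (rule prob_space_normal_density) simp

interpretation gauss: product_prob_space "\<lambda>_. \<N>" "UNIV :: freq set"
 using prob_space_std_normal by (intro product_prob_spaceI)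

definition gauss_seq :: "(freq \<Rightarrow> real) measure"
 where "gauss_seq = (\<Pi>\<^sub>M k\<in>UNIV. \<N>)"

lemma sets_gauss_seq [measurable_cong, simp]: "sets gauss_seq = sets borel"
proof -
 have "sets gauss_seq = sets (\<Pi>\<^sub>M k\<in>UNIV::freq set. (borel :: real measure))"
  unfolding gauss_seq_def by (intro sets_PiM_cong) auto
 then show ?thesis by (simp add: sets_PiM_equal_borel)
qed

lemma space_gauss_seq [simp]: "space gauss_seq = UNIV"
 using sets_eq_imp_space_eq[OF sets_gauss_seq] by simp

lemma prob_space_gauss_seq: "prob_space gauss_seq"
 unfolding gauss_seq_def by (rule prob_space_PiM) (rule prob_space_std_normal)

interpretation gs: prob_space gauss_seq
 by (rule prob_space_gauss_seq)

lemma distr_gauss_seq_restrict: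
 assumes "finite J"
 shows "distr gauss_seq (\<Pi>\<^sub>M k\<in>J. \<N>) (\<lambda>x. restrict x J) = (\<Pi>\<^sub>M k\<in>J. \<N>)"
 unfolding gauss_seq_def using gauss.distr_PiM_restrict_finite[OF assms] by simp

lemma measurable_gauss_seq_restrict:
 "(\<lambda>x. restrict x J) \<in> measurable gauss_seq (\<Pi>\<^sub>M k\<in>J. \<N>)"
 unfolding gauss_seq_def by (rule measurable_restrict_subset) simp

lemma measurable_prod_component:
 fixes h :: "'k \<Rightarrow> real \<Rightarrow> 'b::{real_normed_field, second_countable_topology}"
 assumes "\<And>k. k \<in> J \<Longrightarrow> h k \<in> borel_measurable borel"
 shows "(\<lambda>x. \<Prod>k\<in>J. h k (x k)) \<in> borel_measurable (\<Pi>\<^sub>M k\<in>J. \<N>)"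
proof (rule borel_measurable_prod)
 let ?A = "\<Pi>\<^sub>M k\<in>J. \<N>"
 fix k assume k: "k \<in> J"
 have "(\<lambda>x. x k) \<in> measurable ?A \<N>"
  using k by (rule measurable_component_singleton)
 then have "(\<lambda>x. x k) \<in> borel_measurable ?A"
  by (simp add: measurable_def)
 then show "(\<lambda>x. h k (x k)) \<in> borel_measurable ?A"
  using assms[OF k] by (rule measurable_compose)
qed

lemma integral_gauss_seq_prod:
 fixes h :: "freq \<Rightarrow> real \<Rightarrow> complex"
 assumes J: "finite J" and h: "\<And>k. k \<in> J \<Longrightarrow> integrable \<N> (h k)"
 shows "(\<integral>a. (\<Prod>k\<in>J. h k (a k)) \<partial>gauss_seq) = (\<Prod>k\<in>J. \<integral>x. h k x \<partial>\<N>)"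
proof -
 have hm: "h k \<in> borel_measurable borel" if "k \<in> J" for k
  using borel_measurable_integrable[OF h[OF that]] by simp
 have "(\<integral>a. (\<Prod>k\<in>J. h k (a k)) \<partial>gauss_seq) = (\<integral>a. (\<Prod>k\<in>J. h k (restrict a J k)) \<partial>gauss_seq)"
  by (intro Bochner_Integration.integral_cong refl prod.cong) auto
 also have "... = (\<integral>b. (\<Prod>k\<in>J. h k (b k)) \<partial>distr gauss_seq (\<Pi>\<^sub>M k\<in>J. \<N>) (\<lambda>x. restrict x J))"
  by (rule integral_distr[symmetric, OF measurable_gauss_seq_restrict measurable_prod_component[OF hm]])
 also have "... = (\<Prod>k\<in>J. \<integral>x. h k x \<partial>\<N>)"
  unfolding distr_gauss_seq_restrict[OF J] by (rule gauss.product_integral_prod[OF J h])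
 finally show ?thesis .
qed

lemma nn_integral_gauss_seq_prod:
 fixes h :: "freq \<Rightarrow> real \<Rightarrow> real"
 assumes J: "finite J" and hm: "\<And>k. k \<in> J \<Longrightarrow> h k \<in> borel_measurable borel"
  and h0: "\<And>k x. 0 \<le> h k x"
 shows "(\<integral>\<^sup>+a. ennreal (\<Prod>k\<in>J. h k (a k)) \<partial>gauss_seq) = (\<Prod>k\<in>J. \<integral>\<^sup>+x. ennreal (h k x) \<partial>\<N>)"
proof -
 have m: "(\<lambda>b. ennreal (\<Prod>k\<in>J. h k (b k))) \<in> borel_measurable (\<Pi>\<^sub>M k\<in>J. \<N>)"
  by (rule measurable_compose[OF measurable_prod_component[of J h] measurable_ennreal]) (rule hm)
 have "(\<integral>\<^sup>+a. ennreal (\<Prod>k\<in>J. h k (a k)) \<partial>gauss_seq) = (\<integral>\<^sup>+a. ennreal (\<Prod>k\<in>J. h k (restrict a J k)) \<partial>gauss_seq)"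
  by (intro nn_integral_cong arg_cong[where f = ennreal] prod.cong) auto
 also have "... = (\<integral>\<^sup>+b. ennreal (\<Prod>k\<in>J. h k (b k)) \<partial>distr gauss_seq (\<Pi>\<^sub>M k\<in>J. \<N>) (\<lambda>x. restrict x J))"
  by (rule nn_integral_distr[symmetric, OF measurable_gauss_seq_restrict]) (simp add: m)
 also have "... = (\<integral>\<^sup>+b. (\<Prod>k\<in>J. ennreal (h k (b k))) \<partial>(\<Pi>\<^sub>M k\<in>J. \<N>))"
  unfolding distr_gauss_seq_restrict[OF J] using h0 by (simp add: prod_ennreal)
 also have "... = (\<Prod>k\<in>J. \<integral>\<^sup>+x. ennreal (h k x) \<partial>\<N>)"
  using hm by (intro gauss.product_nn_integral_prod[OF J]) auto
 finally show ?thesis .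
qed

lemma cis_sum: "cis (sum f J) = (\<Prod>k\<in>J. cis (f k))"
 by (induction J rule: infinite_finite_induct) (auto simp: cis_mult[symmetric])

lemma integral_cis_std_normal: "(\<integral>x. cis (t * x) \<partial>\<N>) = complex_of_real (exp (- t\<^sup>2 / 2))"
 using char_normal[of 1 t] by (simp add: char_def cis_conv_exp)

lemma integrable_cis_std_normal: "integrable \<N> (\<lambda>x. cis (t * x))"
 using prob_space.integrable_cis[OF prob_space_std_normal, of "\<lambda>x. t * x"] by simp

lemma gauss_seq_char:
 assumes "finite J"
 shows "(\<integral>a. cis (lin_form J t a) \<partial>gauss_seq) = complex_of_real (exp (- (\<Sum>k\<in>J. (t k)^2) / 2))"
proof -
 have "(\<integral>a. cis (lin_form J t a) \<partial>gauss_seq) = (\<integral>a. (\<Prod>k\<in>J. cis (t k * a k)) \<partial>gauss_seq)"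
  by (simp add: lin_form_def cis_sum)
 also have "... = (\<Prod>k\<in>J. complex_of_real (exp (- (t k)\<^sup>2 / 2)))"
  using integral_gauss_seq_prod[OF assms, of "\<lambda>k x. cis (t k * x)"]
  by (simp add: integrable_cis_std_normal integral_cis_std_normal)
 also have "... = complex_of_real (exp (\<Sum>k\<in>J. - (t k)\<^sup>2 / 2))"
  using assms by (simp add: exp_sum)
 also have "(\<Sum>k\<in>J. - (t k)\<^sup>2 / 2) = - (\<Sum>k\<in>J. (t k)^2) / 2"
  by (simp add: sum_divide_distrib sum_negf)
 finally show ?thesis .
qed

lemma nn_integral_std_normal_square: "(\<integral>\<^sup>+x. ennreal (x\<^sup>2) \<partial>\<N>) = 1"
proof -
 have hb: "has_bochner_integral lborel (\<lambda>x. std_normal_density x * x\<^sup>2) 1"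
  using std_normal_moment_even[of 1] by (simp add: fact_numeral)
 have "(\<integral>\<^sup>+x. ennreal (x\<^sup>2) \<partial>\<N>) = (\<integral>\<^sup>+x. ennreal (std_normal_density x * x\<^sup>2) \<partial>lborel)"
  by (subst nn_integral_density) (auto simp: ennreal_mult)
 also have "... = ennreal (\<integral>x. std_normal_density x * x\<^sup>2 \<partial>lborel)"
  using hb by (intro nn_integral_eq_integral) (auto simp: has_bochner_integral_iff)
 also have "... = 1" using hb by (simp add: has_bochner_integral_iff)
 finally show ?thesis .
qed

lemma measurable_coordinate [measurable]: "(\<lambda>a :: freq \<Rightarrow> real. a k) \<in> borel_measurable borel"
 by (rule borel_measurable_continuous_onI[OF continuous_on_product_coordinates])

lemma gauss_seq_square: "(\<integral>\<^sup>+a. ennreal ((a k)^2) \<partial>gauss_seq) = 1"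
 using nn_integral_gauss_seq_prod[of "{k}" "\<lambda>_ x. x\<^sup>2"] by (simp add: nn_integral_std_normal_square)

lemma measurable_gauss_seq_eq [simp]: "measurable gauss_seq N = measurable borel N"
 by (rule measurable_cong_sets) auto

lemma AE_gauss_seq_admissible: "AE a in gauss_seq. admissible a"
 using gs.AE_admissible[of "\<lambda>a. a"] by (simp add: gauss_seq_square)

lemma zero_average_cas_coeff: "f \<in> \<Z> \<Longrightarrow> cas_coeff f 0 = 0"
 by (simp add: zero_average_test_functions_def cas_coeff_def)

lemma zero_averageD: "f \<in> \<Z> \<Longrightarrow> f \<in> \<D>"
 by (simp add: zero_average_test_functions_def)

lemma zero_average_lincomb:
 assumes "f \<in> \<Z>" "g \<in> \<Z>"
 shows "(\<lambda>z. c * f z + d * g z) \<in> \<Z>"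
 using assms by (auto simp: zero_average_test_functions_def test_functions_lincomb integrable_test_function)

lemma zero_average_cas_sum:
 assumes "0 \<notin> J"
 shows "(\<lambda>z. \<Sum>k\<in>J. c k * cas k z) \<in> \<Z>"
 using assms by (auto simp: zero_average_test_functions_def integral_cas intro!: sum.neutral)

lemma zero_average_cas: "k \<noteq> 0 \<Longrightarrow> cas k \<in> \<Z>"
 by (simp add: zero_average_test_functions_def integral_cas)

text \<open>Almost surely the pairing is the limit of finite Gaussian sums, so dominated convergence
  applies to their characteristic functions; the variances converge by Parseval's identity.\<close>

lemma white_noise_char:
 assumes f: "f \<in> \<Z>"
 shows "(\<integral>a. cis (t * pairing (synth a) f) \<partial>gauss_seq) = complex_of_real (exp (- (t\<^sup>2 * (\<integral>z. f z * f z \<partial>\<T>)) / 2))"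
proof -
 let ?A = "\<lambda>k. t * cas_coeff f k"
 note tf = zero_averageD[OF f]
 define s where "s n = (\<Sum>k\<in>grid n - {0}. cas_coeff f k * cas_coeff f k)" for n
 have "(\<lambda>n. \<integral>a. cis (lin_form (grid n - {0}) ?A a) \<partial>gauss_seq)
   \<longlonglongrightarrow> (\<integral>a. cis (t * pairing (synth a) f) \<partial>gauss_seq)"
 proof (rule integral_dominated_convergence[where w = "\<lambda>_. 1"])
  have cm: "cis \<in> borel_measurable borel" by (intro borel_measurable_continuous_onI continuous_intros)
  show "(\<lambda>a. cis (t * pairing (synth a) f)) \<in> borel_measurable gauss_seq"
   by (rule measurable_compose[OF _ cm]) measurable
  show "(\<lambda>a. cis (lin_form (grid n - {0}) ?A a)) \<in> borel_measurable gauss_seq" for n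
   by (rule measurable_compose[OF _ cm]) (simp add: borel_measurable_continuous_onI[OF continuous_lin_form])
  show "AE a in gauss_seq. (\<lambda>n. cis (lin_form (grid n - {0}) ?A a)) \<longlonglongrightarrow> cis (t * pairing (synth a) f)"
   using AE_gauss_seq_admissible
  proof eventually_elim
   case (elim a)
   have "(\<lambda>n. t * (\<Sum>k\<in>grid n - {0}. a k * cas_coeff f k)) \<longlonglongrightarrow> t * pairing (synth a) f"
    using has_sum_grid[OF summable_on_coeff_mult[OF tf elim]] elim tf
    by (intro tendsto_mult_left) (simp add: pairing_synth synth_fun_def)
   moreover have "t * (\<Sum>k\<in>grid n - {0}. a k * cas_coeff f k) = lin_form (grid n - {0}) ?A a" for n
    by (simp add: lin_form_def sum_distrib_left mult_ac)
   ultimately show ?case by (intro tendsto_cis) simp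
  qed
 qed auto
 moreover have "(\<integral>a. cis (lin_form (grid n - {0}) ?A a) \<partial>gauss_seq)
   = complex_of_real (exp (- (t\<^sup>2 * s n) / 2))" for n
  by (subst gauss_seq_char) (auto simp: s_def power_mult_distrib sum_distrib_left power2_eq_square mult_ac)
 moreover have "(\<lambda>n. complex_of_real (exp (- (t\<^sup>2 * s n) / 2))) \<longlonglongrightarrow> complex_of_real (exp (- (t\<^sup>2 * (\<integral>z. f z * f z \<partial>\<T>)) / 2))"
 proof -
  have "s = (\<lambda>n. \<Sum>k\<in>grid n. cas_coeff f k * cas_coeff f k)"
   unfolding s_def using zero_average_cas_coeff[OF f] by (intro ext sum.mono_neutral_left) auto
  then have "s \<longlonglongrightarrow> (\<integral>z. f z * f z \<partial>\<T>)"
   using Parseval_test_functions[OF tf tf] by simp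
  then show ?thesis by (intro tendsto_intros) auto
 qed
 ultimately show ?thesis using LIMSEQ_unique by (simp only:) blast
qed

text \<open>White noise arises by synthesis from independent standard Gaussians, and its covariance
  follows from the variance by polarisation. Existence has to be proved because
  \<open>white_noise_law\<close> is a choice.\<close>

lemma white_noise_exists: "is_white_noise_law (distr gauss_seq borel synth)"
proof -
 have sm: "synth \<in> measurable gauss_seq borel" by simp
 interpret W: prob_space "distr gauss_seq borel synth"
  by (rule gs.prob_space_distr[OF sm])
 define W where "W = distr gauss_seq borel synth"
 have pm [measurable]: "(\<lambda>x. pairing x f) \<in> borel_measurable W" for f by (simp add: W_def)
 have char: "(\<integral>x. cis (t * pairing x f) \<partial>W) = complex_of_real (exp (- (t\<^sup>2 * (\<integral>z. f z * f z \<partial>\<T>)) / 2))"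
  if "f \<in> \<Z>" for f t
 proof -
  have "(\<lambda>x. cis (t * pairing x f)) \<in> borel_measurable borel"
   by (rule measurable_compose[of "\<lambda>x. t * pairing x f" borel borel cis])
     (auto intro!: borel_measurable_continuous_onI[of cis] continuous_intros)
  then have "(\<integral>x. cis (t * pairing x f) \<partial>W) = (\<integral>a. cis (t * pairing (synth a) f) \<partial>gauss_seq)"
   unfolding W_def by (rule integral_distr[OF sm])
  then show ?thesis using white_noise_char[OF that] by simp
 qed
 have sq0: "0 \<le> (\<integral>z. f z * f z \<partial>\<T>)" for f :: "plane \<Rightarrow> real"
  by (rule Bochner_Integration.integral_nonneg) simp
 have gauss: "centered_gaussian W (\<lambda>x. pairing x f)" and var: "(\<integral>x. (pairing x f)^2 \<partial>W) = (\<integral>z. f z * f z \<partial>\<T>)"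
  if "f \<in> \<Z>" for f
  using W.centered_gaussianI_char[of "\<lambda>x. pairing x f", OF _ sq0] char[OF that] by (auto simp: W_def)
 have cov: "(\<integral>x. pairing x f * pairing x g \<partial>W) = (\<integral>z. f z * g z \<partial>\<T>)"
  if f: "f \<in> \<Z>" and g: "g \<in> \<Z>" for f g
 proof -
  note tf = zero_averageD[OF f] zero_averageD[OF g]
  have add: "(\<lambda>z. f z + g z) \<in> \<Z>" using zero_average_lincomb[OF f g, of 1 1] by simp
  have int: "integrable W (\<lambda>x. (pairing x h)^2)" if "h \<in> \<Z>" for h
   using W.centered_gaussian_properties(2)[of _ 2] gauss[OF that] by (simp add: W_def)
  have intm: "integrable W (\<lambda>x. pairing x f * pairing x g)"
   by (rule integrable_mult_of_squares[OF pm pm int[OF f] int[OF g]])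
  have "(\<integral>x. (pairing x (\<lambda>z. f z + g z))^2 \<partial>W)
    = (\<integral>x. (pairing x f)^2 + (pairing x g)^2 + 2 * (pairing x f * pairing x g) \<partial>W)"
   using tf by (intro Bochner_Integration.integral_cong refl) (simp add: pairing_add power2_sum)
  also have "... = (\<integral>x. (pairing x f)^2 \<partial>W) + (\<integral>x. (pairing x g)^2 \<partial>W) + 2 * (\<integral>x. pairing x f * pairing x g \<partial>W)"
   using int[OF f] int[OF g] intm by simp
  finally have 1: "(\<integral>z. (f z + g z) * (f z + g z) \<partial>\<T>)
    = (\<integral>z. f z * f z \<partial>\<T>) + (\<integral>z. g z * g z \<partial>\<T>) + 2 * (\<integral>x. pairing x f * pairing x g \<partial>W)"
   unfolding var[OF add] var[OF f] var[OF g] .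
  have "(\<integral>z. (f z + g z) * (f z + g z) \<partial>\<T>)
    = (\<integral>z. f z * f z + g z * g z + 2 * (f z * g z) \<partial>\<T>)"
   by (intro Bochner_Integration.integral_cong refl) (simp add: algebra_simps)
  also have "... = (\<integral>z. f z * f z \<partial>\<T>) + (\<integral>z. g z * g z \<partial>\<T>) + 2 * (\<integral>z. f z * g z \<partial>\<T>)"
   using integrable_test_function_mult tf by simp
  finally show ?thesis using 1 by simp
 qed
 have one: "pairing (synth a) (\<lambda>z. 1) = 0" for a
 proof -
  have "a k * cas_coeff (\<lambda>z. 1) k = 0" if "k \<noteq> 0" for k
   using that by (simp add: cas_coeff_def integral_cas)
  then have "(\<Sum>\<^sub>\<infinity>k\<in>- {0}. a k * cas_coeff (\<lambda>z. 1) k) = 0" by (intro infsum_0) auto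
  then show ?thesis by (simp add: pairing_synth synth_fun_def)
 qed
 have "AE x in W. pairing x (\<lambda>z. 1) = 0"
  unfolding W_def by (subst AE_distr_iff[OF sm]) (auto simp: one)
 then show ?thesis
  using gauss cov W.prob_space_axioms unfolding is_white_noise_law_def W_def by simp
qed

text \<open>Everything inside is derived from the characterising property alone, since the chosen
  \<open>white_noise_law\<close> is not known to be the law just constructed.\<close>

locale white_noise =
 fixes M :: "distribution measure"
 assumes law: "is_white_noise_law M"
begin

sublocale prob_space M
 using law by (simp add: is_white_noise_law_def)

lemma sets_M [measurable_cong, simp]: "sets M = sets borel"
 using law by (simp add: is_white_noise_law_def)

lemma measurable_M_eq [simp]: "measurable M N = measurable borel N"
 by (rule measurable_cong_sets) auto

lemma space_M [simp]: "space M = UNIV"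
 using sets_eq_imp_space_eq[OF sets_M] by simp

lemma gaussian: "f \<in> \<Z> \<Longrightarrow> centered_gaussian M (\<lambda>x. pairing x f)"
 using law by (simp add: is_white_noise_law_def)

lemma covariance:
 "f \<in> \<Z> \<Longrightarrow> g \<in> \<Z> \<Longrightarrow>
  (\<integral>x. pairing x f * pairing x g \<partial>M) = (\<integral>z. f z * g z \<partial>\<T>)"
 using law by (simp add: is_white_noise_law_def)

lemma AE_zero_average: "AE x in M. pairing x (\<lambda>z. 1) = 0"
 using law by (simp add: is_white_noise_law_def)

lemma char_pairing:
 assumes "f \<in> \<Z>"
 shows "(\<integral>x. cis (pairing x f) \<partial>M) = complex_of_real (exp (- (\<integral>z. f z * f z \<partial>\<T>) / 2))"
 using centered_gaussian_properties(4)[OF gaussian[OF assms], of 1] covariance[OF assms assms]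
 by (simp add: power2_eq_square)

lemma lin_form_coeffs:
 assumes "finite J"
 shows "lin_form J t (coeffs x) = pairing x (\<lambda>z. \<Sum>k\<in>J - {0}. t k * cas k z)"
proof -
 have "lin_form J t (coeffs x) = (\<Sum>k\<in>J - {0}. t k * pairing x (cas k))"
  unfolding lin_form_def using assms by (intro sum.mono_neutral_cong_right) (auto simp: coeffs_def)
 also have "... = pairing x (\<lambda>z. \<Sum>k\<in>J - {0}. t k * cas k z)"
  by (subst pairing_sum) (auto simp: pairing_scale test_functions_scale)
 finally show ?thesis .
qed

lemma char_coeffs:
 assumes J: "finite J"
 shows "(\<integral>x. cos (lin_form J t (coeffs x) + s) \<partial>M) = Re (cis s * complex_of_real (exp (- (\<Sum>k\<in>J - {0}. (t k)^2) / 2)))"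
proof -
 have za: "(\<lambda>z. \<Sum>k\<in>J - {0}. t k * cas k z) \<in> \<Z>"
  by (rule zero_average_cas_sum) simp
 have "(\<integral>z. (\<Sum>k\<in>J - {0}. t k * cas k z) * (\<Sum>k\<in>J - {0}. t k * cas k z) \<partial>\<T>) = (\<Sum>k\<in>J - {0}. (t k)^2)"
  using integral_cas_sum_squared(2)[of "J - {0}" t] J by (simp add: power2_eq_square)
 then show ?thesis
  unfolding lin_form_coeffs[OF J] by (subst integral_cos_shift) (auto simp: char_pairing[OF za])
qed

lemma coeffs_square: "(\<integral>\<^sup>+x. ennreal ((coeffs x k)^2) \<partial>M) \<le> 1"
proof (cases "k = 0")
 case False
 note za = zero_average_cas[OF False]
 have "(\<integral>\<^sup>+x. ennreal ((coeffs x k)^2) \<partial>M) = ennreal (\<integral>x. (pairing x (cas k))^2 \<partial>M)"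
  using False centered_gaussian_properties(2)[OF gaussian[OF za], of 2]
  by (simp add: coeffs_def nn_integral_eq_integral)
 also have "... = 1" using covariance[OF za za] by (simp add: integral_cas_mult_cas power2_eq_square)
 finally show ?thesis by simp
qed (simp add: coeffs_def)

lemma AE_coeffs_admissible: "AE x in M. admissible (coeffs x)"
 by (rule AE_admissible) (auto simp: coeffs_square)

text \<open>Lets functionals of the noise be read as functionals of its coefficients, on which boxes
  and \<open>clip\<close> act.\<close>

lemma AE_synth_coeffs: "AE x in M. synth (coeffs x) = x"
 using AE_coeffs_admissible AE_zero_average by eventually_elim (rule synth_coeffs)

end

lemma white_noise_law: "is_white_noise_law \<W>"
 unfolding white_noise_law_def by (rule someI[of is_white_noise_law, OF white_noise_exists])

interpretation wn: white_noise \<W>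
 by (rule white_noise.intro[OF white_noise_law])

subsection \<open>Independent particles\<close>

lemma prob_space_particles: "prob_space (particles N)"
 by (rule prob_space_PiM) (rule torus.prob_space_axioms)

text \<open>Fubini in the i-th position. The orthogonality relations below come from a particle that
  enters just one of two factors, with mean zero.\<close>

lemma integral_particle_zero:
 fixes F :: "(nat \<Rightarrow> plane) \<Rightarrow> real"
 assumes i: "i < N" and F: "integrable (particles N) F"
  and 0: "\<And>x. (\<integral>y. F (x(i := y)) \<partial>\<T>) = 0"
 shows "(\<integral>x. F x \<partial>particles N) = 0"
proof -
 have eq: "insert i {..<N} = {..<N}" using i by auto
 have "(\<integral>x. F x \<partial>(\<Pi>\<^sub>M i\<in>insert i ({..<N} - {i}). \<T>))
   = (\<integral>x. (\<integral>y. F (x(i := y)) \<partial>\<T>) \<partial>(\<P> ({..<N} - {i})))"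
  using F by (intro torus_product.product_integral_insert) (auto simp: eq)
 then show ?thesis by (simp add: 0 eq)
qed

lemma nn_integral_particle:
 assumes i: "i < N" and [measurable]: "f \<in> borel_measurable borel"
 shows "(\<integral>\<^sup>+x. f (x i) \<partial>particles N) = (\<integral>\<^sup>+z. f z \<partial>\<T>)"
proof -
 have eq: "insert i {..<N} = {..<N}" using i by auto
 have fm: "(\<lambda>x. f (x i)) \<in> borel_measurable (\<Pi>\<^sub>M i\<in>insert i ({..<N} - {i}). \<T>)"
  by (rule measurable_compose[OF measurable_torus_component]) auto
 have "(\<integral>\<^sup>+x. f (x i) \<partial>(\<Pi>\<^sub>M i\<in>insert i ({..<N} - {i}). \<T>))
   = (\<integral>\<^sup>+x. (\<integral>\<^sup>+y. f ((x(i := y)) i) \<partial>\<T>) \<partial>(\<P> ({..<N} - {i})))"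
  by (rule torus_product.product_nn_integral_insert[OF _ _ fm]) auto
 then show ?thesis
  using prob_space.emeasure_space_1[OF prob_space_PiM[OF torus.prob_space_axioms], of "{..<N} - {i}"] by (simp add: eq)
qed

lemma nn_integral_particle_pair:
 assumes ij: "i < N" "j < N" "i \<noteq> j" and [measurable]: "f \<in> borel_measurable borel" and per: "periodic f"
 shows "(\<integral>\<^sup>+x. f (x i - x j) \<partial>particles N) = (\<integral>\<^sup>+z. f z \<partial>\<T>)"
proof -
 have eq: "insert j {..<N} = {..<N}" using ij by auto
 have fm: "(\<lambda>x. f (x i - x j)) \<in> borel_measurable (\<Pi>\<^sub>M i\<in>insert j ({..<N} - {j}). \<T>)"
  using ij by (intro measurable_pair_difference) auto
 have "(\<integral>\<^sup>+x. f (x i - x j) \<partial>(\<Pi>\<^sub>M i\<in>insert j ({..<N} - {j}). \<T>))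
   = (\<integral>\<^sup>+x. (\<integral>\<^sup>+y. f ((x(j := y)) i - (x(j := y)) j) \<partial>\<T>) \<partial>(\<P> ({..<N} - {j})))"
  by (rule torus_product.product_nn_integral_insert[OF _ _ fm]) auto
 then show ?thesis
  using prob_space.emeasure_space_1[OF prob_space_PiM[OF torus.prob_space_axioms], of "{..<N} - {j}"] ij
  by (simp add: eq nn_integral_torus_reflect[OF per])
qed

text \<open>For k \<noteq> 0 the N variables \<open>cas k (x j)\<close> are centred, normalised and
  orthogonal, which is what the factor 1 / sqrt N is made for.\<close>

lemma emp_coeffs_square: "(\<integral>\<^sup>+x. ennreal ((emp_coeffs N x k)^2) \<partial>particles N) \<le> 1"
proof (cases "k = 0 \<or> N = 0")
 case False
 then have k: "k \<noteq> 0" and N: "0 < N" by auto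
 have m: "(\<lambda>x. cas k (x j)) \<in> borel_measurable (particles N)" if "j \<in> {..<N}" for j
  using that by (intro measurable_compose[OF measurable_torus_component measurable_cas])
 have "(\<integral>\<^sup>+z. ennreal ((cas k z)^2) \<partial>\<T>) = ennreal (\<integral>z. cas k z * cas k z \<partial>\<T>)"
  unfolding power2_eq_square by (intro nn_integral_eq_integral integrable_cas_mult) auto
 then have nn: "(\<integral>\<^sup>+x. ennreal ((cas k (x j))^2) \<partial>particles N) = 1" if "j \<in> {..<N}" for j
  using that nn_integral_particle[of j N "\<lambda>z. ennreal ((cas k z)^2)"] by (simp add: integral_cas_mult_cas)
 have sq: "integrable (particles N) (\<lambda>x. (cas k (x j))^2)" if "j \<in> {..<N}" for j
  using m[OF that] nn[OF that] by (intro integrableI_nonneg) auto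
 have one: "(\<integral>x. (cas k (x j))^2 \<partial>particles N) = 1" if "j \<in> {..<N}" for j
  using nn[OF that] sq[OF that] by (simp add: nn_integral_eq_integral ennreal_eq_1)
 have orth: "(\<integral>x. cas k (x i) * cas k (x j) \<partial>particles N) = 0" if ij: "i \<in> {..<N}" "j \<in> {..<N}" "i \<noteq> j" for i j
  using ij k by (intro integral_particle_zero[of i, OF _ integrable_mult_of_squares[OF m m sq sq]]) (auto simp: integral_cas)
 note os = orthogonal_sum_square[OF finite_lessThan m sq orth]
 have eq: "(emp_coeffs N x k)^2 = (\<Sum>j<N. cas k (x j))^2 / real N" for x
  using k N by (simp add: emp_coeffs_def power_divide)
 show ?thesis unfolding eq using os one N by (subst nn_integral_eq_integral) auto
next
 case True
 then have "emp_coeffs N x k = 0" for x by (auto simp: emp_coeffs_def)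
 then show ?thesis by simp
qed

section \<open>The central limit theorem for the coefficients\<close>

lemma particles_char:
 assumes [measurable]: "g \<in> borel_measurable borel" and N: "0 < N"
 shows "(\<integral>x. cis (\<Sum>j<N. c * g (x j)) \<partial>particles N) = (\<integral>z. cis (c * g z) \<partial>\<T>) ^ N"
proof -
 have "(\<integral>x. (\<Prod>j<N. cis (c * g (x j))) \<partial>particles N) = (\<Prod>j<N. \<integral>z. cis (c * g z) \<partial>\<T>)"
  by (rule torus_product.product_integral_prod) (auto intro!: torus.integrable_cis)
 then show ?thesis by (simp add: cis_sum)
qed

lemma torus_char_approx:
 assumes g: "g \<in> borel_measurable borel" and B: "\<And>z. \<bar>g z\<bar> \<le> B" and 0: "(\<integral>z. g z \<partial>\<T>) = 0"
 shows "cmod ((\<integral>z. cis (t * g z) \<partial>\<T>) - (1 - t\<^sup>2 * (\<integral>z. (g z)^2 \<partial>\<T>) / 2)) \<le> \<bar>t\<bar> ^ 3 * B ^ 3 / 6"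
proof -
 have B0: "0 \<le> B" using order.trans[OF abs_ge_zero B] .
 have sqb: "(g z)^2 \<le> B\<^sup>2" for z using power_mono[OF B[of z] abs_ge_zero, of 2] by simp
 have int: "integrable \<T> g" "integrable \<T> (\<lambda>z. (g z)^2)"
  by (rule integrable_torus_bounded[of _ B], use g B in simp_all)
    (rule integrable_torus_bounded[of _ "B\<^sup>2"], use g sqb in simp_all)
 have "cmod (char (distr \<T> borel g) t - (1 - t\<^sup>2 * (\<integral>z. (g z)^2 \<partial>\<T>) / 2))
   \<le> (t\<^sup>2 / 6) * (\<integral>z. min (6 * (g z)^2) (\<bar>t\<bar> * \<bar>g z\<bar> ^ 3) \<partial>\<T>)"
  by (rule torus.char_approx3') (use g int 0 in auto)
 also have "... \<le> (t\<^sup>2 / 6) * (\<integral>z. \<bar>t\<bar> * B ^ 3 \<partial>\<T>)"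
 proof (intro mult_left_mono integral_mono)
  have le: "min (6 * (g z)^2) (\<bar>t\<bar> * \<bar>g z\<bar> ^ 3) \<le> \<bar>t\<bar> * B ^ 3" for z
   using power_mono[OF B[of z] abs_ge_zero, of 3] by (intro min.coboundedI2 mult_left_mono) auto
  show "min (6 * (g z)^2) (\<bar>t\<bar> * \<bar>g z\<bar> ^ 3) \<le> \<bar>t\<bar> * B ^ 3" for z by (rule le)
  have "0 \<le> min (6 * (g z)^2) (\<bar>t\<bar> * \<bar>g z\<bar> ^ 3)" for z by simp
  then show "integrable \<T> (\<lambda>z. min (6 * (g z)^2) (\<bar>t\<bar> * \<bar>g z\<bar> ^ 3))"
   using le g by (intro integrable_torus_bounded[of _ "\<bar>t\<bar> * B ^ 3"]) (auto simp: abs_of_nonneg)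
 qed auto
 also have "... = \<bar>t\<bar> ^ 3 * B ^ 3 / 6"
  using torus.prob_space by (simp add: power2_eq_square power3_eq_cube abs_mult_self_eq mult_ac)
 finally show ?thesis using g by (simp add: char_distr_cis)
qed

text \<open>For large N both bases have modulus at most 1, so the N-th powers differ by at most N
  times the difference of the bases. That difference is of order N^(-3/2), as g is bounded and
  centred, and \<open>w N ^ N\<close> is the usual exponential limit.\<close>

lemma particles_char_tendsto:
 assumes g: "g \<in> borel_measurable borel" and B: "\<And>z. \<bar>g z\<bar> \<le> B" and 0: "(\<integral>z. g z \<partial>\<T>) = 0"
 shows "(\<lambda>N. (\<integral>z. cis (1 / sqrt (real N) * g z) \<partial>\<T>) ^ N)
  \<longlonglongrightarrow> complex_of_real (exp (- (\<integral>z. (g z)^2 \<partial>\<T>) / 2))"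
proof -
 define v where "v = (\<integral>z. (g z)^2 \<partial>\<T>)"
 have v0: "0 \<le> v" by (simp add: v_def)
 have B0: "0 \<le> B" using order.trans[OF abs_ge_zero B] .
 define w where "w N = complex_of_real (1 + (- v / 2) / real N)" for N
 have lim: "(\<lambda>N. w N ^ N) \<longlonglongrightarrow> complex_of_real (exp (- v / 2))"
  unfolding w_def of_real_power[symmetric] by (intro tendsto_of_real tendsto_exp_limit_sequentially)
 have "(\<lambda>N. (\<integral>z. cis (1 / sqrt (real N) * g z) \<partial>\<T>) ^ N - w N ^ N) \<longlonglongrightarrow> 0"
 proof (rule Lim_null_comparison)
  obtain N0 :: nat where N0: "v \<le> real N0" using real_arch_simple by blast
  show "\<forall>\<^sub>F N in sequentially. norm ((\<integral>z. cis (1 / sqrt (real N) * g z) \<partial>\<T>) ^ N - w N ^ N) \<le> B ^ 3 / 6 * (1 / sqrt (real N))"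
   unfolding eventually_sequentially
  proof (intro exI[of _ "N0 + 1"] allI impI)
   fix N assume N: "N0 + 1 \<le> N"
   then have Npos: "0 < N" and vN: "v \<le> real N" using N0 by auto
   define t where "t = 1 / sqrt (real N)"
   have t: "0 < t" "t\<^sup>2 = 1 / real N" using Npos by (auto simp: t_def power_divide)
   have 1: "cmod (\<integral>z. cis (t * g z) \<partial>\<T>) \<le> 1"
   proof -
    have "cmod (\<integral>z. cis (t * g z) \<partial>\<T>) \<le> (\<integral>z. cmod (cis (t * g z)) \<partial>\<T>)"
     by (rule integral_norm_bound)
    then show ?thesis using torus.prob_space by simp
   qed
   have 2: "cmod (w N) \<le> 1"
   proof -
    have "0 \<le> v / 2 / real N" "v / 2 / real N \<le> 1" using v0 vN Npos by (auto simp: field_simps)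
    then show ?thesis unfolding w_def norm_of_real by (simp add: abs_le_iff)
   qed
   have "norm ((\<integral>z. cis (t * g z) \<partial>\<T>) ^ N - w N ^ N) \<le> real N * cmod ((\<integral>z. cis (t * g z) \<partial>\<T>) - w N)"
    by (rule norm_power_diff[OF 1 2])
   also have "... \<le> real N * (t ^ 3 * B ^ 3 / 6)"
   proof (rule mult_left_mono)
    have "w N = 1 - complex_of_real (t\<^sup>2) * complex_of_real v / 2"
     unfolding w_def t(2) by simp
    then show "cmod ((\<integral>z. cis (t * g z) \<partial>\<T>) - w N) \<le> t ^ 3 * B ^ 3 / 6"
     using torus_char_approx[OF g B 0, of t] t(1) by (simp add: v_def)
   qed simp
   also have "real N * (t ^ 3 * B ^ 3 / 6) = (real N * t\<^sup>2) * (t * B ^ 3 / 6)"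
    by (simp add: power2_eq_square power3_eq_cube)
   also have "... = B ^ 3 / 6 * t" using Npos t(2) by simp
   finally show "norm ((\<integral>z. cis (1 / sqrt (real N) * g z) \<partial>\<T>) ^ N - w N ^ N) \<le> B ^ 3 / 6 * (1 / sqrt (real N))"
    unfolding t_def .
  qed
  have "(\<lambda>N. 1 / sqrt (real N)) \<longlonglongrightarrow> 0"
   using tendsto_inverse_0_at_top[OF filterlim_compose[OF sqrt_at_top filterlim_real_sequentially]]
   by (simp add: inverse_eq_divide)
  then show "(\<lambda>N. B ^ 3 / 6 * (1 / sqrt (real N))) \<longlonglongrightarrow> 0"
   using tendsto_mult_left[of "\<lambda>N. 1 / sqrt (real N)" 0 sequentially "B ^ 3 / 6"] by simp
 qed
 from tendsto_add[OF this lim] show ?thesis by (simp add: v_def)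
qed

text \<open>A linear form in the coefficients is a normalised sum of one function \<psi> over the
  particles, so the joint limit reduces to the scalar central limit theorem. The mode 0 vanishes in
  \<open>emp_coeffs\<close> and is therefore removed from J in the variance.\<close>

lemma emp_coeffs_char_tendsto:
 assumes J: "finite J"
 shows "(\<lambda>N. \<integral>x. cos (lin_form J t (emp_coeffs N x) + s) \<partial>particles N)
  \<longlonglongrightarrow> Re (cis s * complex_of_real (exp (- (\<Sum>k\<in>J - {0}. (t k)^2) / 2)))"
proof -
 define \<psi> where "\<psi> z = (\<Sum>k\<in>J - {0}. t k * cas k z)" for z
 have za: "\<psi> \<in> \<Z>"
  unfolding \<psi>_def[abs_def] by (rule zero_average_cas_sum) simp
 have \<psi>m: "\<psi> \<in> borel_measurable borel" by (rule measurable_test_function[OF zero_averageD[OF za]])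
 obtain B where B: "\<And>z. \<bar>\<psi> z\<bar> \<le> B" using test_function_bounded[OF zero_averageD[OF za]] by blast
 have 0: "(\<integral>z. \<psi> z \<partial>\<T>) = 0" using za by (simp add: zero_average_test_functions_def)
 have var: "(\<integral>z. (\<psi> z)^2 \<partial>\<T>) = (\<Sum>k\<in>J - {0}. (t k)^2)"
  unfolding \<psi>_def using J by (intro integral_cas_sum_squared) simp
 have lf: "lin_form J t (emp_coeffs N x) = (\<Sum>j<N. 1 / sqrt (real N) * \<psi> (x j))" for N x
 proof -
  have "lin_form J t (emp_coeffs N x) = (\<Sum>k\<in>J - {0}. t k * ((\<Sum>j<N. cas k (x j)) / sqrt (real N)))"
   unfolding lin_form_def using J by (intro sum.mono_neutral_cong_right) (auto simp: emp_coeffs_def)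
  also have "... = (\<Sum>k\<in>J - {0}. \<Sum>j<N. 1 / sqrt (real N) * (t k * cas k (x j)))"
   by (intro sum.cong refl) (simp add: sum_divide_distrib sum_distrib_left)
  also have "... = (\<Sum>j<N. \<Sum>k\<in>J - {0}. 1 / sqrt (real N) * (t k * cas k (x j)))" by (rule sum.swap)
  finally show ?thesis by (simp only: \<psi>_def sum_distrib_left)
 qed
 have "(\<lambda>N. Re (cis s * (\<integral>z. cis (1 / sqrt (real N) * \<psi> z) \<partial>\<T>) ^ N))
   \<longlonglongrightarrow> Re (cis s * complex_of_real (exp (- (\<Sum>k\<in>J - {0}. (t k)^2) / 2)))"
  using particles_char_tendsto[OF \<psi>m B 0] unfolding var by (intro tendsto_Re tendsto_mult_left)
 moreover have "\<forall>\<^sub>F N in sequentially. Re (cis s * (\<integral>z. cis (1 / sqrt (real N) * \<psi> z) \<partial>\<T>) ^ N)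
   = (\<integral>x. cos (lin_form J t (emp_coeffs N x) + s) \<partial>particles N)"
  unfolding eventually_sequentially
 proof (intro exI[of _ 1] allI impI)
  fix N :: nat assume N: "1 \<le> N"
   have m: "(\<lambda>x. lin_form J t (emp_coeffs N x)) \<in> borel_measurable (particles N)"
   by (rule measurable_compose[OF measurable_emp_coeffs borel_measurable_continuous_onI[OF continuous_lin_form]])
  have "(\<integral>x. cos (lin_form J t (emp_coeffs N x) + s) \<partial>particles N) = Re (cis s * (\<integral>x. cis (lin_form J t (emp_coeffs N x)) \<partial>particles N))"
   by (rule prob_space.integral_cos_shift[OF prob_space_particles m])
  also have "(\<integral>x. cis (lin_form J t (emp_coeffs N x)) \<partial>particles N) = (\<integral>z. cis (1 / sqrt (real N) * \<psi> z) \<partial>\<T>) ^ N"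
   unfolding lf using N by (intro particles_char \<psi>m) simp
  finally show "Re (cis s * (\<integral>z. cis (1 / sqrt (real N) * \<psi> z) \<partial>\<T>) ^ N)
   = (\<integral>x. cos (lin_form J t (emp_coeffs N x) + s) \<partial>particles N)" ..
 qed
 ultimately show ?thesis by (rule Lim_transform_eventually)
qed

theorem emp_coeffs_convergence:
 fixes f :: "(freq \<Rightarrow> real) \<Rightarrow> real"
 assumes "continuous_on UNIV f" "\<And>x. \<bar>f x\<bar> \<le> B"
 shows "(\<lambda>N. \<integral>x. f (emp_coeffs N x) \<partial>particles N) \<longlonglongrightarrow> (\<integral>y. f (coeffs y) \<partial>\<W>)"
proof (rule coeff_law_convergence[OF prob_space_particles wn.prob_space_axioms _ _ emp_coeffs_square wn.coeffs_square _ assms])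
 show "(\<lambda>N. \<integral>x. cos (lin_form J t (emp_coeffs N x) + s) \<partial>particles N)
   \<longlonglongrightarrow> (\<integral>y. cos (lin_form J t (coeffs y) + s) \<partial>\<W>)" if "finite J" for J t s
  unfolding wn.char_coeffs[OF that] by (rule emp_coeffs_char_tendsto[OF that])
qed auto

text \<open>A constant sequence of laws turns the convergence theorem into a uniqueness theorem.
  Bounded continuous functions of the coefficients of the chosen white noise can thus be integrated
  with independent Gaussians.\<close>

lemma white_noise_coeff_law:
 fixes f :: "(freq \<Rightarrow> real) \<Rightarrow> real"
 assumes "continuous_on UNIV f" "\<And>x. \<bar>f x\<bar> \<le> B"
 shows "(\<integral>a. f (\<lambda>k. if k = 0 then 0 else a k) \<partial>gauss_seq) = (\<integral>y. f (coeffs y) \<partial>\<W>)"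
proof -
 let ?A = "\<integral>y. f (coeffs y) \<partial>\<W>"
 define X where "X = (\<lambda>a k :: freq. if k = 0 then 0 else a k :: real)"
 have Xm: "X \<in> borel_measurable gauss_seq"
  by (rule measurable_coordinatewise_then_product) (simp add: X_def)
 have sq: "(\<integral>\<^sup>+a. ennreal ((X a k)^2) \<partial>gauss_seq) \<le> 1" for k
  by (cases "k = 0") (auto simp: X_def gauss_seq_square)
 have char: "(\<integral>a. cos (lin_form J t (X a) + s) \<partial>gauss_seq) = (\<integral>y. cos (lin_form J t (coeffs y) + s) \<partial>\<W>)"
  if "finite J" for J t s
 proof -
  have lf: "lin_form J t (X a) = lin_form (J - {0}) t a" for a
   unfolding lin_form_def using that by (intro sum.mono_neutral_cong_right) (auto simp: X_def)
  have "(\<integral>a. cos (lin_form (J - {0}) t a + s) \<partial>gauss_seq) = Re (cis s * (\<integral>a. cis (lin_form (J - {0}) t a) \<partial>gauss_seq))"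
   by (rule gs.integral_cos_shift) (simp add: borel_measurable_continuous_onI[OF continuous_lin_form])
  then show ?thesis unfolding lf wn.char_coeffs[OF that] using that by (simp add: gauss_seq_char)
 qed
 have "(\<lambda>n::nat. \<integral>a. f (X a) \<partial>gauss_seq) \<longlonglongrightarrow> ?A"
  by (rule coeff_law_convergence[OF prob_space_gauss_seq wn.prob_space_axioms Xm _ sq wn.coeffs_square _ assms])
    (auto simp: char)
 then have "(\<integral>a. f (X a) \<partial>gauss_seq) = ?A"
  by (rule LIMSEQ_unique[OF tendsto_const])
 then show ?thesis by (simp add: X_def)
qed

subsection \<open>The Wick-ordered energy\<close>

text \<open>Polarisation: the fourth powers of the eight sums with signs on A, B, C, weighted by the
  product of the signs, add up to 8 * 24 = 192 times A B C D. The fourth moment of each sum is three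
  times its squared variance, and expanding the variances leaves the three pairings.\<close>

lemma (in prob_space) isserlis:
 fixes A B C D :: "'a \<Rightarrow> real"
 assumes G: "\<And>a b c d. centered_gaussian M (\<lambda>w. a * A w + b * B w + c * C w + d * D w)"
 shows "integrable M (\<lambda>w. A w * B w * C w * D w)"
  and "(\<integral>w. A w * B w * C w * D w \<partial>M) = (\<integral>w. A w * B w \<partial>M) * (\<integral>w. C w * D w \<partial>M)
   + (\<integral>w. A w * C w \<partial>M) * (\<integral>w. B w * D w \<partial>M) + (\<integral>w. A w * D w \<partial>M) * (\<integral>w. B w * C w \<partial>M)"
proof -
 let ?A = "\<integral>w. A w * B w * C w * D w \<partial>M"
 define L where "L a b c w = a * A w + b * B w + c * C w + D w" for a b c w
 have gL: "centered_gaussian M (L a b c)" for a b c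
  using G[of a b c 1] by (simp add: L_def[abs_def])
 have g: "centered_gaussian M A" "centered_gaussian M B" "centered_gaussian M C" "centered_gaussian M D"
  using G[of 1 0 0 0] G[of 0 1 0 0] G[of 0 0 1 0] G[of 0 0 0 1] by simp_all
 note m = g[THEN centered_gaussian_properties(1)] and s = g[THEN centered_gaussian_properties(2), of 2]
 have int: "integrable M (\<lambda>w. X w * Y w)" if "X \<in> {A, B, C, D}" "Y \<in> {A, B, C, D}" for X Y
  using that m s by (intro integrable_mult_of_squares) auto
 have L2: "(\<integral>w. (L a b c w)^2 \<partial>M) = a\<^sup>2 * (\<integral>w. A w * A w \<partial>M) + b\<^sup>2 * (\<integral>w. B w * B w \<partial>M)
   + c\<^sup>2 * (\<integral>w. C w * C w \<partial>M) + (\<integral>w. D w * D w \<partial>M) + 2 * a * b * (\<integral>w. A w * B w \<partial>M)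
   + 2 * a * c * (\<integral>w. A w * C w \<partial>M) + 2 * a * (\<integral>w. A w * D w \<partial>M) + 2 * b * c * (\<integral>w. B w * C w \<partial>M)
   + 2 * b * (\<integral>w. B w * D w \<partial>M) + 2 * c * (\<integral>w. C w * D w \<partial>M)" for a b c
 proof -
  have "(L a b c w)^2 = a\<^sup>2 * (A w * A w) + b\<^sup>2 * (B w * B w)
   + c\<^sup>2 * (C w * C w) + (D w * D w) + 2 * a * b * (A w * B w)
   + 2 * a * c * (A w * C w) + 2 * a * (A w * D w) + 2 * b * c * (B w * C w)
   + 2 * b * (B w * D w) + 2 * c * (C w * D w)" for w
   unfolding L_def by algebra
  then show ?thesis by (simp add: int)
 qed
 have i4: "integrable M (\<lambda>w. L a b c w ^ 4)" and e4: "(\<integral>w. L a b c w ^ 4 \<partial>M) = 3 * (\<integral>w. (L a b c w)^2 \<partial>M)^2" for a b c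
  using centered_gaussian_properties(2,3)[OF gL] by auto
 have id: "A w * B w * C w * D w = (L 1 1 1 w ^ 4 - L 1 1 (- 1) w ^ 4 - L 1 (- 1) 1 w ^ 4 - L (- 1) 1 1 w ^ 4
   + L 1 (- 1) (- 1) w ^ 4 + L (- 1) 1 (- 1) w ^ 4 + L (- 1) (- 1) 1 w ^ 4 - L (- 1) (- 1) (- 1) w ^ 4) / 192" for w
  unfolding L_def by (simp add: field_simps) algebra
 show "integrable M (\<lambda>w. A w * B w * C w * D w)"
  unfolding id by (intro Bochner_Integration.integrable_divide Bochner_Integration.integrable_add Bochner_Integration.integrable_diff i4)
 have "?A = ((\<integral>w. L 1 1 1 w ^ 4 \<partial>M) - (\<integral>w. L 1 1 (- 1) w ^ 4 \<partial>M)
   - (\<integral>w. L 1 (- 1) 1 w ^ 4 \<partial>M) - (\<integral>w. L (- 1) 1 1 w ^ 4 \<partial>M) + (\<integral>w. L 1 (- 1) (- 1) w ^ 4 \<partial>M)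
   + (\<integral>w. L (- 1) 1 (- 1) w ^ 4 \<partial>M) + (\<integral>w. L (- 1) (- 1) 1 w ^ 4 \<partial>M) - (\<integral>w. L (- 1) (- 1) (- 1) w ^ 4 \<partial>M)) / 192"
  unfolding id by (simp add: i4)
 then show "?A = (\<integral>w. A w * B w \<partial>M) * (\<integral>w. C w * D w \<partial>M)
   + (\<integral>w. A w * C w \<partial>M) * (\<integral>w. B w * D w \<partial>M) + (\<integral>w. A w * D w \<partial>M) * (\<integral>w. B w * C w \<partial>M)"
  unfolding e4 L2 by (simp add: field_simps) algebra
qed

abbreviation torus_pair :: "((plane) \<times> (plane)) measure"
 where "torus_pair \<equiv> \<T> \<Otimes>\<^sub>M \<T>"

interpretation pair_prob_space \<T> \<T> ..

definition bounded_borel :: "(plane \<Rightarrow> real) set"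
 where "bounded_borel = {f \<in> borel_measurable borel. \<exists>B. \<forall>z. \<bar>f z\<bar> \<le> B}"

lemma test_functions_mult_bounded_borel:
 assumes "f \<in> \<D>" "g \<in> \<D>"
 shows "(\<lambda>z. f z * g z) \<in> bounded_borel"
proof -
 obtain B C where B: "\<And>z. \<bar>f z\<bar> \<le> B" and C: "\<And>z. \<bar>g z\<bar> \<le> C" using test_function_bounded assms by meson
 have "\<bar>f z * g z\<bar> \<le> B * C" for z
  unfolding abs_mult using B C order.trans[OF abs_ge_zero B] by (intro mult_mono) auto
 then show ?thesis
  unfolding bounded_borel_def by (intro CollectI conjI exI[of _ "B * C"] allI borel_measurable_times measurable_test_function assms)
qed

lemma pair_integral_mult:
 fixes f g :: "plane \<Rightarrow> real"
 assumes f: "f \<in> bounded_borel" and g: "g \<in> bounded_borel"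
 shows "integrable torus_pair (\<lambda>z. f (fst z) * g (snd z))"
  and "(\<integral>z. f (fst z) * g (snd z) \<partial>torus_pair) = (\<integral>x. f x \<partial>\<T>) * (\<integral>y. g y \<partial>\<T>)"
proof -
 have [measurable]: "f \<in> borel_measurable borel" "g \<in> borel_measurable borel"
  using f g by (auto simp: bounded_borel_def)
 obtain B C where B: "\<And>z. \<bar>f z\<bar> \<le> B" and C: "\<And>z. \<bar>g z\<bar> \<le> C" using f g by (auto simp: bounded_borel_def)
 have "\<bar>f x\<bar> * \<bar>g y\<bar> \<le> B * C" for x y
  using B C order.trans[OF abs_ge_zero B] by (intro mult_mono) auto
 then show int: "integrable torus_pair (\<lambda>z. f (fst z) * g (snd z))"
  by (intro P.integrable_const_bound[where B = "B * C"]) (auto simp: abs_mult)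
 show "(\<integral>z. f (fst z) * g (snd z) \<partial>torus_pair) = (\<integral>x. f x \<partial>\<T>) * (\<integral>y. g y \<partial>\<T>)"
  using integral_fst'[OF int] by simp
qed

lemma tensor_kernel_nth: "tensor_kernel ts x y = (\<Sum>i<length ts. fst (ts ! i) x * snd (ts ! i) y)"
 by (simp add: tensor_kernel_def sum_list_sum_nth atLeast0LessThan case_prod_beta)

lemma tensor_wiener_nth:
 "tensor_wiener_integral ts x = (\<Sum>i<length ts. pairing x (fst (ts ! i)) * pairing x (snd (ts ! i))
  - (\<integral>z. fst (ts ! i) z * snd (ts ! i) z \<partial>\<T>))"
 by (simp add: tensor_wiener_integral_def sum_list_sum_nth atLeast0LessThan case_prod_beta)

lemma measurable_tensor_wiener_integral [measurable]: "tensor_wiener_integral ts \<in> borel_measurable borel"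
 unfolding tensor_wiener_nth[abs_def] by measurable

lemma measurable_tensor_kernel:
 assumes "set ts \<subseteq> \<Z> \<times> \<Z>"
 shows "(\<lambda>z. tensor_kernel ts (fst z) (snd z)) \<in> borel_measurable torus_pair"
 unfolding tensor_kernel_nth
proof (intro borel_measurable_sum borel_measurable_times)
 fix i assume "i \<in> {..<length ts}"
 then have "ts ! i \<in> \<Z> \<times> \<Z>" using assms nth_mem by blast
 then have [measurable]: "fst (ts ! i) \<in> borel_measurable borel" "snd (ts ! i) \<in> borel_measurable borel"
  by (auto simp: mem_Times_iff intro!: measurable_test_function zero_averageD simp del: split_paired_All)
 show "(\<lambda>z. fst (ts ! i) (fst z)) \<in> borel_measurable torus_pair" "(\<lambda>z. snd (ts ! i) (snd z)) \<in> borel_measurable torus_pair"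
  by measurable
qed

lemma pair_integral_sum_mult:
 fixes f g :: "nat \<Rightarrow> nat \<Rightarrow> plane \<Rightarrow> real"
 assumes "\<And>i j. i < n \<Longrightarrow> j < n \<Longrightarrow> f i j \<in> bounded_borel" "\<And>i j. i < n \<Longrightarrow> j < n \<Longrightarrow> g i j \<in> bounded_borel"
 shows "integrable torus_pair (\<lambda>z. \<Sum>i<n. \<Sum>j<n. f i j (fst z) * g i j (snd z))"
  and "(\<integral>z. (\<Sum>i<n. \<Sum>j<n. f i j (fst z) * g i j (snd z)) \<partial>torus_pair)
   = (\<Sum>i<n. \<Sum>j<n. (\<integral>x. f i j x \<partial>\<T>) * (\<integral>y. g i j y \<partial>\<T>))"
proof -
 let ?A = "\<integral>z. (\<Sum>i<n. \<Sum>j<n. f i j (fst z) * g i j (snd z)) \<partial>torus_pair"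
 note int = pair_integral_mult(1)[OF assms]
 show "integrable torus_pair (\<lambda>z. \<Sum>i<n. \<Sum>j<n. f i j (fst z) * g i j (snd z))"
  using int by (intro integral_double_sum(1)) auto
 have "?A = (\<Sum>i<n. \<Sum>j<n. \<integral>z. f i j (fst z) * g i j (snd z) \<partial>torus_pair)"
  using int by (intro integral_double_sum(2)) auto
 then show "?A
   = (\<Sum>i<n. \<Sum>j<n. (\<integral>x. f i j x \<partial>\<T>) * (\<integral>y. g i j y \<partial>\<T>))"
  using pair_integral_mult(2)[OF assms] by simp
qed

context white_noise
begin

text \<open>Centring removes from Isserlis' formula the pairing internal to the two factors and
  leaves the two pairings that link them.\<close>

lemma wick_product:
 assumes "f \<in> \<Z>" "g \<in> \<Z>"
  "h \<in> \<Z>" "k \<in> \<Z>"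
 defines "c \<equiv> \<lambda>f g. \<integral>z. f z * g z \<partial>\<T>"
 shows "integrable M (\<lambda>x. (pairing x f * pairing x g - c f g) * (pairing x h * pairing x k - c h k))"
  and "(\<integral>x. (pairing x f * pairing x g - c f g) * (pairing x h * pairing x k - c h k) \<partial>M) = c f h * c g k + c f k * c g h"
proof -
 note ZA = assms(1-4)
 have G: "centered_gaussian M (\<lambda>x. a * pairing x f + b * pairing x g + u * pairing x h + d * pairing x k)" for a b u d
 proof -
  have z1: "(\<lambda>z. a * f z + b * g z) \<in> \<Z>" (is "?F \<in> _")
   and z2: "(\<lambda>z. u * h z + d * k z) \<in> \<Z>" (is "?H \<in> _")
   using ZA by (auto intro: zero_average_lincomb)
  have "centered_gaussian M (\<lambda>x. pairing x (\<lambda>z. 1 * ?F z + 1 * ?H z))"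
   by (rule gaussian[OF zero_average_lincomb[OF z1 z2]])
  moreover have "pairing x (\<lambda>z. 1 * ?F z + 1 * ?H z) = a * pairing x f + b * pairing x g + u * pairing x h + d * pairing x k" for x
   by (subst pairing_lincomb) (use z1 z2 ZA in \<open>auto simp: pairing_lincomb zero_averageD\<close>)
  ultimately show ?thesis by simp
 qed
 have cov: "(\<integral>x. pairing x p * pairing x q \<partial>M) = c p q" if "p \<in> {f, g, h, k}" "q \<in> {f, g, h, k}" for p q
  unfolding c_def using that ZA by (intro covariance) auto
 have int2: "integrable M (\<lambda>x. pairing x p * pairing x q)" if "p \<in> {f, g, h, k}" "q \<in> {f, g, h, k}" for p q
  using that ZA centered_gaussian_properties(2)[OF gaussian, of _ 2] by (intro integrable_mult_of_squares) auto
 note I = isserlis[OF G]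
 have eq: "(pairing x f * pairing x g - c f g) * (pairing x h * pairing x k - c h k)
   = pairing x f * pairing x g * pairing x h * pairing x k - c h k * (pairing x f * pairing x g)
    - c f g * (pairing x h * pairing x k) + c f g * c h k" for x
  by (simp add: algebra_simps)
 show "integrable M (\<lambda>x. (pairing x f * pairing x g - c f g) * (pairing x h * pairing x k - c h k))"
  unfolding eq by (intro Bochner_Integration.integrable_add Bochner_Integration.integrable_diff I(1) Bochner_Integration.integrable_mult_right int2) auto
 have "(\<integral>x. (pairing x f * pairing x g - c f g) * (pairing x h * pairing x k - c h k) \<partial>M)
   = (\<integral>x. pairing x f * pairing x g * pairing x h * pairing x k \<partial>M) - c h k * c f g - c f g * c h k + c f g * c h k"
  unfolding eq using I(1) prob_space by (simp add: int2 cov)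
 also have "... = c f h * c g k + c f k * c g h"
  unfolding I(2) by (simp add: cov)
 finally show "(\<integral>x. (pairing x f * pairing x g - c f g) * (pairing x h * pairing x k - c h k) \<partial>M) = c f h * c g k + c f k * c g h" .
qed

text \<open>Ito isometry for kernels that may be asymmetric: the second moment is the inner product
  of K with itself plus that of K with its transpose, and 2 a b \<le> a^2 + b^2 bounds it by twice
  the squared norm. The inequality is enough to compare approximations.\<close>

lemma wiener_integral_square_le:
 assumes ts: "set ts \<subseteq> \<Z> \<times> \<Z>"
 shows "(\<integral>\<^sup>+u. ennreal ((tensor_wiener_integral ts u)^2) \<partial>M)
  \<le> 2 * (\<integral>\<^sup>+z. ennreal ((tensor_kernel ts (fst z) (snd z))^2) \<partial>torus_pair)"
  and "integrable M (\<lambda>u. (tensor_wiener_integral ts u)^2)"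
proof -
 let ?A = "\<integral>u. (tensor_wiener_integral ts u)^2 \<partial>M"
 define n f g where "n = length ts" and "f i = fst (ts ! i)" and "g i = snd (ts ! i)" for i
 define c where "c f g = (\<integral>z. f z * g z \<partial>\<T>)" for f g :: "plane \<Rightarrow> real"
 have za: "f i \<in> \<Z>" "g i \<in> \<Z>" if "i < n" for i
 proof -
  have "ts ! i \<in> \<Z> \<times> \<Z>" using ts that nth_mem unfolding n_def by blast
  then show "f i \<in> \<Z>" "g i \<in> \<Z>" by (auto simp: f_def g_def)
 qed
 define K where "K x y = (\<Sum>i<n. f i x * g i y)" for x y
 define W where "W i u = pairing u (f i) * pairing u (g i) - c (f i) (g i)" for i u
 have K: "tensor_kernel ts x y = K x y" for x y by (simp add: tensor_kernel_nth K_def n_def f_def g_def)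
 have W: "tensor_wiener_integral ts u = (\<Sum>i<n. W i u)" for u
  by (simp add: tensor_wiener_nth W_def n_def f_def g_def c_def)
 have tm: "(\<lambda>z. p i z * q j z) \<in> bounded_borel" if "i < n" "j < n" "p = f \<or> p = g" "q = f \<or> q = g" for i j p q
  using that za[THEN zero_averageD] by (intro test_functions_mult_bounded_borel) auto
 have e1: "(K x y)^2 = (\<Sum>i<n. \<Sum>j<n. (f i x * f j x) * (g i y * g j y))" for x y
  unfolding K_def power2_eq_square sum_product by (intro sum.cong refl) (simp add: mult_ac)
 have e2: "(K y x)^2 = (\<Sum>i<n. \<Sum>j<n. (g i x * g j x) * (f i y * f j y))" for x y
  unfolding K_def power2_eq_square sum_product by (intro sum.cong refl) (simp add: mult_ac)
 have e3: "K x y * K y x = (\<Sum>i<n. \<Sum>j<n. (f i x * g j x) * (g i y * f j y))" for x y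
  unfolding K_def sum_product by (intro sum.cong refl) (simp add: mult_ac)
 note p1 = pair_integral_sum_mult[of n "\<lambda>i j z. f i z * f j z" "\<lambda>i j z. g i z * g j z", OF tm[of _ _ f f] tm[of _ _ g g], simplified, folded e1 c_def]
 note p2 = pair_integral_sum_mult[of n "\<lambda>i j z. g i z * g j z" "\<lambda>i j z. f i z * f j z", OF tm[of _ _ g g] tm[of _ _ f f], simplified, folded e2 c_def]
 note p3 = pair_integral_sum_mult[of n "\<lambda>i j z. f i z * g j z" "\<lambda>i j z. g i z * f j z", OF tm[of _ _ f g] tm[of _ _ g f], simplified, folded e3 c_def]
 have "(\<integral>z. 2 * (K (fst z) (snd z) * K (snd z) (fst z)) \<partial>torus_pair) \<le> (\<integral>z. (K (fst z) (snd z))^2 + (K (snd z) (fst z))^2 \<partial>torus_pair)"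
 proof (rule integral_mono)
  show "2 * (K (fst z) (snd z) * K (snd z) (fst z)) \<le> (K (fst z) (snd z))^2 + (K (snd z) (fst z))^2" for z
   using sum_squares_bound[of "K (fst z) (snd z)" "K (snd z) (fst z)"] by (simp add: mult.assoc)
 qed (use p1(1) p2(1) p3(1) in auto)
 moreover have "(\<Sum>i<n. \<Sum>j<n. c (g i) (g j) * c (f i) (f j)) = (\<Sum>i<n. \<Sum>j<n. c (f i) (f j) * c (g i) (g j))"
  by (intro sum.cong refl mult.commute)
 ultimately have sym: "(\<Sum>i<n. \<Sum>j<n. c (f i) (g j) * c (g i) (f j)) \<le> (\<Sum>i<n. \<Sum>j<n. c (f i) (f j) * c (g i) (g j))"
  using p1 p2 p3 by simp
 have wp: "integrable M (\<lambda>u. W i u * W j u)" "(\<integral>u. W i u * W j u \<partial>M) = c (f i) (f j) * c (g i) (g j) + c (f i) (g j) * c (g i) (f j)"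
  if "i < n" "j < n" for i j
  using wick_product[OF za[OF that(1)] za[OF that(2)]] by (simp_all add: W_def c_def)
 have sq: "(\<Sum>i<n. W i u)^2 = (\<Sum>i<n. \<Sum>j<n. W i u * W j u)" for u
  by (simp add: power2_eq_square sum_product)
 show int: "integrable M (\<lambda>u. (tensor_wiener_integral ts u)^2)"
  unfolding W sq using wp by (intro integral_double_sum(1)) auto
 have "?A = (\<Sum>i<n. \<Sum>j<n. \<integral>u. W i u * W j u \<partial>M)"
  unfolding W sq using wp by (intro integral_double_sum(2)) auto
 also have "... = (\<Sum>i<n. \<Sum>j<n. c (f i) (f j) * c (g i) (g j)) + (\<Sum>i<n. \<Sum>j<n. c (f i) (g j) * c (g i) (f j))"
  by (simp add: wp sum.distrib)
 also have "... \<le> 2 * (\<integral>z. (K (fst z) (snd z))^2 \<partial>torus_pair)"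
  using sym by (simp add: p1)
 finally have "ennreal ?A \<le> 2 * ennreal (\<integral>z. (K (fst z) (snd z))^2 \<partial>torus_pair)"
  by (subst ennreal_numeral[symmetric], subst ennreal_mult[symmetric]) (auto intro!: ennreal_leI)
 then show "(\<integral>\<^sup>+u. ennreal ((tensor_wiener_integral ts u)^2) \<partial>M)
  \<le> 2 * (\<integral>\<^sup>+z. ennreal ((tensor_kernel ts (fst z) (snd z))^2) \<partial>torus_pair)"
  unfolding K using int p1(1) by (simp add: nn_integral_eq_integral)
qed

lemma wiener_integral_diff_le:
 assumes ts: "set ts \<subseteq> \<Z> \<times> \<Z>"
  and us: "set us \<subseteq> \<Z> \<times> \<Z>"
 shows "(\<integral>\<^sup>+u. ennreal ((tensor_wiener_integral ts u - tensor_wiener_integral us u)^2) \<partial>M)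
  \<le> 2 * (\<integral>\<^sup>+z. ennreal ((tensor_kernel ts (fst z) (snd z) - tensor_kernel us (fst z) (snd z))^2) \<partial>torus_pair)"
proof -
 \<comment> \<open>Differences are taken within the class of finite tensors: the second list is
   appended with its first factors negated.\<close>
 define vs where "vs = map (\<lambda>p. (\<lambda>z. - fst p z, snd p)) us"
 have neg: "(\<lambda>z. - f z) \<in> \<Z>" if "f \<in> \<Z>" for f
  using zero_average_lincomb[OF that that, of "- 1" 0] by simp
 have vs: "set vs \<subseteq> \<Z> \<times> \<Z>"
  using us neg by (auto simp: vs_def)
 have k: "tensor_kernel (ts @ vs) x y = tensor_kernel ts x y - tensor_kernel us x y" for x y
  by (simp add: vs_def tensor_kernel_def case_prod_unfold o_def uminus_sum_list_map)
 have "tensor_wiener_integral vs u = - tensor_wiener_integral us u" for u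
  using us unfolding vs_def
 proof (induction us)
  case (Cons p us)
  have "pairing u (\<lambda>z. - fst p z) = - pairing u (fst p)"
   using Cons.prems pairing_scale[of "fst p" u "- 1"] by (auto simp: zero_averageD)
  with Cons show ?case by (simp add: tensor_wiener_integral_def case_prod_beta)
 qed (simp add: tensor_wiener_integral_def)
 then have w: "tensor_wiener_integral (ts @ vs) u = tensor_wiener_integral ts u - tensor_wiener_integral us u" for u
  by (simp add: tensor_wiener_integral_def)
 show ?thesis using wiener_integral_square_le(1)[of "ts @ vs"] ts vs by (simp add: k w)
qed

end

section \<open>The truncated Green kernel as a finite tensor\<close>

definition trig_tensors :: "nat \<Rightarrow> ((plane \<Rightarrow> real) \<times> (plane \<Rightarrow> real)) list"
 where "trig_tensors n = map (\<lambda>k. (\<lambda>z. lam k * cas k z, cas k))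
  (filter (\<lambda>k. k \<noteq> 0) (List.product [- int n..int n] [- int n..int n]))"

definition energy_trunc :: "nat \<Rightarrow> (freq \<Rightarrow> real) \<Rightarrow> real"
 where "energy_trunc n a = (\<Sum>k\<in>grid n - {0}. lam k * ((a k)^2 - 1)) / 2"

lemma sum_list_trig_tensors: "sum_list (map f (trig_tensors n)) = (\<Sum>k\<in>grid n - {0}. f (\<lambda>z. lam k * cas k z, cas k))"
proof -
 have "set (filter (\<lambda>k. k \<noteq> 0) (List.product [- int n..int n] [- int n..int n])) = grid n - {0}"
  by (auto simp: grid_def)
 then show ?thesis
  by (simp add: trig_tensors_def o_def sum_list_distinct_conv_sum_set distinct_product)
qed

lemma trig_tensors_zero_average: "set (trig_tensors n) \<subseteq> \<Z> \<times> \<Z>"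
 using zero_average_lincomb[OF zero_average_cas zero_average_cas, of _ _ _ 0]
 by (auto simp: trig_tensors_def zero_average_cas)

text \<open>The sine part of \<open>cas_mult_cas\<close> is odd in the frequency and cancels over
  the symmetric grid; the translation-invariant cosine part remains.\<close>

lemma green_trunc_diff_eq: "(\<Sum>k\<in>grid n. lam k * (cas k x * cas k y)) = green_trunc n (x - y)"
proof -
 let ?A = "\<Sum>k\<in>grid n. lam k * sin (phase k x + phase k y)"
 have "?A = (\<Sum>k\<in>grid n. lam (- k) * sin (phase (- k) x + phase (- k) y))"
  by (rule sum_grid_uminus[symmetric])
 also have "... = - ?A"
  using sin_minus[of "phase _ x + phase _ y"] by (simp add: phase_minus_left lam_uminus sum_negf[symmetric])
 finally have "?A = 0" by simp
 then show ?thesis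
  by (simp add: green_trunc_cos cas_mult_cas phase_diff_right distrib_left sum.distrib)
qed

lemma tensor_kernel_trig: "tensor_kernel (trig_tensors n) x y = green_trunc n (x - y)"
proof -
 have "tensor_kernel (trig_tensors n) x y = (\<Sum>k\<in>grid n - {0}. lam k * (cas k x * cas k y))"
  by (simp add: tensor_kernel_def sum_list_trig_tensors mult.assoc)
 also have "... = (\<Sum>k\<in>grid n. lam k * (cas k x * cas k y))"
  by (intro sum.mono_neutral_left) auto
 finally show ?thesis by (simp only: green_trunc_diff_eq)
qed

lemma tensor_wiener_trig: "tensor_wiener_integral (trig_tensors n) x = 2 * energy_trunc n (coeffs x)"
 by (simp add: tensor_wiener_integral_def sum_list_trig_tensors energy_trunc_def coeffs_def pairing_scale
   cas_test_function integral_cas_mult_cas mult.assoc right_diff_distrib power2_eq_square)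

lemma nn_integral_torus_pair_diff:
 assumes [measurable]: "f \<in> borel_measurable borel" and "periodic f"
 shows "(\<integral>\<^sup>+z. f (fst z - snd z) \<partial>torus_pair) = (\<integral>\<^sup>+z. f z \<partial>\<T>)"
proof -
 have "(\<integral>\<^sup>+z. f (fst z - snd z) \<partial>torus_pair) = (\<integral>\<^sup>+x. (\<integral>\<^sup>+y. f (x - y) \<partial>\<T>) \<partial>\<T>)"
  by (subst torus.nn_integral_fst[symmetric]) auto
 then show ?thesis using torus.emeasure_space_1 by (simp add: nn_integral_torus_reflect[OF assms(2)])
qed

lemma nn_square_triangle:
 fixes f g h :: "'a \<Rightarrow> real"
 assumes [measurable]: "f \<in> borel_measurable M" "g \<in> borel_measurable M" "h \<in> borel_measurable M"
 shows "(\<integral>\<^sup>+x. ennreal ((f x - h x)^2) \<partial>M) \<le> 2 * (\<integral>\<^sup>+x. ennreal ((f x - g x)^2) \<partial>M) + 2 * (\<integral>\<^sup>+x. ennreal ((g x - h x)^2) \<partial>M)"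
proof -
 have "(\<integral>\<^sup>+x. ennreal ((f x - h x)^2) \<partial>M) \<le> (\<integral>\<^sup>+x. 2 * ennreal ((f x - g x)^2) + 2 * ennreal ((g x - h x)^2) \<partial>M)"
 proof (rule nn_integral_mono)
  fix x
  have "(f x - h x)^2 \<le> 2 * (f x - g x)^2 + 2 * (g x - h x)^2"
   using zero_le_power2[of "f x - g x - (g x - h x)"] by (simp add: power2_eq_square algebra_simps)
  then have "ennreal ((f x - h x)^2) \<le> ennreal (2 * (f x - g x)^2 + 2 * (g x - h x)^2)" by (rule ennreal_leI)
  then show "ennreal ((f x - h x)^2) \<le> 2 * ennreal ((f x - g x)^2) + 2 * ennreal ((g x - h x)^2)"
   by (simp add: ennreal_plus ennreal_mult)
 qed
 then show ?thesis by (simp add: nn_integral_add nn_integral_cmult)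
qed

lemma integrable_green_trunc_square: "integrable \<T> (\<lambda>z. (green_trunc n z)^2)"
 using periodic_green_trunc by (intro integrable_periodic_continuous continuous_intros continuous_green_trunc) (simp add: periodic_def)

lemma kernel_L2: "(\<lambda>n. \<integral>\<^sup>+z. ennreal ((tensor_kernel (trig_tensors n) (fst z) (snd z) - green (fst z - snd z))^2) \<partial>torus_pair) \<longlonglongrightarrow> 0"
proof -
 have per: "periodic (\<lambda>z. ennreal ((green_trunc n z - green z)^2))" for n
  using periodic_green_trunc[of n] periodic_green by (simp add: periodic_def)
 have "(\<integral>\<^sup>+z. ennreal ((tensor_kernel (trig_tensors n) (fst z) (snd z) - green (fst z - snd z))^2) \<partial>torus_pair)
   = ennreal (\<integral>z. (green_trunc n z - green z)^2 \<partial>\<T>)" for n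
  using nn_integral_torus_pair_diff[OF _ per, of n]
  by (simp add: tensor_kernel_trig nn_integral_eq_integral integrable_square_diff integrable_green_trunc_square integrable_green_square)
 then show ?thesis using tendsto_ennrealI[OF green_trunc_L2] by simp
qed

text \<open>The kernels of \<open>trig_tensors\<close> converge in L2 to the Green kernel, and the
  isometry bound transports their Cauchy property to the integrals.\<close>

lemma double_wiener_integral_exists:
 "\<exists>X. is_double_wiener_integral \<W> (\<lambda>x y. green (x - y)) X"
proof -
 define W where "W n = tensor_wiener_integral (trig_tensors n)" for n
 define d where "d n = (\<integral>\<^sup>+z. ennreal ((tensor_kernel (trig_tensors n) (fst z) (snd z) - green (fst z - snd z))^2) \<partial>torus_pair)" for n
 note Km [measurable] = measurable_tensor_kernel[OF trig_tensors_zero_average]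
 have sq: "integrable \<W> (\<lambda>u. (W n u)^2)" for n
  unfolding W_def by (rule wn.wiener_integral_square_le(2)[OF trig_tensors_zero_average])
 have Wm [measurable]: "W n \<in> borel_measurable borel" for n by (simp add: W_def)
 have nn: "(\<integral>\<^sup>+u. ennreal ((W i u - W j u)^2) \<partial>\<W>) \<le> 4 * d i + 4 * d j" for i j
 proof -
  have "(\<integral>\<^sup>+u. ennreal ((W i u - W j u)^2) \<partial>\<W>) \<le>
   2 * (\<integral>\<^sup>+z. ennreal ((tensor_kernel (trig_tensors i) (fst z) (snd z) - tensor_kernel (trig_tensors j) (fst z) (snd z))^2) \<partial>torus_pair)"
   unfolding W_def by (rule wn.wiener_integral_diff_le[OF trig_tensors_zero_average trig_tensors_zero_average])
  also have "... \<le> 2 * (2 * d i + 2 * (\<integral>\<^sup>+z. ennreal ((green (fst z - snd z) - tensor_kernel (trig_tensors j) (fst z) (snd z))^2) \<partial>torus_pair))"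
   unfolding d_def by (intro mult_left_mono nn_square_triangle) auto
  also have "... = 4 * d i + 4 * d j"
   by (simp add: d_def power2_commute[of "green _"] distrib_left mult.assoc[symmetric])
  finally show ?thesis .
 qed
 obtain g where g: "g \<in> borel_measurable \<W>" "integrable \<W> (\<lambda>u. (g u)^2)"
  "(\<lambda>n. \<integral>u. (W n u - g u)^2 \<partial>\<W>) \<longlonglongrightarrow> 0"
 proof (rule wn.L2_Cauchy_limit[of W])
  fix e :: real assume e: "0 < e"
  have "\<forall>\<^sub>F n in sequentially. d n < ennreal (e / 16)"
   using kernel_L2 e unfolding d_def by (intro order_tendstoD) auto
  then obtain N where N: "\<And>n. n \<ge> N \<Longrightarrow> d n < ennreal (e / 16)" by (auto simp: eventually_sequentially)
  have "(\<integral>u. (W i u - W j u)^2 \<partial>\<W>) < e" if ij: "i \<ge> N" "j \<ge> N" for i j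
  proof -
   have "ennreal (\<integral>u. (W i u - W j u)^2 \<partial>\<W>) = (\<integral>\<^sup>+u. ennreal ((W i u - W j u)^2) \<partial>\<W>)"
    using sq by (intro nn_integral_eq_integral[symmetric] integrable_square_diff) auto
   also have "... \<le> 4 * ennreal (e / 16) + 4 * ennreal (e / 16)"
    using nn[of i j] N[OF ij(1)] N[OF ij(2)] by (elim order.trans) (intro add_mono mult_left_mono; simp)
   also have "... = ennreal (e / 2)"
    using e by (simp add: ennreal_numeral[symmetric] ennreal_mult[symmetric] ennreal_plus[symmetric] del: ennreal_numeral ennreal_plus)
   finally show ?thesis using e by simp
  qed
  then show "\<exists>N. \<forall>i\<ge>N. \<forall>j\<ge>N. (\<integral>u. (W i u - W j u)^2 \<partial>\<W>) < e" by blast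
 next
  fix r g
  assume "g \<in> borel_measurable \<W>" "integrable \<W> (\<lambda>u. (g u)^2)"
   "(\<lambda>n. \<integral>u. (W n u - g u)^2 \<partial>\<W>) \<longlonglongrightarrow> 0"
  then show thesis by (rule that)
 qed (simp_all add: sq)
 have "(\<integral>\<^sup>+u. ennreal ((W n u - g u)^2) \<partial>\<W>) = ennreal (\<integral>u. (W n u - g u)^2 \<partial>\<W>)" for n
  using sq g by (intro nn_integral_eq_integral integrable_square_diff) auto
 then have "(\<lambda>n. \<integral>\<^sup>+u. ennreal ((W n u - g u)^2) \<partial>\<W>) \<longlonglongrightarrow> 0"
  using tendsto_ennrealI[OF g(3)] by simp
 then show ?thesis
  using trig_tensors_zero_average kernel_L2 g(1) unfolding is_double_wiener_integral_def W_def case_prod_unfold by blast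
qed

text \<open>The chosen double integral comes with an unknown approximating sequence. Comparing its
  kernels with the trigonometric ones, through the isometry bound, shows that
  \<open>energy_trunc\<close> of the coefficients converges to the same variable. This is the only
  access to \<open>wick_energy\<close> from here on.\<close>

lemma wick_energy_properties:
 shows measurable_wick_energy [measurable]: "wick_energy \<in> borel_measurable borel"
  and wick_energy_L2: "(\<lambda>n. \<integral>\<^sup>+u. ennreal ((energy_trunc n (coeffs u) - wick_energy u)^2) \<partial>\<W>) \<longlonglongrightarrow> 0"
proof -
 define X where "X = (SOME X. is_double_wiener_integral \<W> (\<lambda>x y. green (x - y)) X)"
 have we: "wick_energy u = X u / 2" for u by (simp add: wick_energy_def X_def)
 have "is_double_wiener_integral \<W> (\<lambda>x y. green (x - y)) X"
  unfolding X_def using double_wiener_integral_exists by (rule someI_ex)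
 then obtain ts where Xm [measurable]: "X \<in> borel_measurable borel"
  and ts: "\<And>n. set (ts n) \<subseteq> \<Z> \<times> \<Z>"
  and k: "(\<lambda>n. \<integral>\<^sup>+z. ennreal ((tensor_kernel (ts n) (fst z) (snd z) - green (fst z - snd z))^2) \<partial>torus_pair) \<longlonglongrightarrow> 0"
  and w: "(\<lambda>n. \<integral>\<^sup>+u. ennreal ((tensor_wiener_integral (ts n) u - X u)^2) \<partial>\<W>) \<longlonglongrightarrow> 0"
  unfolding is_double_wiener_integral_def case_prod_unfold by auto
 show "wick_energy \<in> borel_measurable borel" unfolding we[abs_def] by measurable
 note [measurable] = measurable_tensor_kernel[OF ts] measurable_tensor_kernel[OF trig_tensors_zero_average]
 define d where "d n = (\<integral>\<^sup>+z. ennreal ((tensor_kernel (trig_tensors n) (fst z) (snd z) - green (fst z - snd z))^2) \<partial>torus_pair)" for n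
 define d' where "d' n = (\<integral>\<^sup>+z. ennreal ((tensor_kernel (ts n) (fst z) (snd z) - green (fst z - snd z))^2) \<partial>torus_pair)" for n
 define w' where "w' n = (\<integral>\<^sup>+u. ennreal ((tensor_wiener_integral (ts n) u - X u)^2) \<partial>\<W>)" for n
 have le: "(\<integral>\<^sup>+u. ennreal ((tensor_wiener_integral (trig_tensors n) u - X u)^2) \<partial>\<W>) \<le> 2 * (2 * (2 * d n + 2 * d' n)) + 2 * w' n" for n
 proof -
  have "(\<integral>\<^sup>+z. ennreal ((tensor_kernel (trig_tensors n) (fst z) (snd z) - tensor_kernel (ts n) (fst z) (snd z))^2) \<partial>torus_pair)
   \<le> 2 * d n + 2 * (\<integral>\<^sup>+z. ennreal ((green (fst z - snd z) - tensor_kernel (ts n) (fst z) (snd z))^2) \<partial>torus_pair)"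
   unfolding d_def by (rule nn_square_triangle) auto
  also have "... = 2 * d n + 2 * d' n" by (simp add: d'_def power2_commute[of "green _"])
  finally have K: "(\<integral>\<^sup>+z. ennreal ((tensor_kernel (trig_tensors n) (fst z) (snd z) - tensor_kernel (ts n) (fst z) (snd z))^2) \<partial>torus_pair) \<le> 2 * d n + 2 * d' n" .
  have "(\<integral>\<^sup>+u. ennreal ((tensor_wiener_integral (trig_tensors n) u - X u)^2) \<partial>\<W>)
   \<le> 2 * (\<integral>\<^sup>+u. ennreal ((tensor_wiener_integral (trig_tensors n) u - tensor_wiener_integral (ts n) u)^2) \<partial>\<W>) + 2 * w' n"
   unfolding w'_def by (rule nn_square_triangle) auto
  also have "... \<le> 2 * (2 * (2 * d n + 2 * d' n)) + 2 * w' n"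
   by (intro add_right_mono mult_left_mono order.trans[OF wn.wiener_integral_diff_le[OF trig_tensors_zero_average ts]] K) auto
  finally show ?thesis .
 qed
 have "(\<lambda>n. 2 * (2 * (2 * d n + 2 * d' n)) + 2 * w' n) \<longlonglongrightarrow> 2 * (2 * (2 * 0 + 2 * 0)) + 2 * 0"
  using kernel_L2 k w unfolding d_def d'_def w'_def by (intro tendsto_intros ennreal_tendsto_cmult) auto
 then have "(\<lambda>n. 2 * (2 * (2 * d n + 2 * d' n)) + 2 * w' n) \<longlonglongrightarrow> 0" by simp
 then have "(\<lambda>n. \<integral>\<^sup>+u. ennreal ((tensor_wiener_integral (trig_tensors n) u - X u)^2) \<partial>\<W>) \<longlonglongrightarrow> 0"
  by (rule tendsto_sandwich[OF _ _ tendsto_const, rotated 2]) (intro always_eventually allI le zero_le)+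
 then show "(\<lambda>n. \<integral>\<^sup>+u. ennreal ((energy_trunc n (coeffs u) - wick_energy u)^2) \<partial>\<W>) \<longlonglongrightarrow> 0"
 proof (rule tendsto_sandwich[OF _ _ tendsto_const, rotated 2])
  show "\<forall>\<^sub>F n in sequentially. (\<integral>\<^sup>+u. ennreal ((energy_trunc n (coeffs u) - wick_energy u)^2) \<partial>\<W>)
   \<le> (\<integral>\<^sup>+u. ennreal ((tensor_wiener_integral (trig_tensors n) u - X u)^2) \<partial>\<W>)"
  proof (intro always_eventually allI nn_integral_mono ennreal_leI)
   fix n u
   have "tensor_wiener_integral (trig_tensors n) u - X u = 2 * (energy_trunc n (coeffs u) - wick_energy u)"
    by (simp add: tensor_wiener_trig we)
   then show "(energy_trunc n (coeffs u) - wick_energy u)^2 \<le> (tensor_wiener_integral (trig_tensors n) u - X u)^2"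
    by (simp only: power_mult_distrib) simp
  qed
 qed auto
qed

subsection \<open>Exponential moments and truncation\<close>

text \<open>\<open>min (exp u) L\<close> equals the exponential of \<open>min u (ln L)\<close>, and
  on that range the slope of the exponential is at most L.\<close>

lemma min_exp_Lipschitz:
 fixes L a b :: real
 assumes L: "0 < L"
 shows "\<bar>min (exp a) L - min (exp b) L\<bar> \<le> L * \<bar>a - b\<bar>"
proof -
 have m: "min (exp u) L = exp (min u (ln L))" for u
 proof (cases "u \<le> ln L")
  case True
  then have "exp u \<le> L" using L exp_le_cancel_iff[of u "ln L"] by simp
  then show ?thesis using True by simp
 next
  case False
  then have "L \<le> exp u" using L exp_le_cancel_iff[of "ln L" u] by simp
  then show ?thesis using False L by simp
 qed
 have *: "exp v - exp u \<le> L * (v - u)" if "u \<le> v" "v \<le> ln L" for u v :: real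
 proof -
  have "exp v \<le> L" using that(2) L exp_le_cancel_iff[of v "ln L"] by simp
  have "exp v - exp u = exp v * (1 - exp (u - v))" by (simp add: right_diff_distrib exp_diff)
  also have "... \<le> exp v * (v - u)" using exp_ge_add_one_self[of "u - v"] by (intro mult_left_mono) (linarith, simp)
  also have "... \<le> L * (v - u)" using \<open>exp v \<le> L\<close> that by (intro mult_right_mono) auto
  finally show ?thesis .
 qed
 define a' b' where "a' = min a (ln L)" and "b' = min b (ln L)"
 have "\<bar>exp a' - exp b'\<bar> \<le> L * \<bar>a' - b'\<bar>"
  using *[of a' b'] *[of b' a'] by (cases a' b' rule: le_cases) (auto simp: a'_def b'_def abs_if)
 also have "... \<le> L * \<bar>a - b\<bar>" using L by (intro mult_left_mono) (auto simp: a'_def b'_def min_def)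
 finally show ?thesis by (simp add: m a'_def b'_def)
qed

text \<open>Cutting at L is paid for by an exponential moment at twice the exponent; the condition 2
  * b \<le> c of the later estimates comes from here.\<close>

lemma exp_excess_le:
 fixes L x :: real
 assumes L: "0 < L"
 shows "exp x - min (exp x) L \<le> exp (2 * x) / L"
proof (cases "exp x \<le> L")
 case False
 have "exp x * L \<le> exp x * exp x" using False by (intro mult_left_mono) auto
 then have "exp x \<le> exp x * exp x / L" using L by (simp add: field_simps)
 then have "exp x \<le> exp (2 * x) / L" by (simp add: exp_add[symmetric])
 then show ?thesis using L False by (simp add: min_def)
qed (use L in simp)

context prob_space
begin

text \<open>Fatou along a subsequence that converges almost everywhere. Uniform bounds for truncated
  energies thus pass to the energy with the true Green function and to the Wick energy.\<close>

lemma exp_moment_limit: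
 fixes X :: "nat \<Rightarrow> 'a \<Rightarrow> real" and Y :: "'a \<Rightarrow> real"
 assumes [measurable]: "\<And>n. X n \<in> borel_measurable M" "Y \<in> borel_measurable M"
  and lim: "(\<lambda>n. \<integral>\<^sup>+w. ennreal ((X n w - Y w)^2) \<partial>M) \<longlonglongrightarrow> 0"
  and bound: "\<And>n. (\<integral>\<^sup>+w. ennreal (exp (c * X n w)) \<partial>M) \<le> C"
 shows "(\<integral>\<^sup>+w. ennreal (exp (c * Y w)) \<partial>M) \<le> C"
proof -
 have "\<forall>\<^sub>F n in sequentially. (\<integral>\<^sup>+w. ennreal ((X n w - Y w)^2) \<partial>M) < 1"
  using lim by (rule order_tendstoD) simp
 then obtain n0 where n0: "\<And>n. n \<ge> n0 \<Longrightarrow> (\<integral>\<^sup>+w. ennreal ((X n w - Y w)^2) \<partial>M) < 1"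
  by (auto simp: eventually_sequentially)
 \<comment> \<open>Shifted by n0, so that every term is integrable.\<close>
 define u where "u n w = (X (n + n0) w - Y w)^2" for n w
 have um [measurable]: "u n \<in> borel_measurable M" for n unfolding u_def[abs_def] by measurable
 have int: "integrable M (u n)" for n
  using n0[of "n + n0"] by (intro integrableI_nonneg) (auto simp: u_def intro: order.strict_trans)
 have "ennreal (\<integral>w. norm (u n w) \<partial>M) = (\<integral>\<^sup>+w. ennreal ((X (n + n0) w - Y w)^2) \<partial>M)" for n
  using int[of n] by (subst nn_integral_eq_integral[symmetric]) (auto simp: u_def[abs_def])
 then have "(\<lambda>n. ennreal (\<integral>w. norm (u n w) \<partial>M)) \<longlonglongrightarrow> 0"
  using LIMSEQ_ignore_initial_segment[OF lim, of n0] by simp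
 then have "(\<lambda>n. \<integral>w. norm (u n w) \<partial>M) \<longlonglongrightarrow> 0" by (subst (asm) ennreal_tendsto_0_iff) auto
 from tendsto_L1_AE_subseq[OF int this] obtain r where r: "strict_mono r" "AE w in M. (\<lambda>n. u (r n) w) \<longlonglongrightarrow> 0" by blast
 have "(\<integral>\<^sup>+w. ennreal (exp (c * Y w)) \<partial>M) = (\<integral>\<^sup>+w. liminf (\<lambda>n. ennreal (exp (c * X (r n + n0) w))) \<partial>M)"
 proof (rule nn_integral_cong_AE)
  show "AE w in M. ennreal (exp (c * Y w)) = liminf (\<lambda>n. ennreal (exp (c * X (r n + n0) w)))"
   using r(2)
  proof eventually_elim
   case (elim w)
   then have "(\<lambda>n. sqrt (u (r n) w)) \<longlonglongrightarrow> sqrt 0" by (rule tendsto_real_sqrt)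
   then have "(\<lambda>n. X (r n + n0) w - Y w) \<longlonglongrightarrow> 0" by (simp add: u_def tendsto_rabs_zero_iff)
   then have "(\<lambda>n. X (r n + n0) w) \<longlonglongrightarrow> Y w" by (rule LIM_zero_cancel)
   then have "(\<lambda>n. ennreal (exp (c * X (r n + n0) w))) \<longlonglongrightarrow> ennreal (exp (c * Y w))"
    by (intro tendsto_ennrealI tendsto_intros)
   then show ?case by (rule lim_imp_Liminf[OF trivial_limit_sequentially, symmetric])
  qed
 qed
 also have "... \<le> liminf (\<lambda>n. \<integral>\<^sup>+w. ennreal (exp (c * X (r n + n0) w)) \<partial>M)"
  by (rule nn_integral_liminf) measurable
 also have "... \<le> liminf (\<lambda>n. C)" by (intro Liminf_mono always_eventually allI bound)
 also have "... = C" by (simp add: Liminf_const)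
 finally show ?thesis .
qed

text \<open>For an exponent between 0 and c, \<open>exp (b * x)\<close> is at most 1 +
  \<open>exp (c * x)\<close>; hence 4 = 1 + 3.\<close>

lemma exp_moment_le:
 fixes X :: "'a \<Rightarrow> real"
 assumes [measurable]: "X \<in> borel_measurable M" and b: "0 \<le> b" "b \<le> c"
  and bound: "(\<integral>\<^sup>+w. ennreal (exp (c * X w)) \<partial>M) \<le> ennreal 3"
 shows "integrable M (\<lambda>w. exp (b * X w))" and "(\<integral>w. exp (b * X w) \<partial>M) \<le> 4"
proof -
 let ?A = "\<integral>\<^sup>+w. ennreal (exp (b * X w)) \<partial>M"
 have le: "exp (b * x) \<le> 1 + exp (c * x)" for x :: real
 proof (cases "0 \<le> x")
  case True
  then have "exp (b * x) \<le> exp (c * x)" using b by (simp add: mult_right_mono)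
  then show ?thesis by linarith
 next
  case False
  then have "exp (b * x) \<le> 1" using b by (simp add: mult_nonneg_nonpos)
  then show ?thesis by (simp add: add_increasing2)
 qed
 have "?A \<le> (\<integral>\<^sup>+w. 1 + ennreal (exp (c * X w)) \<partial>M)"
  using le by (intro nn_integral_mono) (simp add: ennreal_1[symmetric] ennreal_plus[symmetric] del: ennreal_1 ennreal_plus)
 also have "... = 1 + (\<integral>\<^sup>+w. ennreal (exp (c * X w)) \<partial>M)" by (simp add: nn_integral_add emeasure_space_1)
 also have "... \<le> 1 + ennreal 3" using bound by (rule add_left_mono)
 also have "... = ennreal 4" using ennreal_plus[of 1 3] by simp
 finally have nn: "?A \<le> ennreal 4" .
 then show int: "integrable M (\<lambda>w. exp (b * X w))"
  by (intro integrableI_nonneg) (auto intro: order.strict_trans1)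
 have "ennreal (\<integral>w. exp (b * X w) \<partial>M) \<le> ennreal 4" using nn int by (simp add: nn_integral_eq_integral)
 then show "(\<integral>w. exp (b * X w) \<partial>M) \<le> 4" by (subst (asm) ennreal_le_iff) simp_all
qed

text \<open>Replaces an unbounded weight by a bounded function of an L2 approximation Y. Cutting at
  L costs 4 / L, and exchanging X for Y below the cut costs b * L * d by the Lipschitz bound; L is
  to be fixed first and d afterwards.\<close>

lemma exp_truncation_error:
 fixes X Y g :: "'a \<Rightarrow> real"
 assumes [measurable]: "X \<in> borel_measurable M" "Y \<in> borel_measurable M" "g \<in> borel_measurable M"
  and g: "\<And>w. \<bar>g w\<bar> \<le> B" and L: "0 < L" and b: "0 \<le> b" "2 * b \<le> c"
  and bound: "(\<integral>\<^sup>+w. ennreal (exp (c * X w)) \<partial>M) \<le> ennreal 3"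
  and d: "0 \<le> d" "(\<integral>\<^sup>+w. ennreal ((Y w - X w)^2) \<partial>M) \<le> ennreal (d\<^sup>2)"
 shows "\<bar>(\<integral>w. g w * exp (b * X w) \<partial>M) - (\<integral>w. g w * min (exp (b * Y w)) L \<partial>M)\<bar> \<le> B * (4 / L + b * L * d)"
proof -
 let ?A = "\<integral>w. \<bar>Y w - X w\<bar> \<partial>M"
 let ?B = "\<integral>w. exp (2 * b * X w) \<partial>M"
 obtain w0 where "w0 \<in> space M" using not_empty by blast
 have B: "0 \<le> B" using order.trans[OF abs_ge_zero g] .
 have i1: "integrable M (\<lambda>w. exp (b * X w))"
  by (rule exp_moment_le(1)[OF _ _ _ bound]) (use b in auto)
 have i2: "integrable M (\<lambda>w. exp (2 * b * X w))" "?B \<le> 4"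
  by (rule exp_moment_le[OF _ _ _ bound]; use b in simp)+
 have sq: "integrable M (\<lambda>w. (Y w - X w)^2)"
  using d(2) by (intro integrableI_nonneg) (auto intro: order.strict_trans1)
 have "ennreal (\<integral>w. (Y w - X w)^2 \<partial>M) \<le> ennreal (d\<^sup>2)" using d(2) sq by (simp add: nn_integral_eq_integral)
 then have "sqrt (\<integral>w. (Y w - X w)^2 \<partial>M) \<le> sqrt (d\<^sup>2)" by (intro real_sqrt_le_mono) simp
 then have l1: "?A \<le> d" using integral_abs_le_sqrt[OF _ sq] d(1) by simp
 have i3: "integrable M (\<lambda>w. \<bar>Y w - X w\<bar>)" by (rule integrable_abs, rule square_integrable_imp_integrable[OF _ sq]) simp
 have j1: "integrable M (\<lambda>w. g w * exp (b * X w))"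
 proof (rule Bochner_Integration.integrable_bound)
  show "integrable M (\<lambda>w. B * exp (b * X w))" using i1 by simp
  show "AE w in M. norm (g w * exp (b * X w)) \<le> norm (B * exp (b * X w))"
   using g B by (simp add: abs_mult)
 qed simp
 have j2: "integrable M (\<lambda>w. g w * min (exp (b * Y w)) L)"
 proof (rule integrable_const_bound[where B = "B * L"])
  have "\<bar>g w\<bar> * \<bar>min (exp (b * Y w)) L\<bar> \<le> B * L" for w
   using g B L by (intro mult_mono) (auto simp: min_def abs_if)
  then show "AE w in M. norm (g w * min (exp (b * Y w)) L) \<le> B * L" by (simp add: abs_mult)
 qed simp
 have "\<bar>(\<integral>w. g w * exp (b * X w) \<partial>M) - (\<integral>w. g w * min (exp (b * Y w)) L \<partial>M)\<bar>
   = \<bar>\<integral>w. g w * exp (b * X w) - g w * min (exp (b * Y w)) L \<partial>M\<bar>"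
  using j1 j2 by simp
 also have "... \<le> (\<integral>w. \<bar>g w * exp (b * X w) - g w * min (exp (b * Y w)) L\<bar> \<partial>M)" by (rule integral_abs_bound)
 also have "... \<le> (\<integral>w. B * (exp (2 * b * X w) / L + L * b * \<bar>Y w - X w\<bar>) \<partial>M)"
 proof (rule integral_mono)
  fix w
  have "0 \<le> exp (b * X w) - min (exp (b * X w)) L" "exp (b * X w) - min (exp (b * X w)) L \<le> exp (2 * b * X w) / L"
   using exp_excess_le[OF L, of "b * X w"] by (auto simp: mult.assoc)
  moreover have "\<bar>min (exp (b * X w)) L - min (exp (b * Y w)) L\<bar> \<le> L * b * \<bar>Y w - X w\<bar>"
   using min_exp_Lipschitz[OF L, of "b * X w" "b * Y w"] b
   by (simp add: right_diff_distrib[symmetric] abs_mult mult.assoc abs_minus_commute)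
  ultimately have "\<bar>exp (b * X w) - min (exp (b * Y w)) L\<bar> \<le> exp (2 * b * X w) / L + L * b * \<bar>Y w - X w\<bar>" by linarith
  then have "\<bar>g w\<bar> * \<bar>exp (b * X w) - min (exp (b * Y w)) L\<bar> \<le> B * (exp (2 * b * X w) / L + L * b * \<bar>Y w - X w\<bar>)"
   using g B by (intro mult_mono) auto
  then show "\<bar>g w * exp (b * X w) - g w * min (exp (b * Y w)) L\<bar> \<le> B * (exp (2 * b * X w) / L + L * b * \<bar>Y w - X w\<bar>)"
   by (simp add: abs_mult[symmetric] right_diff_distrib)
 qed (use j1 j2 i2 i3 in auto)
 also have "... = B * (?B / L + L * b * ?A)"
  using i2 i3 by simp
 also have "... \<le> B * (4 / L + L * b * d)"
  using B L b i2 l1 by (intro mult_left_mono add_mono divide_right_mono) auto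
 finally show ?thesis by (simp add: mult_ac)
qed

text \<open>Outside the box the weight is split at height R: it is at most R plus
  \<open>exp (2 * b * V w) / R\<close>. The first part meets a probability of order R^(-2), the
  second a bounded moment, so both errors are of order 1/R.\<close>

lemma synth_clip_error:
 fixes V :: "'a \<Rightarrow> real" and F :: "distribution \<Rightarrow> real"
 assumes X [measurable]: "X \<in> borel_measurable M" and sq: "\<And>k. (\<integral>\<^sup>+w. ennreal ((X w k)^2) \<partial>M) \<le> 1"
  and V [measurable]: "V \<in> borel_measurable M" and b: "0 \<le> b" "2 * b \<le> c"
  and bound: "(\<integral>\<^sup>+w. ennreal (exp (c * V w)) \<partial>M) \<le> ennreal 3"
  and F: "continuous_on UNIV F" "\<And>T. \<bar>F T\<bar> \<le> B" and R: "0 < R"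
 shows "\<bar>(\<integral>w. F (synth (X w)) * exp (b * V w) \<partial>M) - (\<integral>w. F (synth (clip R (X w))) * exp (b * V w) \<partial>M)\<bar>
  \<le> 2 * B * ((sqw_total + 4) / R)"
proof -
 let ?A = "\<integral>w. exp (2 * b * V w) \<partial>M"
 have B: "0 \<le> B" using order.trans[OF abs_ge_zero F(2)] .
 have [measurable]: "F \<in> borel_measurable borel" by (rule borel_measurable_continuous_onI[OF F(1)])
 have [measurable]: "(\<lambda>w. synth (clip R (X w))) \<in> borel_measurable M"
  by (rule measurable_compose[OF X borel_measurable_continuous_onI[OF continuous_synth_clip]]) (use R in simp)
 have Xk [measurable]: "(\<lambda>w. X w k) \<in> borel_measurable M" for k
  by (rule measurable_product_then_coordinatewise[OF X])
 define A where "A = {w \<in> space M. \<not> box_bounded R (X w)}"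
 have Am [measurable]: "A \<in> sets M" unfolding A_def box_bounded_def by measurable
 have i1: "integrable M (\<lambda>w. exp (b * V w))"
  by (rule exp_moment_le(1)[OF _ _ _ bound]) (use b in auto)
 have i2: "integrable M (\<lambda>w. exp (2 * b * V w))" "?A \<le> 4"
  by (rule exp_moment_le[OF _ _ _ bound]; use b in simp)+
 have j: "integrable M (\<lambda>w. F (Z w) * exp (b * V w))" if [measurable]: "Z \<in> borel_measurable M" for Z
 proof (rule Bochner_Integration.integrable_bound)
  show "integrable M (\<lambda>w. B * exp (b * V w))" using i1 by simp
  show "AE w in M. norm (F (Z w) * exp (b * V w)) \<le> norm (B * exp (b * V w))"
   using F(2) B by (simp add: abs_mult)
 qed simp
 have k: "integrable M (\<lambda>w. indicator A w * R :: real)"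
  by (rule integrable_const_bound[where B = R]) (use R in \<open>auto simp: indicator_def\<close>)
 have "\<bar>(\<integral>w. F (synth (X w)) * exp (b * V w) \<partial>M) - (\<integral>w. F (synth (clip R (X w))) * exp (b * V w) \<partial>M)\<bar>
   = \<bar>\<integral>w. F (synth (X w)) * exp (b * V w) - F (synth (clip R (X w))) * exp (b * V w) \<partial>M\<bar>"
  using j by simp
 also have "... \<le> (\<integral>w. \<bar>F (synth (X w)) * exp (b * V w) - F (synth (clip R (X w))) * exp (b * V w)\<bar> \<partial>M)" by (rule integral_abs_bound)
 also have "... \<le> (\<integral>w. 2 * B * (indicator A w * R + exp (2 * b * V w) / R) \<partial>M)"
 proof (rule integral_mono)
  fix w assume w: "w \<in> space M"
  show "\<bar>F (synth (X w)) * exp (b * V w) - F (synth (clip R (X w))) * exp (b * V w)\<bar>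
   \<le> 2 * B * (indicator A w * R + exp (2 * b * V w) / R)"
  proof (cases "w \<in> A")
   case True
   have "\<bar>F (synth (X w)) - F (synth (clip R (X w)))\<bar> \<le> 2 * B"
    using F(2)[of "synth (X w)"] F(2)[of "synth (clip R (X w))"] by linarith
   moreover have "exp (b * V w) \<le> R + exp (2 * b * V w) / R"
    using exp_excess_le[OF R, of "b * V w"] by (simp add: min_def mult.assoc split: if_splits)
   ultimately have "\<bar>F (synth (X w)) - F (synth (clip R (X w)))\<bar> * exp (b * V w) \<le> 2 * B * (R + exp (2 * b * V w) / R)"
    using B by (intro mult_mono) auto
   then show ?thesis using True by (simp add: left_diff_distrib[symmetric] abs_mult)
  next
   case False
   then show ?thesis using w B R by (simp add: A_def clip_eq)
  qed
 qed (use j k i2 in \<open>auto intro!: Bochner_Integration.integrable_diff\<close>)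
 also have "... = 2 * B * (measure M A * R + ?A / R)"
  using k i2 by simp
 also have "... \<le> 2 * B * (sqw_total / R\<^sup>2 * R + 4 / R)"
  using B R i2 prob_not_box_bounded_le[OF X sq R]
  by (intro mult_left_mono add_mono mult_right_mono divide_right_mono) (auto simp: A_def)
 also have "... = 2 * B * ((sqw_total + 4) / R)" using R by (simp add: power2_eq_square add_divide_distrib)
 finally show ?thesis .
qed

end

subsection \<open>The interaction energy of the particles\<close>

lemma sum_square_symmetric:
 fixes f :: "nat \<Rightarrow> nat \<Rightarrow> real"
 assumes "\<And>i j. f i j = f j i"
 shows "(\<Sum>i<N. \<Sum>j<N. f i j) = (\<Sum>i<N. f i i) + 2 * (\<Sum>j<N. \<Sum>i<j. f i j)"
proof (induction N)
 case (Suc N)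
 have "(\<Sum>j<N. f N j) = (\<Sum>j<N. f j N)" using assms by simp
 with Suc show ?case by (simp add: sum.distrib)
qed simp

text \<open>The diagonal terms i = j contribute \<open>green_trunc n 0\<close>, which equals the sum
  of the \<open>lam k\<close>. Leaving out the self-interactions is thus exactly the Wick
  subtraction, for every n and every N > 0.\<close>

lemma energy_trunc_emp_coeffs:
 assumes N: "0 < N"
 shows "(\<Sum>j<N. \<Sum>i<j. green_trunc n (x i - x j)) / real N = energy_trunc n (emp_coeffs N x)"
proof -
 let ?A = "\<Sum>k\<in>grid n - {0}. lam k * (emp_coeffs N x k)^2"
 let ?B = "\<Sum>j<N. \<Sum>i<j. green_trunc n (x i - x j)"
 have sq: "(emp_coeffs N x k)^2 = (\<Sum>i<N. \<Sum>j<N. cas k (x i) * cas k (x j)) / real N" if "k \<noteq> 0" for k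
  using that N by (simp add: emp_coeffs_def power_divide power2_eq_square[of "sum _ _"] sum_product)
 have "?A = (\<Sum>k\<in>grid n - {0}. \<Sum>i<N. \<Sum>j<N. lam k * (cas k (x i) * cas k (x j)) / real N)"
  by (intro sum.cong refl) (simp add: sq sum_distrib_left sum_divide_distrib)
 also have "... = (\<Sum>k\<in>grid n. \<Sum>i<N. \<Sum>j<N. lam k * (cas k (x i) * cas k (x j)) / real N)"
  by (intro sum.mono_neutral_left) auto
 also have "... = (\<Sum>i<N. \<Sum>j<N. \<Sum>k\<in>grid n. lam k * (cas k (x i) * cas k (x j)) / real N)"
  by (subst sum.swap, intro sum.cong refl, rule sum.swap)
 also have "... = (\<Sum>i<N. \<Sum>j<N. green_trunc n (x i - x j)) / real N"
  by (simp add: sum_divide_distrib[symmetric] green_trunc_diff_eq)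
 also have "... = (real N * green_trunc n 0 + 2 * ?B) / real N"
  by (subst sum_square_symmetric[OF green_trunc_swap]) simp
 finally have a: "?A = green_trunc n 0 + 2 * ?B / real N"
  using N by (simp add: add_divide_distrib)
 have "(\<Sum>k\<in>grid n - {0}. lam k) = (\<Sum>k\<in>grid n. lam k)" by (intro sum.mono_neutral_left) auto
 also have "... = green_trunc n 0" by (simp add: green_trunc_def cas_def)
 finally show ?thesis
  using a by (simp add: energy_trunc_def right_diff_distrib sum_subtractf)
qed

lemma continuous_energy_trunc: "continuous_on UNIV (energy_trunc n)"
 unfolding energy_trunc_def
 by (intro continuous_on_divide continuous_on_sum continuous_on_mult continuous_on_diff continuous_on_power continuous_on_const continuous_on_product_coordinates) auto

lemma measurable_energy_trunc [measurable]: "energy_trunc n \<in> borel_measurable borel"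
 by (rule borel_measurable_continuous_onI[OF continuous_energy_trunc])

lemma measurable_hamiltonian [measurable]: "hamiltonian N \<in> borel_measurable (particles N)"
 unfolding hamiltonian_def by (intro borel_measurable_sum measurable_pair_difference) auto

text \<open>Of two distinct pairs, one contains a particle that is absent from the other;
  integrating over it gives zero, so the pair terms are orthogonal. At most N^2 terms with equal
  second moment, divided by N^2, give a bound free of N.\<close>

lemma pair_energy_square:
 assumes D [measurable]: "D \<in> borel_measurable borel" and per: "periodic D"
  and sq: "integrable \<T> (\<lambda>z. (D z)^2)" and 0: "(\<integral>z. D z \<partial>\<T>) = 0"
 shows "(\<integral>\<^sup>+x. ennreal (((\<Sum>j<N. \<Sum>i<j. D (x i - x j)) / real N)^2) \<partial>particles N) \<le> ennreal (\<integral>z. (D z)^2 \<partial>\<T>)"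
proof -
 define I where "I = (SIGMA j:{..<N}. {..<j})"
 define U where "U p x = D (x (snd p) - x (fst p))" for p :: "nat \<times> nat" and x :: "nat \<Rightarrow> plane"
 define v where "v = (\<integral>z. (D z)^2 \<partial>\<T>)"
 have v: "0 \<le> v" by (simp add: v_def)
 have m: "U p \<in> borel_measurable (particles N)" if "p \<in> I" for p
  unfolding U_def[abs_def] using that by (intro measurable_pair_difference D) (auto simp: I_def)
 have nn: "(\<integral>\<^sup>+x. ennreal ((U p x)^2) \<partial>particles N) = ennreal v" if "p \<in> I" for p
 proof -
  have "periodic (\<lambda>z. ennreal ((D z)^2))" using per by (simp add: periodic_def)
  from nn_integral_particle_pair[OF _ _ _ _ this, of "snd p" N "fst p"]
  have "(\<integral>\<^sup>+x. ennreal ((U p x)^2) \<partial>particles N) = (\<integral>\<^sup>+z. ennreal ((D z)^2) \<partial>\<T>)"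
   using that by (auto simp: I_def U_def)
  then show ?thesis using sq by (simp add: v_def nn_integral_eq_integral)
 qed
 have int: "integrable (particles N) (\<lambda>x. (U p x)^2)" if "p \<in> I" for p
  using m[OF that] nn[OF that] by (intro integrableI_nonneg) auto
 have val: "(\<integral>x. (U p x)^2 \<partial>particles N) = v" if "p \<in> I" for p
 proof -
  have "ennreal (\<integral>x. (U p x)^2 \<partial>particles N) = ennreal v"
   using nn[OF that] int[OF that] by (simp add: nn_integral_eq_integral)
  then show ?thesis using v by simp
 qed
 have z: "(\<integral>y. D (y - w) \<partial>\<T>) = 0" "(\<integral>y. D (w - y) \<partial>\<T>) = 0" for w
  using integral_torus_shift[OF per D, of "- w"] integral_torus_reflect[OF per D, of w] 0 by simp_all
 have orth: "(\<integral>x. U p x * U q x \<partial>particles N) = 0" if p: "p \<in> I" and q: "q \<in> I" and ne: "p \<noteq> q" for p q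
 proof -
  obtain i j k l where pq: "p = (j, i)" "q = (l, k)" by fastforce
  have ord: "i < j" "j < N" "k < l" "l < N" using p q by (auto simp: I_def pq)
  have F: "integrable (particles N) (\<lambda>x. U p x * U q x)"
   by (rule integrable_mult_of_squares[OF m[OF p] m[OF q] int[OF p] int[OF q]])
  \<comment> \<open>Pairs are stored with the larger index first. The particle integrated out is j
    if q does not contain it; if j = l it is i; if j = k it is l, which exceeds both j and
    i.\<close>
  consider "j \<noteq> k" "j \<noteq> l" | "j = l" "i \<noteq> k" | "j = k" using ne pq by auto
  then show ?thesis
  proof cases
   case 1
   then show ?thesis using ord by (intro integral_particle_zero[OF _ F, of j]) (auto simp: U_def pq z)
  next
   case 2
   then show ?thesis using ord by (intro integral_particle_zero[OF _ F, of i]) (auto simp: U_def pq z)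
  next
   case 3
   then show ?thesis using ord by (intro integral_particle_zero[OF _ F, of l]) (auto simp: U_def pq z)
  qed
 qed
 have fin: "finite I" by (simp add: I_def)
 note os = orthogonal_sum_square[OF fin m int orth]
 have "card I \<le> card ({..<N} \<times> {..<N})" by (rule card_mono) (auto simp: I_def)
 then have card: "real (card I) \<le> real N * real N" by (simp add: of_nat_mult[symmetric] del: of_nat_mult)
 have eq: "((\<Sum>j<N. \<Sum>i<j. D (x i - x j)) / real N)^2 = (\<Sum>p\<in>I. U p x)^2 / (real N)^2" for x
  by (simp add: I_def U_def sum.Sigma power_divide case_prod_unfold)
 have "(\<integral>x. (\<Sum>p\<in>I. U p x)^2 / (real N)^2 \<partial>particles N) = real (card I) * v / (real N)^2"
  using os by (simp add: val)
 also have "... \<le> v"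
 proof (cases "N = 0")
  case False
  then show ?thesis using mult_right_mono[OF card v] by (simp add: field_simps power2_eq_square)
 qed (simp add: v)
 finally show ?thesis
  unfolding eq v_def[symmetric] using os(1) v by (subst nn_integral_eq_integral) (auto intro: ennreal_leI)
qed

lemma hamiltonian_L2:
 assumes N: "0 < N"
 shows "(\<integral>\<^sup>+x. ennreal ((energy_trunc n (emp_coeffs N x) - hamiltonian N x / real N)^2) \<partial>particles N)
  \<le> ennreal (\<integral>z. (green_trunc n z - green z)^2 \<partial>\<T>)"
proof -
 define D where "D z = green_trunc n z - green z" for z
 have "periodic D" using periodic_green_trunc[of n] periodic_green by (simp add: periodic_def D_def)
 moreover have "(\<integral>z. D z \<partial>\<T>) = 0"
  using is_green_function_green integrable_green integral_green_trunc integrable_green_trunc by (simp add: D_def is_green_function_def)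
 moreover have "integrable \<T> (\<lambda>z. (D z)^2)"
  unfolding D_def by (intro integrable_square_diff integrable_green_trunc_square integrable_green_square) auto
 ultimately have "(\<integral>\<^sup>+x. ennreal (((\<Sum>j<N. \<Sum>i<j. D (x i - x j)) / real N)^2) \<partial>particles N) \<le> ennreal (\<integral>z. (D z)^2 \<partial>\<T>)"
  by (intro pair_energy_square) (simp_all add: D_def[abs_def])
 moreover have "(\<Sum>j<N. \<Sum>i<j. D (x i - x j)) / real N = energy_trunc n (emp_coeffs N x) - hamiltonian N x / real N" for x
  using energy_trunc_emp_coeffs[OF N, of n x] by (simp add: D_def sum_subtractf hamiltonian_def diff_divide_distrib)
 ultimately show ?thesis by (simp add: D_def)
qed

lemma exp_moment_energy_trunc:
 assumes N: "0 < N"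
 shows "(\<integral>\<^sup>+x. ennreal (exp (coupling / 2 * energy_trunc n (emp_coeffs N x))) \<partial>particles N) \<le> ennreal 3"
 using nn_integral_exp_energy_trunc_le[OF N, of n] by (simp add: energy_trunc_emp_coeffs[OF N, symmetric])

lemma exp_moment_hamiltonian:
 assumes N: "0 < N"
 shows "(\<integral>\<^sup>+x. ennreal (exp (coupling / 2 * (hamiltonian N x / real N))) \<partial>particles N) \<le> ennreal 3"
proof (rule prob_space.exp_moment_limit[OF prob_space_particles _ _ _ exp_moment_energy_trunc[OF N]])
 show "(\<lambda>n. \<integral>\<^sup>+x. ennreal ((energy_trunc n (emp_coeffs N x) - hamiltonian N x / real N)^2) \<partial>particles N) \<longlonglongrightarrow> 0"
 proof (rule tendsto_sandwich[OF _ _ tendsto_const, rotated 2])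
  show "(\<lambda>n. ennreal (\<integral>z. (green_trunc n z - green z)^2 \<partial>\<T>)) \<longlonglongrightarrow> 0"
   using tendsto_ennrealI[OF green_trunc_L2] by simp
 qed (intro always_eventually allI hamiltonian_L2[OF N] zero_le)+
qed measurable

text \<open>Inherited from the particles: the exponential cut at m is bounded and continuous in the
  coefficients, so the bound 3 survives the limit in N, and monotone convergence removes the
  cut.\<close>

lemma exp_moment_energy_trunc_coeffs:
 "(\<integral>\<^sup>+y. ennreal (exp (coupling / 2 * energy_trunc n (coeffs y))) \<partial>\<W>) \<le> ennreal 3"
proof -
 define h where "h m a = min (exp (coupling / 2 * energy_trunc n a)) (real m)" for m a
 have hc: "continuous_on UNIV (h m)" for m
  unfolding h_def by (intro continuous_intros continuous_energy_trunc)
 have hb: "\<bar>h m a\<bar> \<le> real m" for m a by (auto simp: h_def min_def)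
 have [measurable]: "h m \<in> borel_measurable borel" for m by (rule borel_measurable_continuous_onI[OF hc])
 have h0: "0 \<le> h m a" for m a by (simp add: h_def)
 have le: "(\<integral>y. h m (coeffs y) \<partial>\<W>) \<le> 3" for m
 proof (rule LIMSEQ_le_const2[OF emp_coeffs_convergence[OF hc hb]])
  show "\<exists>N0. \<forall>N\<ge>N0. (\<integral>x. h m (emp_coeffs N x) \<partial>particles N) \<le> 3"
  proof (intro exI[of _ 1] allI impI)
   fix N :: nat assume N: "1 \<le> N"
   have int: "integrable (particles N) (\<lambda>x. h m (emp_coeffs N x))"
    by (rule finite_measure.integrable_const_bound[OF prob_space.finite_measure[OF prob_space_particles], where B = "real m"]) (use hb in auto)
   have "ennreal (\<integral>x. h m (emp_coeffs N x) \<partial>particles N) = (\<integral>\<^sup>+x. ennreal (h m (emp_coeffs N x)) \<partial>particles N)"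
    using int h0 by (simp add: nn_integral_eq_integral)
   also have "... \<le> (\<integral>\<^sup>+x. ennreal (exp (coupling / 2 * energy_trunc n (emp_coeffs N x))) \<partial>particles N)"
    by (intro nn_integral_mono ennreal_leI) (simp add: h_def)
   also have "... \<le> ennreal 3" using N by (intro exp_moment_energy_trunc) simp
   finally show "(\<integral>x. h m (emp_coeffs N x) \<partial>particles N) \<le> 3" by (subst (asm) ennreal_le_iff) simp_all
  qed
 qed
 have sup: "(SUP m. ennreal (h m a)) = ennreal (exp (coupling / 2 * energy_trunc n a))" for a
 proof (rule antisym)
  obtain m where "exp (coupling / 2 * energy_trunc n a) \<le> real m" using real_arch_simple by blast
  then have "h m a = exp (coupling / 2 * energy_trunc n a)" by (simp add: h_def)
  then show "ennreal (exp (coupling / 2 * energy_trunc n a)) \<le> (SUP m. ennreal (h m a))" by (metis SUP_upper UNIV_I)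
 qed (auto intro!: SUP_least ennreal_leI simp: h_def)
 have "(\<integral>\<^sup>+y. ennreal (exp (coupling / 2 * energy_trunc n (coeffs y))) \<partial>\<W>) = (\<integral>\<^sup>+y. (SUP m. ennreal (h m (coeffs y))) \<partial>\<W>)"
  by (simp add: sup)
 also have "... = (SUP m. \<integral>\<^sup>+y. ennreal (h m (coeffs y)) \<partial>\<W>)"
 proof (rule nn_integral_monotone_convergence_SUP)
  show "incseq (\<lambda>m y. ennreal (h m (coeffs y)))"
   by (auto simp: incseq_def le_fun_def h_def intro!: ennreal_leI)
 qed simp
 also have "... \<le> ennreal 3"
 proof (rule SUP_least)
  fix m
  have "integrable \<W> (\<lambda>y. h m (coeffs y))"
   by (rule wn.integrable_const_bound[where B = "real m"]) (use hb in auto)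
  then show "(\<integral>\<^sup>+y. ennreal (h m (coeffs y)) \<partial>\<W>) \<le> ennreal 3"
   using ennreal_leI[OF le[of m]] h0 by (simp add: nn_integral_eq_integral)
 qed
 finally show ?thesis .
qed

lemma exp_moment_wick_energy:
 "(\<integral>\<^sup>+x. ennreal (exp (coupling / 2 * wick_energy x)) \<partial>\<W>) \<le> ennreal 3"
 by (rule wn.exp_moment_limit[OF _ _ wick_energy_L2 exp_moment_energy_trunc_coeffs]) simp_all

subsection \<open>Convergence of the weighted expectations\<close>

text \<open>One cut-off n has to serve the particles for all N and white noise at the same time,
  because the limit in N is taken at fixed n.\<close>

lemma green_trunc_close:
 assumes "0 < d"
 shows "\<exists>n. (\<forall>N>0. (\<integral>\<^sup>+x. ennreal ((energy_trunc n (emp_coeffs N x) - hamiltonian N x / real N)^2) \<partial>particles N) \<le> ennreal (d\<^sup>2))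
  \<and> (\<integral>\<^sup>+y. ennreal ((energy_trunc n (coeffs y) - wick_energy y)^2) \<partial>\<W>) \<le> ennreal (d\<^sup>2)"
proof -
 have "\<forall>\<^sub>F n in sequentially. (\<integral>\<^sup>+y. ennreal ((energy_trunc n (coeffs y) - wick_energy y)^2) \<partial>\<W>) < ennreal (d\<^sup>2)"
  using wick_energy_L2 by (rule order_tendstoD) (use assms in simp)
 moreover have "\<forall>\<^sub>F n in sequentially. (\<integral>z. (green_trunc n z - green z)^2 \<partial>\<T>) < d\<^sup>2"
  using green_trunc_L2 by (rule order_tendstoD) (use assms in simp)
 ultimately have "\<forall>\<^sub>F n in sequentially. (\<integral>\<^sup>+y. ennreal ((energy_trunc n (coeffs y) - wick_energy y)^2) \<partial>\<W>) < ennreal (d\<^sup>2)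
   \<and> (\<integral>z. (green_trunc n z - green z)^2 \<partial>\<T>) < d\<^sup>2" by (rule eventually_conj)
 then obtain n where n: "(\<integral>\<^sup>+y. ennreal ((energy_trunc n (coeffs y) - wick_energy y)^2) \<partial>\<W>) < ennreal (d\<^sup>2)"
   "(\<integral>z. (green_trunc n z - green z)^2 \<partial>\<T>) < d\<^sup>2"
  by (auto dest: eventually_happens)
 have "(\<integral>\<^sup>+x. ennreal ((energy_trunc n (emp_coeffs N x) - hamiltonian N x / real N)^2) \<partial>particles N) \<le> ennreal (d\<^sup>2)" if "0 < N" for N
  by (rule order.trans[OF hamiltonian_L2[OF that] ennreal_leI]) (use n(2) in simp)
 with n(1) show ?thesis by (auto intro: less_imp_le)
qed

text \<open>The two weights are not continuous functions of the coefficients. Both are replaced by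
  the same bounded continuous function, the exponential of \<open>energy_trunc\<close> cut at L, to
  which \<open>emp_coeffs_convergence\<close> applies.\<close>

lemma weighted_coeff_limit:
 fixes f :: "(freq \<Rightarrow> real) \<Rightarrow> real"
 assumes f: "continuous_on UNIV f" "\<And>a. \<bar>f a\<bar> \<le> B" and b: "0 < b" "b \<le> coupling / 4"
 shows "(\<lambda>N. \<integral>x. f (emp_coeffs N x) * exp (b * (hamiltonian N x / real N)) \<partial>particles N)
  \<longlonglongrightarrow> (\<integral>y. f (coeffs y) * exp (b * wick_energy y) \<partial>\<W>)"
proof (rule tendsto_by_approximation)
 let ?A = "\<integral>y. f (coeffs y) * exp (b * wick_energy y) \<partial>\<W>"
 fix e :: real assume e: "0 < e"
 have B: "0 \<le> B" using order.trans[OF abs_ge_zero f(2)] .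
 have [measurable]: "f \<in> borel_measurable borel" by (rule borel_measurable_continuous_onI[OF f(1)])
 \<comment> \<open>L makes B * (4 / L) at most e / 2, then d makes the Lipschitz error at most e /
   2; B + 1 keeps both positive when B = 0.\<close>
 define L where "L = 8 * (B + 1) / e"
 define d where "d = e / (2 * (B + 1) * b * L)"
 have L: "0 < L" and d: "0 < d" using B e b by (auto simp: L_def d_def)
 have "B * (4 / L) \<le> e / 2" using B e by (simp add: L_def field_simps)
 moreover have "b * L * d = e / (2 * (B + 1))" using b L by (simp add: d_def)
 then have "B * (b * L * d) = B * e / (2 * (B + 1))" by simp
 moreover have "B * e / (2 * (B + 1)) \<le> e / 2" using B e by (simp add: field_simps)
 ultimately have le: "B * (4 / L + b * L * d) \<le> e" unfolding distrib_left by linarith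
 obtain n where n: "\<And>N. 0 < N \<Longrightarrow> (\<integral>\<^sup>+x. ennreal ((energy_trunc n (emp_coeffs N x) - hamiltonian N x / real N)^2) \<partial>particles N) \<le> ennreal (d\<^sup>2)"
  "(\<integral>\<^sup>+y. ennreal ((energy_trunc n (coeffs y) - wick_energy y)^2) \<partial>\<W>) \<le> ennreal (d\<^sup>2)"
  using green_trunc_close[OF d] by blast
 define h where "h a = f a * min (exp (b * energy_trunc n a)) L" for a
 have hc: "continuous_on UNIV h" unfolding h_def by (intro continuous_intros f continuous_energy_trunc)
 have hb: "\<bar>h a\<bar> \<le> B * L" for a
  unfolding h_def abs_mult using f(2) B L by (intro mult_mono) (auto simp: min_def abs_if)
 have b2: "0 \<le> b" "2 * b \<le> coupling / 2" using b by auto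
 show "\<exists>u c. (\<forall>\<^sub>F N in sequentially. \<bar>(\<integral>x. f (emp_coeffs N x) * exp (b * (hamiltonian N x / real N)) \<partial>particles N) - u N\<bar> \<le> e)
  \<and> \<bar>?A - c\<bar> \<le> e \<and> u \<longlonglongrightarrow> c"
 proof (intro exI conjI)
  show "(\<lambda>N. \<integral>x. h (emp_coeffs N x) \<partial>particles N) \<longlonglongrightarrow> (\<integral>y. h (coeffs y) \<partial>\<W>)"
   by (rule emp_coeffs_convergence[OF hc hb])
  show "\<bar>?A - (\<integral>y. h (coeffs y) \<partial>\<W>)\<bar> \<le> e"
   unfolding h_def
   by (rule order.trans[OF wn.exp_truncation_error[OF _ _ _ f(2) L b2 exp_moment_wick_energy less_imp_le[OF d] n(2)] le]) simp_all
  show "\<forall>\<^sub>F N in sequentially. \<bar>(\<integral>x. f (emp_coeffs N x) * exp (b * (hamiltonian N x / real N)) \<partial>particles N) - (\<integral>x. h (emp_coeffs N x) \<partial>particles N)\<bar> \<le> e"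
   unfolding eventually_sequentially
  proof (intro exI[of _ 1] allI impI)
   fix N :: nat assume "1 \<le> N"
   then have N: "0 < N" by simp
   show "\<bar>(\<integral>x. f (emp_coeffs N x) * exp (b * (hamiltonian N x / real N)) \<partial>particles N) - (\<integral>x. h (emp_coeffs N x) \<partial>particles N)\<bar> \<le> e"
    unfolding h_def
    by (rule order.trans[OF prob_space.exp_truncation_error[OF prob_space_particles _ _ _ f(2) L b2 exp_moment_hamiltonian[OF N] less_imp_le[OF d] n(1)[OF N]] le]) simp_all
  qed
 qed
qed

lemma weighted_limit:
 fixes F :: "distribution \<Rightarrow> real"
 assumes F: "continuous_on UNIV F" "\<And>T. \<bar>F T\<bar> \<le> B" and b: "0 < b" "b \<le> coupling / 4"
 shows "(\<lambda>N. \<integral>x. F (empirical_vorticity N x) * exp (b * (hamiltonian N x / real N)) \<partial>particles N)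
  \<longlonglongrightarrow> (\<integral>y. F y * exp (b * wick_energy y) \<partial>\<W>)"
proof (rule tendsto_by_approximation)
 let ?A = "\<integral>y. F y * exp (b * wick_energy y) \<partial>\<W>"
 fix e :: real assume e: "0 < e"
 have B: "0 \<le> B" using order.trans[OF abs_ge_zero F(2)] .
 have [measurable]: "F \<in> borel_measurable borel" by (rule borel_measurable_continuous_onI[OF F(1)])
 have S: "0 \<le> sqw_total" by (rule sqw_total_nonneg)
 \<comment> \<open>Makes the error of \<open>synth_clip_error\<close> at most e.\<close>
 define R where "R = 2 * (B + 1) * (sqw_total + 4) / e"
 have R: "0 < R" using B S e by (simp add: R_def)
 have "B * 2 * (sqw_total + 4) \<le> R * e" using S e by (simp add: R_def)
 then have le: "2 * B * ((sqw_total + 4) / R) \<le> e" using R by (simp add: field_simps)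
 have b2: "0 \<le> b" "2 * b \<le> coupling / 2" using b by auto
 define h where "h a = F (synth (clip R a))" for a
 have hc: "continuous_on UNIV h"
  unfolding h_def by (rule continuous_on_compose2[OF F(1) continuous_synth_clip]) (use R in auto)
 show "\<exists>u c. (\<forall>\<^sub>F N in sequentially. \<bar>(\<integral>x. F (empirical_vorticity N x) * exp (b * (hamiltonian N x / real N)) \<partial>particles N) - u N\<bar> \<le> e)
  \<and> \<bar>?A - c\<bar> \<le> e \<and> u \<longlonglongrightarrow> c"
 proof (intro exI conjI)
  show "(\<lambda>N. \<integral>x. h (emp_coeffs N x) * exp (b * (hamiltonian N x / real N)) \<partial>particles N)
   \<longlonglongrightarrow> (\<integral>y. h (coeffs y) * exp (b * wick_energy y) \<partial>\<W>)"
   by (rule weighted_coeff_limit[OF hc _ b, of B]) (simp add: h_def F(2))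
  \<comment> \<open>White noise is recovered from its coefficients almost surely; for the particles
    the corresponding identity is exact.\<close>
  have "?A = (\<integral>y. F (synth (coeffs y)) * exp (b * wick_energy y) \<partial>\<W>)"
  proof (rule integral_cong_AE)
   show "AE y in \<W>. F y * exp (b * wick_energy y) = F (synth (coeffs y)) * exp (b * wick_energy y)"
    using wn.AE_synth_coeffs by eventually_elim simp
  qed simp_all
  then show "\<bar>?A - (\<integral>y. h (coeffs y) * exp (b * wick_energy y) \<partial>\<W>)\<bar> \<le> e"
   unfolding h_def
   using order.trans[OF wn.synth_clip_error[OF _ wn.coeffs_square _ b2 exp_moment_wick_energy F R] le] by simp
  show "\<forall>\<^sub>F N in sequentially. \<bar>(\<integral>x. F (empirical_vorticity N x) * exp (b * (hamiltonian N x / real N)) \<partial>particles N)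
    - (\<integral>x. h (emp_coeffs N x) * exp (b * (hamiltonian N x / real N)) \<partial>particles N)\<bar> \<le> e"
   unfolding eventually_sequentially
  proof (intro exI[of _ 1] allI impI)
   fix N :: nat assume "1 \<le> N"
   then have N: "0 < N" by simp
   show "\<bar>(\<integral>x. F (empirical_vorticity N x) * exp (b * (hamiltonian N x / real N)) \<partial>particles N)
    - (\<integral>x. h (emp_coeffs N x) * exp (b * (hamiltonian N x / real N)) \<partial>particles N)\<bar> \<le> e"
    unfolding h_def empirical_vorticity_eq_synth[OF N]
    by (rule order.trans[OF prob_space.synth_clip_error[OF prob_space_particles _ emp_coeffs_square _ b2 exp_moment_hamiltonian[OF N] F R] le]) simp_all
  qed
 qed
qed

lemma (in prob_space) integral_pos:
 fixes f :: "'a \<Rightarrow> real"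
 assumes "integrable M f" "\<And>x. 0 < f x"
 shows "0 < (\<integral>x. f x \<partial>M)"
proof -
 let ?A = "\<integral>x. f x \<partial>M"
 have "?A \<noteq> 0"
 proof
  assume "?A = 0"
  then have "AE x in M. f x = 0" using assms by (subst (asm) integral_nonneg_eq_0_iff_AE) (auto intro: less_imp_le)
  then have "AE x in M. False" by eventually_elim (use assms(2) in \<open>simp add: less_le\<close>)
  then show False by simp
 qed
 moreover have "0 \<le> ?A" using assms(2) by (intro Bochner_Integration.integral_nonneg) (auto intro: less_imp_le)
 ultimately show ?thesis by simp
qed

lemma (in prob_space) prob_space_density_normalized:
 fixes f :: "'a \<Rightarrow> real"
 assumes int: "integrable M f" and pos: "\<And>x. 0 < f x"
 shows "prob_space (density M (\<lambda>x. ennreal (f x / (\<integral>y. f y \<partial>M))))"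
proof -
 note p = integral_pos[OF assms]
 have "(\<integral>\<^sup>+x. ennreal (f x / (\<integral>y. f y \<partial>M)) \<partial>M) = ennreal (\<integral>x. f x / (\<integral>y. f y \<partial>M) \<partial>M)"
  using int by (intro nn_integral_eq_integral AE_I2 divide_nonneg_pos less_imp_le[OF pos] p) simp
 also have "... = 1" using p by simp
 finally show ?thesis
  using borel_measurable_integrable[OF int] by (intro prob_spaceI) (simp add: emeasure_density)
qed

lemma partition_fun_eq: "partition_fun N b = (\<integral>x. exp (b * (hamiltonian N x / real N)) \<partial>particles N)"
 by (simp add: partition_fun_def)

theorem partition_fun_limit:
 assumes "0 < b" "b \<le> coupling / 4"
 shows "(\<lambda>N. partition_fun N b) \<longlonglongrightarrow> (\<integral>x. exp (b * wick_energy x) \<partial>\<W>)"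
 using weighted_coeff_limit[OF _ _ assms, of "\<lambda>_. 1" 1] by (simp add: partition_fun_eq)

text \<open>A Gibbs expectation is the quotient of a weighted integral by the partition function.
  Numerator and denominator converge separately, and the limit of the denominator is
  positive.\<close>

theorem vorticity_law_limit:
 assumes b: "0 < b" "b \<le> coupling / 4"
 shows "weakly_converges (\<lambda>N. vorticity_law N b) (energy_enstrophy b)"
proof -
 define Z where "Z = (\<integral>y. exp (b * wick_energy y) \<partial>\<W>)"
 have int: "integrable \<W> (\<lambda>y. exp (b * wick_energy y))"
  by (rule wn.exp_moment_le(1)[OF _ _ _ exp_moment_wick_energy]) (use b coupling_pos in auto)
 have Z: "0 < Z" unfolding Z_def by (rule wn.integral_pos[OF int]) simp
 have intN: "integrable (particles N) (\<lambda>x. exp (b / real N * hamiltonian N x))" if "0 < N" for N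
  using prob_space.exp_moment_le(1)[OF prob_space_particles _ _ _ exp_moment_hamiltonian[OF that], of b] b coupling_pos by simp
 have gp: "prob_space (gibbs N b)" if "0 < N" for N
  unfolding gibbs_def partition_fun_def
  by (rule prob_space.prob_space_density_normalized[OF prob_space_particles intN[OF that]]) simp
 have em: "empirical_vorticity N \<in> borel_measurable (gibbs N b)" if "0 < N" for N
  using measurable_empirical_vorticity[OF that] by (simp add: gibbs_def)
 have F: "(\<lambda>N. \<integral>T. F T \<partial>vorticity_law N b) \<longlonglongrightarrow> (\<integral>T. F T \<partial>energy_enstrophy b)"
  if Fc: "continuous_on UNIV F" and Fb: "bounded (range F)" for F :: "distribution \<Rightarrow> real"
 proof -
  obtain B where B: "\<And>T. \<bar>F T\<bar> \<le> B" using Fb by (auto simp: bounded_iff)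
  have Fm [measurable]: "F \<in> borel_measurable borel" by (rule borel_measurable_continuous_onI[OF Fc])
  have lim: "(\<lambda>N. (\<integral>x. F (empirical_vorticity N x) * exp (b * (hamiltonian N x / real N)) \<partial>particles N) / partition_fun N b)
   \<longlonglongrightarrow> (\<integral>y. F y * exp (b * wick_energy y) \<partial>\<W>) / Z"
   using Z unfolding Z_def by (intro tendsto_divide weighted_limit[OF Fc B b] partition_fun_limit[OF b]) simp
  have "(\<integral>T. F T \<partial>energy_enstrophy b) = (\<integral>y. exp (b * wick_energy y) / Z * F y \<partial>\<W>)"
   unfolding energy_enstrophy_def Z_def[symmetric] using Z by (subst integral_density) auto
  also have "... = (\<integral>y. F y * exp (b * wick_energy y) / Z \<partial>\<W>)"
   by (intro Bochner_Integration.integral_cong refl) simp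
  finally have E: "(\<integral>T. F T \<partial>energy_enstrophy b) = (\<integral>y. F y * exp (b * wick_energy y) \<partial>\<W>) / Z" by simp
  have "\<forall>\<^sub>F N in sequentially. (\<integral>x. F (empirical_vorticity N x) * exp (b * (hamiltonian N x / real N)) \<partial>particles N) / partition_fun N b
    = (\<integral>T. F T \<partial>vorticity_law N b)"
   unfolding eventually_sequentially
  proof (intro exI[of _ 1] allI impI)
   fix N :: nat assume "1 \<le> N"
   then have N: "0 < N" by simp
   note [measurable] = measurable_empirical_vorticity[OF N]
   have P: "0 < partition_fun N b"
    unfolding partition_fun_def by (rule prob_space.integral_pos[OF prob_space_particles intN[OF N]]) simp
   have "(\<integral>T. F T \<partial>vorticity_law N b) = (\<integral>x. F (empirical_vorticity N x) \<partial>gibbs N b)"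
    unfolding vorticity_law_def by (rule integral_distr[OF em[OF N]]) simp
   also have "... = (\<integral>x. exp (b / real N * hamiltonian N x) / partition_fun N b * F (empirical_vorticity N x) \<partial>particles N)"
    unfolding gibbs_def using P by (subst integral_density) auto
   also have "... = (\<integral>x. F (empirical_vorticity N x) * exp (b * (hamiltonian N x / real N)) / partition_fun N b \<partial>particles N)"
    by (intro Bochner_Integration.integral_cong refl) simp
   finally show "(\<integral>x. F (empirical_vorticity N x) * exp (b * (hamiltonian N x / real N)) \<partial>particles N) / partition_fun N b
    = (\<integral>T. F T \<partial>vorticity_law N b)" by simp
  qed
  from Lim_transform_eventually[OF lim this] show ?thesis unfolding E .
 qed
 have "prob_space (energy_enstrophy b)"
  unfolding energy_enstrophy_def by (rule wn.prob_space_density_normalized[OF int]) simp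
 moreover have "sets (energy_enstrophy b) = sets borel" by (simp add: energy_enstrophy_def)
 moreover have "\<forall>\<^sub>F N in sequentially. prob_space (vorticity_law N b) \<and> sets (vorticity_law N b) = sets borel"
  unfolding eventually_sequentially
  by (intro exI[of _ 1] allI impI conjI) (auto simp: vorticity_law_def intro!: prob_space.prob_space_distr gp em)
 ultimately show ?thesis unfolding weakly_converges_def using F by blast
qed

subsection \<open>Gaussian exponential integrals\<close>

text \<open>Logarithm of one factor of the determinant. It is of second order in
  \<open>lam k\<close>, hence summable, although \<open>lam\<close> itself is not.\<close>

definition ldet :: "real \<Rightarrow> freq \<Rightarrow> real"
 where "ldet b k = ln (1 - b * lam k) + b * lam k"

text \<open>Together with the Gaussian weight the integrand is a multiple of the normal density of
  variance 1 / (1 - c).\<close>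

lemma nn_integral_std_normal_exp_quadratic:
 assumes c: "c < 1"
 shows "(\<integral>\<^sup>+x. ennreal (exp (c * (x\<^sup>2 - 1) / 2)) \<partial>\<N>) = ennreal (exp (- (ln (1 - c) + c) / 2))"
proof -
 define s where "s = 1 - c"
 define e where "e = exp (- (ln s + c) / 2)"
 have s: "0 < s" using c by (simp add: s_def)
 have e: "e = exp (- c / 2) / sqrt s"
 proof -
  have "e = exp (- c / 2) * exp (- (ln s / 2))" by (simp add: e_def exp_add[symmetric] field_simps)
  also have "exp (- (ln s / 2)) = inverse (sqrt s)" using s by (simp add: ln_sqrt[symmetric] exp_minus)
  finally show ?thesis by (simp add: field_simps)
 qed
 have eq: "std_normal_density x * exp (c * (x\<^sup>2 - 1) / 2) = e * normal_density 0 (1 / sqrt s) x" for x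
 proof -
  have "exp (- x\<^sup>2 / 2) * exp (c * (x\<^sup>2 - 1) / 2) = exp (- c / 2) * exp (- s * x\<^sup>2 / 2)"
   by (simp add: exp_add[symmetric] s_def field_simps)
  moreover have "normal_density 0 (1 / sqrt s) x = sqrt s / sqrt (2 * pi) * exp (- s * x\<^sup>2 / 2)"
   using s by (simp add: normal_density_def real_sqrt_divide power_divide field_simps)
  ultimately show ?thesis using s by (simp add: std_normal_density_def e field_simps)
 qed
 have "(\<integral>\<^sup>+x. ennreal (exp (c * (x\<^sup>2 - 1) / 2)) \<partial>\<N>)
   = (\<integral>\<^sup>+x. ennreal (std_normal_density x * exp (c * (x\<^sup>2 - 1) / 2)) \<partial>lborel)"
  by (subst nn_integral_density) (auto simp: ennreal_mult)
 also have "... = ennreal (\<integral>x. e * normal_density 0 (1 / sqrt s) x \<partial>lborel)"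
  unfolding eq using s by (intro nn_integral_eq_integral) (auto simp: e_def)
 also have "... = ennreal e" using s by simp
 finally show ?thesis by (simp add: e_def s_def)
qed

lemma (in prob_space) integral_min_tendsto:
 fixes f :: "'a \<Rightarrow> real"
 assumes int: "integrable M f" and pos: "\<And>x. 0 \<le> f x"
 shows "(\<lambda>m. \<integral>x. min (f x) (real m) \<partial>M) \<longlonglongrightarrow> (\<integral>x. f x \<partial>M)"
proof (rule integral_dominated_convergence[OF _ _ int])
 note [measurable] = borel_measurable_integrable[OF int]
 show "AE x in M. (\<lambda>m. min (f x) (real m)) \<longlonglongrightarrow> f x"
 proof (rule AE_I2)
  fix x
  obtain m0 where "f x \<le> real m0" using real_arch_simple by blast
  then have "\<forall>\<^sub>F m in sequentially. min (f x) (real m) = f x"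
   unfolding eventually_sequentially by (intro exI[of _ m0]) (auto simp: min_def)
  then show "(\<lambda>m. min (f x) (real m)) \<longlonglongrightarrow> f x" by (rule tendsto_eventually)
 qed
 show "AE x in M. norm (min (f x) (real m)) \<le> f x" for m using pos by (auto simp: min_def)
 show "f \<in> borel_measurable M" "(\<lambda>x. min (f x) (real m)) \<in> borel_measurable M" for m by measurable
qed

text \<open>The integral factorises under \<open>gauss_seq\<close>. It is carried over to the chosen
  white noise through cuts at m, since \<open>white_noise_coeff_law\<close> speaks of bounded
  continuous functions.\<close>

lemma integral_exp_energy_trunc:
 assumes b: "0 < b" "b \<le> coupling / 4"
 shows "(\<integral>x. exp (b * energy_trunc n (coeffs x)) \<partial>\<W>) = exp (- (\<Sum>k\<in>grid n - {0}. ldet b k) / 2)"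
proof -
 let ?A = "- (\<Sum>k\<in>grid n - {0}. ldet b k) / 2"
 let ?B = "\<integral>\<^sup>+a. ennreal (exp (b * energy_trunc n a)) \<partial>gauss_seq"
 let ?C = "\<integral>a. exp (b * energy_trunc n a) \<partial>gauss_seq"
 have c: "b * lam k < 1" for k
 proof -
  have "b * lam k \<le> (1 / 8) * 1" using b coupling_le lam_le_1[of k] by (intro mult_mono) auto
  then show ?thesis by simp
 qed
 have ex: "exp (b * energy_trunc n a) = (\<Prod>k\<in>grid n - {0}. exp (b * lam k * ((a k)^2 - 1) / 2))" for a
  by (simp add: energy_trunc_def exp_sum[symmetric] sum_distrib_left sum_divide_distrib mult.assoc)
 have "?B = (\<Prod>k\<in>grid n - {0}. ennreal (exp (- ldet b k / 2)))"
  unfolding ex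
  by (subst nn_integral_gauss_seq_prod) (auto simp: nn_integral_std_normal_exp_quadratic[OF c] ldet_def)
 also have "... = ennreal (exp ?A)"
  by (simp add: prod_ennreal exp_sum[symmetric] sum_negf sum_divide_distrib)
 finally have nn: "?B = ennreal (exp ?A)" .
 have int: "integrable gauss_seq (\<lambda>a. exp (b * energy_trunc n a))"
  using nn by (intro integrableI_nonneg) auto
 have val: "?C = exp ?A"
  using nn int by (simp add: nn_integral_eq_integral)
 have eq: "(\<integral>a. min (exp (b * energy_trunc n a)) (real m) \<partial>gauss_seq) = (\<integral>x. min (exp (b * energy_trunc n (coeffs x))) (real m) \<partial>\<W>)" for m
 proof -
  have "energy_trunc n (\<lambda>k. if k = 0 then 0 else a k) = energy_trunc n a" for a
   by (simp add: energy_trunc_def)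
  moreover have "continuous_on UNIV (\<lambda>a. min (exp (b * energy_trunc n a)) (real m))"
   by (intro continuous_intros continuous_energy_trunc)
  ultimately show ?thesis
   using white_noise_coeff_law[of "\<lambda>a. min (exp (b * energy_trunc n a)) (real m)" "real m"] by (simp add: min_def)
 qed
 have "integrable \<W> (\<lambda>x. exp (b * energy_trunc n (coeffs x)))"
  by (rule wn.exp_moment_le(1)[OF _ _ _ exp_moment_energy_trunc_coeffs]) (use b coupling_pos in auto)
 then have "(\<lambda>m. \<integral>x. min (exp (b * energy_trunc n (coeffs x))) (real m) \<partial>\<W>)
   \<longlonglongrightarrow> (\<integral>x. exp (b * energy_trunc n (coeffs x)) \<partial>\<W>)"
  by (rule wn.integral_min_tendsto) simp
 moreover have "(\<lambda>m. \<integral>a. min (exp (b * energy_trunc n a)) (real m) \<partial>gauss_seq) \<longlonglongrightarrow> ?C"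
  using int by (rule gs.integral_min_tendsto) simp
 ultimately show ?thesis unfolding eq val[symmetric] by (rule LIMSEQ_unique)
qed

text \<open>L2 convergence of the exponents and their common moment bound give convergence of the
  exponentials: both sides are compared with one cut integral c.\<close>

lemma integral_exp_energy_trunc_tendsto:
 assumes b: "0 < b" "b \<le> coupling / 4"
 shows "(\<lambda>n. \<integral>x. exp (b * energy_trunc n (coeffs x)) \<partial>\<W>) \<longlonglongrightarrow> (\<integral>x. exp (b * wick_energy x) \<partial>\<W>)"
proof (rule tendsto_by_approximation)
 fix e :: real assume e: "0 < e"
 define L where "L = 8 / e"
 define d where "d = e / (2 * b * L)"
 have L: "0 < L" and d: "0 < d" using e b by (auto simp: L_def d_def)
 have b2: "0 \<le> b" "2 * b \<le> coupling / 2" using b by auto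
 have le: "1 * (4 / L + b * L * d) \<le> e" "1 * (4 / L + b * L * 0) \<le> e" using e b L by (auto simp: L_def d_def)
 define c where "c = (\<integral>x. 1 * min (exp (b * wick_energy x)) L \<partial>\<W>)"
 have "\<forall>\<^sub>F n in sequentially. (\<integral>\<^sup>+x. ennreal ((energy_trunc n (coeffs x) - wick_energy x)^2) \<partial>\<W>) < ennreal (d\<^sup>2)"
  using wick_energy_L2 by (rule order_tendstoD) (use d in simp)
 then have "\<forall>\<^sub>F n in sequentially. \<bar>(\<integral>x. 1 * exp (b * energy_trunc n (coeffs x)) \<partial>\<W>) - c\<bar> \<le> e"
 proof eventually_elim
  case (elim n)
  then have *: "(\<integral>\<^sup>+x. ennreal ((wick_energy x - energy_trunc n (coeffs x))^2) \<partial>\<W>) \<le> ennreal (d\<^sup>2)"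
   by (simp add: power2_commute[of "wick_energy _"] less_imp_le)
  show ?case
   unfolding c_def
   by (rule order.trans[OF wn.exp_truncation_error[where B = 1, OF _ _ _ _ L b2 exp_moment_energy_trunc_coeffs less_imp_le[OF d] *] le(1)]) simp_all
 qed
 \<comment> \<open>The same estimate with the approximation equal to the variable itself, at
   distance 0.\<close>
 moreover have "\<bar>(\<integral>x. 1 * exp (b * wick_energy x) \<partial>\<W>) - c\<bar> \<le> e"
  unfolding c_def
  by (rule order.trans[OF wn.exp_truncation_error[where B = 1, OF _ _ _ _ L b2 exp_moment_wick_energy order.refl] le(2)]) simp_all
 ultimately show "\<exists>u c. (\<forall>\<^sub>F n in sequentially. \<bar>(\<integral>x. exp (b * energy_trunc n (coeffs x)) \<partial>\<W>) - u n\<bar> \<le> e)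
  \<and> \<bar>(\<integral>x. exp (b * wick_energy x) \<partial>\<W>) - c\<bar> \<le> e \<and> u \<longlonglongrightarrow> c"
  by (intro exI[of _ "\<lambda>_. c"] exI[of _ c]) simp
qed

subsection \<open>The spectrum of the Green operator\<close>

lemma periodic_shift:
 assumes "periodic f" shows "periodic (\<lambda>z. f (z + y))"
 unfolding periodic_def
proof (intro allI conjI)
 fix a b
 have "f (a + fst y + 1, b + snd y) = f (a + fst y, b + snd y)" "f (a + fst y, b + snd y + 1) = f (a + fst y, b + snd y)"
  using assms unfolding periodic_def by blast+
 then show "f ((a + 1, b) + y) = f ((a, b) + y)" "f ((a, b + 1) + y) = f ((a, b) + y)"
  by (simp_all add: plus_prod_def add_ac)
qed

lemma cas_add: "cas k (x + y) = cos (phase k y) * cas k x + sin (phase k y) * cas (- k) x"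
 by (simp add: cas_def phase_add_right phase_minus_left cos_add sin_add algebra_simps)

lemma green_op_cas: "green_op (cas k) x = lam k * cas k x"
proof -
 have per: "periodic (\<lambda>z. green z * cas k (x - z))"
  by (rule periodic_mult[OF periodic_green periodic_reflect[OF periodic_cas]])
 have "green_op (cas k) x = (\<integral>z. green z * cas k (x - z) \<partial>\<T>)"
  using integral_torus_reflect[OF per, of x] by (simp add: green_op_def)
 also have "... = (\<integral>z. cos (phase k x) * (green z * cas (- k) z) + sin (phase k x) * (green z * cas k z) \<partial>\<T>)"
 proof (intro Bochner_Integration.integral_cong refl)
  fix z show "green z * cas k (x - z) = cos (phase k x) * (green z * cas (- k) z) + sin (phase k x) * (green z * cas k z)"
   by (simp add: cas_def phase_diff_right phase_minus_left cos_diff sin_diff algebra_simps)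
 qed
 also have "... = cos (phase k x) * lam k + sin (phase k x) * lam k"
  using cas_coeff_green[of k] cas_coeff_green[of "- k"] by (simp add: integrable_cas_mult integrable_green cas_coeff_def)
 finally show ?thesis by (simp add: cas_def algebra_simps)
qed

lemma L2_zeroD:
 assumes "f \<in> L2_zero"
 shows "f \<in> borel_measurable borel" "integrable \<T> f" "cas_coeff f 0 = 0"
proof -
 show "f \<in> borel_measurable borel" "cas_coeff f 0 = 0" using assms by (simp_all add: L2_zero_def cas_coeff_def)
 show "integrable \<T> f"
  by (rule torus.square_integrable_imp_integrable) (use assms in \<open>simp_all add: L2_zero_def\<close>)
qed

lemma cas_in_L2_zero: "k \<noteq> 0 \<Longrightarrow> cas k \<in> L2_zero"
 using integrable_cas_mult[OF integrable_cas, of k k] by (simp add: L2_zero_def integral_cas power2_eq_square)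

text \<open>After Fubini the inner integral over x is a multiple of the convolution of
  \<open>green\<close> with \<open>cas k\<close>, which acts as \<open>lam k\<close> because the
  coefficients of \<open>green\<close> at k and - k coincide.\<close>

lemma cas_coeff_green_op:
 assumes f: "f \<in> L2_zero"
 shows "cas_coeff (green_op f) k = lam k * cas_coeff f k"
proof -
 note [measurable] = L2_zeroD(1)[OF f]
 define h where "h x y = green (x - y) * f y * cas k x" for x y
 have hm [measurable]: "case_prod h \<in> borel_measurable torus_pair" unfolding h_def by measurable
 have "integrable torus_pair (case_prod h)"
 proof (rule integrableI_bounded[OF hm])
  have per: "periodic (\<lambda>z. ennreal \<bar>green z\<bar>)" using periodic_green by (simp add: periodic_def)
  have "(\<integral>\<^sup>+z. ennreal (norm (case_prod h z)) \<partial>torus_pair) = (\<integral>\<^sup>+y. (\<integral>\<^sup>+x. ennreal \<bar>h x y\<bar> \<partial>\<T>) \<partial>\<T>)"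
   by (subst nn_integral_snd[symmetric]) (auto simp: case_prod_unfold)
  also have "... \<le> (\<integral>\<^sup>+y. (\<integral>\<^sup>+x. ennreal (2 * \<bar>f y\<bar>) * ennreal \<bar>green (x - y)\<bar> \<partial>\<T>) \<partial>\<T>)"
  proof (intro nn_integral_mono)
   fix x y
   have "\<bar>h x y\<bar> \<le> 2 * \<bar>f y\<bar> * \<bar>green (x - y)\<bar>"
    using mult_left_mono[OF abs_cas_le[of k x], of "\<bar>green (x - y)\<bar> * \<bar>f y\<bar>"] by (simp add: h_def abs_mult mult_ac)
   then show "ennreal \<bar>h x y\<bar> \<le> ennreal (2 * \<bar>f y\<bar>) * ennreal \<bar>green (x - y)\<bar>"
    by (simp add: ennreal_mult[symmetric] ennreal_leI)
  qed
  also have "... = (\<integral>\<^sup>+y. ennreal (2 * \<bar>f y\<bar>) * (\<integral>\<^sup>+z. ennreal \<bar>green z\<bar> \<partial>\<T>) \<partial>\<T>)"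
  proof (intro nn_integral_cong)
   fix y
   have "(\<integral>\<^sup>+x. ennreal \<bar>green (x - y)\<bar> \<partial>\<T>) = (\<integral>\<^sup>+z. ennreal \<bar>green z\<bar> \<partial>\<T>)"
    using nn_integral_torus_reflect[OF periodic_reflect[OF per], of 0 y] nn_integral_torus_reflect[OF per, of 0] by simp
   then show "(\<integral>\<^sup>+x. ennreal (2 * \<bar>f y\<bar>) * ennreal \<bar>green (x - y)\<bar> \<partial>\<T>) = ennreal (2 * \<bar>f y\<bar>) * (\<integral>\<^sup>+z. ennreal \<bar>green z\<bar> \<partial>\<T>)"
    by (simp add: nn_integral_cmult)
  qed
  also have "... = (\<integral>\<^sup>+y. ennreal (2 * \<bar>f y\<bar>) \<partial>\<T>) * (\<integral>\<^sup>+z. ennreal \<bar>green z\<bar> \<partial>\<T>)"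
   by (simp add: nn_integral_multc)
  also have "... < \<infinity>"
   using L2_zeroD(2)[OF f] integrable_green by (simp add: nn_integral_eq_integral ennreal_mult_less_top)
  finally show "(\<integral>\<^sup>+z. ennreal (norm (case_prod h z)) \<partial>torus_pair) < \<infinity>" .
 qed
 then have fub: "(\<integral>y. (\<integral>x. h x y \<partial>\<T>) \<partial>\<T>) = (\<integral>x. (\<integral>y. h x y \<partial>\<T>) \<partial>\<T>)"
  by (rule Fubini_integral)
 have "(\<integral>x. h x y \<partial>\<T>) = f y * (lam k * cas k y)" for y
 proof -
  have per: "periodic (\<lambda>z. green z * cas k (z + y))"
   by (rule periodic_mult[OF periodic_green periodic_shift[OF periodic_cas]])
  have "(\<integral>x. h x y \<partial>\<T>) = f y * (\<integral>x. green (x - y) * cas k x \<partial>\<T>)"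
   by (simp add: h_def mult_ac)
  also have "(\<integral>x. green (x - y) * cas k x \<partial>\<T>) = (\<integral>z. green z * cas k (z + y) \<partial>\<T>)"
   using integral_torus_shift[OF per, of "- y"] by simp
  also have "... = (\<integral>z. cos (phase k y) * (green z * cas k z) + sin (phase k y) * (green z * cas (- k) z) \<partial>\<T>)"
   by (simp add: cas_add algebra_simps)
  also have "... = cos (phase k y) * lam k + sin (phase k y) * lam k"
   using cas_coeff_green[of k] cas_coeff_green[of "- k"] by (simp add: integrable_cas_mult integrable_green cas_coeff_def)
  also have "... = lam k * cas k y" by (simp add: cas_def algebra_simps)
  finally show ?thesis .
 qed
 then have "(\<integral>x. (\<integral>y. h x y \<partial>\<T>) \<partial>\<T>) = (\<integral>y. lam k * (f y * cas k y) \<partial>\<T>)"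
  unfolding fub[symmetric] by (simp add: mult_ac)
 then show ?thesis by (simp add: h_def green_op_def cas_coeff_def)
qed

lemma eigenspace_coeff:
 assumes f: "f \<in> eigenspace green_op l" and k: "k = 0 \<or> lam k \<noteq> l"
 shows "cas_coeff f k = 0"
proof -
 have L2: "f \<in> L2_zero" and ae: "AE z in \<T>. green_op f z = l * f z" using f by (auto simp: eigenspace_def)
 note [measurable] = L2_zeroD(1)[OF L2]
 have [measurable]: "green_op f \<in> borel_measurable borel" unfolding green_op_def[abs_def] by measurable
 have "cas_coeff (green_op f) k = cas_coeff (\<lambda>z. l * f z) k"
  unfolding cas_coeff_def by (intro integral_cong_AE) (use ae in auto)
 then have "lam k * cas_coeff f k = l * cas_coeff f k"
  unfolding cas_coeff_green_op[OF L2] by (simp add: cas_coeff_def mult.assoc)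
 then show ?thesis using k L2_zeroD(3)[OF L2] by auto
qed

lemma cas_in_eigenspace: "k \<noteq> 0 \<Longrightarrow> cas k \<in> eigenspace green_op (lam k)"
 by (simp add: eigenspace_def cas_in_L2_zero green_op_cas)

text \<open>An eigenfunction that is not almost everywhere zero has a nonzero coefficient by
  \<open>torus_uniqueness\<close>, and \<open>eigenspace_coeff\<close> then makes the eigenvalue
  equal to \<open>lam\<close> at that nonzero frequency. In particular 0 is not an
  eigenvalue.\<close>

lemma eigenvalues_green_op: "eigenvalues green_op = lam ` (- {0})"
proof (intro equalityI subsetI)
 fix l assume "l \<in> eigenvalues green_op"
 then obtain f where f: "f \<in> eigenspace green_op l" "\<not> (AE z in \<T>. f z = 0)" by (auto simp: eigenvalues_def)
 have "integrable \<T> f" using f(1) L2_zeroD(2) by (simp add: eigenspace_def)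
 then obtain k where "cas_coeff f k \<noteq> 0" using torus_uniqueness f(2) by blast
 then show "l \<in> lam ` (- {0})" using eigenspace_coeff[OF f(1), of k] by auto
next
 fix l assume "l \<in> lam ` (- {0})"
 then obtain k where k: "k \<noteq> 0" "l = lam k" by auto
 have "\<not> (AE z in \<T>. cas k z = 0)"
 proof
  assume "AE z in \<T>. cas k z = 0"
  then have "(\<integral>z. cas k z * cas k z \<partial>\<T>) = 0" by (intro integral_eq_zero_AE) auto
  then show False by (simp add: integral_cas_mult_cas)
 qed
 then show "l \<in> eigenvalues green_op" using cas_in_eigenspace[OF k(1)] k(2) by (auto simp: eigenvalues_def)
qed

text \<open>Since \<open>lam k\<close> is at most 1 / \<open>sqw k\<close>, a positive eigenvalue
  confines its frequencies to a grid.\<close>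

lemma finite_lam_eq:
 assumes "0 < l"
 shows "finite {k. lam k = l}"
proof (rule finite_subset)
 show "{k. lam k = l} \<subseteq> grid (nat \<lceil>1 / l\<rceil>)"
 proof
  fix k assume "k \<in> {k. lam k = l}"
  then have s: "sqw k \<le> 1 / l" using lam_le[of k] assms sqw_pos[of k] by (simp add: field_simps)
  have "\<bar>j\<bar> \<le> \<lceil>1 / l\<rceil>" if "(of_int j)^2 \<le> sqw k" for j :: int
  proof -
   have "\<bar>j\<bar> * 1 \<le> \<bar>j\<bar> * \<bar>j\<bar>" by (cases "j = 0") (simp, rule mult_left_mono, auto)
   then have "of_int \<bar>j\<bar> \<le> (of_int (j\<^sup>2) :: real)" by (simp add: power2_eq_square abs_mult_self_eq flip: of_int_abs of_int_mult)
   then have "of_int \<bar>j\<bar> \<le> 1 / l" using that s by simp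
   then show ?thesis by linarith
  qed
  from this[of "fst k"] this[of "snd k"] have "\<bar>fst k\<bar> \<le> \<lceil>1 / l\<rceil>" "\<bar>snd k\<bar> \<le> \<lceil>1 / l\<rceil>" by (auto simp: sqw_def)
  moreover have "0 < 1 / l" using assms by simp
  then have "0 \<le> \<lceil>1 / l\<rceil>" by linarith
  ultimately show "k \<in> grid (nat \<lceil>1 / l\<rceil>)"
   unfolding grid_def mem_Times_iff atLeastAtMost_iff by linarith
 qed
qed simp

text \<open>Gaussian elimination: an unknown p that occurs in equation l is solved for and
  substituted into the other equations, so that one unknown and one equation disappear
  together.\<close>

lemma underdetermined_system:
 fixes a :: "'i \<Rightarrow> 'k \<Rightarrow> real"
 assumes "finite K" "finite I" "card K < card I"
 shows "\<exists>c. (\<exists>i\<in>I. c i \<noteq> 0) \<and> (\<forall>k\<in>K. (\<Sum>i\<in>I. c i * a i k) = 0)"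
 using assms
proof (induction K arbitrary: I a rule: finite_induct)
 case empty
 then obtain i where "i \<in> I" by fastforce
 then show ?case by (intro exI[of _ "\<lambda>_. 1"]) auto
next
 case (insert l K)
 show ?case
 proof (cases "\<forall>i\<in>I. a i l = 0")
  case True
  obtain c where "\<exists>i\<in>I. c i \<noteq> 0" "\<forall>k\<in>K. (\<Sum>i\<in>I. c i * a i k) = 0"
   using insert.IH[OF insert.prems(1), of a] insert.prems insert.hyps by auto
  then show ?thesis using True by (intro exI[of _ c]) auto
 next
  case False
  then obtain p where p: "p \<in> I" "a p l \<noteq> 0" by blast
  define q where "q i = a i l / a p l" for i
  have "card K < card (I - {p})" using insert.prems insert.hyps p by simp
  then obtain c where c: "\<exists>i\<in>I - {p}. c i \<noteq> 0" "\<forall>k\<in>K. (\<Sum>i\<in>I - {p}. c i * (a i k - q i * a p k)) = 0"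
   using insert.IH[of "I - {p}" "\<lambda>i k. a i k - q i * a p k"] insert.prems by auto
  define c' where "c' i = (if i = p then - (\<Sum>i\<in>I - {p}. c i * q i) else c i)" for i
  have eq: "(\<Sum>i\<in>I. c' i * a i k) = (\<Sum>i\<in>I - {p}. c i * (a i k - q i * a p k))" for k
  proof -
   have "(\<Sum>i\<in>I. c' i * a i k) = c' p * a p k + (\<Sum>i\<in>I - {p}. c' i * a i k)"
    using insert.prems p by (simp add: sum.remove)
   also have "(\<Sum>i\<in>I - {p}. c' i * a i k) = (\<Sum>i\<in>I - {p}. c i * a i k)" by (intro sum.cong) (auto simp: c'_def)
   finally show ?thesis
    by (simp add: c'_def right_diff_distrib sum_subtractf sum_distrib_right mult.assoc)
  qed
  have "c i * (a i l - q i * a p l) = 0" for i using p by (simp add: q_def)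
  then have "(\<Sum>i\<in>I. c' i * a i l) = 0" unfolding eq by (simp only: sum.neutral_const)
  then have "\<forall>k\<in>insert l K. (\<Sum>i\<in>I. c' i * a i k) = 0" using c(2) unfolding eq by simp
  moreover have "\<exists>i\<in>I. c' i \<noteq> 0" using c(1) by (auto simp: c'_def)
  ultimately show ?thesis by blast
 qed
qed

lemma cas_coeff_combination:
 fixes f :: "nat \<Rightarrow> plane \<Rightarrow> real"
 assumes "\<And>i. i < n \<Longrightarrow> integrable \<T> (f i)"
 shows "cas_coeff (\<lambda>z. \<Sum>i<n. c i * f i z) k = (\<Sum>i<n. c i * cas_coeff (f i) k)"
proof -
 have "cas_coeff (\<lambda>z. \<Sum>i<n. c i * f i z) k = (\<integral>z. (\<Sum>i<n. c i * (f i z * cas k z)) \<partial>\<T>)"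
  by (simp add: cas_coeff_def sum_distrib_right mult.assoc)
 also have "... = (\<Sum>i<n. \<integral>z. c i * (f i z * cas k z) \<partial>\<T>)"
  using assms by (intro Bochner_Integration.integral_sum Bochner_Integration.integrable_mult_right integrable_cas_mult) auto
 finally show ?thesis by (simp add: cas_coeff_def)
qed

text \<open>The functions \<open>cas k\<close> with \<open>lam k = l\<close> are independent. For
  the upper bound, among more functions than such frequencies some nontrivial combination has
  vanishing coefficients there; all other coefficients vanish on the eigenspace, so the combination
  is zero almost everywhere.\<close>

lemma multiplicity_green_op:
 assumes l: "0 < l"
 shows "multiplicity_of green_op l = card {k. lam k = l}"
proof -
 define K where "K = {k. lam k = l}"
 have K: "finite K" unfolding K_def by (rule finite_lam_eq[OF l])
 have K0: "k \<noteq> 0" "lam k = l" if "k \<in> K" for k using that l by (auto simp: K_def)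
 define S where "S = {n. \<exists>f :: nat \<Rightarrow> plane \<Rightarrow> real. (\<forall>i<n. f i \<in> eigenspace green_op l) \<and>
  (\<forall>c. (AE z in \<T>. (\<Sum>i<n. c i * f i z) = 0) \<longrightarrow> (\<forall>i<n. c i = 0))}"
 have "card K \<in> S"
 proof -
  obtain e where e: "bij_betw e {..<card K} K" using ex_bij_betw_nat_finite[OF K] by (auto simp: atLeast0LessThan)
  then have eK: "e i \<in> K" if "i < card K" for i using that by (auto simp: bij_betw_def)
  have "c j = 0" if ae: "AE z in \<T>. (\<Sum>i<card K. c i * cas (e i) z) = 0" and j: "j < card K" for c j
  proof -
   have "cas_coeff (\<lambda>z. \<Sum>i<card K. c i * cas (e i) z) (e j) = 0"
    unfolding cas_coeff_def using ae by (intro integral_eq_zero_AE) auto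
   then have "(\<Sum>i<card K. c i * cas_coeff (cas (e i)) (e j)) = 0" by (subst (asm) cas_coeff_combination) auto
   moreover have "(\<Sum>i<card K. c i * cas_coeff (cas (e i)) (e j)) = (\<Sum>i<card K. if i = j then c i else 0)"
   proof (intro sum.cong refl)
    fix i assume "i \<in> {..<card K}"
    then have "e i = e j \<longleftrightarrow> i = j" using e j by (auto simp: bij_betw_def inj_on_def)
    then show "c i * cas_coeff (cas (e i)) (e j) = (if i = j then c i else 0)"
     by (simp add: cas_coeff_def integral_cas_mult_cas)
   qed
   ultimately show ?thesis using j by simp
  qed
  moreover have "cas (e i) \<in> eigenspace green_op l" if "i < card K" for i
   using cas_in_eigenspace[of "e i"] K0[OF eK[OF that]] by simp
  ultimately show ?thesis unfolding S_def by (intro CollectI exI[of _ "\<lambda>i. cas (e i)"]) blast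
 qed
 moreover have "n \<le> card K" if n: "n \<in> S" for n
 proof (rule ccontr)
  assume "\<not> n \<le> card K"
  obtain f :: "nat \<Rightarrow> plane \<Rightarrow> real" where f: "\<And>i. i < n \<Longrightarrow> f i \<in> eigenspace green_op l"
   and ind: "\<And>c. (AE z in \<T>. (\<Sum>i<n. c i * f i z) = 0) \<Longrightarrow> \<forall>i<n. c i = 0"
   using n unfolding S_def by blast
  have int: "integrable \<T> (f i)" if "i < n" for i
   using f[OF that] L2_zeroD(2) by (simp add: eigenspace_def)
  obtain c where c: "\<exists>i\<in>{..<n}. c i \<noteq> 0" "\<forall>k\<in>K. (\<Sum>i<n. c i * cas_coeff (f i) k) = 0"
   using underdetermined_system[OF K, of "{..<n}" "\<lambda>i k. cas_coeff (f i) k"] \<open>\<not> n \<le> card K\<close> by auto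
  have "AE z in \<T>. (\<Sum>i<n. c i * f i z) = 0"
  proof (rule torus_uniqueness)
   show "integrable \<T> (\<lambda>z. \<Sum>i<n. c i * f i z)" using int by (intro Bochner_Integration.integrable_sum) simp
   show "cas_coeff (\<lambda>z. \<Sum>i<n. c i * f i z) k = 0" for k
   proof (cases "k \<in> K")
    case False
    then have "cas_coeff (f i) k = 0" if "i < n" for i using eigenspace_coeff[OF f[OF that], of k] by (simp add: K_def)
    then show ?thesis by (simp add: cas_coeff_combination[OF int])
   qed (use c(2) in \<open>simp add: cas_coeff_combination[OF int]\<close>)
  qed
  from ind[OF this] c(1) show False by auto
 qed
 \<comment> \<open>\<open>Sup\<close> on the naturals has its intended meaning because the set has a
   maximum.\<close>
 ultimately have "Sup S = card K" by (rule cSup_eq_maximum)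
 then show ?thesis by (simp add: multiplicity_of_def S_def K_def)
qed

subsection \<open>The Carleman--Fredholm determinant\<close>

lemma summable_on_ldet:
 assumes b: "0 < b" "b \<le> 1 / 2"
 shows "ldet b summable_on A"
proof -
 have "(\<lambda>k. norm (ldet b k)) summable_on UNIV"
 proof (rule summable_on_comparison_test)
  show "(\<lambda>k. (lam k)^2) summable_on UNIV" by (rule summable_on_lam_square)
  show "norm (ldet b k) \<le> (lam k)^2" for k
  proof -
   have c: "0 \<le> b * lam k" "b * lam k \<le> 1 / 2" using b lam_le_1[of k] mult_mono[of b "1/2" "lam k" 1] by auto
   have "\<bar>ldet b k\<bar> \<le> 2 * (b * lam k)^2"
    using abs_ln_one_plus_x_minus_x_bound_nonpos[of "- (b * lam k)"] c by (simp add: ldet_def)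
   also have "... = (2 * b\<^sup>2) * (lam k)^2" by (simp add: power_mult_distrib)
   also have "... \<le> 1 * (lam k)^2"
    using b power_mono[of b "1/2" 2] by (intro mult_right_mono) (auto simp: power2_eq_square)
   finally show ?thesis by simp
  qed
 qed auto
 then have "ldet b summable_on UNIV" by (rule abs_summable_summable)
 then show ?thesis by (rule summable_on_subset_banach) simp
qed

text \<open>The determinant is a limit over finite sets F of eigenvalues, the sum one over finite
  sets of frequencies. \<Phi> F collects the nonzero frequencies with eigenvalue in F; it is finite
  because eigenvalues are positive, and it exhausts all nonzero frequencies as F grows, so unordered
  summability identifies the limits.\<close>

lemma det2_green_op:
 assumes b: "0 < b" "b \<le> 1 / 2"
 shows "det2_I_minus b green_op = exp (\<Sum>\<^sub>\<infinity>k\<in>- {0}. ldet b k)"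
proof -
 let ?A = "\<Sum>\<^sub>\<infinity>k\<in>- {0}. ldet b k"
 define \<Phi> where "\<Phi> F = {k. k \<noteq> 0 \<and> lam k \<in> F}" for F
 define E where "E = eigenvalues green_op"
 have E: "E = lam ` (- {0})" unfolding E_def by (rule eigenvalues_green_op)
 have pos: "0 < l" if "l \<in> E" for l using that lam_pos by (auto simp: E)
 have \<Phi>: "\<Phi> F = (\<Union>l\<in>F. {k. lam k = l})" if "F \<subseteq> E" for F
  using that pos[of 0] by (force simp: \<Phi>_def)
 have fin: "finite (\<Phi> F)" if "finite F" "F \<subseteq> E" for F
  using that pos unfolding \<Phi>[OF that(2)] by (intro finite_UN_I finite_lam_eq) auto
 have d: "(1 - b * lam k) * exp (b * lam k) = exp (ldet b k)" for k
 proof -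
  have "b * lam k < 1" using b lam_le_1[of k] mult_mono[of b "1/2" "lam k" 1] by auto
  then show ?thesis by (simp add: ldet_def exp_add)
 qed
 have prod: "(\<Prod>l\<in>F. ((1 - b * l) * exp (b * l)) ^ multiplicity_of green_op l) = exp (\<Sum>k\<in>\<Phi> F. ldet b k)"
  if F: "finite F" "F \<subseteq> E" for F
 proof -
  have "(\<Prod>l\<in>F. ((1 - b * l) * exp (b * l)) ^ multiplicity_of green_op l) = (\<Prod>l\<in>F. \<Prod>k\<in>{k. lam k = l}. exp (ldet b k))"
  proof (intro prod.cong refl)
   fix l assume "l \<in> F"
   then have "0 < l" using F pos by auto
   have "(\<Prod>k\<in>{k. lam k = l}. exp (ldet b k)) = (\<Prod>k\<in>{k. lam k = l}. (1 - b * l) * exp (b * l))"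
    by (intro prod.cong refl) (auto simp: d[symmetric])
   then show "((1 - b * l) * exp (b * l)) ^ multiplicity_of green_op l = (\<Prod>k\<in>{k. lam k = l}. exp (ldet b k))"
    by (simp add: multiplicity_green_op[OF \<open>0 < l\<close>])
  qed
  also have "... = (\<Prod>k\<in>\<Phi> F. exp (ldet b k))"
   unfolding \<Phi>[OF F(2)] using F pos by (intro prod.UNION_disjoint[symmetric]) (auto intro: finite_lam_eq)
  finally show ?thesis using fin[OF F] by (simp add: exp_sum)
 qed
 have "filterlim \<Phi> (finite_subsets_at_top (- {0})) (finite_subsets_at_top E)"
  unfolding filterlim_finite_subsets_at_top
 proof (intro allI impI)
  fix X :: "freq set" assume X: "finite X \<and> X \<subseteq> - {0}"
  show "\<forall>\<^sub>F F in finite_subsets_at_top E. finite (\<Phi> F) \<and> X \<subseteq> \<Phi> F \<and> \<Phi> F \<subseteq> - {0}"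
   unfolding eventually_finite_subsets_at_top
  proof (intro exI[of _ "lam ` X"] conjI allI impI)
   show "finite (lam ` X)" "lam ` X \<subseteq> E" using X by (auto simp: E)
   fix F assume F: "finite F \<and> lam ` X \<subseteq> F \<and> F \<subseteq> E"
   then show "finite (\<Phi> F)" "X \<subseteq> \<Phi> F" "\<Phi> F \<subseteq> - {0}" using X fin by (auto simp: \<Phi>_def)
  qed
 qed
 moreover have "(sum (ldet b) \<longlongrightarrow> ?A) (finite_subsets_at_top (- {0}))"
  using has_sum_infsum[OF summable_on_ldet[OF b]] by (simp add: has_sum_def)
 ultimately have "((\<lambda>F. \<Sum>k\<in>\<Phi> F. ldet b k) \<longlongrightarrow> ?A) (finite_subsets_at_top E)"
  by (rule filterlim_compose[rotated])
 then have "((\<lambda>F. exp (\<Sum>k\<in>\<Phi> F. ldet b k)) \<longlongrightarrow> exp ?A) (finite_subsets_at_top E)"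
  by (rule tendsto_exp)
 moreover have "\<forall>\<^sub>F F in finite_subsets_at_top E. exp (\<Sum>k\<in>\<Phi> F. ldet b k) = (\<Prod>l\<in>F. ((1 - b * l) * exp (b * l)) ^ multiplicity_of green_op l)"
  unfolding eventually_finite_subsets_at_top by (intro exI[of _ "{}"]) (auto simp: prod)
 ultimately have "((\<lambda>F. \<Prod>l\<in>F. ((1 - b * l) * exp (b * l)) ^ multiplicity_of green_op l) \<longlongrightarrow> exp ?A) (finite_subsets_at_top E)"
  by (rule Lim_transform_eventually)
 then show ?thesis unfolding det2_I_minus_def E_def[symmetric] by (intro tendsto_Lim) auto
qed

lemma integral_exp_wick_energy:
 assumes b: "0 < b" "b \<le> coupling / 4"
 shows "(\<integral>x. exp (b * wick_energy x) \<partial>\<W>) = det2_I_minus b green_op powr (- 1 / 2)"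
proof -
 let ?A = "\<lambda>n. exp (- (\<Sum>k\<in>grid n - {0}. ldet b k) / 2)"
 let ?B = "- (\<Sum>\<^sub>\<infinity>k\<in>- {0}. ldet b k) / 2"
 let ?C = "\<integral>x. exp (b * wick_energy x) \<partial>\<W>"
 have b2: "b \<le> 1 / 2" using b coupling_le by simp
 have "?A \<longlonglongrightarrow> exp ?B"
  by (intro tendsto_intros has_sum_grid summable_on_ldet b b2) simp
 moreover have "?A \<longlonglongrightarrow> ?C"
  using integral_exp_energy_trunc_tendsto[OF b] by (simp add: integral_exp_energy_trunc[OF b])
 ultimately have "?C = exp ?B"
  using LIMSEQ_unique by blast
 then show ?thesis by (simp add: det2_green_op[OF b(1) b2] powr_def)
qed

text \<open>The factor 4 keeps \<open>2 * \<beta>\<close> below the range \<open>coupling / 2\<close> of the exponential moment bound.\<close>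

theorem theorem1:
 "\<exists>\<beta>\<^sub>0::real. 0 < \<beta>\<^sub>0 \<and> \<beta>\<^sub>0 < 8 * pi \<and>
   (\<forall>\<beta>. 0 < \<beta> \<and> \<beta> < \<beta>\<^sub>0 \<longrightarrow>
    (\<lambda>N. partition_fun N \<beta>) \<longlonglongrightarrow> det2_I_minus \<beta> green_op powr (- 1 / 2)) \<and>
   (\<forall>\<beta>. 0 < \<beta> \<and> \<beta> < \<beta>\<^sub>0 \<longrightarrow>
    weakly_converges (\<lambda>N. vorticity_law N \<beta>) (energy_enstrophy \<beta>))"
proof (intro exI[of _ "coupling / 4"] conjI allI impI)
 show "0 < coupling / 4" using coupling_pos by simp
 show "coupling / 4 < 8 * pi" using coupling_le pi_gt3 by linarith
 show "(\<lambda>N. partition_fun N \<beta>) \<longlonglongrightarrow> det2_I_minus \<beta> green_op powr (- 1 / 2)" if "0 < \<beta> \<and> \<beta> < coupling / 4" for \<beta>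
  using partition_fun_limit[of \<beta>] integral_exp_wick_energy[of \<beta>] that by simp
 show "weakly_converges (\<lambda>N. vorticity_law N \<beta>) (energy_enstrophy \<beta>)" if "0 < \<beta> \<and> \<beta> < coupling / 4" for \<beta>
  using vorticity_law_limit[of \<beta>] that by simp
qed

end
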